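(* Let $g$ be the Sobolev metric of order $m\ge2$, let $c_A\in\mathrm{Imm}^m$, and let $B\subset W^m_\theta$ be either a $W^m_\theta$-weakly sequentially closed set or the equivalence class $\{c\in\mathrm{Imm}^m\mid c=c_B\circ\phi,\ \phi\in C^0(S^1,S^1)\text{ bijective and orientation-preserving}\}$ of some $c_B\in\mathrm{Imm}^m$ with respect to reparameterization. Let $\epsilon>0$ and $K\in\mathbb N$ be fixed, and let $\mathbf E^K\in\{\mathbf E^K_{\rm lin},\mathbf E^{\epsilon,K}_{\rm reg},\mathbf E^K_{\rm rat}\}$ (with $m=2$ in the case $\mathbf E^K=\mathbf E^K_{\rm rat}$). If there exists a discrete path $(c_0,\ldots,c_K)$ with $c_0=c_A$ and $c_K\in B$ of finite discrete path energy $\mathbf E^K$, then there also exists one of minimal discrete path energy, i.e. a minimizer of $\mathbf E^K$ among all discrete paths $(c_0,\ldots,c_K)$ with $c_0=c_A$ and $c_K\in B$.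
   Context: $S^1$ is the unit circle, parametrized by $\theta\in\mathbb R$ modulo $2\pi$; $d\ge2$, $m\ge2$ integers; $'$, $\partial_\theta$ and $h^{(i)}$ denote derivatives in $\theta$. $W^m_\theta=W^{m,2}(S^1,\mathbb R^d)$ with norm $\|u\|^2_{W^m_\theta}=\int_{S^1}|u|^2+|\partial_\theta^m u|^2\,d\theta$; $\mathrm{Imm}^m=\{c\in W^m_\theta\mid c'(\theta)\neq0\ \forall\theta\}$. For $c\in\mathrm{Imm}^m$ let $\partial_s=|c'|^{-1}\partial_\theta$, $ds=|c'|d\theta$; the Sobolev metric of order $m$ is $g_c(\xi,\zeta)=\int_{S^1}\sum_{j=0}^m\partial_s^j\xi\cdot\partial_s^j\zeta\,ds$. For a path $\mathbf c\in W^{1,2}((0,1),W^m_\theta)$ with $\mathbf c(t)\in \mathrm{Imm}^m$ for all $t\in[0,1]$ the path energy is $\mathcal E[\mathbf c]=\int_0^1g_{\mathbf c(t)}(\dot{\mathbf c}(t),\dot{\mathbf c}(t))\,dt$; $\mathcal E[\mathbf c]=\infty$ if $\mathbf c$ leaves $\mathrm{Imm}^m$. A discrete path is a tuple $(c_0,\ldots,c_K)$ of curves in $\mathrm{Imm}^m$; its discrete path energy is $\mathbf E^K[(c_0,\ldots,c_K)]=K\sum_{k=1}^K\mathcal W[c_{k-1},c_k]$, where $\mathbf E^K_{\rm lin}$, $\mathbf E^{\epsilon,K}_{\rm reg}$, $\mathbf E^K_{\rm rat}$ correspond to $\mathcal W=\mathcal W_{\rm lin},\mathcal W^\epsilon_{\rm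 reg},\mathcal W_{\rm rat}$, respectively, defined as follows for $\hat c,\check c\in\mathrm{Imm}^m$. Put $\mathbf c(t,\theta)=(1-t)\hat c(\theta)+t\check c(\theta)$, $h=\check c-\hat c$. (1) $\mathcal W_{\rm lin}[\hat c,\check c]=\mathcal E[\mathbf c]$. (2) For $\epsilon>0$ let $\max^\epsilon(\alpha,\beta)=\alpha+\frac{(\beta-\alpha)+\sqrt{(\beta-\alpha)^2+\epsilon^2}}2$, $\min^\epsilon(\alpha,\beta)=\alpha+\frac{(\beta-\alpha)-\sqrt{(\beta-\alpha)^2+\epsilon^2}}2$, $L^{+,\epsilon}=\max^\epsilon(|\hat c'|,|\check c'|)$, $L^{-,\epsilon}=\frac12\left|\frac{\hat c'}{|\hat c'|}+\frac{\check c'}{|\check c'|}\right|\max(0,\min^\epsilon(|\hat c'|,|\check c'|))$ (functions of $\theta$). Define recursively $P_1=h'$, $P_{j+1}=|\mathbf c'|^2\,\partial_\theta P_j-(3j-2)(\mathbf c'\cdot\mathbf c'')P_j$ (functions of $(t,\theta)$; one has $\partial_s^j h=|\mathbf c'|^{-(3j-2)}P_j$ along $\mathbf c(t)$). Then $$\mathcal W^\epsilon_{\rm reg}[\hat c,\check c]=\int_{S^1}L^{+,\epsilon}|h|^2+\int_0^1\sum_{j=1}^m\frac{|P_j|^2}{(L^{-,\epsilon})^{6j-5}}\,dt\,d\theta\in[0,\infty],$$ with the conventions $0/0=0$ and $a/0=\infty$ for $a>0$. (3) ($m=2$ only) Pointwise in $\theta$ let $r=|\hat c'|$, $p=|\check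 c'|$, $q=\hat c'\cdot\check c'$, $v=\frac q{rp}$, $\rho=\hat c'\cdot\hat c''$, $\sigma=\check c'\cdot\check c''$, $\tau=\frac12(\hat c'\cdot\check c''+\check c'\cdot\hat c'')$, $\ell_t=(1-t)r+tp$, $D_t=(1-t)^2r^2+2t(1-t)q+t^2p^2$, $N_t=\rho(1-t)^2+\sigma t^2+2\tau t(1-t)$. Then $$\mathcal W_{\rm rat}[\hat c,\check c]=\int_{S^1}\tfrac{r+p}2|\check c-\hat c|^2+(\tfrac1v-1)(r+p)+(r-p)\log\tfrac rp+\tfrac12\left(\tfrac1{rq}+\tfrac1{pq}\right)|\check c''-\hat c''|^2-2\left(\int_0^1\tfrac{\ell_tN_t}{D_t^3}dt\right)(\rho+\sigma-2\tau)+\left(\int_0^1\tfrac{\ell_tN_t^2}{D_t^4}dt\right)(r^2+p^2-2q)\,d\theta,$$ where the integrand is $+\infty$ wherever $q(\theta)\le0$. *)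

theory Defs
  imports "HOL-Analysis.Analysis"
begin

section \<open>Sobolev curves on the circle\<close>

text \<open>Functions on the circle are \<open>2\<pi>\<close>-periodic functions of the angle. Integrals over the circle are
  integrals over one period.\<close>

type_synonym 'd curve = "real \<Rightarrow> real ^ 'd"

definition circle :: "real measure" where
  "circle = restrict_space lborel {0..<2 * pi}"

definition periodic :: "(real \<Rightarrow> 'a) \<Rightarrow> bool" where
  "periodic u \<longleftrightarrow> (\<forall>\<theta>. u (\<theta> + 2 * pi) = u \<theta>)"

definition L2 :: "(real \<Rightarrow> real ^ 'd::finite) set" where
  "L2 = {u. periodic u \<and> u \<in> borel_measurable borel \<and> integrable circle (\<lambda>\<theta>. (norm (u \<theta>))\<^sup>2)}"

definition test_function :: "(real \<Rightarrow> real) \<Rightarrow> bool" where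
  "test_function \<phi> \<longleftrightarrow> periodic \<phi> \<and> (\<forall>k. (deriv ^^ k) \<phi> differentiable_on UNIV)"

definition has_weak_deriv :: "('d::finite) curve \<Rightarrow> 'd curve \<Rightarrow> bool" where
  "has_weak_deriv u v \<longleftrightarrow> u \<in> L2 \<and> v \<in> L2 \<and>
    (\<forall>\<phi>. test_function \<phi> \<longrightarrow>
      (LINT \<theta>|circle. deriv \<phi> \<theta> *\<^sub>R u \<theta>) = - (LINT \<theta>|circle. \<phi> \<theta> *\<^sub>R v \<theta>))"

text \<open>A weak derivative is unique only up to null sets. If it has a continuous representative (which is
  then unique and the classical derivative, when the function itself is continuous), that one is
  chosen, so that pointwise statements about it make sense; otherwise the representative is arbitrary
  and occurs only under integrals.\<close>

definition wder :: "('d::finite) curve \<Rightarrow> 'd curve" where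
  "wder u = (SOME v. has_weak_deriv u v \<and>
    ((\<exists>w. has_weak_deriv u w \<and> continuous_on UNIV w) \<longrightarrow> continuous_on UNIV v))"

text \<open>For \<open>m \<ge> 1\<close>, every class in \<open>W\<^sup>m\<^sup>,\<^sup>2\<close> has exactly one continuous representative; the space is taken
  to consist of these.\<close>

definition sobolev :: "nat \<Rightarrow> ('d::finite) curve set" where
  "sobolev m = {u. periodic u \<and> continuous_on UNIV u \<and> (\<forall>j<m. \<exists>v. has_weak_deriv ((wder ^^ j) u) v)}"

definition sobolev_norm :: "nat \<Rightarrow> ('d::finite) curve \<Rightarrow> real" where
  "sobolev_norm m u = sqrt (LINT \<theta>|circle. (norm (u \<theta>))\<^sup>2 + (norm ((wder ^^ m) u \<theta>))\<^sup>2)"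

definition sobolev_dual :: "nat \<Rightarrow> (('d::finite) curve \<Rightarrow> real) set" where
  "sobolev_dual m = {l.
     (\<forall>u\<in>sobolev m. \<forall>v\<in>sobolev m. l (\<lambda>\<theta>. u \<theta> + v \<theta>) = l u + l v) \<and>
     (\<forall>a. \<forall>u\<in>sobolev m. l (\<lambda>\<theta>. a *\<^sub>R u \<theta>) = a * l u) \<and>
     (\<exists>C. \<forall>u\<in>sobolev m. \<bar>l u\<bar> \<le> C * sobolev_norm m u)}"

definition weakly_seq_closed :: "nat \<Rightarrow> ('d::finite) curve set \<Rightarrow> bool" where
  "weakly_seq_closed m B \<longleftrightarrow> B \<subseteq> sobolev m \<and>
    (\<forall>u v. (\<forall>n. u n \<in> B) \<and> v \<in> sobolev m \<and>
       (\<forall>l\<in>sobolev_dual m. (\<lambda>n. l (u n)) \<longlonglongrightarrow> l v) \<longrightarrow> v \<in> B)"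

definition Imm :: "nat \<Rightarrow> ('d::finite) curve set" where
  "Imm m = {c \<in> sobolev m. \<forall>\<theta>. wder c \<theta> \<noteq> 0}"


section \<open>Reparameterization\<close>

text \<open>Here the circle is the unit circle in the complex plane with \<open>\<theta>\<close> parametrizing \<open>cis \<theta>\<close>. A bijection of
  the circle preserves orientation if its lift to the angles is increasing.\<close>

definition circle_reparam :: "(complex \<Rightarrow> complex) \<Rightarrow> bool" where
  "circle_reparam \<phi> \<longleftrightarrow> continuous_on (sphere 0 1) \<phi> \<and> bij_betw \<phi> (sphere 0 1) (sphere 0 1) \<and>
    (\<exists>\<Phi>. continuous_on UNIV \<Phi> \<and> mono \<Phi> \<and> (\<forall>\<theta>. \<phi> (cis \<theta>) = cis (\<Phi> \<theta>)))"

definition reparam_class :: "nat \<Rightarrow> ('d::finite) curve \<Rightarrow> 'd curve set" where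
  "reparam_class m cB = {c \<in> Imm m. \<exists>\<phi>. circle_reparam \<phi> \<and>
     (\<forall>\<theta> \<eta>. \<phi> (cis \<theta>) = cis \<eta> \<longrightarrow> c \<theta> = cB \<eta>)}"


section \<open>The Sobolev metric and the path energy\<close>

definition arc_deriv :: "('d::finite) curve \<Rightarrow> 'd curve \<Rightarrow> 'd curve" where
  "arc_deriv c \<xi> = (\<lambda>\<theta>. (1 / norm (wder c \<theta>)) *\<^sub>R wder \<xi> \<theta>)"

definition sobolev_metric :: "nat \<Rightarrow> ('d::finite) curve \<Rightarrow> 'd curve \<Rightarrow> 'd curve \<Rightarrow> real" where
  "sobolev_metric m c \<xi> \<zeta> = (LINT \<theta>|circle.
     (\<Sum>j=0..m. ((arc_deriv c ^^ j) \<xi> \<theta>) \<bullet> ((arc_deriv c ^^ j) \<zeta> \<theta>)) * norm (wder c \<theta>))"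

text \<open>The time derivative is the strong one with respect to the Sobolev norm; for a path in
  \<open>W\<^sup>1\<^sup>,\<^sup>2((0,1), W\<^sup>m\<^sup>,\<^sup>2)\<close> it exists for almost every time.\<close>

definition time_deriv :: "nat \<Rightarrow> (real \<Rightarrow> ('d::finite) curve) \<Rightarrow> real \<Rightarrow> 'd curve" where
  "time_deriv m c t = (THE u. u \<in> sobolev m \<and>
     ((\<lambda>s. sobolev_norm m (\<lambda>\<theta>. (1 / (s - t)) *\<^sub>R (c s \<theta> - c t \<theta>) - u \<theta>)) \<longlongrightarrow> 0) (at t within {0..1}))"

definition path_energy :: "nat \<Rightarrow> (real \<Rightarrow> ('d::finite) curve) \<Rightarrow> ennreal" where
  "path_energy m c = (if \<forall>t\<in>{0..1}. c t \<in> Imm m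
     then \<integral>\<^sup>+t\<in>{0..1}. ennreal (sobolev_metric m (c t) (time_deriv m c t) (time_deriv m c t)) \<partial>lborel
     else \<infinity>)"

definition linear_path :: "('d::finite) curve \<Rightarrow> 'd curve \<Rightarrow> real \<Rightarrow> 'd curve" where
  "linear_path a b t = (\<lambda>\<theta>. (1 - t) *\<^sub>R a \<theta> + t *\<^sub>R b \<theta>)"


section \<open>Approximations of the squared Riemannian distance\<close>

definition W_lin :: "nat \<Rightarrow> ('d::finite) curve \<Rightarrow> 'd curve \<Rightarrow> ereal" where
  "W_lin m a b = enn2ereal (path_energy m (linear_path a b))"

definition max_eps :: "real \<Rightarrow> real \<Rightarrow> real \<Rightarrow> real" where
  "max_eps \<epsilon> \<alpha> \<beta> = \<alpha> + ((\<beta> - \<alpha>) + sqrt ((\<beta> - \<alpha>)\<^sup>2 + \<epsilon>\<^sup>2)) / 2"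

definition min_eps :: "real \<Rightarrow> real \<Rightarrow> real \<Rightarrow> real" where
  "min_eps \<epsilon> \<alpha> \<beta> = \<alpha> + ((\<beta> - \<alpha>) - sqrt ((\<beta> - \<alpha>)\<^sup>2 + \<epsilon>\<^sup>2)) / 2"

definition L_plus :: "real \<Rightarrow> ('d::finite) curve \<Rightarrow> 'd curve \<Rightarrow> real \<Rightarrow> real" where
  "L_plus \<epsilon> a b \<theta> = max_eps \<epsilon> (norm (wder a \<theta>)) (norm (wder b \<theta>))"

definition L_minus :: "real \<Rightarrow> ('d::finite) curve \<Rightarrow> 'd curve \<Rightarrow> real \<Rightarrow> real" where
  "L_minus \<epsilon> a b \<theta> = 1 / 2 * norm (sgn (wder a \<theta>) + sgn (wder b \<theta>)) *
     max 0 (min_eps \<epsilon> (norm (wder a \<theta>)) (norm (wder b \<theta>)))"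

text \<open>The derivative in \<open>\<theta>\<close> of a function of \<open>(t, \<theta>)\<close>. Choosing the representatives separately for each \<open>t\<close>
  would only determine them up to a null set depending on \<open>t\<close>; joint measurability makes the choice
  unique up to null sets in \<open>(t, \<theta>)\<close>, as needed for integration in \<open>t\<close> at fixed \<open>\<theta>\<close>.\<close>

definition wder_path :: "(real \<Rightarrow> ('d::finite) curve) \<Rightarrow> real \<Rightarrow> 'd curve" where
  "wder_path P = (SOME Q. (\<lambda>(t, \<theta>). Q t \<theta>) \<in> borel_measurable borel \<and>
     (\<forall>t\<in>{0..1}. has_weak_deriv (P t) (Q t)))"

text \<open>The value at index 0 is a dummy; the recursion starts with index 1.\<close>

primrec reg_P :: "(real \<Rightarrow> ('d::finite) curve) \<Rightarrow> 'd curve \<Rightarrow> nat \<Rightarrow> real \<Rightarrow> 'd curve" where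
  "reg_P c h 0 = (\<lambda>t \<theta>. 0)"
| "reg_P c h (Suc j) = (if j = 0 then (\<lambda>t. wder h) else
     (\<lambda>t \<theta>. (norm (wder_path c t \<theta>))\<^sup>2 *\<^sub>R wder_path (reg_P c h j) t \<theta> -
        ((3 * real j - 2) * (wder_path c t \<theta> \<bullet> wder_path (wder_path c) t \<theta>)) *\<^sub>R reg_P c h j t \<theta>))"

text \<open>Division in \<^typ>\<open>ennreal\<close> satisfies \<open>0 / 0 = 0\<close> and \<open>a / 0 = \<infinity>\<close> for \<open>a > 0\<close>.\<close>

definition W_reg :: "real \<Rightarrow> nat \<Rightarrow> ('d::finite) curve \<Rightarrow> 'd curve \<Rightarrow> ereal" where
  "W_reg \<epsilon> m a b = (let h = (\<lambda>\<theta>. b \<theta> - a \<theta>); P = reg_P (linear_path a b) h in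
     enn2ereal (\<integral>\<^sup>+\<theta>. (ennreal (L_plus \<epsilon> a b \<theta> * (norm (h \<theta>))\<^sup>2) +
       (\<integral>\<^sup>+t\<in>{0..1}. (\<Sum>j=1..m. ennreal ((norm (P j t \<theta>))\<^sup>2) / ennreal (L_minus \<epsilon> a b \<theta> ^ (6 * j - 5)))
          \<partial>lborel)) \<partial>circle))"

text \<open>The integral of an extended real function as the difference of the integrals of its positive
  and negative parts.\<close>

definition ereal_integral :: "'a measure \<Rightarrow> ('a \<Rightarrow> ereal) \<Rightarrow> ereal" where
  "ereal_integral M f =
     enn2ereal (\<integral>\<^sup>+x. e2ennreal (f x) \<partial>M) - enn2ereal (\<integral>\<^sup>+x. e2ennreal (- f x) \<partial>M)"

definition W_rat_integrand :: "('d::finite) curve \<Rightarrow> 'd curve \<Rightarrow> real \<Rightarrow> ereal" where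
  "W_rat_integrand a b \<theta> = (let
      a1 = wder a \<theta>; b1 = wder b \<theta>;
      a2 = wder (wder a) \<theta>; b2 = wder (wder b) \<theta>;
      r = norm a1; p = norm b1; q = a1 \<bullet> b1; v = q / (r * p);
      \<rho> = a1 \<bullet> a2; \<sigma> = b1 \<bullet> b2; \<tau> = 1 / 2 * (a1 \<bullet> b2 + b1 \<bullet> a2);
      l = (\<lambda>t. (1 - t) * r + t * p);
      D = (\<lambda>t. (1 - t)\<^sup>2 * r\<^sup>2 + 2 * t * (1 - t) * q + t\<^sup>2 * p\<^sup>2);
      N = (\<lambda>t. \<rho> * (1 - t)\<^sup>2 + \<sigma> * t\<^sup>2 + 2 * \<tau> * t * (1 - t))
    in if q \<le> 0 then \<infinity> else ereal (
      (r + p) / 2 * (norm (b \<theta> - a \<theta>))\<^sup>2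
      + (1 / v - 1) * (r + p) + (r - p) * ln (r / p)
      + 1 / 2 * (1 / (r * q) + 1 / (p * q)) * (norm (b2 - a2))\<^sup>2
      - 2 * (LINT t:{0..1}|lborel. l t * N t / D t ^ 3) * (\<rho> + \<sigma> - 2 * \<tau>)
      + (LINT t:{0..1}|lborel. l t * (N t)\<^sup>2 / D t ^ 4) * (r\<^sup>2 + p\<^sup>2 - 2 * q)))"

definition W_rat :: "('d::finite) curve \<Rightarrow> 'd curve \<Rightarrow> ereal" where
  "W_rat a b = ereal_integral circle (W_rat_integrand a b)"


section \<open>Discrete paths\<close>

text \<open>A tuple of \<open>K + 1\<close> curves is a sequence of which only the entries \<open>0, \<dots>, K\<close> matter.\<close>

definition discrete_path :: "nat \<Rightarrow> nat \<Rightarrow> (nat \<Rightarrow> ('d::finite) curve) \<Rightarrow> bool" where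
  "discrete_path m K c \<longleftrightarrow> (\<forall>k\<le>K. c k \<in> Imm m)"

definition discrete_energy ::
    "(('d::finite) curve \<Rightarrow> 'd curve \<Rightarrow> ereal) \<Rightarrow> nat \<Rightarrow> (nat \<Rightarrow> 'd curve) \<Rightarrow> ereal" where
  "discrete_energy W K c = ereal (real K) * (\<Sum>k=1..K. W (c (k - 1)) (c k))"

end

theory Submission
  imports Defs "HOL-Complex_Analysis.Great_Picard"
begin

text \<open>Let \<open>c n\<close> be a minimizing sequence of discrete paths. Each of the three functionals dominates the
  energy of the linear path between its arguments. A bound on that energy keeps the speed of the linear path
  away from zero and bounds its endpoint in the Sobolev norm in terms of its starting point, so that inductively,
  starting from the fixed curve \<open>c n 0\<close>, a subsequence of every curve of the discrete path converges weakly to an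
  immersion. The functionals are lower semicontinuous along such sequences, because the derivatives of top order,
  the only ones that converge merely weakly, enter quadratically with nonnegative weights. For the rational
  functional this becomes visible after writing its integrand as an integral over the time of nonnegative terms.\<close>

section \<open>Square integrable functions on the circle\<close>

text \<open>Compactness has to overcome a circularity. The energy bounds arc length derivatives of
  the increment \<open>h\<close> along the path, whereas derivatives in the angle are wanted;
  passing between them costs derivatives of the speed, which involve those of \<open>h\<close>. At a
  sufficiently early time \<open>t\<close>, where \<open>t\<close> times the first arc length
  derivative of \<open>h\<close> has norm at most 1/2, the speed becomes an explicit smooth function
  of the initial velocity and of that derivative, and orders can be gained one at a time. The
  regularized and the rational functional do not presuppose that the linear path consists of
  immersions. Domination of the path energy thus starts by deriving this from finiteness of the
  functional, for almost all times and then for all. The rational integrand stems from exact time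
  integrals of the energy terms with the interpolated speed in place of |c'|: the integral of 1 /
  |c'|^2, in general an arctangent, is replaced by the larger integral of r^2 / e^2, where
  \<open>e\<close> is the scalar product of the initial velocity with c'. The nonnegative excess of
  r^2 / e^2 over 1 / |c'|^2 stays as a weight.\<close>

definition sqint :: "(real => 'a::euclidean_space) set" where
 "sqint = {u. u \<in> borel_measurable borel \<and> integrable circle (\<lambda>z. (norm (u z))\<^sup>2)}"

definition ip :: "(real => 'a::euclidean_space) => (real => 'a) => real" where
 "ip u v = (LINT z|circle. u z \<bullet> v z)"

definition nsq :: "(real => 'a::euclidean_space) => real" where
 "nsq u = (LINT z|circle. (norm (u z))\<^sup>2)"

lemma space_circle: "space circle = {0..<2 * pi}"
 by (simp add: circle_def)

lemma sets_circle: "A \<in> sets borel ==> A \<inter> {0..<2*pi} \<in> sets circle"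
 by (auto simp: circle_def sets_restrict_space)

lemma emeasure_circle: "A \<in> sets borel ==> emeasure circle (A \<inter> {0..<2*pi}) = emeasure lborel (A \<inter> {0..<2*pi})"
 by (auto simp: circle_def emeasure_restrict_space)

lemma measurable_circle [measurable (raw)]:
 "f \<in> borel_measurable borel ==> f \<in> borel_measurable circle"
 unfolding circle_def by (intro measurable_restrict_space1) simp

lemma finite_measure_circle: "finite_measure circle"
proof
 have "emeasure circle (space circle) = emeasure lborel {0..<2 * pi}"
  using emeasure_circle[of UNIV] by (simp add: space_circle)
 then show "emeasure circle (space circle) \<noteq> \<infinity>"
  by simp
qed

interpretation circle: finite_measure circle
 by (rule finite_measure_circle)

lemma measure_circle: "measure circle (space circle) = 2 * pi"
proof -
 have "emeasure circle (space circle) = emeasure lborel {0..<2 * pi}"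
  using emeasure_circle[of UNIV] by (simp add: space_circle)
 then show ?thesis by (simp add: measure_def)
qed

lemma sqintD:
 assumes "u \<in> sqint"
 shows "u \<in> borel_measurable borel" "integrable circle (\<lambda>z. (norm (u z))\<^sup>2)"
 using assms by (auto simp: sqint_def)

lemma sqint_bound:
 fixes u :: "real => 'a::euclidean_space" and f :: "real => 'b::euclidean_space"
 assumes u[measurable]: "u \<in> borel_measurable borel" and f: "f \<in> sqint"
  and le: "\<And>z. z \<in> {0..<2*pi} ==> norm (u z) \<le> C * norm (f z)"
 shows "u \<in> sqint"
 unfolding sqint_def
proof safe
 note [measurable] = sqintD(1)[OF f]
 have "integrable circle (\<lambda>z. C\<^sup>2 * (norm (f z))\<^sup>2)"
  using sqintD(2)[OF f] by simp
 then show "integrable circle (\<lambda>z. (norm (u z))\<^sup>2)"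
 proof (rule Bochner_Integration.integrable_bound)
  have "norm (u z) ^ 2 \<le> C\<^sup>2 * (norm (f z))\<^sup>2" if "z \<in> {0..<2*pi}" for z
   using power_mono[OF le[OF that] norm_ge_zero, of 2] by (simp add: power_mult_distrib)
  then show "AE z in circle. norm ((norm (u z))\<^sup>2) \<le> norm (C\<^sup>2 * (norm (f z))\<^sup>2)"
   by (intro AE_I2) (auto simp: space_circle power_mult_distrib)
 qed measurable
qed (rule u)

lemma sqint_const [simp]: "(\<lambda>_. c) \<in> sqint"
 by (auto simp: sqint_def)

lemma sqint_bounded:
 assumes "u \<in> borel_measurable borel" "\<And>z. z \<in> {0..<2*pi} ==> norm (u z) \<le> C"
 shows "u \<in> sqint"
 using sqint_bound[of u "\<lambda>_. 1::real" C] assms by simp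

lemma sqint_add [simp]:
 assumes f: "f \<in> sqint" and g: "g \<in> sqint"
 shows "(\<lambda>z. f z + g z) \<in> sqint"
 unfolding sqint_def
proof safe
 note [measurable] = sqintD(1)[OF f] sqintD(1)[OF g]
 show "(\<lambda>z. f z + g z) \<in> borel_measurable borel" by measurable
 have "integrable circle (\<lambda>z. 2 * (norm (f z))\<^sup>2 + 2 * (norm (g z))\<^sup>2)"
  using sqintD(2)[OF f] sqintD(2)[OF g] by simp
 then show "integrable circle (\<lambda>z. (norm (f z + g z))\<^sup>2)"
 proof (rule Bochner_Integration.integrable_bound)
  have "(norm (f z + g z))\<^sup>2 \<le> 2 * (norm (f z))\<^sup>2 + 2 * (norm (g z))\<^sup>2" for z
   by (smt (verit, ccfv_SIG) norm_ge_zero norm_triangle_ineq power_mono sum_squares_bound power2_sum)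
  then show "AE z in circle. norm ((norm (f z + g z))\<^sup>2) \<le> norm (2 * (norm (f z))\<^sup>2 + 2 * (norm (g z))\<^sup>2)"
   by (intro AE_I2) auto
 qed measurable
qed

lemma sqint_scaleR [simp]: "f \<in> sqint ==> (\<lambda>z. c *\<^sub>R f z) \<in> sqint"
 by (rule sqint_bound[where C = "\<bar>c\<bar>" and f = f]) (auto dest: sqintD)

lemma sqint_minus [simp]: "f \<in> sqint ==> (\<lambda>z. - f z) \<in> sqint"
 using sqint_scaleR[of f "-1"] by simp

lemma sqint_diff [simp]: "f \<in> sqint ==> g \<in> sqint ==> (\<lambda>z. f z - g z) \<in> sqint"
 using sqint_add[of f "\<lambda>z. - g z"] by simp

lemma integrable_norm_mult:
 fixes f :: "real => 'a::euclidean_space" and g :: "real => 'b::euclidean_space"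
 assumes f: "f \<in> sqint" and g: "g \<in> sqint"
 shows "integrable circle (\<lambda>z. norm (f z) * norm (g z))"
proof -
 note [measurable] = sqintD(1)[OF f] sqintD(1)[OF g]
 have "integrable circle (\<lambda>z. (norm (f z))\<^sup>2 + (norm (g z))\<^sup>2)"
  using sqintD(2)[OF f] sqintD(2)[OF g] by simp
 then show ?thesis
 proof (rule Bochner_Integration.integrable_bound)
  have "norm (f z) * norm (g z) \<le> (norm (f z))\<^sup>2 + (norm (g z))\<^sup>2" for z
   using sum_squares_bound[of "norm (f z)" "norm (g z)"] mult_nonneg_nonneg[OF norm_ge_zero[of "f z"] norm_ge_zero[of "g z"]]
   by linarith
  then show "AE z in circle. norm (norm (f z) * norm (g z)) \<le> norm ((norm (f z))\<^sup>2 + (norm (g z))\<^sup>2)"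
   by (intro AE_I2) auto
 qed measurable
qed

lemma integrable_sqint_bilinear:
 fixes f :: "real => 'a::euclidean_space" and g :: "real => 'b::euclidean_space"
  and B :: "'a => 'b => 'c::euclidean_space"
 assumes "bounded_bilinear B" and f: "f \<in> sqint" and g: "g \<in> sqint"
 shows "integrable circle (\<lambda>z. B (f z) (g z))"
proof -
 interpret B: bounded_bilinear B by fact
 note [measurable] = sqintD(1)[OF f] sqintD(1)[OF g]
 obtain K where K: "\<And>x y. norm (B x y) \<le> norm x * norm y * K" using B.bounded by blast
 have "continuous_on UNIV (\<lambda>x. B (fst x) (snd x))"
  by (intro continuous_on_eq_continuous_at[THEN iffD2] ballI B.continuous continuous_intros open_UNIV)
 then have m: "(\<lambda>x. B (fst x) (snd x)) \<in> borel_measurable borel"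
  by (rule borel_measurable_continuous_onI)
 have "(\<lambda>z. (\<lambda>x. B (fst x) (snd x)) (f z, g z)) \<in> borel_measurable circle"
  by (rule measurable_compose[OF _ m]) measurable
 then have [measurable]: "(\<lambda>z. B (f z) (g z)) \<in> borel_measurable circle" by simp
 have "integrable circle (\<lambda>z. norm (f z) * norm (g z) * K)"
  using integrable_norm_mult[OF f g] by simp
 then show ?thesis
 proof (rule Bochner_Integration.integrable_bound)
  have "norm (B (f z) (g z)) \<le> norm (norm (f z) * norm (g z) * K)" for z
   using K[of "f z" "g z"] abs_ge_self[of "norm (f z) * norm (g z) * K"] by (simp only: real_norm_def)
  then show "AE z in circle. norm (B (f z) (g z)) \<le> norm (norm (f z) * norm (g z) * K)"
   by simp
 qed measurable
qed

lemma integrable_sqint_inner [simp]: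
 "f \<in> sqint ==> g \<in> sqint ==> integrable circle (\<lambda>z. f z \<bullet> g z)"
 using integrable_sqint_bilinear[OF bounded_bilinear_inner] .

lemma integrable_sqint: "f \<in> sqint ==> integrable circle f"
 using integrable_sqint_bilinear[OF bounded_bilinear_scaleR, of "\<lambda>_. 1" f] by simp

lemma nsq_nonneg [simp]: "0 \<le> nsq u"
 by (simp add: nsq_def)

lemma nsq_ip: "nsq u = ip u u"
 by (simp add: nsq_def ip_def power2_norm_eq_inner)

lemma ip_commute: "ip u v = ip v u"
 by (simp add: ip_def inner_commute)

lemma ip_add: "f \<in> sqint ==> g \<in> sqint ==> h \<in> sqint ==> ip f (\<lambda>z. g z + h z) = ip f g + ip f h"
 by (simp add: ip_def inner_add_right)

lemma ip_diff: "f \<in> sqint ==> g \<in> sqint ==> h \<in> sqint ==> ip f (\<lambda>z. g z - h z) = ip f g - ip f h"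
 by (simp add: ip_def inner_diff_right)

lemma ip_scaleR: "ip f (\<lambda>z. c *\<^sub>R g z) = c * ip f g"
 by (simp add: ip_def)

lemma ip_add_left: "f \<in> sqint ==> g \<in> sqint ==> h \<in> sqint ==> ip (\<lambda>z. g z + h z) f = ip g f + ip h f"
 by (simp add: ip_def inner_add_left)

lemma ip_diff_left: "f \<in> sqint ==> g \<in> sqint ==> h \<in> sqint ==> ip (\<lambda>z. g z - h z) f = ip g f - ip h f"
 by (simp add: ip_def inner_diff_left)

lemma ip_scaleR_left: "ip (\<lambda>z. c *\<^sub>R g z) f = c * ip g f"
 by (simp add: ip_def)

lemma nsq_add: "f \<in> sqint ==> g \<in> sqint ==> nsq (\<lambda>z. f z + g z) = nsq f + 2 * ip f g + nsq g"
 using ip_commute[of g f] by (simp add: nsq_ip ip_add ip_add_left)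

lemma nsq_diff: "f \<in> sqint ==> g \<in> sqint ==> nsq (\<lambda>z. f z - g z) = nsq f - 2 * ip f g + nsq g"
 using ip_commute[of g f] by (simp add: nsq_ip ip_diff ip_diff_left)

lemma nsq_scaleR: "nsq (\<lambda>z. c *\<^sub>R f z) = c\<^sup>2 * nsq f"
 by (simp add: nsq_def power_mult_distrib)

lemma integral_norm_mult_le:
 fixes f :: "real => 'a::euclidean_space" and g :: "real => 'b::euclidean_space"
 assumes f: "f \<in> sqint" and g: "g \<in> sqint"
 shows "(LINT z|circle. norm (f z) * norm (g z)) \<le> sqrt (nsq f) * sqrt (nsq g)"
proof -
 note [measurable] = sqintD(1)[OF f] sqintD(1)[OF g]
 let ?I = "LINT z|circle. norm (f z) * norm (g z)"
 have "(\<integral>\<^sup>+z. ennreal (norm (f z)) * ennreal (norm (g z)) \<partial>circle)\<^sup>2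
  \<le> (\<integral>\<^sup>+z. ennreal (norm (f z)) ^ 2 \<partial>circle) * (\<integral>\<^sup>+z. ennreal (norm (g z)) ^ 2 \<partial>circle)"
  by (rule Cauchy_Schwarz_nn_integral) measurable
 also have "(\<integral>\<^sup>+z. ennreal (norm (f z)) ^ 2 \<partial>circle) = ennreal (nsq f)"
  unfolding nsq_def by (simp add: ennreal_power nn_integral_eq_integral[OF sqintD(2)[OF f]])
 also have "(\<integral>\<^sup>+z. ennreal (norm (g z)) ^ 2 \<partial>circle) = ennreal (nsq g)"
  unfolding nsq_def by (simp add: ennreal_power nn_integral_eq_integral[OF sqintD(2)[OF g]])
 also have "(\<integral>\<^sup>+z. ennreal (norm (f z)) * ennreal (norm (g z)) \<partial>circle) = ennreal ?I"
  using nn_integral_eq_integral[OF integrable_norm_mult[OF f g]] by (simp add: ennreal_mult)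
 finally have "?I\<^sup>2 \<le> nsq f * nsq g"
  by (simp add: ennreal_power ennreal_mult[symmetric])
 then have "?I \<le> sqrt (nsq f * nsq g)"
  by (rule real_le_rsqrt)
 then show ?thesis by (simp add: real_sqrt_mult)
qed

lemma ip_le:
 assumes f: "f \<in> sqint" and g: "g \<in> sqint"
 shows "\<bar>ip f g\<bar> \<le> sqrt (nsq f) * sqrt (nsq g)"
proof -
 have "\<bar>ip f g\<bar> \<le> (LINT z|circle. norm (f z \<bullet> g z))"
  unfolding ip_def by (metis integral_norm_bound real_norm_def)
 also have "\<dots> \<le> (LINT z|circle. norm (f z) * norm (g z))"
  using f g by (intro integral_mono integrable_norm_mult integrable_norm integrable_sqint_inner)
   (auto simp: Cauchy_Schwarz_ineq2)
 also note integral_norm_mult_le[OF f g]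
 finally show ?thesis .
qed

lemma integral_norm_le_nsq:
 assumes "f \<in> sqint"
 shows "(LINT z|circle. norm (f z)) \<le> sqrt (2 * pi) * sqrt (nsq f)"
 using integral_norm_mult_le[OF sqint_const[of "1::real"] assms]
 by (simp add: nsq_def measure_circle)

lemma nsq_mono:
 assumes f: "f \<in> sqint" and g: "g \<in> sqint" and "\<And>z. z \<in> {0..<2*pi} ==> norm (f z) \<le> norm (g z)"
 shows "nsq f \<le> nsq g"
 unfolding nsq_def using f g assms(3)
 by (intro integral_mono) (auto dest: sqintD simp: space_circle power_mono)

lemma nsq_le_bound:
 assumes f: "f \<in> sqint" and "\<And>z. z \<in> {0..<2*pi} ==> norm (f z) \<le> C"
 shows "nsq f \<le> 2 * pi * C\<^sup>2"
proof -
 have "0 \<in> {0..<2*pi}" by simp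
 then have "C \<ge> 0" using assms(2)[of 0] norm_ge_zero[of "f 0"] by linarith
 then have "nsq f \<le> nsq (\<lambda>_. C)"
  using assms by (intro nsq_mono) auto
 then show ?thesis by (simp add: nsq_def measure_circle mult.commute)
qed

section \<open>Weak convergence of square integrable functions\<close>

lemma nsq_tendsto_0:
 fixes F :: "nat => real => 'a::euclidean_space" and g :: "real => 'b::euclidean_space"
 assumes F: "\<And>n. F n \<in> borel_measurable borel" and g: "g \<in> sqint"
  and lim: "\<And>z. z \<in> {0..<2*pi} ==> (\<lambda>n. F n z) \<longlonglongrightarrow> f z"
  and f: "f \<in> borel_measurable borel"
  and bd: "\<And>n z. z \<in> {0..<2*pi} ==> norm (F n z) \<le> C * norm (g z)"
 shows "(\<lambda>n. nsq (\<lambda>z. F n z - f z)) \<longlonglongrightarrow> 0" "f \<in> sqint"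
proof -
 note [measurable] = F f sqintD(1)[OF g]
 have fb: "norm (f z) \<le> C * norm (g z)" if "z \<in> {0..<2*pi}" for z
  using bd[OF that] by (intro LIMSEQ_le_const2[OF tendsto_norm[OF lim[OF that]]]) auto
 show "f \<in> sqint" using fb by (rule sqint_bound[OF f g])
 have "(\<lambda>n. nsq (\<lambda>z. F n z - f z)) \<longlonglongrightarrow> (LINT z|circle. (0::real))"
  unfolding nsq_def
 proof (rule integral_dominated_convergence[where w = "\<lambda>z. (2 * C)\<^sup>2 * (norm (g z))\<^sup>2"])
  show "integrable circle (\<lambda>z. (2 * C)\<^sup>2 * (norm (g z))\<^sup>2)" using sqintD(2)[OF g] by simp
  show "AE z in circle. (\<lambda>n. (norm (F n z - f z))\<^sup>2) \<longlonglongrightarrow> 0"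
  proof (rule AE_I2)
   fix z assume "z \<in> space circle"
   then have "(\<lambda>n. (norm (F n z - f z))\<^sup>2) \<longlonglongrightarrow> (norm (f z - f z))\<^sup>2"
    by (intro tendsto_intros lim) (auto simp: space_circle)
   then show "(\<lambda>n. (norm (F n z - f z))\<^sup>2) \<longlonglongrightarrow> 0" by simp
  qed
  fix n
  show "AE z in circle. norm ((norm (F n z - f z))\<^sup>2) \<le> (2 * C)\<^sup>2 * (norm (g z))\<^sup>2"
  proof (rule AE_I2)
   fix z assume "z \<in> space circle"
   then have th: "z \<in> {0..<2*pi}" by (simp add: space_circle)
   have "norm (F n z - f z) \<le> (2 * C) * norm (g z)"
    using norm_triangle_ineq4[of "F n z" "f z"] bd[OF th, of n] fb[OF th] by linarith
   from power_mono[OF this, of 2] show "norm ((norm (F n z - f z))\<^sup>2) \<le> (2 * C)\<^sup>2 * (norm (g z))\<^sup>2"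
    by (simp add: power_mult_distrib)
  qed
 qed measurable
 then show "(\<lambda>n. nsq (\<lambda>z. F n z - f z)) \<longlonglongrightarrow> 0" by simp
qed

text \<open>Riesz-Fischer on a finite measure: Cauchy in the mean square implies Cauchy in L1, an
  almost everywhere convergent subsequence then supplies the limit, and Fatou's lemma carries the
  Cauchy estimate over to it.\<close>

lemma sqint_complete:
 fixes F :: "nat => real => 'a::euclidean_space"
 assumes F: "\<And>n. F n \<in> sqint"
  and cauchy: "\<And>e. e > 0 ==> \<exists>N. \<forall>i\<ge>N. \<forall>j\<ge>N. nsq (\<lambda>z. F i z - F j z) < e"
 obtains f where "f \<in> sqint" "(\<lambda>n. nsq (\<lambda>z. F n z - f z)) \<longlonglongrightarrow> 0"
proof -
 note [measurable] = sqintD(1)[OF F]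
 have "\<exists>N. \<forall>i\<ge>N. \<forall>j\<ge>N. (LINT z|circle. norm (F i z - F j z)) < e" if "e > 0" for e
 proof -
  have "(e / sqrt (2*pi))\<^sup>2 > 0" using that by simp
  then obtain N where N: "\<forall>i\<ge>N. \<forall>j\<ge>N. nsq (\<lambda>z. F i z - F j z) < (e / sqrt (2*pi))\<^sup>2"
   using cauchy by blast
  have "(LINT z|circle. norm (F i z - F j z)) < e" if "i \<ge> N" "j \<ge> N" for i j
  proof -
   have "sqrt (nsq (\<lambda>z. F i z - F j z)) < e / sqrt (2*pi)"
    using N that \<open>e > 0\<close> by (intro real_less_lsqrt) auto
   then have "sqrt (2*pi) * sqrt (nsq (\<lambda>z. F i z - F j z)) < e"
    by (simp add: field_simps)
   with integral_norm_le_nsq[OF sqint_diff[OF F F], of i j] show ?thesis by linarith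
  qed
  then show ?thesis by blast
 qed
 then obtain r where r: "strict_mono r" "AE z in circle. Cauchy (\<lambda>i. F (r i) z)"
  using cauchy_L1_AE_cauchy_subseq[of circle F, OF integrable_sqint[OF F]] by blast
 define f where "f = (\<lambda>z. lim (\<lambda>i. F (r i) z))"
 have f[measurable]: "f \<in> borel_measurable borel"
  unfolding f_def by measurable
 have le: "(\<integral>\<^sup>+z. ennreal ((norm (F n z - f z))\<^sup>2) \<partial>circle) \<le> ennreal e"
  if e: "\<And>j. j \<ge> N ==> nsq (\<lambda>z. F n z - F j z) < e" for n N e
 proof -
  have "(\<integral>\<^sup>+z. ennreal ((norm (F n z - f z))\<^sup>2) \<partial>circle)
   = (\<integral>\<^sup>+z. liminf (\<lambda>j. ennreal ((norm (F n z - F (r j) z))\<^sup>2)) \<partial>circle)"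
  proof (intro nn_integral_cong_AE)
   show "AE z in circle. ennreal ((norm (F n z - f z))\<^sup>2) = liminf (\<lambda>j. ennreal ((norm (F n z - F (r j) z))\<^sup>2))"
    using r(2)
   proof eventually_elim
    case (elim z)
    then have "(\<lambda>i. F (r i) z) \<longlonglongrightarrow> f z"
     by (simp add: f_def Cauchy_convergent_iff convergent_LIMSEQ_iff)
    then have "(\<lambda>j. ennreal ((norm (F n z - F (r j) z))\<^sup>2)) \<longlonglongrightarrow> ennreal ((norm (F n z - f z))\<^sup>2)"
     by (intro tendsto_ennrealI tendsto_intros)
    from lim_imp_Liminf[OF trivial_limit_sequentially this] show ?case by simp
   qed
  qed
  also have "\<dots> \<le> liminf (\<lambda>j. \<integral>\<^sup>+z. ennreal ((norm (F n z - F (r j) z))\<^sup>2) \<partial>circle)"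
   by (rule nn_integral_liminf) measurable
  also have "\<dots> \<le> ennreal e"
  proof -
   have "(\<integral>\<^sup>+z. ennreal ((norm (F n z - F (r j) z))\<^sup>2) \<partial>circle) \<le> ennreal e" if "j \<ge> N" for j
   proof -
    have "r j \<ge> N" using seq_suble[OF r(1), of j] that by linarith
    then have "nsq (\<lambda>z. F n z - F (r j) z) \<le> e" using e by force
    then show ?thesis
     using nn_integral_eq_integral[OF sqintD(2)[OF sqint_diff[OF F F]]]
     by (simp add: nsq_def ennreal_leI)
   qed
   then have "\<forall>\<^sub>F j in sequentially. (\<integral>\<^sup>+z. ennreal ((norm (F n z - F (r j) z))\<^sup>2) \<partial>circle) \<le> ennreal e"
    by (auto simp: eventually_sequentially)
   then show ?thesis by (intro Liminf_le) auto
  qed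
  finally show ?thesis .
 qed
 obtain N where N: "\<forall>i\<ge>N. \<forall>j\<ge>N. nsq (\<lambda>z. F i z - F j z) < 1" using cauchy[of 1] by auto
 have "(\<integral>\<^sup>+z. ennreal ((norm (F N z - f z))\<^sup>2) \<partial>circle) \<le> ennreal 1"
  using N by (intro le[of N]) auto
 then have "integrable circle (\<lambda>z. (norm (F N z - f z))\<^sup>2)"
  unfolding integrable_iff_bounded by (auto simp: le_less_trans)
 then have d: "(\<lambda>z. F N z - f z) \<in> sqint" by (auto simp: sqint_def)
 have fs: "f \<in> sqint" using sqint_diff[OF F[of N] d] by simp
 moreover have "(\<lambda>n. nsq (\<lambda>z. F n z - f z)) \<longlonglongrightarrow> 0"
 proof (rule LIMSEQ_I)
  fix e :: real assume "0 < e"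
  then obtain N where N: "\<forall>i\<ge>N. \<forall>j\<ge>N. nsq (\<lambda>z. F i z - F j z) < e/2" using cauchy[of "e/2"] by auto
  have "nsq (\<lambda>z. F n z - f z) < e" if "n \<ge> N" for n
  proof -
   have "(\<integral>\<^sup>+z. ennreal ((norm (F n z - f z))\<^sup>2) \<partial>circle) \<le> ennreal (e/2)"
    using N that by (intro le[of N]) auto
   then have "nsq (\<lambda>z. F n z - f z) \<le> e/2"
    using nn_integral_eq_integral[OF sqintD(2)[OF sqint_diff[OF F[of n] fs]]] \<open>e > 0\<close>
    by (simp add: nsq_def)
   then show ?thesis using \<open>e > 0\<close> by simp
  qed
  then show "\<exists>no. \<forall>n\<ge>no. norm (nsq (\<lambda>z. F n z - f z) - 0) < e" by auto
 qed
 ultimately show ?thesis using that by blast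
qed

text \<open>The representing function minimizes the quadratic functional
  \<open>J f = nsq f - 2 * L f\<close>. The parallelogram identity makes minimizing sequences
  Cauchy, and vanishing of the first variation at the minimizer is the representation.\<close>

lemma sqint_riesz:
 fixes L :: "(real => 'a::euclidean_space) => real"
 assumes add: "\<And>f g. f \<in> sqint ==> g \<in> sqint ==> L (\<lambda>z. f z + g z) = L f + L g"
  and scale: "\<And>f c. f \<in> sqint ==> L (\<lambda>z. c *\<^sub>R f z) = c * L f"
  and bd: "\<And>f. f \<in> sqint ==> \<bar>L f\<bar> \<le> C * sqrt (nsq f)"
 obtains u where "u \<in> sqint" "\<And>f. f \<in> sqint ==> L f = ip u f"
proof -
 define J where "J f = nsq f - 2 * L f" for f
 have J_ge: "J f \<ge> - C\<^sup>2" if "f \<in> sqint" for f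
 proof -
  have "(sqrt (nsq f) - C)\<^sup>2 \<ge> 0" by simp
  then have "nsq f - 2 * (C * sqrt (nsq f)) \<ge> - C\<^sup>2" by (simp add: power2_diff algebra_simps)
  then show ?thesis using bd[OF that] by (simp add: J_def)
 qed
 define I where "I = (INF f\<in>sqint. J f)"
 have bb: "bdd_below (J ` sqint)" using J_ge by (auto intro!: bdd_belowI2)
 have I_le: "I \<le> J f" if "f \<in> sqint" for f
  unfolding I_def by (rule cINF_lower[OF bb that])
 have "\<exists>f\<in>sqint. J f < I + 1 / Suc n" for n
 proof (rule ccontr)
  assume "\<not> ?thesis"
  then have "I + 1 / Suc n \<le> I"
   unfolding I_def by (intro cINF_greatest) (auto simp: not_less intro: exI[of _ "\<lambda>_. 0"] sqint_const)
  then show False by (simp add: field_simps)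
 qed
 then obtain F where F: "\<And>n. F n \<in> sqint" and JF: "\<And>n. J (F n) < I + 1 / Suc n" by metis
 have L_minus: "L (\<lambda>z. f z - g z) = L f - L g" if "f \<in> sqint" "g \<in> sqint" for f g
  using add[of f "\<lambda>z. (-1) *\<^sub>R g z"] scale[of g "-1"] that by simp
 have par: "nsq (\<lambda>z. f z - g z) \<le> 2 * (J f + J g - 2 * I)" if fg: "f \<in> sqint" "g \<in> sqint" for f g
 proof -
  have "I \<le> J (\<lambda>z. (1/2) *\<^sub>R (f z + g z))" by (intro I_le sqint_scaleR sqint_add fg)
  also have "\<dots> = (1/4) * (nsq f + 2 * ip f g + nsq g) - (L f + L g)"
   using fg by (simp only: J_def nsq_scaleR scale sqint_add nsq_add add) (simp add: power2_eq_square field_simps)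
  finally show ?thesis using fg by (simp add: J_def nsq_diff field_simps)
 qed
 have cau: "\<exists>N. \<forall>i\<ge>N. \<forall>j\<ge>N. nsq (\<lambda>z. F i z - F j z) < e" if "e > 0" for e
 proof -
  have "\<exists>N. inverse (real (Suc N)) < e / 4" by (rule reals_Archimedean) (use that in simp)
  then obtain N where N: "1 / Suc N < e / 4" unfolding inverse_eq_divide by blast
  have "nsq (\<lambda>z. F i z - F j z) < e" if "i \<ge> N" "j \<ge> N" for i j
  proof -
   have "1 / Suc i \<le> 1 / Suc N" "1 / Suc j \<le> 1 / Suc N" using that by (auto simp: field_simps)
   then show ?thesis using par[OF F F, of i j] JF[of i] JF[of j] N by simp
  qed
  then show ?thesis by blast
 qed
 then obtain u where u: "u \<in> sqint" and lim: "(\<lambda>n. nsq (\<lambda>z. F n z - u z)) \<longlonglongrightarrow> 0"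
  using sqint_complete[of F, OF F] by blast
 have Ju: "J u \<le> J f" if f: "f \<in> sqint" for f
 proof -
  have eq: "J u = J (F n) - nsq (\<lambda>z. F n z - u z) - 2 * ip u (\<lambda>z. F n z - u z) + 2 * L (\<lambda>z. F n z - u z)" for n
   using u F[of n] ip_commute[of "F n" u] by (simp add: J_def nsq_diff L_minus ip_diff ip_diff_left nsq_ip)
  have "(\<lambda>n. sqrt (nsq (\<lambda>z. F n z - u z))) \<longlonglongrightarrow> sqrt 0"
   by (intro tendsto_intros lim)
  then have s0: "(\<lambda>n. sqrt (nsq (\<lambda>z. F n z - u z))) \<longlonglongrightarrow> 0" by simp
  have b: "J u \<le> I + 1 / Suc n + 2 * (sqrt (nsq u) * sqrt (nsq (\<lambda>z. F n z - u z))) + 2 * (C * sqrt (nsq (\<lambda>z. F n z - u z)))" for n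
  proof -
   have "\<bar>ip u (\<lambda>z. F n z - u z)\<bar> \<le> sqrt (nsq u) * sqrt (nsq (\<lambda>z. F n z - u z))"
    using u F[of n] by (intro ip_le) auto
   moreover have "\<bar>L (\<lambda>z. F n z - u z)\<bar> \<le> C * sqrt (nsq (\<lambda>z. F n z - u z))"
    using u F[of n] by (intro bd) auto
   moreover have "J (F n) < I + 1 / Suc n" "0 \<le> nsq (\<lambda>z. F n z - u z)" using JF by auto
   ultimately show ?thesis using eq[of n] by linarith
  qed
  have "(\<lambda>n. I + 1 / Suc n + 2 * (sqrt (nsq u) * sqrt (nsq (\<lambda>z. F n z - u z))) + 2 * (C * sqrt (nsq (\<lambda>z. F n z - u z))))
   \<longlonglongrightarrow> I + 0 + 2 * (sqrt (nsq u) * 0) + 2 * (C * 0)"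
   by (intro tendsto_intros s0 LIMSEQ_Suc[OF lim_1_over_n])
  then have "J u \<le> I" using b by (intro LIMSEQ_le_const[where X = "\<lambda>n. I + 1 / Suc n + 2 * (sqrt (nsq u) * sqrt (nsq (\<lambda>z. F n z - u z))) + 2 * (C * sqrt (nsq (\<lambda>z. F n z - u z)))"]) auto
  with I_le[OF f] show ?thesis by simp
 qed
 have "L f = ip u f" if f: "f \<in> sqint" for f
 proof -
  have q: "0 \<le> s\<^sup>2 * nsq f + 2 * s * (ip u f - L f)" for s
  proof -
   have "J u \<le> J (\<lambda>z. u z + s *\<^sub>R f z)" using u f by (intro Ju) auto
   also have "\<dots> = J u + (s\<^sup>2 * nsq f + 2 * s * (ip u f - L f))"
    using u f by (simp add: J_def nsq_add nsq_scaleR ip_scaleR add scale algebra_simps)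
   finally show ?thesis by simp
  qed
  show ?thesis
  proof (rule ccontr)
   assume ne: "L f \<noteq> ip u f"
   define d where "d = ip u f - L f"
   \<comment> \<open>A step along which the quadratic polynomial in \<open>q\<close> becomes
     negative; the summand 1 keeps the denominator positive when \<open>f\<close> vanishes almost
     everywhere.\<close>
   define s where "s = - d / (nsq f + 1)"
   have p: "nsq f + 1 > 0" using nsq_nonneg[of f] by linarith
   have d: "d = - (s * (nsq f + 1))" using p by (simp add: s_def)
   have "s\<^sup>2 * nsq f + 2 * s * d = - (s\<^sup>2 * (nsq f + 2))"
    by (subst d) (simp add: power2_eq_square algebra_simps)
   also have "\<dots> < 0" using ne p by (auto simp: s_def d_def)
   finally show False using q[of s] by (simp add: d_def)
  qed
 qed
 then show ?thesis using that u by blast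
qed

lemma tendsto_0_sqrt_nsq: "(\<lambda>n. nsq (F n)) \<longlonglongrightarrow> 0 ==> (\<lambda>n. sqrt (nsq (F n))) \<longlonglongrightarrow> 0"
 using tendsto_real_sqrt[of "\<lambda>n. nsq (F n)" 0] by simp

lemma nsq_cong_AE:
 assumes "AE th in circle. f th = g th" "f \<in> sqint" "g \<in> sqint"
 shows "nsq f = nsq g"
 unfolding nsq_def using assms by (intro integral_cong_AE) (auto dest: sqintD)

lemma ip_cong_AE:
 assumes "AE th in circle. f th = g th" "f \<in> sqint" "g \<in> sqint" "h \<in> sqint"
 shows "ip h f = ip h g"
proof -
 note [measurable] = sqintD(1)[OF assms(2)] sqintD(1)[OF assms(3)] sqintD(1)[OF assms(4)]
 show ?thesis
  unfolding ip_def using assms(1) by (intro integral_cong_AE) (auto intro: AE_mp)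
qed

text \<open>Weak L2 convergence of periodic functions. The norm bound is carried along because it
  lets the test function vary along the sequence, provided that it converges strongly.\<close>

definition wl2 :: "(nat => real => 'a::euclidean_space) => (real => 'a) => bool" where
 "wl2 U u \<longleftrightarrow> (\<forall>n. U n \<in> sqint \<and> periodic (U n)) \<and> u \<in> sqint \<and> periodic u \<and>
  (\<exists>M. \<forall>n. nsq (U n) \<le> M) \<and> (\<forall>\<phi>\<in>sqint. (\<lambda>n. ip \<phi> (U n)) \<longlonglongrightarrow> ip \<phi> u)"

lemma wl2D:
 assumes "wl2 U u"
 shows "U n \<in> sqint" "periodic (U n)" "u \<in> sqint" "periodic u"
  "\<exists>M. \<forall>n. nsq (U n) \<le> M" "\<phi> \<in> sqint ==> (\<lambda>n. ip \<phi> (U n)) \<longlonglongrightarrow> ip \<phi> u"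
 using assms by (auto simp: wl2_def)

lemma wl2_strong:
 assumes U: "wl2 U u" and P: "\<And>n. P n \<in> sqint" "p \<in> sqint" "(\<lambda>n. nsq (\<lambda>th. P n th - p th)) \<longlonglongrightarrow> 0"
 shows "(\<lambda>n. ip (P n) (U n)) \<longlonglongrightarrow> ip p u"
proof -
 obtain M where M: "\<And>n. nsq (U n) \<le> M" using wl2D(5)[OF U] by blast
 have eq: "ip (P n) (U n) = ip p (U n) + ip (U n) (\<lambda>th. P n th - p th)" for n
  using wl2D(1)[OF U] P ip_commute[of "U n" p] ip_commute[of "U n" "P n"] by (simp add: ip_diff)
 have "(\<lambda>n. ip (U n) (\<lambda>th. P n th - p th)) \<longlonglongrightarrow> 0"
 proof (rule Lim_null_comparison)
  show "\<forall>\<^sub>F n in sequentially. norm (ip (U n) (\<lambda>th. P n th - p th)) \<le> sqrt M * sqrt (nsq (\<lambda>th. P n th - p th))"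
  proof (rule always_eventually, rule allI)
   fix n
   have "\<bar>ip (U n) (\<lambda>th. P n th - p th)\<bar> \<le> sqrt (nsq (U n)) * sqrt (nsq (\<lambda>th. P n th - p th))"
    using wl2D(1)[OF U] P by (intro ip_le) auto
   also have "\<dots> \<le> sqrt M * sqrt (nsq (\<lambda>th. P n th - p th))"
    using M by (intro mult_right_mono) auto
   finally show "norm (ip (U n) (\<lambda>th. P n th - p th)) \<le> \<dots>" by simp
  qed
  show "(\<lambda>n. sqrt M * sqrt (nsq (\<lambda>th. P n th - p th))) \<longlonglongrightarrow> 0"
   using tendsto_mult[OF tendsto_const[of "sqrt M"] tendsto_0_sqrt_nsq[OF P(3)]] by simp
 qed
 from tendsto_add[OF wl2D(6)[OF U P(2)] this] show ?thesis by (simp add: eq)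
qed

lemma wl2_subseq: "wl2 U u ==> strict_mono r ==> wl2 (\<lambda>n. U (r n)) u"
 unfolding wl2_def by (auto intro: LIMSEQ_subseq_LIMSEQ[unfolded o_def])

lemma wl2_cong_AE:
 assumes U: "wl2 U u" and V: "\<And>n. V n \<in> sqint" "\<And>n. periodic (V n)" "v \<in> sqint" "periodic v"
  and eq: "\<And>n. AE th in circle. V n th = U n th" "AE th in circle. v th = u th"
 shows "wl2 V v"
 using wl2D[OF U] V nsq_cong_AE[OF eq(1) V(1) wl2D(1)[OF U]]
  ip_cong_AE[OF eq(1) V(1) wl2D(1)[OF U]] ip_cong_AE[OF eq(2) V(3) wl2D(3)[OF U]]
 by (auto simp: wl2_def)

lemma wl2_add: "wl2 U u ==> wl2 V v ==> wl2 (\<lambda>n th. U n th + V n th) (\<lambda>th. u th + v th)"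
proof -
 assume U: "wl2 U u" and V: "wl2 V v"
 obtain M N where M: "\<And>n. nsq (U n) \<le> M" and N: "\<And>n. nsq (V n) \<le> N"
  using wl2D(5)[OF U] wl2D(5)[OF V] by blast
 have "nsq (\<lambda>th. U n th + V n th) \<le> 2 * M + 2 * N" for n
 proof -
  have "nsq (\<lambda>th. U n th - V n th) \<ge> 0" by simp
  then show ?thesis using M[of n] N[of n] wl2D(1)[OF U] wl2D(1)[OF V]
   by (simp add: nsq_add nsq_diff)
 qed
 moreover have "(\<lambda>n. ip \<phi> (\<lambda>th. U n th + V n th)) \<longlonglongrightarrow> ip \<phi> (\<lambda>th. u th + v th)" if "\<phi> \<in> sqint" for \<phi>
  using tendsto_add[OF wl2D(6)[OF U that] wl2D(6)[OF V that]] that wl2D[OF U] wl2D[OF V]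
  by (simp add: ip_add)
 ultimately show ?thesis
  using wl2D(1-4)[OF U] wl2D(1-4)[OF V] by (auto simp: wl2_def periodic_def)
qed

text \<open>A diagonal subsequence handles the countably many indicators of half-lines with rational
  end point times basis vectors. The test functions for which the pairings converge form a linear
  space that is closed in L2. A Dynkin system argument enlarges it to the indicators of all Borel
  sets, and simple functions approximate the rest.\<close>

lemma weakly_convergent_functionals:
 fixes U :: "nat => real => 'a::euclidean_space"
 assumes U: "\<And>n. U n \<in> sqint" and M: "\<And>n. nsq (U n) \<le> M"
 obtains r where "strict_mono (r :: nat => nat)" "\<And>\<phi>. \<phi> \<in> sqint ==> convergent (\<lambda>n. ip \<phi> (U (r n)))"
proof -
 have M0: "M \<ge> 0" using M[of 0] nsq_nonneg[of "U 0"] by linarith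
 have iple: "\<bar>ip \<phi> (U n)\<bar> \<le> sqrt (nsq \<phi>) * sqrt M" if "\<phi> \<in> sqint" for \<phi> n
  using ip_le[OF that U] mult_left_mono[OF real_sqrt_le_mono[OF M], of "sqrt (nsq \<phi>)"]
  by (meson nsq_nonneg order_trans real_sqrt_ge_zero)
 define h :: "real => 'a => real => 'a" where "h x b = (\<lambda>th. indicator {..x} th *\<^sub>R b)" for x b
 have ind_sq: "(\<lambda>th. indicator A th *\<^sub>R b) \<in> sqint" if [measurable]: "A \<in> sets borel" for A and b :: 'a
  by (rule sqint_bounded[where C = "norm b"]) (auto simp: indicator_def)
 have h: "h x b \<in> sqint" for x b unfolding h_def by (rule ind_sq) auto
 have nind: "nsq (\<lambda>th. indicator A th *\<^sub>R b) \<le> 2 * pi * (norm b)\<^sup>2" if "A \<in> sets borel" for A and b :: 'a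
  by (rule nsq_le_bound[OF ind_sq[OF that]]) (auto simp: indicator_def)
 define S where "S = (\<rat> :: real set) \<times> (Basis :: 'a set)"
 have "countable S" unfolding S_def by (intro countable_SIGMA countable_rat) (simp add: countable_finite)
 moreover have "norm (ip (h (fst s) (snd s)) (U n)) \<le> sqrt (2 * pi) * sqrt M" if "s \<in> S" for s n
 proof -
  have "nsq (h (fst s) (snd s)) \<le> 2 * pi"
   using nind[of "{..fst s}" "snd s"] that by (auto simp: S_def h_def)
  then have "sqrt (nsq (h (fst s) (snd s))) * sqrt M \<le> sqrt (2 * pi) * sqrt M"
   using M0 by (intro mult_right_mono) auto
  then show ?thesis using iple[OF h[of "fst s" "snd s"], of n] by simp
 qed
 ultimately obtain r where r: "strict_mono (r :: nat => nat)"
  and rS: "\<And>s. s \<in> S ==> \<exists>l. (\<lambda>n. ip (h (fst s) (snd s)) (U (r n))) \<longlonglongrightarrow> l"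
  using function_convergent_subsequence[of S "\<lambda>n s. ip (h (fst s) (snd s)) (U n)"] by metis
 define V where "V = {\<phi> \<in> sqint. convergent (\<lambda>n. ip \<phi> (U (r n)))}"
 have V_add: "(\<lambda>th. \<phi> th + \<psi> th) \<in> V" if "\<phi> \<in> V" "\<psi> \<in> V" for \<phi> \<psi>
  using that convergent_add[of "\<lambda>n. ip \<phi> (U (r n))" "\<lambda>n. ip \<psi> (U (r n))"] U
  by (simp add: V_def ip_add_left)
 have V_diff: "(\<lambda>th. \<phi> th - \<psi> th) \<in> V" if "\<phi> \<in> V" "\<psi> \<in> V" for \<phi> \<psi>
  using that convergent_diff[of "\<lambda>n. ip \<phi> (U (r n))" "\<lambda>n. ip \<psi> (U (r n))"] U
  by (simp add: V_def ip_diff_left)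
 have V_scale: "(\<lambda>th. c *\<^sub>R \<phi> th) \<in> V" if "\<phi> \<in> V" for \<phi> c
  using that convergent_mult[OF convergent_const[of c], of "\<lambda>n. ip \<phi> (U (r n))"] U
  by (simp add: V_def ip_scaleR_left)
 have V_closed: "\<phi> \<in> V" if \<phi>: "\<phi> \<in> sqint" and ap: "\<And>e. e > 0 ==> \<exists>\<psi>\<in>V. nsq (\<lambda>th. \<phi> th - \<psi> th) \<le> e" for \<phi>
 proof -
  have "Cauchy (\<lambda>n. ip \<phi> (U (r n)))"
  proof (rule metric_CauchyI)
   fix e :: real assume e: "e > 0"
   define d where "d = (e / (3 * (sqrt M + 1)))\<^sup>2"
   have sM: "sqrt M \<ge> 0" using M0 by simp
   then have sM': "0 < 3 + sqrt M * 3" by linarith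
   have "d > 0" using e sM sM' by (simp add: d_def)
   then obtain \<psi> where \<psi>: "\<psi> \<in> V" "nsq (\<lambda>th. \<phi> th - \<psi> th) \<le> d" using ap by blast
   then have "\<psi> \<in> sqint" "Cauchy (\<lambda>n. ip \<psi> (U (r n)))" by (auto simp: V_def Cauchy_convergent_iff)
   then obtain N where N: "\<And>m n. m \<ge> N ==> n \<ge> N ==> dist (ip \<psi> (U (r m))) (ip \<psi> (U (r n))) < e/3"
    using e by (meson metric_CauchyD zero_less_divide_iff zero_less_numeral)
   have cl: "\<bar>ip \<phi> (U (r n)) - ip \<psi> (U (r n))\<bar> \<le> e/3" for n
   proof -
    have "ip \<phi> (U (r n)) - ip \<psi> (U (r n)) = ip (\<lambda>th. \<phi> th - \<psi> th) (U (r n))"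
     using \<phi> \<open>\<psi> \<in> sqint\<close> U by (simp add: ip_diff_left)
    also have "\<bar>\<dots>\<bar> \<le> sqrt (nsq (\<lambda>th. \<phi> th - \<psi> th)) * sqrt M"
     using \<phi> \<open>\<psi> \<in> sqint\<close> by (intro iple) auto
    also have "\<dots> \<le> sqrt d * sqrt M" using \<psi>(2) sM by (intro mult_right_mono) auto
    also have "\<dots> = e / (3 * (sqrt M + 1)) * sqrt M" using e sM sM' by (simp add: d_def)
    also have "\<dots> \<le> e/3" using e sM sM' by (simp add: field_simps)
    finally show ?thesis .
   qed
   have "dist (ip \<phi> (U (r m))) (ip \<phi> (U (r n))) < e" if "m \<ge> N" "n \<ge> N" for m n
    using N[OF that] cl[of m] cl[of n] unfolding dist_real_def by linarith
   then show "\<exists>N. \<forall>m\<ge>N. \<forall>n\<ge>N. dist (ip \<phi> (U (r m))) (ip \<phi> (U (r n))) < e" by blast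
  qed
  then show ?thesis using \<phi> by (simp add: V_def Cauchy_convergent_iff)
 qed
 have V_lim: "\<phi> \<in> V" if F: "\<And>n. F n \<in> V" and l: "(\<lambda>n. nsq (\<lambda>th. F n th - \<phi> th)) \<longlonglongrightarrow> 0" and \<phi>: "\<phi> \<in> sqint" for F \<phi>
 proof (rule V_closed[OF \<phi>])
  fix e :: real assume "e > 0"
  then obtain n where "norm (nsq (\<lambda>th. F n th - \<phi> th) - 0) < e" using LIMSEQ_D[OF l] by blast
  moreover have "nsq (\<lambda>th. F n th - \<phi> th) = nsq (\<lambda>th. \<phi> th - F n th)"
   by (simp add: nsq_def norm_minus_commute)
  ultimately show "\<exists>\<psi>\<in>V. nsq (\<lambda>th. \<phi> th - \<psi> th) \<le> e" using F by (intro bexI[of _ "F n"]) auto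
 qed
 have V_h: "h x b \<in> V" if b: "b \<in> Basis" for x b
 proof -
  have "\<exists>q\<in>\<rat>. x < q \<and> q < x + 1 / Suc n" for n
   by (rule Rats_dense_in_real) simp
  then obtain q where q: "\<And>n. q n \<in> \<rat>" "\<And>n. x < q n" "\<And>n. q n < x + 1 / Suc n" by metis
  have qx: "q \<longlonglongrightarrow> x"
  proof (rule tendsto_sandwich[of "\<lambda>_. x" _ _ "\<lambda>n. x + 1 / Suc n"])
   show "(\<lambda>n. x + 1 / real (Suc n)) \<longlonglongrightarrow> x"
    using tendsto_add[OF tendsto_const[of x] LIMSEQ_Suc[OF lim_1_over_n]] by simp
  qed (use q in \<open>auto intro!: always_eventually less_imp_le\<close>)
  have "h (q n) b \<in> V" for n
   using rS[of "(q n, b)"] q(1) b h by (auto simp: S_def V_def convergent_def)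
  moreover have "(\<lambda>n. nsq (\<lambda>th. h (q n) b th - h x b th)) \<longlonglongrightarrow> 0"
  proof (rule nsq_tendsto_0(1)[where g = "\<lambda>_. 1::real" and C = "norm b"])
   fix th :: real
   show "(\<lambda>n. h (q n) b th) \<longlonglongrightarrow> h x b th"
   proof (cases "th \<le> x")
    case True
    then have "h (q n) b th = h x b th" for n using q(2)[of n] by (simp add: h_def)
    then show ?thesis by simp
   next
    case False
    then have "\<forall>\<^sub>F n in sequentially. q n < th" using order_tendstoD(2)[OF qx, of th] by simp
    then have "\<forall>\<^sub>F n in sequentially. h (q n) b th = h x b th"
     by eventually_elim (use False in \<open>auto simp: h_def\<close>)
    then show ?thesis by (rule tendsto_eventually)
   qed
  qed (use h in \<open>auto dest: sqintD simp: h_def indicator_def\<close>)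
  ultimately show ?thesis using h by (rule V_lim)
 qed
 have V_ind: "(\<lambda>th. indicator A th *\<^sub>R b) \<in> V" if b: "b \<in> Basis" and A: "A \<in> sets borel" for A b
 proof -
  have bo: "sets borel = sigma_sets UNIV (range (atMost :: real => real set))"
   by (subst borel_eq_atMost) (simp add: sets_measure_of)
  have one: "(\<lambda>th. b) \<in> V"
  proof -
   \<comment> \<open>As 7 exceeds 2 pi, the half-line up to 7 covers the whole period, and its
     indicator is constant there.\<close>
   have "nsq (\<lambda>th. h 7 b th - b) \<le> 2 * pi * 0\<^sup>2"
    using pi_less_4 pi_approx(2) by (intro nsq_le_bound sqint_diff h) (auto simp: h_def indicator_def)
   then have z: "nsq (\<lambda>th. h 7 b th - b) = 0" using nsq_nonneg[of "\<lambda>th. h 7 b th - b"] by simp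
   show ?thesis by (rule V_lim[of "\<lambda>n. h 7 b"]) (simp_all add: z V_h[OF b])
  qed
  have ist: "Int_stable (range (atMost :: real => real set))"
   by (auto simp: Int_stable_def)
  have clo: "range (atMost :: real => real set) \<subseteq> Pow UNIV" by simp
  have "A \<in> sigma_sets UNIV (range (atMost :: real => real set))" using A bo by simp
  from ist clo this show ?thesis
  proof (induction rule: sigma_sets_induct_disjoint)
   case (basic A)
   then show ?case using V_h[OF b] by (auto simp: h_def)
  next
   case empty
   show ?case using V_scale[OF one, of 0] by simp
  next
   case (compl A)
   have "(\<lambda>th. b - indicator A th *\<^sub>R b) \<in> V" by (rule V_diff[OF one compl(2)])
   also have "(\<lambda>th. b - indicator A th *\<^sub>R b) = (\<lambda>th. indicator (UNIV - A) th *\<^sub>R b)"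
    by (auto simp: indicator_def)
   finally show ?case .
  next
   case (union A)
   have Am[measurable]: "A i \<in> sets borel" for i using union(2) bo by blast
   have fin: "(\<lambda>th. indicator (\<Union>i<n. A i) th *\<^sub>R b) \<in> V" for n
   proof (induction n)
    case 0
    show ?case using V_scale[OF one, of 0] by simp
   next
    case (Suc n)
    define X where "X = (\<Union>i<n. A i)"
    have "A n \<inter> A i = {}" if "i < n" for i
     using disjoint_family_onD[OF union(1), of n i] that by simp
    then have disj: "A n \<inter> X = {}" by (auto simp: X_def)
    have "(\<Union>i<Suc n. A i) = A n \<union> X" by (simp add: lessThan_Suc X_def)
    moreover have "indicator (A n \<union> X) th *\<^sub>R b = indicator X th *\<^sub>R b + indicator (A n) th *\<^sub>R b" for th
     using disj by (cases "th \<in> X"; cases "th \<in> A n") (auto simp: indicator_def)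
    ultimately have "(\<lambda>th. indicator (\<Union>i<Suc n. A i) th *\<^sub>R b) = (\<lambda>th. indicator (\<Union>i<n. A i) th *\<^sub>R b + indicator (A n) th *\<^sub>R b)"
     by (simp add: X_def)
    then show ?case using V_add[OF Suc union(3)[of n]] by simp
   qed
   show ?case
   proof (rule V_lim[OF fin])
    show "(\<lambda>n. nsq (\<lambda>th. indicator (\<Union>i<n. A i) th *\<^sub>R b - indicator (\<Union>(range A)) th *\<^sub>R b)) \<longlonglongrightarrow> 0"
    proof (rule nsq_tendsto_0(1)[where g = "\<lambda>_. 1::real" and C = "norm b"])
     fix th :: real
     show "(\<lambda>n. indicator (\<Union>i<n. A i) th *\<^sub>R b) \<longlonglongrightarrow> indicator (\<Union>(range A)) th *\<^sub>R b"
     proof (cases "th \<in> \<Union>(range A)")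
      case True
      then obtain i where "th \<in> A i" by blast
      then have "indicator (\<Union>i<n. A i) th *\<^sub>R b = indicator (\<Union>(range A)) th *\<^sub>R b" if "n > i" for n
       using that by (auto simp: indicator_def)
      then show ?thesis
       by (intro tendsto_eventually) (auto simp: eventually_sequentially intro: exI[of _ "Suc i"])
     next
      case False
      then have "indicator (\<Union>i<n. A i) th *\<^sub>R b = indicator (\<Union>(range A)) th *\<^sub>R b" for n
       by (auto simp: indicator_def)
      then show ?thesis by (intro tendsto_eventually always_eventually allI)
     qed
    qed (auto simp: indicator_def)
    show "(\<lambda>th. indicator (\<Union>(range A)) th *\<^sub>R b) \<in> sqint" by (rule ind_sq) measurable
   qed
  qed
 qed
 have V_sum: "(\<lambda>th. \<Sum>i\<in>I. G i th) \<in> V" if "finite I" "\<And>i. i \<in> I ==> G i \<in> V" for I :: "'a set" and G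
  using that
 proof (induction I rule: finite_induct)
  case empty
  have "(\<lambda>th. 0 *\<^sub>R (indicator {} th *\<^sub>R (SOME b. b \<in> (Basis :: 'a set)))) \<in> V"
   by (rule V_scale[OF V_ind]) (auto simp: some_in_eq)
  then show ?case by simp
 next
  case (insert x I)
  then show ?case using V_add[of "G x" "\<lambda>th. \<Sum>i\<in>I. G i th"] by simp
 qed
 have V_ind': "(\<lambda>th. indicator A th *\<^sub>R y) \<in> V" if A: "A \<in> sets borel" for A and y :: 'a
 proof -
  have "(\<lambda>th. \<Sum>b\<in>Basis. (y \<bullet> b) *\<^sub>R (indicator A th *\<^sub>R b)) \<in> V"
   by (rule V_sum[OF finite_Basis V_scale[OF V_ind[OF _ A]]])
  moreover have "(\<Sum>b\<in>Basis. (y \<bullet> b) *\<^sub>R (indicator A th *\<^sub>R b)) = indicator A th *\<^sub>R y" for th :: real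
   by (subst euclidean_representation[of y, symmetric]) (simp add: scaleR_sum_right mult.commute del: euclidean_representation)
  ultimately show ?thesis by simp
 qed
 have "\<phi> \<in> V" if \<phi>: "\<phi> \<in> sqint" for \<phi>
 proof -
  have [measurable]: "\<phi> \<in> borel_measurable borel" by (rule sqintD(1)[OF \<phi>])
  obtain F where F: "\<And>i. simple_function borel (F i)" "\<And>x. (\<lambda>i. F i x) \<longlonglongrightarrow> \<phi> x" "\<And>i x. dist (F i x) 0 \<le> 2 * dist (\<phi> x) 0"
   using borel_measurable_implies_sequence_metric[of \<phi> borel 0] by auto
  have Fm: "F i \<in> borel_measurable borel" for i by (rule borel_measurable_simple_function[OF F(1)])
  have "F i \<in> V" for i
  proof -
   have fin: "finite (range (F i))" using F(1)[of i] by (simp add: simple_function_def)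
   have "(\<lambda>th. \<Sum>y\<in>range (F i). indicator (F i -` {y}) th *\<^sub>R y) \<in> V"
   proof (rule V_sum[OF fin])
    fix y
    have "F i -` {y} \<in> sets borel" using measurable_sets[OF Fm, of "{y}" i] by simp
    then show "(\<lambda>th. indicator (F i -` {y}) th *\<^sub>R y) \<in> V" by (rule V_ind')
   qed
   moreover have "(\<Sum>y\<in>range (F i). indicator (F i -` {y}) th *\<^sub>R y) = F i th" for th
   proof -
    have "(\<Sum>y\<in>range (F i). indicator (F i -` {y}) th *\<^sub>R y) = (\<Sum>y\<in>range (F i). if y = F i th then y else 0)"
     by (intro sum.cong) (auto simp: indicator_def)
    then show ?thesis using fin by simp
   qed
   ultimately show ?thesis by simp
  qed
  then show ?thesis
  proof (rule V_lim)
   show "(\<lambda>n. nsq (\<lambda>th. F n th - \<phi> th)) \<longlonglongrightarrow> 0"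
    by (rule nsq_tendsto_0(1)[where g = \<phi> and C = 2]) (use F Fm \<phi> in auto)
  qed (rule \<phi>)
 qed
 then show ?thesis using that[OF r] by (simp add: V_def)
qed

definition periodize :: "(real => 'a) => real => 'a" where
 "periodize u th = u (th - 2 * pi * of_int \<lfloor>th / (2 * pi)\<rfloor>)"

lemma periodic_periodize: "periodic (periodize u)"
proof -
 have "\<lfloor>(th + 2 * pi) / (2 * pi)\<rfloor> = \<lfloor>th / (2 * pi)\<rfloor> + 1" for th
  by (simp add: add_divide_distrib)
 then show ?thesis by (simp add: periodic_def periodize_def algebra_simps)
qed

lemma periodize_eq: "th \<in> {0..<2 * pi} ==> periodize u th = u th"
proof -
 assume "th \<in> {0..<2 * pi}"
 then have "\<lfloor>th / (2 * pi)\<rfloor> = 0" by (simp add: floor_eq_iff field_simps)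
 then show ?thesis by (simp add: periodize_def)
qed

lemma periodize_measurable: "u \<in> borel_measurable borel ==> periodize u \<in> borel_measurable borel"
 unfolding periodize_def[abs_def] by (rule measurable_compose[of _ borel borel]) measurable

lemma periodize_sqint: "u \<in> sqint ==> periodize u \<in> sqint"
 by (rule sqint_bound[where f = u and C = 1]) (auto simp: periodize_measurable periodize_eq dest: sqintD)

text \<open>The limits of the pairings form a bounded linear functional, whose Riesz representative
  is the weak limit. That representative is only determined on one period; periodization extends it
  without changing any pairing.\<close>

lemma weakly_compact:
 fixes U :: "nat => real => 'a::euclidean_space"
 assumes U: "\<And>n. U n \<in> sqint" "\<And>n. periodic (U n)" and M: "\<And>n. nsq (U n) \<le> M"
 obtains r u where "strict_mono (r :: nat => nat)" "wl2 (\<lambda>n. U (r n)) u"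
proof -
 obtain r where r: "strict_mono (r :: nat => nat)" "\<And>\<phi>. \<phi> \<in> sqint ==> convergent (\<lambda>n. ip \<phi> (U (r n)))"
  using weakly_convergent_functionals[of U, OF U(1) M] by blast
 define L where "L \<phi> = lim (\<lambda>n. ip \<phi> (U (r n)))" for \<phi>
 have L: "(\<lambda>n. ip \<phi> (U (r n))) \<longlonglongrightarrow> L \<phi>" if "\<phi> \<in> sqint" for \<phi>
  using r(2)[OF that] by (simp add: L_def convergent_LIMSEQ_iff)
 obtain u where u: "u \<in> sqint" "\<And>\<phi>. \<phi> \<in> sqint ==> L \<phi> = ip u \<phi>"
 proof (rule sqint_riesz[of L "sqrt M"])
  fix f g :: "real => 'a" assume fg: "f \<in> sqint" "g \<in> sqint"
  have "(\<lambda>n. ip (\<lambda>th. f th + g th) (U (r n))) \<longlonglongrightarrow> L f + L g"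
   using tendsto_add[OF L[OF fg(1)] L[OF fg(2)]] fg U by (simp add: ip_add_left)
  then show "L (\<lambda>th. f th + g th) = L f + L g"
   using L[OF sqint_add[OF fg]] LIMSEQ_unique by blast
 next
  fix f :: "real => 'a" and c :: real assume f: "f \<in> sqint"
  have "(\<lambda>n. ip (\<lambda>th. c *\<^sub>R f th) (U (r n))) \<longlonglongrightarrow> c * L f"
   using tendsto_mult[OF tendsto_const[of c] L[OF f]] by (simp add: ip_scaleR_left)
  then show "L (\<lambda>th. c *\<^sub>R f th) = c * L f"
   using L[OF sqint_scaleR[OF f]] LIMSEQ_unique by blast
 next
  fix f :: "real => 'a" assume f: "f \<in> sqint"
  show "\<bar>L f\<bar> \<le> sqrt M * sqrt (nsq f)"
  proof (rule LIMSEQ_le_const2[OF tendsto_rabs[OF L[OF f]]])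
   have "\<bar>ip f (U n)\<bar> \<le> sqrt M * sqrt (nsq f)" for n
    using ip_le[OF f U(1)] mult_left_mono[OF real_sqrt_le_mono[OF M], of "sqrt (nsq f)"]
    by (smt (verit) mult.commute nsq_nonneg real_sqrt_ge_zero)
   then show "\<exists>N. \<forall>n\<ge>N. \<bar>ip f (U (r n))\<bar> \<le> sqrt M * sqrt (nsq f)" by blast
  qed
 qed blast
 have ae: "AE th in circle. periodize u th = u th"
  by (rule AE_I2) (simp add: space_circle periodize_eq)
 have "(\<lambda>n. ip \<phi> (U (r n))) \<longlonglongrightarrow> ip \<phi> (periodize u)" if "\<phi> \<in> sqint" for \<phi>
  using L[OF that] u(2)[OF that] ip_cong_AE[OF ae periodize_sqint[OF u(1)] u(1) that] by (simp add: ip_commute)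
 then have "wl2 (\<lambda>n. U (r n)) (periodize u)"
  using U periodic_periodize periodize_sqint[OF u(1)] M[of "r _"] by (auto simp: wl2_def)
 then show ?thesis using that r(1) by blast
qed

text \<open>No regularity of the weights is needed: the truncated infima of their tails increase to the lower limit.\<close>

lemma weighted_nsq_lsc:
 fixes U :: "nat => real => 'a::euclidean_space" and w :: "nat => real => ennreal"
 assumes U: "wl2 U u" and w[measurable]: "\<And>n. w n \<in> borel_measurable borel"
 shows "(\<integral>\<^sup>+th. liminf (\<lambda>n. w n th) * ennreal ((norm (u th))\<^sup>2) \<partial>circle) \<le>
  liminf (\<lambda>n. \<integral>\<^sup>+th. w n th * ennreal ((norm (U n th))\<^sup>2) \<partial>circle)"
proof -
 note [measurable] = sqintD(1)[OF wl2D(1)[OF U]] sqintD(1)[OF wl2D(3)[OF U]]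
 define v where "v N th = min (of_nat N) (INF n\<in>{N..}. w n th)" for N th
 have [measurable]: "v N \<in> borel_measurable borel" for N unfolding v_def[abs_def] by measurable
 have v_mono: "v N th \<le> v N' th" if "N \<le> N'" for N N' th
  unfolding v_def by (intro min.mono INF_superset_mono) (use that in auto)
 have v_sup: "(SUP N. v N th) = liminf (\<lambda>n. w n th)" for th
 proof (rule antisym)
  show "(SUP N. v N th) \<le> liminf (\<lambda>n. w n th)"
   unfolding liminf_SUP_INF v_def by (intro SUP_mono) (auto intro: min.cobounded2)
  show "liminf (\<lambda>n. w n th) \<le> (SUP N. v N th)"
   unfolding liminf_SUP_INF
  proof (rule SUP_least)
   fix k
   let ?a = "INF n\<in>{k..}. w n th"
   have "min (of_nat N) ?a \<le> (SUP N. v N th)" for N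
   proof -
    have "min (of_nat N) ?a \<le> v (max N k) th"
     unfolding v_def by (intro min.mono INF_superset_mono) (auto simp: of_nat_mono)
    also have "\<dots> \<le> (SUP N. v N th)" by (rule SUP_upper) simp
    finally show ?thesis .
   qed
   then have "(SUP N. min (of_nat N) ?a) \<le> (SUP N. v N th)" by (intro SUP_least)
   moreover have "(SUP N. min (of_nat N) ?a) = ?a"
   proof (rule antisym)
    show "?a \<le> (SUP N. min (of_nat N) ?a)"
    proof (rule le_SUP_iff[THEN iffD2], intro allI impI)
     fix y assume y: "y < ?a"
     then have "y < top" by (rule less_le_trans) simp
     then obtain n where "y < of_nat n" using ennreal_Ex_less_of_nat[of y] by blast
     then show "\<exists>i\<in>UNIV. y < min (of_nat i) ?a" using y by (intro bexI[of _ n]) auto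
    qed
   qed (auto intro: SUP_least)
   ultimately show "?a \<le> (SUP N. v N th)" by simp
  qed
 qed
 have step: "(\<integral>\<^sup>+th. v N th * ennreal ((norm (u th))\<^sup>2) \<partial>circle) \<le>
  liminf (\<lambda>n. \<integral>\<^sup>+th. w n th * ennreal ((norm (U n th))\<^sup>2) \<partial>circle)" for N
 proof -
  define g where "g th = enn2real (v N th)" for th
  have [measurable]: "g \<in> borel_measurable borel" unfolding g_def[abs_def] by measurable
  have vN: "v N th \<le> of_nat N" for th by (simp add: v_def)
  have vg: "v N th = ennreal (g th)" for th
   using vN[of th] by (auto simp: g_def intro!: ennreal_enn2real[symmetric])
    (metis ennreal_less_top ennreal_of_nat_eq_real_of_nat le_less_trans)
  have g0: "g th \<ge> 0" for th by (simp add: g_def)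
  have gN: "g th \<le> real N" for th
   using vN[of th] g0 by (simp add: vg ennreal_of_nat_eq_real_of_nat)
  have gs: "(\<lambda>th. g th *\<^sub>R f th) \<in> sqint" if f: "f \<in> sqint" for f :: "real => 'a"
  proof (rule sqint_bound[where f = f and C = "real N"])
   show "(\<lambda>th. g th *\<^sub>R f th) \<in> borel_measurable borel" using sqintD(1)[OF f] by measurable
  qed (use f g0 gN in \<open>auto intro: mult_right_mono\<close>)
  have us: "u \<in> sqint" and Us: "U n \<in> sqint" for n by (rule wl2D[OF U])+
  have nn: "(\<integral>\<^sup>+th. v N th * ennreal ((norm (f th))\<^sup>2) \<partial>circle) = ennreal (ip (\<lambda>th. g th *\<^sub>R f th) f)"
   if f: "f \<in> sqint" for f :: "real => 'a"
  proof -
   have "(\<integral>\<^sup>+th. v N th * ennreal ((norm (f th))\<^sup>2) \<partial>circle) = (\<integral>\<^sup>+th. ennreal (g th *\<^sub>R f th \<bullet> f th) \<partial>circle)"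
    by (intro nn_integral_cong) (simp add: vg ennreal_mult[symmetric] g0 power2_norm_eq_inner)
   also have "\<dots> = ennreal (ip (\<lambda>th. g th *\<^sub>R f th) f)"
    unfolding ip_def by (intro nn_integral_eq_integral integrable_sqint_inner gs[OF f] f) (auto simp: g0)
   finally show ?thesis .
  qed
  \<comment> \<open>Expanding the weighted square of \<open>U n - u\<close> bounds the quadratic
    term from below by an expression affine in \<open>U n\<close>, which passes to the weak limit.
    The truncation at \<open>N\<close> makes \<open>g\<close> bounded, so that \<open>g\<close>
    times \<open>u\<close> is an admissible test function.\<close>
  have low: "2 * ip (\<lambda>th. g th *\<^sub>R u th) (U n) - ip (\<lambda>th. g th *\<^sub>R u th) u \<le> ip (\<lambda>th. g th *\<^sub>R U n th) (U n)" for n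
  proof -
   have "0 \<le> ip (\<lambda>th. g th *\<^sub>R (U n th - u th)) (\<lambda>th. U n th - u th)"
    unfolding ip_def by (intro integral_nonneg_AE AE_I2) (simp add: g0)
   also have "\<dots> = (LINT th|circle. g th *\<^sub>R U n th \<bullet> U n th - 2 * (g th *\<^sub>R u th \<bullet> U n th) + g th *\<^sub>R u th \<bullet> u th)"
    unfolding ip_def by (intro Bochner_Integration.integral_cong) (auto simp: inner_diff algebra_simps inner_commute)
   also have "\<dots> = ip (\<lambda>th. g th *\<^sub>R U n th) (U n) - 2 * ip (\<lambda>th. g th *\<^sub>R u th) (U n) + ip (\<lambda>th. g th *\<^sub>R u th) u"
    using integrable_sqint_inner[OF gs[OF us] us] integrable_sqint_inner[OF gs[OF us] Us[of n]]
     integrable_sqint_inner[OF gs[OF Us[of n]] Us[of n]] by (simp add: ip_def)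
   finally show ?thesis by linarith
  qed
  have "(\<lambda>n. ennreal (2 * ip (\<lambda>th. g th *\<^sub>R u th) (U n) - ip (\<lambda>th. g th *\<^sub>R u th) u)) \<longlonglongrightarrow>
   ennreal (2 * ip (\<lambda>th. g th *\<^sub>R u th) u - ip (\<lambda>th. g th *\<^sub>R u th) u)"
   by (intro tendsto_ennrealI tendsto_intros wl2D(6)[OF U] gs us)
  from lim_imp_Liminf[OF trivial_limit_sequentially this]
  have "ennreal (ip (\<lambda>th. g th *\<^sub>R u th) u) = liminf (\<lambda>n. ennreal (2 * ip (\<lambda>th. g th *\<^sub>R u th) (U n) - ip (\<lambda>th. g th *\<^sub>R u th) u))"
   by simp
  also have "\<dots> \<le> liminf (\<lambda>n. \<integral>\<^sup>+th. w n th * ennreal ((norm (U n th))\<^sup>2) \<partial>circle)"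
  proof (rule Liminf_mono, unfold eventually_sequentially, intro exI allI impI)
   fix n assume "N \<le> n"
   have "ennreal (2 * ip (\<lambda>th. g th *\<^sub>R u th) (U n) - ip (\<lambda>th. g th *\<^sub>R u th) u) \<le> ennreal (ip (\<lambda>th. g th *\<^sub>R U n th) (U n))"
    by (rule ennreal_leI[OF low])
   also have "\<dots> = (\<integral>\<^sup>+th. v N th * ennreal ((norm (U n th))\<^sup>2) \<partial>circle)" by (rule nn[OF Us, symmetric])
   also have "\<dots> \<le> (\<integral>\<^sup>+th. w n th * ennreal ((norm (U n th))\<^sup>2) \<partial>circle)"
   proof (intro nn_integral_mono mult_right_mono)
    fix th
    have "v N th \<le> (INF n\<in>{N..}. w n th)" by (simp add: v_def)
    also have "\<dots> \<le> w n th" by (rule INF_lower) (use \<open>N \<le> n\<close> in auto)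
    finally show "v N th \<le> w n th" .
   qed auto
   finally show "ennreal (2 * ip (\<lambda>th. g th *\<^sub>R u th) (U n) - ip (\<lambda>th. g th *\<^sub>R u th) u) \<le>
    (\<integral>\<^sup>+th. w n th * ennreal ((norm (U n th))\<^sup>2) \<partial>circle)" .
  qed
  finally show ?thesis by (simp add: nn[OF us])
 qed
 have "(\<integral>\<^sup>+th. liminf (\<lambda>n. w n th) * ennreal ((norm (u th))\<^sup>2) \<partial>circle)
  = (\<integral>\<^sup>+th. (SUP N. v N th * ennreal ((norm (u th))\<^sup>2)) \<partial>circle)"
  by (simp add: v_sup[symmetric] SUP_mult_right_ennreal)
 also have "\<dots> = (SUP N. \<integral>\<^sup>+th. v N th * ennreal ((norm (u th))\<^sup>2) \<partial>circle)"
  by (intro nn_integral_monotone_convergence_SUP) (auto simp: incseq_def le_fun_def intro!: mult_right_mono v_mono)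
 also have "\<dots> \<le> liminf (\<lambda>n. \<integral>\<^sup>+th. w n th * ennreal ((norm (U n th))\<^sup>2) \<partial>circle)"
  by (rule SUP_least) (rule step)
 finally show ?thesis .
qed

section \<open>Absolutely continuous functions\<close>

text \<open>Absolute continuity is expressed through the derivative: \<open>u\<close> is a primitive
  of the Lebesgue integrable \<open>v\<close>. Chain and product rule then become integral
  estimates, with no recourse to differentiability almost everywhere.\<close>

definition ac :: "real => real => (real => 'a::euclidean_space) => (real => 'a) => bool" where
 "ac a b u v \<longleftrightarrow> v absolutely_integrable_on {a..b} \<and>
  (\<forall>x\<in>{a..b}. \<forall>y\<in>{x..b}. (v has_integral (u y - u x)) {x..y})"

lemma acD:
 assumes "ac a b u v"
 shows "v absolutely_integrable_on {a..b}"
  "a \<le> x ==> x \<le> y ==> y \<le> b ==> (v has_integral (u y - u x)) {x..y}"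
 using assms by (auto simp: ac_def)

lemma ac_integral:
 "ac a b u v ==> a \<le> x ==> x \<le> y ==> y \<le> b ==> integral {x..y} v = u y - u x"
 using acD(2) integral_unique by blast

lemma absint_sub:
 fixes v :: "real => 'a::euclidean_space"
 assumes "v absolutely_integrable_on {a..b}" "a \<le> x" "y \<le> b"
 shows "v absolutely_integrable_on {x..y}" "v integrable_on {x..y}" "(\<lambda>s. norm (v s)) integrable_on {x..y}"
proof -
 show 1: "v absolutely_integrable_on {x..y}"
  by (rule absolutely_integrable_on_subinterval[OF assms(1)]) (use assms in auto)
 then show "v integrable_on {x..y}" "(\<lambda>s. norm (v s)) integrable_on {x..y}"
  by (auto simp: absolutely_integrable_on_def)
qed

lemma ac_subinterval: "ac a b u v ==> a \<le> a' ==> b' \<le> b ==> ac a' b' u v"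
 by (auto simp: ac_def intro: absint_sub(1))

lemma ac_continuous:
 assumes "ac a b u v"
 shows "continuous_on {a..b} u"
proof -
 have "continuous_on {a..b} (\<lambda>x. u a + integral {a..x} v)"
  using absint_sub(2)[OF acD(1)[OF assms], of a b]
  by (intro continuous_intros indefinite_integral_continuous_1) auto
 then show ?thesis
  by (rule continuous_on_eq) (use ac_integral[OF assms, of a] in auto)
qed

lemma ac_norm_diff_le:
 assumes "ac a b u v" "a \<le> x" "x \<le> y" "y \<le> b"
 shows "norm (u y - u x) \<le> integral {x..y} (\<lambda>s. norm (v s))"
proof -
 have "norm (integral {x..y} v) \<le> integral {x..y} (\<lambda>s. norm (v s))"
  by (rule integral_norm_bound_integral) (use absint_sub(2,3)[OF acD(1)[OF assms(1)]] assms(2,4) in auto)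
 then show ?thesis by (simp add: ac_integral[OF assms])
qed

text \<open>The error on the left is subadditive and the integral on the right additive over
  adjacent intervals, so subdivision into short pieces makes the local estimate global with the same
  factor \<open>e\<close>, which then tends to 0.\<close>

lemma ac_locallyI:
 fixes w :: "real => 'a::euclidean_space"
 assumes v: "v absolutely_integrable_on {a..b}" and q: "q integrable_on {a..b}"
  and loc: "\<And>e. e > 0 ==> \<exists>d>0. \<forall>x y. a \<le> x \<longrightarrow> x \<le> y \<longrightarrow> y \<le> b \<longrightarrow> y < x + d \<longrightarrow>
   norm (w y - w x - integral {x..y} v) \<le> e * integral {x..y} q"
 shows "ac a b w v"
 unfolding ac_def
proof (intro conjI ballI v)
 fix x y assume xy: "x \<in> {a..b}" "y \<in> {x..b}"
 have qi: "q integrable_on {s..t}" if "x \<le> s" "t \<le> y" for s t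
  by (rule integrable_subinterval_real[OF q]) (use xy that in auto)
 have vi: "v integrable_on {s..t}" if "x \<le> s" "t \<le> y" for s t
  by (rule absint_sub(2)[OF v]) (use xy that in auto)
 have main: "norm (w y - w x - integral {x..y} v) \<le> e * integral {x..y} q" if "e > 0" for e
 proof -
  obtain d where d: "d > 0" "\<And>x y. a \<le> x ==> x \<le> y ==> y \<le> b ==> y < x + d ==>
   norm (w y - w x - integral {x..y} v) \<le> e * integral {x..y} q"
   using loc[OF \<open>e > 0\<close>] by blast
  obtain N :: nat where N: "(y - x) / d < real N" using reals_Archimedean2 by blast
  have N0: "N > 0" using N xy d(1) by (cases N) (auto simp: field_simps)
  define z where "z i = x + real i * ((y - x) / real N)" for i
  have zN: "z N = y" and z0: "z 0 = x" using N0 by (auto simp: z_def)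
  have zS: "z (Suc i) = z i + (y - x) / real N" for i
   by (simp only: z_def of_nat_Suc distrib_right mult_1 add_ac)
  have st: "0 \<le> (y - x) / real N" "(y - x) / real N < d" using xy N N0 d(1) by (auto simp: field_simps)
  have zm: "z i \<le> z j" if "i \<le> j" for i j
   unfolding z_def using that st(1) by (intro add_left_mono mult_right_mono) auto
  have "norm (w (z i) - w x - integral {x..z i} v) \<le> e * integral {x..z i} q" if "i \<le> N" for i
   using that
  proof (induction i)
   case 0
   then show ?case by (simp add: z0)
  next
   case (Suc i)
   have le: "x \<le> z i" "z i \<le> z (Suc i)" "z (Suc i) \<le> y"
    using zm[of 0 i] zm[of i "Suc i"] zm[of "Suc i" N] Suc.prems zN z0 by auto
   have "norm (w (z (Suc i)) - w (z i) - integral {z i..z (Suc i)} v) \<le> e * integral {z i..z (Suc i)} q"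
    using le xy st by (intro d(2)) (auto simp: zS)
   moreover have "integral {x..z (Suc i)} v = integral {x..z i} v + integral {z i..z (Suc i)} v"
    using le by (intro Henstock_Kurzweil_Integration.integral_combine[symmetric] vi) auto
   moreover have "integral {x..z (Suc i)} q = integral {x..z i} q + integral {z i..z (Suc i)} q"
    using le by (intro Henstock_Kurzweil_Integration.integral_combine[symmetric] qi) auto
   moreover have "norm (w (z i) - w x - integral {x..z i} v) \<le> e * integral {x..z i} q"
    using Suc by auto
   moreover have "w (z (Suc i)) - w x - integral {x..z (Suc i)} v =
    (w (z i) - w x - integral {x..z i} v) + (w (z (Suc i)) - w (z i) - integral {z i..z (Suc i)} v)"
    using calculation(2) by simp
   then have "norm (w (z (Suc i)) - w x - integral {x..z (Suc i)} v) \<le>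
    norm (w (z i) - w x - integral {x..z i} v) + norm (w (z (Suc i)) - w (z i) - integral {z i..z (Suc i)} v)"
    by (metis norm_triangle_ineq)
   ultimately show ?case
    by (simp only: distrib_left)
  qed
  from this[of N] show ?thesis by (simp add: zN)
 qed
 have "norm (w y - w x - integral {x..y} v) \<le> 0"
 proof (rule field_le_epsilon)
  fix e :: real assume e: "e > 0"
  define I where "I = integral {x..y} q"
  have "norm (w y - w x - integral {x..y} v) \<le> e / (\<bar>I\<bar> + 1) * I"
   unfolding I_def by (rule main) (use e in auto)
  also have "\<dots> \<le> e / (\<bar>I\<bar> + 1) * (\<bar>I\<bar> + 1)" using e by (intro mult_left_mono) auto
  also have "\<dots> = e" by (simp add: field_simps)
  finally show "norm (w y - w x - integral {x..y} v) \<le> 0 + e" by simp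
 qed
 then have "integral {x..y} v = w y - w x" by simp
 then show "(v has_integral (w y - w x)) {x..y}"
  using vi[of x y] by (metis integrable_integral order_refl)
qed

text \<open>By the mean value theorem the increment of \<open>F (u x)\<close> over a short interval
  is \<open>F' (u s)\<close> times that of \<open>u\<close>, for some \<open>s\<close> in the
  interval. Uniform continuity allows \<open>F' (u s)\<close> to be replaced by
  \<open>F' (u t)\<close> under the integral of \<open>v\<close>, at the cost of \<open>e\<close>
  times the integral of its norm.\<close>

lemma ac_chain:
 fixes u v :: "real => real"
 assumes u: "ac a b u v" and S: "is_interval S" "\<And>x. x \<in> {a..b} ==> u x \<in> S"
  and F: "\<And>z. z \<in> S ==> (F has_real_derivative F' z) (at z)"
  and cont: "continuous_on {a..b} (\<lambda>x. F' (u x))"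
 shows "ac a b (\<lambda>x. F (u x)) (\<lambda>x. F' (u x) * v x)"
proof (rule ac_locallyI[where q = "\<lambda>s. norm (v s)"])
 have meas: "(\<lambda>x. F' (u x)) \<in> borel_measurable (lebesgue_on {a..b})"
  by (rule continuous_imp_measurable_on_sets_lebesgue[OF cont]) auto
 have bnd: "bounded ((\<lambda>x. F' (u x)) ` {a..b})"
  by (intro compact_imp_bounded compact_continuous_image cont) auto
 show ai: "(\<lambda>x. F' (u x) * v x) absolutely_integrable_on {a..b}"
  by (rule absolutely_integrable_bounded_measurable_product_real[OF meas _ bnd acD(1)[OF u]]) auto
 show "(\<lambda>s. norm (v s)) integrable_on {a..b}"
  by (rule absint_sub(3)[OF acD(1)[OF u]]) auto
 fix e :: real assume e: "e > 0"
 have "uniformly_continuous_on {a..b} (\<lambda>x. F' (u x))"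
  by (rule compact_uniformly_continuous[OF cont]) auto
 then obtain d where d: "d > 0" "\<And>s s'. s \<in> {a..b} ==> s' \<in> {a..b} ==> dist s' s < d ==> dist (F' (u s')) (F' (u s)) < e"
  using e unfolding uniformly_continuous_on_def by metis
 have "norm (F (u y) - F (u x) - integral {x..y} (\<lambda>x. F' (u x) * v x)) \<le> e * integral {x..y} (\<lambda>s. norm (v s))"
  if xy: "a \<le> x" "x \<le> y" "y \<le> b" "y < x + d" for x y
 proof -
  have cu: "continuous_on {x..y} u" by (rule continuous_on_subset[OF ac_continuous[OF u]]) (use xy in auto)
  have "\<exists>s\<in>{x..y}. F (u y) - F (u x) = F' (u s) * (u y - u x)"
  proof (cases "u x" "u y" rule: linorder_cases)
   case less
   have "z \<in> S" if "u x \<le> z" "z \<le> u y" for z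
    by (rule mem_is_interval_1_I[OF S(1) S(2)[of x] S(2)[of y] that]) (use xy in auto)
   then have "\<exists>z>u x. z < u y \<and> F (u y) - F (u x) = (u y - u x) * F' z"
    by (intro MVT2[OF less] F)
   then obtain z where "u x < z" "z < u y" "F (u y) - F (u x) = (u y - u x) * F' z" by blast
   moreover then obtain s where "x \<le> s" "s \<le> y" "u s = z"
    using IVT'[of u x z y] cu xy by auto
   ultimately show ?thesis by (intro bexI[of _ s]) auto
  next
   case equal
   then show ?thesis using xy by (intro bexI[of _ x]) auto
  next
   case greater
   have "z \<in> S" if "u y \<le> z" "z \<le> u x" for z
    by (rule mem_is_interval_1_I[OF S(1) S(2)[of y] S(2)[of x] that]) (use xy in auto)
   then have "\<exists>z>u y. z < u x \<and> F (u x) - F (u y) = (u x - u y) * F' z"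
    by (intro MVT2[OF greater] F)
   then obtain z where "u y < z" "z < u x" "F (u x) - F (u y) = (u x - u y) * F' z" by blast
   moreover then obtain s where "x \<le> s" "s \<le> y" "u s = z"
    using IVT2'[of u y z x] cu xy by auto
   ultimately show ?thesis by (intro bexI[of _ s]) (auto simp: algebra_simps)
  qed
  then obtain s where s: "s \<in> {x..y}" "F (u y) - F (u x) = F' (u s) * (u y - u x)" by blast
  have "((\<lambda>t. F' (u s) * v t - F' (u t) * v t) has_integral (F' (u s) * (u y - u x) - integral {x..y} (\<lambda>x. F' (u x) * v x))) {x..y}"
   using xy by (intro has_integral_diff has_integral_mult_right acD(2)[OF u] integrable_integral absint_sub(2)[OF ai])
  then have "norm (F (u y) - F (u x) - integral {x..y} (\<lambda>x. F' (u x) * v x))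
   = norm (integral {x..y} (\<lambda>t. F' (u s) * v t - F' (u t) * v t))"
   unfolding s(2) by (simp add: integral_unique)
  also have "\<dots> \<le> integral {x..y} (\<lambda>t. e * norm (v t))"
  proof (rule integral_norm_bound_integral)
   show "(\<lambda>t. F' (u s) * v t - F' (u t) * v t) integrable_on {x..y}"
    using xy by (intro integrable_diff integrable_on_mult_right absint_sub(2)[OF ai] absint_sub(2)[OF acD(1)[OF u]])
   show "(\<lambda>t. e * norm (v t)) integrable_on {x..y}"
    using xy by (intro integrable_on_mult_right absint_sub(3)[OF acD(1)[OF u]])
   fix t assume t: "t \<in> {x..y}"
   have "dist (F' (u s)) (F' (u t)) < e" using s t xy by (intro d(2)) (auto simp: dist_real_def)
   then have "\<bar>F' (u s) - F' (u t)\<bar> * \<bar>v t\<bar> \<le> e * \<bar>v t\<bar>" by (intro mult_right_mono) (auto simp: dist_real_def)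
   then show "norm (F' (u s) * v t - F' (u t) * v t) \<le> e * norm (v t)"
    by (simp add: abs_mult[symmetric] left_diff_distrib)
  qed
  also have "\<dots> = e * integral {x..y} (\<lambda>s. norm (v s))" by simp
  finally show ?thesis .
 qed
 then show "\<exists>d>0. \<forall>x y. a \<le> x \<longrightarrow> x \<le> y \<longrightarrow> y \<le> b \<longrightarrow> y < x + d \<longrightarrow>
  norm (F (u y) - F (u x) - integral {x..y} (\<lambda>x. F' (u x) * v x)) \<le> e * integral {x..y} (\<lambda>s. norm (v s))"
  using d(1) by blast
qed

lemma absint_bilinear:
 fixes B :: "'a::euclidean_space => 'b::euclidean_space => 'c::euclidean_space" and f :: "real => 'a"
 assumes "bounded_bilinear B" "continuous_on {a..b} f" "g absolutely_integrable_on {a..b}"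
 shows "(\<lambda>x. B (f x) (g x)) absolutely_integrable_on {a..b}"
proof (rule absolutely_integrable_bounded_measurable_product[where h = B])
 show "bilinear B" using assms(1) by (simp add: bilinear_conv_bounded_bilinear)
 show "f \<in> borel_measurable (lebesgue_on {a..b})"
  by (rule continuous_imp_measurable_on_sets_lebesgue[OF assms(2)]) auto
 show "bounded (f ` {a..b})"
  by (intro compact_imp_bounded compact_continuous_image assms) auto
 show "{a..b} \<in> sets lebesgue" by simp
qed (rule assms)

text \<open>The increment splits as \<open>B (u1 y - u1 x) (u2 y) + B (u1 x) (u2 y - u2 x)\<close>;
  on short intervals the values frozen at the end points differ from the running ones by at most
  \<open>e / K\<close>.\<close>

lemma ac_bilinear:
 fixes B :: "'a::euclidean_space => 'b::euclidean_space => 'c::euclidean_space"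
 assumes B: "bounded_bilinear B" and 1: "ac a b u1 v1" and 2: "ac a b u2 v2"
 shows "ac a b (\<lambda>x. B (u1 x) (u2 x)) (\<lambda>x. B (v1 x) (u2 x) + B (u1 x) (v2 x))"
proof (rule ac_locallyI[where q = "\<lambda>s. norm (v1 s) + norm (v2 s)"])
 interpret B: bounded_bilinear B by fact
 note ai1 = absint_bilinear[OF B ac_continuous[OF 1] acD(1)[OF 2]]
 note ai2 = absint_bilinear[OF B.flip ac_continuous[OF 2] acD(1)[OF 1]]
 show ai: "(\<lambda>x. B (v1 x) (u2 x) + B (u1 x) (v2 x)) absolutely_integrable_on {a..b}"
  using set_integral_add(1)[OF ai2 ai1] .
 show "(\<lambda>s. norm (v1 s) + norm (v2 s)) integrable_on {a..b}"
  by (intro integrable_add absint_sub(3)[OF acD(1)[OF 1]] absint_sub(3)[OF acD(1)[OF 2]]) auto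
 fix e :: real assume e: "e > 0"
 obtain K where K: "K > 0" "\<And>x y. norm (B x y) \<le> norm x * norm y * K" using B.pos_bounded by blast
 have "uniformly_continuous_on {a..b} u1" "uniformly_continuous_on {a..b} u2"
  by (auto intro!: compact_uniformly_continuous ac_continuous[OF 1] ac_continuous[OF 2])
 moreover have "e / K > 0" using e K by simp
 ultimately obtain d1 d2 where d1: "d1 > 0" "\<And>s s'. s \<in> {a..b} ==> s' \<in> {a..b} ==> dist s' s < d1 ==> dist (u1 s') (u1 s) < e / K"
  and d2: "d2 > 0" "\<And>s s'. s \<in> {a..b} ==> s' \<in> {a..b} ==> dist s' s < d2 ==> dist (u2 s') (u2 s) < e / K"
  unfolding uniformly_continuous_on_def by metis
 have "norm (B (u1 y) (u2 y) - B (u1 x) (u2 x) - integral {x..y} (\<lambda>x. B (v1 x) (u2 x) + B (u1 x) (v2 x)))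
   \<le> e * integral {x..y} (\<lambda>s. norm (v1 s) + norm (v2 s))"
  if xy: "a \<le> x" "x \<le> y" "y \<le> b" "y < x + min d1 d2" for x y
 proof -
  have h1: "((\<lambda>t. B (v1 t) (u2 y)) has_integral B (u1 y - u1 x) (u2 y)) {x..y}"
   using has_integral_linear[OF acD(2)[OF 1 xy(1-3)] B.bounded_linear_left[of "u2 y"]] by (simp add: o_def)
  have h2: "((\<lambda>t. B (u1 x) (v2 t)) has_integral B (u1 x) (u2 y - u2 x)) {x..y}"
   using has_integral_linear[OF acD(2)[OF 2 xy(1-3)] B.bounded_linear_right[of "u1 x"]] by (simp add: o_def)
  have h3: "((\<lambda>x. B (v1 x) (u2 x) + B (u1 x) (v2 x)) has_integral integral {x..y} (\<lambda>x. B (v1 x) (u2 x) + B (u1 x) (v2 x))) {x..y}"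
   using xy by (intro integrable_integral absint_sub(2)[OF ai])
  note h = has_integral_diff[OF has_integral_add[OF h1 h2] h3]
  have "B (u1 y - u1 x) (u2 y) + B (u1 x) (u2 y - u2 x) = B (u1 y) (u2 y) - B (u1 x) (u2 x)"
   by (simp add: B.diff_left B.diff_right)
  with h have "norm (B (u1 y) (u2 y) - B (u1 x) (u2 x) - integral {x..y} (\<lambda>x. B (v1 x) (u2 x) + B (u1 x) (v2 x)))
   = norm (integral {x..y} (\<lambda>t. B (v1 t) (u2 y) + B (u1 x) (v2 t) - (B (v1 t) (u2 t) + B (u1 t) (v2 t))))"
   by (simp add: integral_unique)
  also have "\<dots> \<le> integral {x..y} (\<lambda>t. e * (norm (v1 t) + norm (v2 t)))"
  proof (rule integral_norm_bound_integral)
   show "(\<lambda>t. B (v1 t) (u2 y) + B (u1 x) (v2 t) - (B (v1 t) (u2 t) + B (u1 t) (v2 t))) integrable_on {x..y}"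
    using h by blast
   show "(\<lambda>t. e * (norm (v1 t) + norm (v2 t))) integrable_on {x..y}"
    using xy by (intro integrable_on_mult_right integrable_add absint_sub(3)[OF acD(1)[OF 1]] absint_sub(3)[OF acD(1)[OF 2]])
   fix t assume t: "t \<in> {x..y}"
   have t2: "norm (u2 y - u2 t) \<le> e / K" and t1: "norm (u1 x - u1 t) \<le> e / K"
    using d1(2)[of t x] d2(2)[of t y] t xy by (auto simp: dist_norm min_def split: if_splits)
   have "norm (B (v1 t) (u2 y - u2 t)) \<le> norm (v1 t) * (e / K) * K"
    using K(1) t2 by (intro order_trans[OF K(2)] mult_right_mono mult_left_mono) auto
   moreover have "norm (B (u1 x - u1 t) (v2 t)) \<le> (e / K) * norm (v2 t) * K"
    using K(1) t1 by (intro order_trans[OF K(2)] mult_right_mono) auto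
   moreover have "B (v1 t) (u2 y) + B (u1 x) (v2 t) - (B (v1 t) (u2 t) + B (u1 t) (v2 t)) = B (v1 t) (u2 y - u2 t) + B (u1 x - u1 t) (v2 t)"
    by (simp add: B.diff_left B.diff_right)
   ultimately show "norm (B (v1 t) (u2 y) + B (u1 x) (v2 t) - (B (v1 t) (u2 t) + B (u1 t) (v2 t))) \<le> e * (norm (v1 t) + norm (v2 t))"
    using norm_triangle_ineq[of "B (v1 t) (u2 y - u2 t)" "B (u1 x - u1 t) (v2 t)"] K(1) by (simp add: field_simps)
  qed
  also have "\<dots> = e * integral {x..y} (\<lambda>s. norm (v1 s) + norm (v2 s))" by simp
  finally show ?thesis .
 qed
 moreover have "min d1 d2 > 0" using d1 d2 by simp
 ultimately show "\<exists>d>0. \<forall>x y. a \<le> x \<longrightarrow> x \<le> y \<longrightarrow> y \<le> b \<longrightarrow> y < x + d \<longrightarrow>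
  norm (B (u1 y) (u2 y) - B (u1 x) (u2 x) - integral {x..y} (\<lambda>x. B (v1 x) (u2 x) + B (u1 x) (v2 x)))
   \<le> e * integral {x..y} (\<lambda>s. norm (v1 s) + norm (v2 s))"
  by blast
qed

lemma ac_const: "ac a b (\<lambda>_. c) (\<lambda>_. 0)"
 by (auto simp: ac_def)

lemma ac_add: "ac a b u1 v1 ==> ac a b u2 v2 ==> ac a b (\<lambda>x. u1 x + u2 x) (\<lambda>x. v1 x + v2 x)"
 unfolding ac_def
proof (safe, goal_cases)
 case (2 x y)
 then show ?case using has_integral_add[of v1 "u1 y - u1 x" "{x..y}" v2 "u2 y - u2 x"] by (simp add: algebra_simps)
qed (auto intro: set_integral_add)

lemma ac_scaleR: "ac a b u v ==> ac a b (\<lambda>x. c *\<^sub>R u x) (\<lambda>x. c *\<^sub>R v x)"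
 using ac_bilinear[OF bounded_bilinear_scaleR ac_const[of a b c]] by simp

text \<open>The derivative is spelled as a product of inverses so that the closure of weak
  convergence under products can be applied to it factor by factor.\<close>

lemma ac_inverse:
 fixes u v :: "real => real"
 assumes u: "ac a b u v" and pos: "\<And>x. x \<in> {a..b} ==> u x > 0"
 shows "ac a b (\<lambda>x. inverse (u x)) (\<lambda>x. - (inverse (u x) * inverse (u x)) * v x)"
proof (rule ac_chain[OF u, where S = "{0<..}"])
 have ne: "\<forall>x\<in>{a..b}. u x \<noteq> 0" using pos by (metis less_irrefl)
 show "continuous_on {a..b} (\<lambda>x. - (inverse (u x) * inverse (u x)))"
  by (intro continuous_intros ac_continuous[OF u] ne)
 show "(inverse has_real_derivative - (inverse z * inverse z)) (at z)" if "z \<in> {0<..}" for z :: real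
  using that DERIV_inverse[of z UNIV] by (simp add: power2_eq_square)
qed (use pos in \<open>auto simp: is_interval_io\<close>)

text \<open>Writing the derivative of the root with \<open>inverse\<close> times
  \<open>sqrt\<close>, instead of an inverse root, expresses it through two functions whose
  convergence is available at one order less.\<close>

lemma ac_sqrt:
 fixes u v :: "real => real"
 assumes u: "ac a b u v" and pos: "\<And>x. x \<in> {a..b} ==> u x > 0"
 shows "ac a b (\<lambda>x. sqrt (u x)) (\<lambda>x. (1/2 * (inverse (u x) * sqrt (u x))) * v x)"
proof (rule ac_chain[OF u, where S = "{0<..}"])
 have ne: "\<forall>x\<in>{a..b}. u x \<noteq> 0" using pos by (metis less_irrefl)
 show "continuous_on {a..b} (\<lambda>x. 1/2 * (inverse (u x) * sqrt (u x)))"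
  by (intro continuous_intros ac_continuous[OF u] ne)
 show "(sqrt has_real_derivative 1/2 * (inverse z * sqrt z)) (at z)" if "z \<in> {0<..}" for z :: real
 proof -
  have "inverse (sqrt z) = inverse z * sqrt z" using that by (simp add: field_simps)
  then show ?thesis using that DERIV_real_sqrt[of z] by (simp add: field_simps)
 qed
qed (use pos in \<open>auto simp: is_interval_io\<close>)

lemma ac_cong_negligible:
 assumes "ac a b u v" "negligible N" "\<And>x. x \<in> {a..b} - N ==> v' x = v x"
 shows "ac a b u v'"
 unfolding ac_def
proof (intro conjI ballI)
 show "v' absolutely_integrable_on {a..b}"
  by (rule absolutely_integrable_spike[OF acD(1)[OF assms(1)] assms(2)]) (use assms(3) in auto)
 fix x y assume "x \<in> {a..b}" "y \<in> {x..b}"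
 then show "(v' has_integral (u y - u x)) {x..y}"
  using assms(3) by (intro has_integral_spike[OF assms(2) _ acD(2)[OF assms(1)]]) auto
qed

section \<open>Periodic functions and integrals over one period\<close>

lemma periodic_shift_int:
 assumes "periodic u"
 shows "u (th + 2 * pi * of_int k) = u th"
proof (induction k rule: int_induct[of _ 0])
 case (step1 i)
 then show ?case using assms[unfolded periodic_def, rule_format, of "th + 2 * pi * of_int i"]
  by (simp add: algebra_simps)
next
 case (step2 i)
 then show ?case using assms[unfolded periodic_def, rule_format, of "th + 2 * pi * of_int (i - 1)"]
  by (simp add: algebra_simps)
qed simp

lemma periodic_reduce:
 obtains k where "th + 2 * pi * of_int k \<in> {0..<2*pi}"
proof
 have "2 * pi * of_int \<lfloor>th / (2*pi)\<rfloor> \<le> 2 * pi * (th / (2*pi))"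
  by (intro mult_left_mono of_int_floor_le) auto
 moreover have "2 * pi * (th / (2*pi)) < 2 * pi * (of_int \<lfloor>th / (2*pi)\<rfloor> + 1)"
  by (intro mult_strict_left_mono floor_correct[THEN conjunct2]) auto
 ultimately show "th + 2 * pi * of_int (- \<lfloor>th / (2*pi)\<rfloor>) \<in> {0..<2*pi}"
  by (simp add: algebra_simps)
qed

lemma periodic_all:
 assumes "periodic u" "\<And>th. th \<in> {0..<2*pi} ==> P (u th)"
 shows "P (u th)"
proof -
 obtain k where "th + 2 * pi * of_int k \<in> {0..<2*pi}" by (rule periodic_reduce)
 from assms(2)[OF this] show ?thesis by (simp add: periodic_shift_int[OF assms(1)])
qed

lemma periodic_continuous:
 fixes u :: "real => 'a::topological_space"
 assumes p: "periodic u" and c: "continuous_on {0..2*pi} u"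
 shows "continuous_on UNIV u"
proof -
 have ck: "continuous_on {2 * pi * of_int k .. 2 * pi * of_int k + 2 * pi} u" for k :: int
 proof -
  have "continuous_on {2 * pi * of_int k .. 2 * pi * of_int k + 2 * pi} (\<lambda>th. u (th - 2 * pi * of_int k))"
   by (rule continuous_on_compose2[OF c]) (auto intro!: continuous_intros)
  then show ?thesis
   using periodic_shift_int[OF p, of _ "-k"] by (simp add: algebra_simps)
 qed
 have "isCont u th" for th
 proof -
  obtain j where j: "th + 2 * pi * of_int j \<in> {0..<2*pi}" by (rule periodic_reduce)
  define k where "k = - j"
  have k: "2 * pi * of_int k \<le> th" "th < 2 * pi * of_int k + 2 * pi"
   using j by (auto simp: k_def)
  have "continuous_on ({2 * pi * of_int (k-1) .. 2 * pi * of_int (k-1) + 2 * pi} \<union> {2 * pi * of_int k .. 2 * pi * of_int k + 2 * pi}) u"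
   by (intro continuous_on_closed_Un ck) auto
  moreover have "{2 * pi * of_int (k-1) .. 2 * pi * of_int (k-1) + 2 * pi} \<union> {2 * pi * of_int k .. 2 * pi * of_int k + 2 * pi}
   = {2 * pi * of_int k - 2 * pi .. 2 * pi * of_int k + 2 * pi}"
   by (auto simp: algebra_simps)
  ultimately show ?thesis
   using k by (intro continuous_on_interior[of "{2 * pi * of_int k - 2 * pi .. 2 * pi * of_int k + 2 * pi}"]) auto
 qed
 then show ?thesis by (simp add: continuous_at_imp_continuous_on)
qed

text \<open>The bridge between the Bochner integral over the half-open period and the gauge integral
  over the closed interval, in terms of which \<open>ac\<close> is formulated; the additional end
  point is a null set.\<close>

lemma circle_integral:
 fixes f :: "real => 'a::euclidean_space"
 assumes [measurable]: "f \<in> borel_measurable borel" and i: "integrable circle f"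
 shows "f absolutely_integrable_on {0..2*pi}" "(LINT th|circle. f th) = integral {0..2*pi} f"
proof -
 have 1: "integrable lborel (\<lambda>x. indicator {0..<2*pi} x *\<^sub>R f x)"
  using i unfolding circle_def by (subst (asm) integrable_restrict_space) auto
 have ae: "AE x in lborel. indicator {0..<2*pi} x *\<^sub>R f x = indicator {0..2*pi} x *\<^sub>R f x"
 proof -
  have "AE x in lborel. x \<noteq> 2 * pi" by (rule AE_lborel_singleton)
  then show ?thesis by eventually_elim (auto simp: indicator_def)
 qed
 have 2: "integrable lborel (\<lambda>x. indicator {0..2*pi} x *\<^sub>R f x)"
  by (rule integrable_cong_AE_imp[OF 1]) (use ae in auto)
 show "f absolutely_integrable_on {0..2*pi}"
  unfolding set_integrable_def using 2 by (subst integrable_completion) auto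
 have "(LINT th|circle. f th) = (LINT x|lborel. indicator {0..<2*pi} x *\<^sub>R f x)"
  unfolding circle_def by (subst integral_restrict_space) auto
 also have "\<dots> = (LINT x|lborel. indicator {0..2*pi} x *\<^sub>R f x)"
  using ae by (intro integral_cong_AE) auto
 also have "\<dots> = integral {0..2*pi} f"
  using set_borel_integral_eq_integral(2)[of "{0..2*pi}" f] 2 by (simp add: set_integrable_def set_lebesgue_integral_def)
 finally show "(LINT th|circle. f th) = integral {0..2*pi} f" .
qed

lemma AE_circle_negligible:
 assumes "AE th in circle. P th"
 obtains N where "negligible N" "\<And>th. th \<in> {0..2*pi} - N ==> P th"
proof -
 have "AE th in lborel. th \<in> {0..<2*pi} \<longrightarrow> P th"
  using assms unfolding circle_def by (subst (asm) AE_restrict_space_iff) auto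
 then have "AE th in lebesgue. th \<in> {0..<2*pi} \<longrightarrow> P th" by (rule AE_completion)
 then obtain N where N: "{th. \<not> (th \<in> {0..<2*pi} \<longrightarrow> P th)} \<subseteq> N" "N \<in> null_sets lebesgue"
  by (auto elim!: AE_E simp: null_sets_def)
 have "negligible (insert (2*pi) N)" using N(2) by (simp add: negligible_iff_null_sets)
 then show ?thesis using N(1) by (intro that[of "insert (2*pi) N"]) force+
qed

section \<open>Weak convergence in Sobolev spaces\<close>

text \<open>Differentiation in the Sobolev sense for values in any Euclidean space. The operator
  \<open>wder\<close> exists for curves only, while speeds, scalar products and test functions are
  real valued.\<close>

definition cder :: "(real => 'a::euclidean_space) => (real => 'a) => bool" where
 "cder u v \<longleftrightarrow> periodic u \<and> ac 0 (2 * pi) u v"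

lemma cderD: "cder u v ==> periodic u" "cder u v ==> ac 0 (2 * pi) u v"
 by (auto simp: cder_def)

lemma cder_continuous: "cder u v ==> continuous_on UNIV u"
 by (auto simp: cder_def intro: periodic_continuous ac_continuous)

lemma cder_measurable: "cder u v ==> u \<in> borel_measurable borel"
 by (intro borel_measurable_continuous_onI cder_continuous)

lemma periodic_bounded:
 fixes u :: "real => 'a::real_normed_vector"
 assumes "periodic u" "continuous_on UNIV u"
 obtains C where "\<And>s. norm (u s) \<le> C"
proof -
 have "bounded (u ` {0..2*pi})"
  by (intro compact_imp_bounded compact_continuous_image continuous_on_subset[OF assms(2)]) auto
 then obtain C where "\<forall>s\<in>{0..2*pi}. norm (u s) \<le> C" by (auto simp: bounded_iff)
 then have "norm (u s) \<le> C" for s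
  using periodic_all[OF assms(1), of "\<lambda>x. norm x \<le> C"] by auto
 then show ?thesis using that by blast
qed

lemma cder_sqint: "cder u v ==> u \<in> sqint"
 by (metis periodic_bounded cderD(1) cder_continuous cder_measurable sqint_bounded)

lemma cder_const: "cder (\<lambda>_. c) (\<lambda>_. 0)"
 by (auto simp: cder_def periodic_def ac_const)

lemma cder_add: "cder u1 v1 ==> cder u2 v2 ==> cder (\<lambda>x. u1 x + u2 x) (\<lambda>x. v1 x + v2 x)"
 by (auto simp: cder_def periodic_def ac_add)

lemma cder_scaleR: "cder u v ==> cder (\<lambda>x. c *\<^sub>R u x) (\<lambda>x. c *\<^sub>R v x)"
 by (auto simp: cder_def periodic_def ac_scaleR)

lemma cder_bilinear:
 fixes B :: "'a::euclidean_space => 'b::euclidean_space => 'c::euclidean_space"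
 shows "bounded_bilinear B ==> cder u1 v1 ==> cder u2 v2 ==>
  cder (\<lambda>x. B (u1 x) (u2 x)) (\<lambda>x. B (v1 x) (u2 x) + B (u1 x) (v2 x))"
 by (auto simp: cder_def periodic_def ac_bilinear)

lemma cder_inverse:
 fixes u v :: "real => real"
 shows "cder u v ==> (\<And>x. u x > 0) ==> cder (\<lambda>x. inverse (u x)) (\<lambda>x. - (inverse (u x) * inverse (u x)) * v x)"
 unfolding cder_def by (intro conjI ac_inverse) (auto simp: periodic_def)

lemma cder_sqrt:
 fixes u v :: "real => real"
 shows "cder u v ==> (\<And>x. u x > 0) ==> cder (\<lambda>x. sqrt (u x)) (\<lambda>x. (1/2 * (inverse (u x) * sqrt (u x))) * v x)"
 unfolding cder_def by (intro conjI ac_sqrt) (auto simp: periodic_def)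

text \<open>Bounded pointwise convergence plays the role of uniform convergence for the lower order
  derivatives: it survives nonlinear operations, and dominated convergence turns it into strong
  convergence against square integrable functions.\<close>

definition pc :: "(nat => real => 'a::euclidean_space) => (real => 'a) => bool" where
 "pc U u \<longleftrightarrow> (\<exists>M. \<forall>n s. norm (U n s) \<le> M) \<and> (\<forall>s. (\<lambda>n. U n s) \<longlonglongrightarrow> u s)"

lemma pcD: "pc U u ==> \<exists>M. \<forall>n s. norm (U n s) \<le> M" "pc U u ==> (\<lambda>n. U n s) \<longlonglongrightarrow> u s"
 by (auto simp: pc_def)

lemma pc_constI: "(\<And>s. norm (u s) \<le> M) ==> pc (\<lambda>_. u) u"
 unfolding pc_def by auto

lemma pc_subseq: "pc U u ==> strict_mono r ==> pc (\<lambda>n. U (r n)) u"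
 unfolding pc_def by (auto intro: LIMSEQ_subseq_LIMSEQ[unfolded o_def])

lemma pc_limit_norm_le: "pc U u ==> (\<And>n. norm (U n s) \<le> M) ==> norm (u s) \<le> M"
 by (rule LIMSEQ_le_const2[OF tendsto_norm[OF pcD(2)]]) auto

lemma pc_bilinear:
 fixes B :: "'a::euclidean_space => 'b::euclidean_space => 'c::euclidean_space"
 assumes B: "bounded_bilinear B" and U: "pc U u" and V: "pc V v"
 shows "pc (\<lambda>n s. B (U n s) (V n s)) (\<lambda>s. B (u s) (v s))"
 unfolding pc_def
proof safe
 interpret B: bounded_bilinear B by fact
 obtain K where K: "K > 0" "\<And>x y. norm (B x y) \<le> norm x * norm y * K" using B.pos_bounded by blast
 obtain M N where M: "\<And>n s. norm (U n s) \<le> M" and N: "\<And>n s. norm (V n s) \<le> N"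
  using pcD(1)[OF U] pcD(1)[OF V] by blast
 have "M \<ge> 0" using norm_ge_zero[of "U 0 0"] M[of 0 0] by linarith
 then have "norm (B (U n s) (V n s)) \<le> M * N * K" for n s
  using K(1) by (intro order_trans[OF K(2)] mult_right_mono mult_mono M N) auto
 then show "\<exists>M. \<forall>n s. norm (B (U n s) (V n s)) \<le> M" by blast
 fix s show "(\<lambda>n. B (U n s) (V n s)) \<longlonglongrightarrow> B (u s) (v s)"
  by (intro B.tendsto pcD(2) U V)
qed

lemma pc_add:
 assumes U: "pc U u" and V: "pc V v"
 shows "pc (\<lambda>n s. U n s + V n s) (\<lambda>s. u s + v s)"
 unfolding pc_def
proof safe
 obtain M N where M: "\<And>n s. norm (U n s) \<le> M" and N: "\<And>n s. norm (V n s) \<le> N"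
  using pcD(1)[OF U] pcD(1)[OF V] by blast
 then show "\<exists>M. \<forall>n s. norm (U n s + V n s) \<le> M" by (intro exI[of _ "M + N"]) (auto intro: norm_triangle_mono)
qed (intro tendsto_add pcD(2) U V)

lemma pc_const: "c \<longlonglongrightarrow> l ==> pc (\<lambda>n _. c n) (\<lambda>_. l)"
 unfolding pc_def using convergent_imp_bounded[of c l] by (auto simp: bounded_iff)

lemma pc_inverse:
 assumes U: "pc U (u :: real => real)" and d: "d > 0" "\<And>n s. U n s \<ge> d"
 shows "pc (\<lambda>n s. inverse (U n s)) (\<lambda>s. inverse (u s))"
 unfolding pc_def
proof safe
 have "norm (inverse (U n s)) \<le> inverse d" for n s
  using d(1) d(2)[of n s] by (auto intro!: le_imp_inverse_le)
 then show "\<exists>M. \<forall>n s. norm (inverse (U n s)) \<le> M" by blast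
 fix s
 have "u s \<ge> d" using d(2) by (intro LIMSEQ_le_const[OF pcD(2)[OF U]]) auto
 then show "(\<lambda>n. inverse (U n s)) \<longlonglongrightarrow> inverse (u s)"
  using d(1) by (intro tendsto_inverse pcD(2)[OF U]) auto
qed

lemma pc_sqrt:
 assumes U: "pc U (u :: real => real)"
 shows "pc (\<lambda>n s. sqrt (U n s)) (\<lambda>s. sqrt (u s))"
 unfolding pc_def
proof safe
 obtain M where M: "\<And>n s. norm (U n s) \<le> M" using pcD(1)[OF U] by blast
 then have "norm (sqrt (U n s)) \<le> sqrt M" for n s
 proof -
  have "\<bar>sqrt x\<bar> = sqrt \<bar>x\<bar>" for x :: real
   by (cases "x \<ge> 0") (auto simp: abs_real_def real_sqrt_minus)
  then show ?thesis using M[of n s] by simp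
 qed
 then show "\<exists>M. \<forall>n s. norm (sqrt (U n s)) \<le> M" by blast
qed (intro tendsto_intros pcD(2) U)

lemma measurable_bilinear:
 fixes B :: "'a::euclidean_space => 'b::euclidean_space => 'c::euclidean_space"
 assumes "bounded_bilinear B" "f \<in> borel_measurable M" "g \<in> borel_measurable M"
 shows "(\<lambda>x. B (f x) (g x)) \<in> borel_measurable M"
proof -
 interpret B: bounded_bilinear B by fact
 have "continuous_on UNIV (\<lambda>x. B (fst x) (snd x))"
  by (intro continuous_on_eq_continuous_at[THEN iffD2] ballI B.continuous continuous_intros open_UNIV)
 then have m: "(\<lambda>x. B (fst x) (snd x)) \<in> borel_measurable borel"
  by (rule borel_measurable_continuous_onI)
 have "(\<lambda>x. (\<lambda>x. B (fst x) (snd x)) (f x, g x)) \<in> borel_measurable M"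
  by (rule measurable_compose[OF _ m]) (use assms in measurable)
 then show ?thesis by simp
qed

lemma pc_wl2:
 fixes U :: "nat => real => 'a::euclidean_space"
 assumes U: "pc U u" and m: "\<And>n. U n \<in> borel_measurable borel" and p: "\<And>n. periodic (U n)"
 shows "wl2 U u"
 unfolding wl2_def
proof (intro conjI ballI allI)
 obtain M where M: "\<And>n s. norm (U n s) \<le> M" using pcD(1)[OF U] by blast
 have um: "u \<in> borel_measurable borel"
  by (rule borel_measurable_LIMSEQ_metric[OF m pcD(2)[OF U]])
 show Us: "U n \<in> sqint" for n by (rule sqint_bounded[OF m M])
 note lim = nsq_tendsto_0[of U "\<lambda>_. 1::real" u M, OF m sqint_const pcD(2)[OF U] um]
 show us: "u \<in> sqint" using lim(2) M by simp
 have "nsq (U n) \<le> 2 * pi * M\<^sup>2" for n by (rule nsq_le_bound[OF Us M])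
 then show "\<exists>M. \<forall>n. nsq (U n) \<le> M" by blast
 show "periodic u"
  unfolding periodic_def
 proof
  fix s
  have "U n (s + 2 * pi) = U n s" for n using p[of n] by (simp add: periodic_def)
  then show "u (s + 2 * pi) = u s"
   using LIMSEQ_unique[OF pcD(2)[OF U, of s]] pcD(2)[OF U, of "s + 2 * pi"] by simp
 qed
 fix \<phi> :: "real => 'a" assume \<phi>: "\<phi> \<in> sqint"
 have "(\<lambda>n. nsq (\<lambda>s. U n s - u s)) \<longlonglongrightarrow> 0" using lim(1) M by simp
 then have "(\<lambda>n. sqrt (nsq \<phi>) * sqrt (nsq (\<lambda>s. U n s - u s))) \<longlonglongrightarrow> sqrt (nsq \<phi>) * 0"
  by (intro tendsto_mult tendsto_const tendsto_0_sqrt_nsq)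
 then have l0: "(\<lambda>n. sqrt (nsq \<phi>) * sqrt (nsq (\<lambda>s. U n s - u s))) \<longlonglongrightarrow> 0" by simp
 have "norm (ip \<phi> (U n) - ip \<phi> u) \<le> sqrt (nsq \<phi>) * sqrt (nsq (\<lambda>s. U n s - u s))" for n
  using ip_le[OF \<phi> sqint_diff[OF Us us]] unfolding ip_diff[OF \<phi> Us us] by simp
 then have "(\<lambda>n. ip \<phi> (U n) - ip \<phi> u) \<longlonglongrightarrow> 0"
  by (intro Lim_null_comparison[OF always_eventually l0]) auto
 then show "(\<lambda>n. ip \<phi> (U n)) \<longlonglongrightarrow> ip \<phi> u" by (simp add: LIM_zero_iff)
qed (rule p)

text \<open>The pointwise convergent factor is moved onto the test function by means of
  \<open>S\<close>, the adjoint of \<open>B (q s)\<close> applied to \<open>\<phi> s\<close>. The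
  new test functions converge strongly by dominated convergence, so that \<open>wl2_strong\<close>
  applies.\<close>

lemma wl2_bilinear:
 fixes B :: "'a::euclidean_space => 'b::euclidean_space => 'c::euclidean_space"
 assumes B: "bounded_bilinear B" and P: "pc P p" "\<And>n. P n \<in> borel_measurable borel" "\<And>n. periodic (P n)"
  and U: "wl2 U u"
 shows "wl2 (\<lambda>n s. B (P n s) (U n s)) (\<lambda>s. B (p s) (u s))"
 unfolding wl2_def
proof (intro conjI ballI allI)
 interpret B: bounded_bilinear B by fact
 obtain K where K: "K > 0" "\<And>x y. norm (B x y) \<le> norm x * norm y * K" using B.pos_bounded by blast
 obtain M where M: "\<And>n s. norm (P n s) \<le> M" using pcD(1)[OF P(1)] by blast
 have M0: "M \<ge> 0" using norm_ge_zero[of "P 0 0"] M[of 0 0] by linarith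
 have Mp: "norm (p s) \<le> M" for s by (rule pc_limit_norm_le[OF P(1) M])
 note wp = wl2D[OF pc_wl2[OF P]]
 note [measurable] = P(2) sqintD(1)[OF wp(3)] sqintD(1)[OF wl2D(1)[OF U]] sqintD(1)[OF wl2D(3)[OF U]]
 have bd: "norm (B x y) \<le> (M * K) * norm y" if "norm x \<le> M" for x y
  using order_trans[OF K(2) mult_right_mono[OF mult_right_mono[OF that norm_ge_zero[of y]] less_imp_le[OF K(1)]]]
  by (simp add: ac_simps)
 show BU: "(\<lambda>s. B (P n s) (U n s)) \<in> sqint" for n
  by (rule sqint_bound[OF measurable_bilinear[OF B] wl2D(1)[OF U], where C = "M * K"]) (use bd M in auto)
 show Bu: "(\<lambda>s. B (p s) (u s)) \<in> sqint"
  by (rule sqint_bound[OF measurable_bilinear[OF B] wl2D(3)[OF U], where C = "M * K"]) (use bd Mp in auto)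
 show "periodic (\<lambda>s. B (P n s) (U n s))" for n using P(3)[of n] wl2D(2)[OF U, of n] by (simp add: periodic_def)
 show "periodic (\<lambda>s. B (p s) (u s))" using wp(4) wl2D(4)[OF U] by (simp add: periodic_def)
 obtain N where N: "\<And>n. nsq (U n) \<le> N" using wl2D(5)[OF U] by blast
 have "nsq (\<lambda>s. B (P n s) (U n s)) \<le> (M * K)\<^sup>2 * N" for n
 proof -
  have "nsq (\<lambda>s. B (P n s) (U n s)) \<le> nsq (\<lambda>s. (M * K) *\<^sub>R U n s)"
   using bd M M0 K by (intro nsq_mono BU sqint_scaleR wl2D(1)[OF U]) (auto simp: abs_mult)
  also have "\<dots> \<le> (M * K)\<^sup>2 * N" unfolding nsq_scaleR by (intro mult_left_mono N) auto
  finally show ?thesis .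
 qed
 then show "\<exists>M. \<forall>n. nsq (\<lambda>s. B (P n s) (U n s)) \<le> M" by blast
 fix \<phi> :: "real => 'c" assume \<phi>: "\<phi> \<in> sqint"
 note [measurable] = sqintD(1)[OF \<phi>]
 define S where "S = (\<lambda>q s. \<Sum>j\<in>(Basis::'b set). (\<phi> s \<bullet> B (q s) j) *\<^sub>R j)"
 have adj: "S q s \<bullet> y = \<phi> s \<bullet> B (q s) y" for q s y
 proof -
  have "\<phi> s \<bullet> B (q s) y = \<phi> s \<bullet> B (q s) (\<Sum>j\<in>Basis. (y \<bullet> j) *\<^sub>R j)" by (simp add: euclidean_representation)
  also have "\<dots> = (\<Sum>j\<in>Basis. (y \<bullet> j) * (\<phi> s \<bullet> B (q s) j))"
   by (simp add: B.sum_right B.scaleR_right inner_sum_right)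
  also have "\<dots> = S q s \<bullet> y" by (simp add: S_def inner_sum_left inner_commute[of y] mult.commute)
  finally show ?thesis by simp
 qed
 have Sm: "S q \<in> borel_measurable borel" if [measurable]: "q \<in> borel_measurable borel" for q
  unfolding S_def by (intro borel_measurable_sum borel_measurable_scaleR borel_measurable_inner measurable_bilinear[OF B]) auto
 have Sb: "norm (S q s) \<le> (M * K * DIM('b)) * norm (\<phi> s)" if "norm (q s) \<le> M" for q s
 proof -
  have "norm (S q s) \<le> (\<Sum>j\<in>(Basis::'b set). norm ((\<phi> s \<bullet> B (q s) j) *\<^sub>R j))" unfolding S_def by (rule norm_sum)
  also have "\<dots> \<le> (\<Sum>j\<in>(Basis::'b set). norm (\<phi> s) * (M * K))"
  proof (rule sum_mono)
   fix j :: 'b assume j: "j \<in> Basis"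
   have "\<bar>\<phi> s \<bullet> B (q s) j\<bar> \<le> norm (\<phi> s) * norm (B (q s) j)" by (rule Cauchy_Schwarz_ineq2)
   also have "\<dots> \<le> norm (\<phi> s) * (M * K)" using bd[OF that, of j] j by (intro mult_left_mono) auto
   finally show "norm ((\<phi> s \<bullet> B (q s) j) *\<^sub>R j) \<le> norm (\<phi> s) * (M * K)" using j by simp
  qed
  also have "\<dots> = (M * K * DIM('b)) * norm (\<phi> s)" by simp
  finally show ?thesis .
 qed
 have Ss: "S q \<in> sqint" if "q \<in> borel_measurable borel" "\<And>s. norm (q s) \<le> M" for q
  by (rule sqint_bound[OF Sm[OF that(1)] \<phi> Sb]) (rule that)
 have "(\<lambda>n. ip (S (P n)) (U n)) \<longlonglongrightarrow> ip (S p) u"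
 proof (rule wl2_strong[OF U])
  show "S (P n) \<in> sqint" for n by (rule Ss[OF P(2) M])
  show "S p \<in> sqint" by (rule Ss[OF _ Mp]) measurable
  show "(\<lambda>n. nsq (\<lambda>s. S (P n) s - S p s)) \<longlonglongrightarrow> 0"
  proof (rule nsq_tendsto_0(1)[OF Sm[OF P(2)] \<phi> _ Sm Sb[OF M]])
   fix s show "(\<lambda>n. S (P n) s) \<longlonglongrightarrow> S p s"
    unfolding S_def by (intro tendsto_intros B.tendsto pcD(2)[OF P(1)])
  qed measurable
 qed
 then show "(\<lambda>n. ip \<phi> (\<lambda>s. B (P n s) (U n s))) \<longlonglongrightarrow> ip \<phi> (\<lambda>s. B (p s) (u s))"
  by (simp add: ip_def adj)
qed

text \<open>Weak convergence in the Sobolev space of order \<open>k\<close>, with the gain from the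
  compact embedding built in: only the derivative of order \<open>k\<close> converges merely weakly,
  the lower ones converge pointwise and boundedly. The derivatives are quantified existentially,
  which covers real valued sequences, to which \<open>wder\<close> does not apply.\<close>

primrec wc :: "nat => (nat => real => 'a::euclidean_space) => (real => 'a) => bool" where
 "wc 0 U u \<longleftrightarrow> wl2 U u"
| "wc (Suc k) U u \<longleftrightarrow> pc U u \<and> (\<exists>V v. (\<forall>n. cder (U n) (V n)) \<and> cder u v \<and> wc k V v)"

text \<open>Membership in the space is convergence of a constant sequence, so that every closure
  property of \<open>wc\<close> holds for single functions as well.\<close>

abbreviation Sob :: "nat => (real => 'a::euclidean_space) => bool" where
 "Sob k u \<equiv> wc k (\<lambda>_. u) u"

lemma wc_SucI: "pc U u ==> (\<And>n. cder (U n) (V n)) ==> cder u v ==> wc k V v ==> wc (Suc k) U u"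
 by auto

lemma wc_SucE:
 assumes "wc (Suc k) U u"
 obtains V v where "pc U u" "\<And>n. cder (U n) (V n)" "cder u v" "wc k V v"
 using assms by auto

declare wc.simps(2) [simp del]

lemma wc_pc: "wc k U u ==> k > 0 ==> pc U u"
 by (cases k) (auto elim: wc_SucE)

lemma wc_regular:
 assumes "wc k U u"
 shows "U n \<in> sqint" "periodic (U n)" "u \<in> sqint" "periodic u"
 using assms by (cases k; auto elim!: wc_SucE dest: wl2D cder_sqint cderD)+

lemma wc_measurable:
 assumes "wc k U u"
 shows "U n \<in> borel_measurable borel" "u \<in> borel_measurable borel"
 using wc_regular[OF assms] by (auto dest: sqintD)

lemma wc_Suc: "wc (Suc k) U u ==> wc k U u"
proof (induction k arbitrary: U u)
 case 0
 then show ?case by (auto elim!: wc_SucE intro!: pc_wl2 dest: cder_measurable cderD)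
next
 case (Suc k)
 from Suc.prems obtain V v where "pc U u" "\<And>n. cder (U n) (V n)" "cder u v" "wc (Suc k) V v" by (rule wc_SucE) blast
 with Suc.IH show ?case by (intro wc_SucI[of U u V v]) auto
qed

lemma wc_le: "wc k U u ==> j \<le> k ==> wc j U u"
 by (induction k) (auto simp: le_Suc_eq dest: wc_Suc)

lemma wc_Sob: "wc k U u ==> Sob k u"
proof (induction k arbitrary: U u)
 case 0
 then show ?case by (auto simp: wl2_def)
next
 case (Suc k)
 from Suc.prems obtain V v where *: "pc U u" "\<And>n. cder (U n) (V n)" "cder u v" "wc k V v" by (rule wc_SucE) blast
 obtain M where "\<And>n s. norm (U n s) \<le> M" using pcD(1)[OF *(1)] by blast
 then have "pc (\<lambda>_. u) u" by (intro pc_constI pc_limit_norm_le[OF *(1)])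
 with * Suc.IH show ?case by (intro wc_SucI[of _ _ "\<lambda>_. v" v]) auto
qed

lemma wc_Sob_seq: "wc k U u ==> Sob k (U n)"
proof (induction k arbitrary: U u)
 case 0
 then show ?case by (auto simp: wl2_def)
next
 case (Suc k)
 from Suc.prems obtain V v where *: "pc U u" "\<And>n. cder (U n) (V n)" "cder u v" "wc k V v" by (rule wc_SucE) blast
 obtain M where "\<And>n s. norm (U n s) \<le> M" using pcD(1)[OF *(1)] by blast
 then have "pc (\<lambda>_. U n) (U n)" by (rule pc_constI)
 with * Suc.IH show ?case by (intro wc_SucI[of _ _ "\<lambda>_. V n" "V n"]) auto
qed

lemma wc_subseq: "wc k U u ==> strict_mono r ==> wc k (\<lambda>n. U (r n)) u"
proof (induction k arbitrary: U u)
 case 0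
 then show ?case by (auto intro: wl2_subseq)
next
 case (Suc k)
 from Suc.prems(1) obtain V v where "pc U u" "\<And>n. cder (U n) (V n)" "cder u v" "wc k V v" by (rule wc_SucE) blast
 note * = this
 show ?case by (rule wc_SucI[OF pc_subseq[OF *(1) Suc.prems(2)] *(2) *(3) Suc.IH[OF *(4) Suc.prems(2)]])
qed

lemma wc_add: "wc k U u ==> wc k V v ==> wc k (\<lambda>n s. U n s + V n s) (\<lambda>s. u s + v s)"
proof (induction k arbitrary: U u V v)
 case 0
 then show ?case by (auto intro: wl2_add)
next
 case (Suc k)
 from Suc.prems(1) obtain U' u' where "pc U u" "\<And>n. cder (U n) (U' n)" "cder u u'" "wc k U' u'" by (rule wc_SucE) blast
 moreover from Suc.prems(2) obtain V' v' where "pc V v" "\<And>n. cder (V n) (V' n)" "cder v v'" "wc k V' v'" by (rule wc_SucE) blast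
 ultimately show ?case using Suc.IH[of U' u' V' v']
  by (intro wc_SucI[of _ _ "\<lambda>n s. U' n s + V' n s" "\<lambda>s. u' s + v' s"] pc_add cder_add) auto
qed

text \<open>At order 0 the product of two weakly convergent factors need not converge to the product
  of the limits, hence one of them has to converge pointwise. The Leibniz rule produces products
  with the undifferentiated factor on either side, so the induction has to carry both
  versions.\<close>

lemma wc_bilinear_aux:
 fixes B :: "'a::euclidean_space => 'b::euclidean_space => 'c::euclidean_space"
 assumes B: "bounded_bilinear B"
 shows "(\<forall>U u V v. pc U u \<longrightarrow> wc k U u \<longrightarrow> wc k V v \<longrightarrow> wc k (\<lambda>n s. B (U n s) (V n s)) (\<lambda>s. B (u s) (v s))) \<and>
  (\<forall>U u V v. pc V v \<longrightarrow> wc k U u \<longrightarrow> wc k V v \<longrightarrow> wc k (\<lambda>n s. B (U n s) (V n s)) (\<lambda>s. B (u s) (v s)))"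
proof (induction k)
 case 0
 have "wl2 (\<lambda>n s. B (U n s) (V n s)) (\<lambda>s. B (u s) (v s))" if "pc U u" "wl2 U u" "wl2 V v" for U u V v
  using wl2D(1,2)[OF that(2)] sqintD(1) that by (intro wl2_bilinear[OF B]) auto
 moreover have "wl2 (\<lambda>n s. B (U n s) (V n s)) (\<lambda>s. B (u s) (v s))" if "pc V v" "wl2 U u" "wl2 V v" for U u V v
  using wl2D(1,2)[OF that(3)] sqintD(1) that by (intro wl2_bilinear[OF bounded_bilinear.flip[OF B]]) auto
 ultimately show ?case by simp
next
 case (Suc k)
 have "wc (Suc k) (\<lambda>n s. B (U n s) (V n s)) (\<lambda>s. B (u s) (v s))" if UV: "wc (Suc k) U u" "wc (Suc k) V v" for U u V v
 proof -
  obtain U' u' where 1: "pc U u" "\<And>n. cder (U n) (U' n)" "cder u u'" "wc k U' u'" using UV(1) by (rule wc_SucE) blast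
  obtain V' v' where 2: "pc V v" "\<And>n. cder (V n) (V' n)" "cder v v'" "wc k V' v'" using UV(2) by (rule wc_SucE) blast
  note * = 1 2
  have "wc k (\<lambda>n s. B (U' n s) (V n s)) (\<lambda>s. B (u' s) (v s))"
   using Suc.IH *(4,5) wc_Suc[OF UV(2)] by blast
  moreover have "wc k (\<lambda>n s. B (U n s) (V' n s)) (\<lambda>s. B (u s) (v' s))"
   using Suc.IH *(1,8) wc_Suc[OF UV(1)] by blast
  ultimately have "wc k (\<lambda>n s. B (U' n s) (V n s) + B (U n s) (V' n s)) (\<lambda>s. B (u' s) (v s) + B (u s) (v' s))"
   by (rule wc_add)
  then show ?thesis
   by (intro wc_SucI[OF pc_bilinear[OF B *(1,5)] cder_bilinear[OF B *(2,6)] cder_bilinear[OF B *(3,7)]])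
 qed
 then show ?case by blast
qed

lemma wc_bilinear:
 fixes B :: "'a::euclidean_space => 'b::euclidean_space => 'c::euclidean_space"
 assumes B: "bounded_bilinear B" and "pc U u" "wc k U u" "wc k V v"
 shows "wc k (\<lambda>n s. B (U n s) (V n s)) (\<lambda>s. B (u s) (v s))"
 using wc_bilinear_aux[OF B, of k] assms by blast

lemmas wc_scaleR = wc_bilinear[OF bounded_bilinear_scaleR]
lemmas wc_mult = wc_bilinear[OF bounded_bilinear_mult]
lemmas wc_inner = wc_bilinear[OF bounded_bilinear_inner]
lemmas pc_scaleR = pc_bilinear[OF bounded_bilinear_scaleR]
lemmas pc_mult = pc_bilinear[OF bounded_bilinear_mult]
lemmas pc_inner = pc_bilinear[OF bounded_bilinear_inner]

lemma wc_const: "c \<longlonglongrightarrow> l ==> wc k (\<lambda>n _. c n) (\<lambda>_. l)"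
proof (induction k arbitrary: c l)
 case 0
 then show ?case by (auto intro!: pc_wl2 pc_const simp: periodic_def)
next
 case (Suc k)
 from Suc.IH[of "\<lambda>_. 0" 0] Suc.prems show ?case
  by (intro wc_SucI[of _ _ "\<lambda>_ _. 0" "\<lambda>_. 0"] pc_const cder_const) auto
qed

lemma wc_cmult: "c \<longlonglongrightarrow> l ==> wc k U u ==> wc k (\<lambda>n s. c n *\<^sub>R U n s) (\<lambda>s. l *\<^sub>R u s)"
 using wc_scaleR[OF pc_const wc_const] by blast

lemma wc_diff: "wc k U u ==> wc k V v ==> wc k (\<lambda>n s. U n s - V n s) (\<lambda>s. u s - v s)"
 using wc_add[of k U u "\<lambda>n s. (-1) *\<^sub>R V n s" "\<lambda>s. (-1) *\<^sub>R v s"] wc_cmult[of "\<lambda>_. -1" "-1" k V v] by simp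

text \<open>In the derivative of the inverse, the squared inverse converges at one order less by the
  induction hypothesis and multiplies the convergent derivative of \<open>U\<close>. The uniform
  lower bound keeps the inverses bounded.\<close>

lemma wc_inverse:
 assumes "wc k U (u :: real => real)" "pc U u" "d > 0" "\<And>n s. U n s \<ge> d"
 shows "wc k (\<lambda>n s. inverse (U n s)) (\<lambda>s. inverse (u s))"
 using assms
proof (induction k)
 case 0
 have U: "U n \<in> borel_measurable borel" "periodic (U n)" for n using wc_measurable(1)[OF 0(1)] wc_regular(2)[OF 0(1)] .
 note [measurable] = U(1)
 show ?case unfolding wc.simps(1)
  by (rule pc_wl2[OF pc_inverse[OF 0(2-4)]]) (measurable, use U(2) in \<open>simp add: periodic_def\<close>)
next
 case (Suc k)
 obtain V v where V: "\<And>n. cder (U n) (V n)" "cder u v" "wc k V v" using Suc.prems(1) by (rule wc_SucE) blast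
 note pci = pc_inverse[OF Suc.prems(2-4)]
 have iwc: "wc k (\<lambda>n s. inverse (U n s)) (\<lambda>s. inverse (u s))"
  using Suc wc_Suc by blast
 have u: "u s \<ge> d" for s using Suc.prems(4) by (intro LIMSEQ_le_const[OF pcD(2)[OF Suc.prems(2)]]) auto
 note p2 = pc_mult[OF pc_const[OF tendsto_const[of "-1::real"]] pc_mult[OF pci pci]]
 have "wc k (\<lambda>n s. - 1 * (inverse (U n s) * inverse (U n s)) * V n s) (\<lambda>s. - 1 * (inverse (u s) * inverse (u s)) * v s)"
  by (rule wc_mult[OF p2 wc_mult[OF pc_const wc_const wc_mult[OF pci iwc iwc]] V(3)]) auto
 then have w: "wc k (\<lambda>n s. - (inverse (U n s) * inverse (U n s)) * V n s) (\<lambda>s. - (inverse (u s) * inverse (u s)) * v s)"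
  by simp
 show ?case
  by (rule wc_SucI[OF pci cder_inverse[OF V(1)] cder_inverse[OF V(2)] w])
   (use Suc.prems(3,4) u in \<open>auto intro: less_le_trans\<close>)
qed

lemma wc_sqrt:
 assumes "wc k U (u :: real => real)" "pc U u" "d > 0" "\<And>n s. U n s \<ge> d"
 shows "wc k (\<lambda>n s. sqrt (U n s)) (\<lambda>s. sqrt (u s))"
 using assms
proof (induction k)
 case 0
 have U: "U n \<in> borel_measurable borel" "periodic (U n)" for n using wc_measurable(1)[OF 0(1)] wc_regular(2)[OF 0(1)] .
 note [measurable] = U(1)
 show ?case unfolding wc.simps(1)
  by (rule pc_wl2[OF pc_sqrt[OF 0(2)]]) (measurable, use U(2) in \<open>simp add: periodic_def\<close>)
next
 case (Suc k)
 obtain V v where V: "\<And>n. cder (U n) (V n)" "cder u v" "wc k V v" using Suc.prems(1) by (rule wc_SucE) blast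
 note pci = pc_inverse[OF Suc.prems(2-4)] and pcs = pc_sqrt[OF Suc.prems(2)]
 have iwc: "wc k (\<lambda>n s. inverse (U n s)) (\<lambda>s. inverse (u s))"
  using Suc.prems wc_Suc wc_inverse by blast
 have swc: "wc k (\<lambda>n s. sqrt (U n s)) (\<lambda>s. sqrt (u s))"
  using Suc wc_Suc by blast
 have u: "u s \<ge> d" for s using Suc.prems(4) by (intro LIMSEQ_le_const[OF pcD(2)[OF Suc.prems(2)]]) auto
 note p2 = pc_mult[OF pc_const[OF tendsto_const[of "1/2::real"]] pc_mult[OF pci pcs]]
 have w: "wc k (\<lambda>n s. 1/2 * (inverse (U n s) * sqrt (U n s)) * V n s) (\<lambda>s. 1/2 * (inverse (u s) * sqrt (u s)) * v s)"
  by (rule wc_mult[OF p2 wc_mult[OF pc_const wc_const wc_mult[OF pci iwc swc]] V(3)]) auto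
 show ?case
  by (rule wc_SucI[OF pcs cder_sqrt[OF V(1)] cder_sqrt[OF V(2)] w])
   (use Suc.prems(3,4) u in \<open>auto intro: less_le_trans\<close>)
qed

lemma pc_norm:
 assumes "pc U u"
 shows "pc (\<lambda>n s. norm (U n s)) (\<lambda>s. norm (u s))"
 using assms by (auto simp: pc_def intro: tendsto_norm)

lemma wc_norm:
 fixes U :: "nat => real => 'a::euclidean_space"
 assumes "wc k U u" "pc U u" "d > 0" "\<And>n s. norm (U n s) \<ge> d"
 shows "wc k (\<lambda>n s. norm (U n s)) (\<lambda>s. norm (u s))"
proof -
 have "U n s \<bullet> U n s \<ge> d\<^sup>2" for n s
  using power_mono[OF assms(4)[of n s], of 2] assms(3) by (simp add: power2_norm_eq_inner)
 then have "wc k (\<lambda>n s. sqrt (U n s \<bullet> U n s)) (\<lambda>s. sqrt (u s \<bullet> u s))"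
  using assms by (intro wc_sqrt[where d = "d\<^sup>2"] wc_inner pc_inner) auto
 then show ?thesis by (simp add: norm_eq_sqrt_inner)
qed

section \<open>Weak derivatives\<close>

lemma L2_iff: "u \<in> L2 \<longleftrightarrow> u \<in> sqint \<and> periodic u"
 by (auto simp: L2_def sqint_def)

text \<open>A class of smooth periodic test functions that is an algebra and separates the points of
  the circle, so that the Stone-Weierstrass theorem shows it to be rich enough.\<close>

inductive trigpoly :: "(real => real) => bool" where
 const: "trigpoly (\<lambda>_. c)"
| cos: "trigpoly cos"
| sin: "trigpoly sin"
| add: "trigpoly f ==> trigpoly g ==> trigpoly (\<lambda>x. f x + g x)"
| mult: "trigpoly f ==> trigpoly g ==> trigpoly (\<lambda>x. f x * g x)"

lemma trigpoly_has_derivative: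
 "trigpoly f ==> \<exists>f'. trigpoly f' \<and> (\<forall>x. (f has_real_derivative f' x) (at x))"
proof (induction rule: trigpoly.induct)
 case (const c)
 show ?case by (rule exI[of _ "\<lambda>_. 0"]) (auto intro: trigpoly.const)
next
 case cos
 have "trigpoly (\<lambda>x. -1 * sin x)" by (intro trigpoly.intros)
 then show ?case by (intro exI[of _ "\<lambda>x. -1 * sin x"]) (auto intro!: derivative_eq_intros)
next
 case sin
 show ?case by (rule exI[of _ cos]) (auto intro!: derivative_eq_intros trigpoly.cos)
next
 case (add f g)
 then obtain f' g' where "trigpoly f'" "trigpoly g'" "\<forall>x. (f has_real_derivative f' x) (at x)" "\<forall>x. (g has_real_derivative g' x) (at x)"
  by blast
 then show ?case by (intro exI[of _ "\<lambda>x. f' x + g' x"]) (auto intro!: derivative_eq_intros trigpoly.add)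
next
 case (mult f g)
 then obtain f' g' where *: "trigpoly f'" "trigpoly g'" "\<forall>x. (f has_real_derivative f' x) (at x)" "\<forall>x. (g has_real_derivative g' x) (at x)"
  by blast
 have "trigpoly (\<lambda>x. f' x * g x + f x * g' x)" by (intro trigpoly.add trigpoly.mult mult * )
 with * show ?case by (intro exI[of _ "\<lambda>x. f' x * g x + f x * g' x"]) (auto intro!: derivative_eq_intros)
qed

lemma trigpoly_deriv:
 assumes "trigpoly f"
 shows "trigpoly (deriv f)" "(f has_real_derivative deriv f x) (at x)"
proof -
 obtain f' where f': "trigpoly f'" "\<forall>x. (f has_real_derivative f' x) (at x)"
  using trigpoly_has_derivative[OF assms] by blast
 then have "deriv f = f'" by (auto intro: DERIV_imp_deriv)
 with f' show "trigpoly (deriv f)" "(f has_real_derivative deriv f x) (at x)" by auto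
qed

lemma trigpoly_periodic: "trigpoly f ==> periodic f"
 by (induction rule: trigpoly.induct) (auto simp: periodic_def)

lemma trigpoly_differentiable: "trigpoly f ==> ((deriv ^^ k) f) differentiable_on UNIV"
proof (induction k arbitrary: f)
 case 0
 then show ?case using trigpoly_deriv(2)[of f]
  by (auto simp: differentiable_on_def real_differentiable_def intro: differentiable_at_withinI)
next
 case (Suc k)
 then show ?case by (simp add: funpow_Suc_right trigpoly_deriv(1) del: funpow.simps)
qed

lemma trigpoly_test: "trigpoly f ==> test_function f"
 by (simp add: test_function_def trigpoly_periodic trigpoly_differentiable)

lemma trigpoly_continuous: "trigpoly f ==> continuous_on S f"
 using trigpoly_deriv(2) by (meson DERIV_isCont continuous_at_imp_continuous_on)

lemma integrable_mult_sqint: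
 fixes v :: "real => 'a::euclidean_space"
 assumes v: "v \<in> sqint" and g: "g \<in> borel_measurable borel" "\<And>s. \<bar>g s\<bar> \<le> C"
 shows "integrable circle (\<lambda>s. g s *\<^sub>R v s)"
 using integrable_sqint_bilinear[OF bounded_bilinear_scaleR sqint_bounded[of g C] v] g by auto

lemma trigpoly_sqint: "trigpoly f ==> f \<in> sqint"
 by (metis periodic_bounded trigpoly_periodic trigpoly_continuous sqint_bounded borel_measurable_continuous_onI)

lemma integrable_trigpoly:
 fixes v :: "real => 'a::euclidean_space"
 shows "v \<in> sqint ==> trigpoly f ==> integrable circle (\<lambda>s. f s *\<^sub>R v s)"
 using integrable_sqint_bilinear[OF bounded_bilinear_scaleR trigpoly_sqint] .

text \<open>Stone-Weierstrass on the unit circle in the complex plane: real and imaginary part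
  separate points, and they pull back along \<open>cis\<close> to cosine and sine.\<close>

lemma trig_orthogonal_continuous:
 fixes v :: "real => 'a::euclidean_space" and G :: "complex => real"
 assumes v: "v \<in> sqint" and z: "\<And>f. trigpoly f ==> (LINT s|circle. f s *\<^sub>R v s) = 0"
  and G: "continuous_on UNIV G" "\<And>x. \<bar>G x\<bar> \<le> 1"
 shows "(LINT s|circle. G (cis s) *\<^sub>R v s) = 0"
proof -
 have Gm: "(\<lambda>s. G (cis s)) \<in> borel_measurable borel"
  by (intro borel_measurable_continuous_onI continuous_on_compose2[OF G(1)] continuous_intros) auto
 have Gi: "integrable circle (\<lambda>s. G (cis s) *\<^sub>R v s)"
  by (rule integrable_mult_sqint[OF v Gm G(2)])
 define I where "I = (LINT s|circle. norm (v s))"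
 have I0: "I \<ge> 0" by (simp add: I_def)
 have "norm (LINT s|circle. G (cis s) *\<^sub>R v s) \<le> 0"
 proof (rule field_le_epsilon)
  fix e :: real assume e: "e > 0"
  define P where "P g \<longleftrightarrow> continuous_on UNIV g \<and> trigpoly (\<lambda>s. g (cis s))" for g :: "complex => real"
  have "\<exists>g. P g \<and> (\<forall>x\<in>sphere 0 1. \<bar>G x - g x\<bar> < e / (I + 1))"
  proof (rule Stone_Weierstrass_HOL)
   show "compact (sphere (0::complex) 1)" by simp
   show "P (\<lambda>x. c)" for c by (auto simp: P_def intro: trigpoly.const)
   show "continuous_on (sphere 0 1) f" if "P f" for f using that by (auto simp: P_def intro: continuous_on_subset)
   show "P (\<lambda>x. f x + g x)" "P (\<lambda>x. f x * g x)" if "P f \<and> P g" for f g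
    using that by (auto simp: P_def intro!: continuous_intros trigpoly.add trigpoly.mult)
   have "P Re" "P Im" by (auto simp: P_def intro!: continuous_intros trigpoly.cos trigpoly.sin)
   then show "\<exists>f. P f \<and> f x \<noteq> f y" if "x \<in> sphere 0 1 \<and> y \<in> sphere 0 1 \<and> x \<noteq> y" for x y
    using that complex_eqI by blast
   show "continuous_on (sphere 0 1) G" using G(1) continuous_on_subset by blast
   show "0 < e / (I + 1)" using e I0 by simp
  qed
  then obtain g where g: "trigpoly (\<lambda>s. g (cis s))" "\<And>x. x \<in> sphere 0 1 ==> \<bar>G x - g x\<bar> < e / (I + 1)"
   by (auto simp: P_def)
  have gi: "integrable circle (\<lambda>s. g (cis s) *\<^sub>R v s)" by (rule integrable_trigpoly[OF v g(1)])
  have "(LINT s|circle. G (cis s) *\<^sub>R v s) = (LINT s|circle. G (cis s) *\<^sub>R v s - g (cis s) *\<^sub>R v s)"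
   using Gi gi z[OF g(1)] by simp
  also have "norm \<dots> \<le> (LINT s|circle. e / (I + 1) * norm (v s))"
  proof (rule order_trans[OF integral_norm_bound integral_mono])
   show "integrable circle (\<lambda>s. norm (G (cis s) *\<^sub>R v s - g (cis s) *\<^sub>R v s))" using Gi gi by auto
   show "integrable circle (\<lambda>s. e / (I + 1) * norm (v s))" using integrable_sqint[OF v] by auto
   fix s
   have "\<bar>G (cis s) - g (cis s)\<bar> * norm (v s) \<le> e / (I + 1) * norm (v s)"
    using g(2)[of "cis s"] by (intro mult_right_mono) auto
   then show "norm (G (cis s) *\<^sub>R v s - g (cis s) *\<^sub>R v s) \<le> e / (I + 1) * norm (v s)"
    by (simp add: scaleR_diff_left[symmetric])
  qed
  also have "\<dots> = e / (I + 1) * I" by (simp add: I_def)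
  also have "\<dots> \<le> e / (I + 1) * (I + 1)" using e I0 by (intro mult_left_mono) auto
  also have "\<dots> = e" using I0 by simp
  finally show "norm (LINT s|circle. G (cis s) *\<^sub>R v s) \<le> 0 + e" by simp
 qed
 then show ?thesis by simp
qed

text \<open>The continuous functions \<open>G k\<close>, cut off in terms of the distance to the
  set, decrease to its indicator.\<close>

lemma trig_orthogonal_closed:
 fixes v :: "real => 'a::euclidean_space"
 assumes v: "v \<in> sqint" and z: "\<And>f. trigpoly f ==> (LINT s|circle. f s *\<^sub>R v s) = 0"
  and A: "closed A" "A \<noteq> {}"
 shows "(LINT s|circle. indicator A (cis s) *\<^sub>R v s) = 0"
proof -
 define G where "G k z = max 0 (1 - real k * infdist z A)" for k and z :: complex
 have Gc: "continuous_on UNIV (G k)" for k unfolding G_def[abs_def] by (intro continuous_intros)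
 have Gb: "\<bar>G k z\<bar> \<le> 1" for k z using infdist_nonneg[of z A] by (auto simp: G_def max_def)
 have Gm[measurable]: "(\<lambda>s. G k (cis s)) \<in> borel_measurable borel" for k
  by (intro borel_measurable_continuous_onI continuous_on_compose2[OF Gc] continuous_intros) auto
 have cism: "cis \<in> borel_measurable borel"
  by (intro borel_measurable_continuous_onI continuous_intros)
 have "A \<in> sets borel" using A by simp
 then have [measurable]: "(\<lambda>s. indicator A (cis s) :: real) \<in> borel_measurable borel"
  by (intro measurable_compose[OF cism]) simp
 note [measurable] = sqintD(1)[OF v]
 have "(\<lambda>k. LINT s|circle. G k (cis s) *\<^sub>R v s) \<longlonglongrightarrow> (LINT s|circle. indicator A (cis s) *\<^sub>R v s)"
 proof (rule integral_dominated_convergence[where w = "\<lambda>s. norm (v s)"])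
  show "integrable circle (\<lambda>s. norm (v s))" using integrable_sqint[OF v] by simp
  show "AE s in circle. norm (G k (cis s) *\<^sub>R v s) \<le> norm (v s)" for k
   using Gb[of k] by (intro AE_I2) (simp add: mult_left_le_one_le)
  have "(\<lambda>k. G k z) \<longlonglongrightarrow> indicator A z" for z
  proof (cases "z \<in> A")
   case True
   then show ?thesis by (simp add: G_def)
  next
   case False
   then have p: "infdist z A > 0" using A by (metis infdist_pos_not_in_closed)
   obtain N where N: "1 < real N * infdist z A" using reals_Archimedean3[OF p] by blast
   have "G k z = 0" if "k \<ge> N" for k
   proof -
    have "real N * infdist z A \<le> real k * infdist z A" using that p by (intro mult_right_mono) auto
    then show ?thesis using N by (simp add: G_def)
   qed
   then show ?thesis using False
    by (intro tendsto_eventually) (auto simp: eventually_sequentially)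
  qed
  then show "AE s in circle. (\<lambda>k. G k (cis s) *\<^sub>R v s) \<longlonglongrightarrow> indicator A (cis s) *\<^sub>R v s"
   by (intro AE_I2 tendsto_scaleR tendsto_const)
 qed measurable
 moreover have "(LINT s|circle. G k (cis s) *\<^sub>R v s) = 0" for k
  by (rule trig_orthogonal_continuous[OF v z Gc Gb])
 ultimately show ?thesis by (simp add: LIMSEQ_const_iff)
qed

lemma cis_eq_iff: "cis x = cis y \<longleftrightarrow> (\<exists>k::int. x = y + 2 * pi * of_int k)"
 unfolding cis_conv_exp exp_eq by (auto simp: complex_eq_iff algebra_simps)

lemma cis_inj:
 assumes "\<bar>x - y\<bar> < 2 * pi" "cis x = cis y"
 shows "x = y"
proof -
 have "\<i> * complex_of_real x = \<i> * complex_of_real y"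
 proof (rule exp_complex_eqI)
  show "exp (\<i> * complex_of_real x) = exp (\<i> * complex_of_real y)"
   using assms(2) by (simp only: cis_conv_exp)
 qed (use assms(1) in simp)
 then show ?thesis by simp
qed

text \<open>Arcs that begin at the angle 0 are compact, so the integrals of \<open>v\<close> over
  all initial segments of the period vanish. Half-lines generate the Borel sets, hence the integral
  over every Borel set vanishes.\<close>

lemma trig_orthogonal_AE:
 fixes v :: "real => 'a::euclidean_space"
 assumes v: "v \<in> sqint" and z: "\<And>f. trigpoly f ==> (LINT s|circle. f s *\<^sub>R v s) = 0"
 shows "AE s in circle. v s = 0"
proof -
 note [measurable] = sqintD(1)[OF v]
 define I where "I A = (LINT s|circle. indicator A s *\<^sub>R v s)" for A
 have ii: "integrable circle (\<lambda>s. indicator A s *\<^sub>R v s)" if "A \<in> sets borel" for A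
  using that by (intro integrable_mult_sqint[OF v, of _ 1]) (auto simp: indicator_def)
 have all: "I UNIV = 0" using z[OF trigpoly.const[of 1]] by (simp add: I_def)
 have atm: "I {..x} = 0" for x
 proof -
  consider "x < 0" | "0 \<le> x" "x < 2 * pi" | "2 * pi \<le> x" by linarith
  then show ?thesis
  proof cases
   case 1
   have "I {..x} = (LINT s|circle. 0)"
    unfolding I_def using 1 by (intro Bochner_Integration.integral_cong) (auto simp: space_circle)
   then show ?thesis by simp
  next
   case 2
   have "compact (cis ` {0..x})" by (intro compact_continuous_image continuous_intros) auto
   then have "(LINT s|circle. indicator (cis ` {0..x}) (cis s) *\<^sub>R v s) = 0"
    using 2 by (intro trig_orthogonal_closed[OF v z] compact_imp_closed) auto
   moreover have "indicator (cis ` {0..x}) (cis s) = (indicator {..x} s :: real)" if th: "s \<in> space circle" for s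
   proof -
    have "cis s \<in> cis ` {0..x} \<longleftrightarrow> s \<le> x"
    proof
     assume "cis s \<in> cis ` {0..x}"
     then obtain s' where t: "s' \<in> {0..x}" "cis s = cis s'" by blast
     have "s = s'" using t th 2 by (intro cis_inj) (auto simp: space_circle abs_real_def)
     then show "s \<le> x" using t by simp
    qed (use th in \<open>auto simp: space_circle\<close>)
    then show ?thesis by (simp add: indicator_def)
   qed
   ultimately show ?thesis unfolding I_def
    by (metis (no_types, lifting) Bochner_Integration.integral_cong)
  next
   case 3
   have "I {..x} = I UNIV"
    unfolding I_def using 3 by (intro Bochner_Integration.integral_cong) (auto simp: space_circle)
   then show ?thesis using all by simp
  qed
 qed
 have bo: "sets borel = sigma_sets UNIV (range (atMost :: real => real set))"
  by (subst borel_eq_atMost) (simp add: sets_measure_of)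
 have I0: "I A = 0" if "A \<in> sets borel" for A
 proof -
  have ist: "Int_stable (range (atMost :: real => real set))" by (auto simp: Int_stable_def)
  have clo: "range (atMost :: real => real set) \<subseteq> Pow UNIV" by simp
  have "A \<in> sigma_sets UNIV (range (atMost :: real => real set))" using that bo by simp
  from ist clo this show ?thesis
  proof (induction rule: sigma_sets_induct_disjoint)
   case (basic A)
   then show ?case using atm by auto
  next
   case empty
   show ?case by (simp add: I_def)
  next
   case (compl A)
   then have A: "A \<in> sets borel" using bo by simp
   have "I (UNIV - A) = (LINT s|circle. indicator UNIV s *\<^sub>R v s - indicator A s *\<^sub>R v s)"
    unfolding I_def by (intro Bochner_Integration.integral_cong) (auto simp: indicator_def)
   also have "\<dots> = I UNIV - I A" unfolding I_def by (intro Bochner_Integration.integral_diff ii A) auto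
   finally show ?case using all compl by simp
  next
   case (union A)
   have A: "A i \<in> sets borel" for i using union(2) bo by blast
   have e1: "set_lebesgue_integral circle (\<Union>i. A i \<inter> {0..<2*pi}) v = (\<Sum>i. set_lebesgue_integral circle (A i \<inter> {0..<2*pi}) v)"
   proof (rule lebesgue_integral_countable_add)
    show "A i \<inter> {0..<2*pi} \<in> sets circle" for i by (rule sets_circle[OF A])
    show "A i \<inter> {0..<2*pi} \<inter> (A j \<inter> {0..<2*pi}) = {}" if "i \<noteq> j" for i j
     using disjoint_family_onD[OF union(1), of i j] that by auto
    show "set_integrable circle (\<Union>i. A i \<inter> {0..<2*pi}) v"
     unfolding set_integrable_def using A by (intro ii) auto
   qed
   have e2: "set_lebesgue_integral circle (B \<inter> {0..<2*pi}) v = I B" for B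
    unfolding set_lebesgue_integral_def I_def
    by (intro Bochner_Integration.integral_cong) (auto simp: space_circle indicator_def)
   have e3: "(\<Union>i. A i \<inter> {0..<2*pi}) = (\<Union>i. A i) \<inter> {0..<2*pi}" by blast
   have "I (\<Union>i. A i) = (\<Sum>i. I (A i))" using e1 by (simp only: e2 e3)
   then show ?case using union(3) by simp
  qed
 qed
 show ?thesis
 proof (rule circle.density_zero[OF integrable_sqint[OF v]])
  fix A assume "A \<in> sets circle"
  then have "A \<in> sets borel" by (auto simp: circle_def sets_restrict_space)
  then show "set_lebesgue_integral circle A v = 0" using I0 by (simp add: I_def set_lebesgue_integral_def)
 qed
qed

text \<open>The product of \<open>\<phi>\<close> and \<open>u\<close> is periodic and absolutely
  continuous, so its derivative has integral zero over one period.\<close>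

lemma cder_integration_by_parts:
 fixes u v :: "real => 'a::euclidean_space"
 assumes u: "cder u v" and v: "v \<in> sqint" and \<phi>: "test_function \<phi>"
 shows "(LINT s|circle. deriv \<phi> s *\<^sub>R u s) = - (LINT s|circle. \<phi> s *\<^sub>R v s)"
proof -
 have d: "(\<phi> has_real_derivative deriv \<phi> x) (at x)" for x
  using \<phi>[unfolded test_function_def, THEN conjunct2, rule_format, of 0]
  by (auto simp: differentiable_on_def DERIV_deriv_iff_real_differentiable)
 have cd: "continuous_on UNIV (deriv \<phi>)"
  using \<phi>[unfolded test_function_def, THEN conjunct2, rule_format, of 1]
  by (auto intro: differentiable_imp_continuous_on)
 have "ac 0 (2*pi) \<phi> (deriv \<phi>)"
  unfolding ac_def
 proof (intro conjI ballI)
  show "deriv \<phi> absolutely_integrable_on {0..2*pi}"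
   by (intro absolutely_integrable_continuous_real continuous_on_subset[OF cd]) auto
  fix x y assume "x \<in> {0..2*pi}" "y \<in> {x..2*pi}"
  then show "(deriv \<phi> has_integral (\<phi> y - \<phi> x)) {x..y}"
   using d by (intro fundamental_theorem_of_calculus)
    (auto simp: has_real_derivative_iff_has_vector_derivative[symmetric] intro: has_field_derivative_at_within)
 qed
 then have c\<phi>: "cder \<phi> (deriv \<phi>)" using \<phi> by (simp add: cder_def test_function_def)
 have p': "periodic (deriv \<phi>)"
  unfolding periodic_def
 proof
  fix x
  have "((\<lambda>x. \<phi> (x + 2*pi)) has_real_derivative deriv \<phi> (x + 2*pi)) (at x)"
   using DERIV_shift[of \<phi> "deriv \<phi> (x + 2*pi)" x "2*pi"] d by simp
  moreover have "(\<lambda>x. \<phi> (x + 2*pi)) = \<phi>" using \<phi> by (auto simp: test_function_def periodic_def)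
  ultimately show "deriv \<phi> (x + 2*pi) = deriv \<phi> x" using DERIV_unique d by metis
 qed
 have dsq: "deriv \<phi> \<in> sqint"
  by (metis periodic_bounded p' cd sqint_bounded borel_measurable_continuous_onI)
 note i1 = integrable_sqint_bilinear[OF bounded_bilinear_scaleR dsq cder_sqint[OF u]]
 note i2 = integrable_sqint_bilinear[OF bounded_bilinear_scaleR cder_sqint[OF c\<phi>] v]
 have m: "(\<lambda>s. deriv \<phi> s *\<^sub>R u s + \<phi> s *\<^sub>R v s) \<in> borel_measurable borel"
  using sqintD(1)[OF dsq] sqintD(1)[OF v] cder_measurable[OF u] cder_measurable[OF c\<phi>] by measurable
 note c = cder_bilinear[OF bounded_bilinear_scaleR c\<phi> u]
 have "(LINT s|circle. deriv \<phi> s *\<^sub>R u s + \<phi> s *\<^sub>R v s) = integral {0..2*pi} (\<lambda>s. deriv \<phi> s *\<^sub>R u s + \<phi> s *\<^sub>R v s)"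
  by (rule circle_integral(2)[OF m]) (use i1 i2 in auto)
 also have "\<dots> = \<phi> (2*pi) *\<^sub>R u (2*pi) - \<phi> 0 *\<^sub>R u 0"
  by (rule ac_integral[OF cderD(2)[OF c]]) auto
 also have "\<dots> = 0"
  using cderD(1)[OF c, unfolded periodic_def, rule_format, of 0] by simp
 finally show ?thesis using i1 i2 by (simp add: eq_neg_iff_add_eq_0)
qed

lemma cder_has_weak_deriv: "cder u v ==> v \<in> sqint ==> periodic v ==> has_weak_deriv u v"
 using cder_integration_by_parts[of u v] by (auto simp: has_weak_deriv_def L2_iff cder_sqint cderD)

lemma has_weak_deriv_unique:
 assumes "has_weak_deriv u v" "has_weak_deriv u v'"
 shows "AE s in circle. v s = v' s"
proof -
 have v: "v \<in> sqint" "v' \<in> sqint" using assms by (auto simp: has_weak_deriv_def L2_iff)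
 have "AE s in circle. v s - v' s = 0"
 proof (rule trig_orthogonal_AE)
  show "(LINT s|circle. f s *\<^sub>R (v s - v' s)) = 0" if "trigpoly f" for f
  proof -
   have "(LINT s|circle. f s *\<^sub>R v s) = (LINT s|circle. f s *\<^sub>R v' s)"
    using assms[unfolded has_weak_deriv_def, THEN conjunct2, THEN conjunct2, rule_format, OF trigpoly_test[OF that]]
    by simp
   then show ?thesis using integrable_trigpoly[OF v(1) that] integrable_trigpoly[OF v(2) that]
    by (simp add: scaleR_diff_right)
  qed
 qed (use v in auto)
 then show ?thesis by simp
qed

lemma has_weak_deriv_cong:
 assumes "has_weak_deriv u v" "u' \<in> L2" "v' \<in> L2" "AE s in circle. u' s = u s" "AE s in circle. v' s = v s"
 shows "has_weak_deriv u' v'"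
 unfolding has_weak_deriv_def
proof (intro conjI allI impI assms)
 fix \<phi> assume \<phi>: "test_function \<phi>"
 have [measurable]: "u \<in> borel_measurable borel" "v \<in> borel_measurable borel" "u' \<in> borel_measurable borel" "v' \<in> borel_measurable borel"
  using assms by (auto simp: has_weak_deriv_def L2_def)
 have [measurable]: "\<phi> \<in> borel_measurable borel" "deriv \<phi> \<in> borel_measurable borel"
  using \<phi>[unfolded test_function_def, THEN conjunct2, rule_format, of 0]
  \<phi>[unfolded test_function_def, THEN conjunct2, rule_format, of 1]
  by (auto intro!: borel_measurable_continuous_onI differentiable_imp_continuous_on)
 have "(LINT s|circle. deriv \<phi> s *\<^sub>R u' s) = (LINT s|circle. deriv \<phi> s *\<^sub>R u s)"
  using assms(4) by (intro integral_cong_AE) auto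
 moreover have "(LINT s|circle. \<phi> s *\<^sub>R v' s) = (LINT s|circle. \<phi> s *\<^sub>R v s)"
  using assms(5) by (intro integral_cong_AE) auto
 ultimately show "(LINT s|circle. deriv \<phi> s *\<^sub>R u' s) = - (LINT s|circle. \<phi> s *\<^sub>R v' s)"
  using assms(1) \<phi> by (simp add: has_weak_deriv_def)
qed

text \<open>Mean zero is what makes a primitive periodic. Thus weak derivatives can be tested
  against all mean zero trigonometric polynomials in place of the derivative of the test
  function.\<close>

lemma trigpoly_mean_zero_antiderivative:
 assumes f: "trigpoly f" and m: "(LINT s|circle. f s) = 0"
 obtains \<phi> where "test_function \<phi>" "deriv \<phi> = f"
proof -
 have "\<exists>F. \<forall>x::real. -\<infinity> < ereal x \<longrightarrow> ereal x < \<infinity> \<longrightarrow> (F has_vector_derivative f x) (at x)"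
  by (rule einterval_antiderivative) (auto intro: DERIV_isCont[OF trigpoly_deriv(2)[OF f]])
 then obtain F where F: "\<And>x. (F has_real_derivative f x) (at x)"
  by (auto simp: has_real_derivative_iff_has_vector_derivative)
 have dF: "deriv F = f" using F by (auto intro: DERIV_imp_deriv)
 have "((\<lambda>x. F (x + 2*pi) - F x) has_real_derivative 0) (at x)" for x
   using DERIV_diff[OF DERIV_shift[THEN iffD1, OF F[of "x + 2*pi"]] F[of x]] trigpoly_periodic[OF f]
   by (simp add: periodic_def)
 then have "F (x + 2*pi) - F x = F (0 + 2*pi) - F 0" for x
  using DERIV_isconst_all[of "\<lambda>x. F (x + 2*pi) - F x" x 0] by blast
 moreover have "F (2*pi) - F 0 = 0"
 proof -
  have "(f has_integral (F (2*pi) - F 0)) {0..2*pi}"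
   using F by (intro fundamental_theorem_of_calculus)
    (auto simp: has_real_derivative_iff_has_vector_derivative[symmetric] intro: has_field_derivative_at_within)
  then show ?thesis
   using m circle_integral(2)[OF sqintD(1)[OF trigpoly_sqint[OF f]] integrable_sqint[OF trigpoly_sqint[OF f]]]
   by (simp add: integral_unique)
 qed
 ultimately have p: "periodic F" by (simp add: periodic_def)
 have "((deriv ^^ k) F) differentiable_on UNIV" for k
 proof (cases k)
  case 0
  then show ?thesis using F by (auto simp: differentiable_on_def real_differentiable_def intro!: differentiable_at_withinI)
 next
  case (Suc j)
  then show ?thesis by (simp add: funpow_Suc_right dF trigpoly_differentiable[OF f] del: funpow.simps)
 qed
 then show ?thesis using that[of F] p dF by (simp add: test_function_def)
qed

text \<open>Du Bois-Reymond: testing with the constant 1 shows that \<open>v\<close> has mean zero,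
  so its primitive \<open>U\<close> is periodic. The difference \<open>u - U\<close> is orthogonal
  to the derivatives of test functions, hence to all mean zero trigonometric polynomials, and is
  therefore constant almost everywhere.\<close>

lemma has_weak_deriv_cder:
 assumes w: "has_weak_deriv u v"
 obtains w where "cder w v" "AE s in circle. u s = w s"
proof -
 have us: "u \<in> sqint" "periodic u" and vs: "v \<in> sqint" "periodic v" using w by (auto simp: has_weak_deriv_def L2_iff)
 have "(LINT s|circle. v s) = 0"
 proof -
  have "deriv (\<lambda>x::real. 1::real) = (\<lambda>x. 0)" by auto
  then show ?thesis
   using w trigpoly_test[OF trigpoly.const[of 1]] unfolding has_weak_deriv_def by (auto dest!: spec[of _ "\<lambda>x. 1"])
 qed
 then have v0: "integral {0..2*pi} v = 0"
  using circle_integral(2)[OF sqintD(1)[OF vs(1)] integrable_sqint[OF vs(1)]] by simp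
 have va: "v absolutely_integrable_on {0..2*pi}"
  by (rule circle_integral(1)[OF sqintD(1)[OF vs(1)] integrable_sqint[OF vs(1)]])
 define U where "U = periodize (\<lambda>x. integral {0..x} v)"
 have Ux: "U x = integral {0..x} v" if "x \<in> {0..2*pi}" for x
 proof (cases "x = 2*pi")
  case True
  have "U (2*pi) = U 0" using periodic_periodize[of "\<lambda>x. integral {0..x} v"] by (simp add: U_def periodic_def) (metis add_0)
  also have "\<dots> = 0" by (simp add: U_def periodize_eq)
  finally show ?thesis using True v0 by simp
 next
  case False
  then show ?thesis using that by (simp add: U_def periodize_eq)
 qed
 have Uc: "cder U v"
  unfolding cder_def ac_def
 proof (intro conjI ballI va)
  show "periodic U" unfolding U_def by (rule periodic_periodize)
  fix x y assume xy: "x \<in> {0..2*pi}" "y \<in> {x..2*pi}"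
  have "integral {0..x} v + integral {x..y} v = integral {0..y} v"
   using xy by (intro Henstock_Kurzweil_Integration.integral_combine absint_sub(2)[OF va]) auto
  then have "integral {x..y} v = U y - U x" using Ux[of x] Ux[of y] xy by (auto simp: algebra_simps)
  then show "(v has_integral (U y - U x)) {x..y}"
   using absint_sub(2)[OF va, of x y] xy by (metis atLeastAtMost_iff integrable_integral)
 qed
 have Us: "U \<in> sqint" by (rule cder_sqint[OF Uc])
 define d where "d s = u s - U s" for s
 have ds: "d \<in> sqint" unfolding d_def[abs_def] using us Us by simp
 have orth: "(LINT s|circle. deriv \<phi> s *\<^sub>R d s) = 0" if \<phi>: "test_function \<phi>" "trigpoly (deriv \<phi>)" for \<phi>
 proof -
  have "(LINT s|circle. deriv \<phi> s *\<^sub>R u s) = (LINT s|circle. deriv \<phi> s *\<^sub>R U s)"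
   using w \<phi> cder_integration_by_parts[OF Uc vs(1)] by (simp add: has_weak_deriv_def)
  then show ?thesis using integrable_trigpoly[OF us(1) \<phi>(2)] integrable_trigpoly[OF Us \<phi>(2)]
   by (simp add: d_def scaleR_diff_right)
 qed
 define \<kappa> where "\<kappa> = (1 / (2*pi)) *\<^sub>R (LINT s|circle. d s)"
 have "AE s in circle. d s - \<kappa> = 0"
 proof (rule trig_orthogonal_AE)
  show "(\<lambda>s. d s - \<kappa>) \<in> sqint" using ds by simp
  fix f assume f: "trigpoly f"
  define m where "m = (LINT s|circle. f s) / (2*pi)"
  have fi: "integrable circle f" by (rule integrable_sqint[OF trigpoly_sqint[OF f]])
  have g: "trigpoly (\<lambda>x. f x + - m)" by (intro trigpoly.add f trigpoly.const)
  moreover have "(LINT s|circle. f s + - m) = 0"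
   using fi by (simp add: m_def measure_circle)
  ultimately obtain \<phi> where "test_function \<phi>" "deriv \<phi> = (\<lambda>x. f x + - m)"
   by (rule trigpoly_mean_zero_antiderivative)
  then have "(LINT s|circle. (f s + - m) *\<^sub>R d s) = 0" using orth[of \<phi>] g by simp
  then have "(LINT s|circle. f s *\<^sub>R d s) = m *\<^sub>R (LINT s|circle. d s)"
   using integrable_trigpoly[OF ds f] integrable_sqint[OF ds] by (simp add: scaleR_diff_left)
  moreover have "(LINT s|circle. f s *\<^sub>R \<kappa>) = m *\<^sub>R (LINT s|circle. d s)"
   using fi by (simp add: \<kappa>_def m_def)
  ultimately show "(LINT s|circle. f s *\<^sub>R (d s - \<kappa>)) = 0"
   using integrable_trigpoly[OF ds f] integrable_trigpoly[OF sqint_const[of \<kappa>] f] by (simp add: scaleR_diff_right)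
 qed
 then have "AE s in circle. u s = U s + \<kappa>" by eventually_elim (simp add: d_def algebra_simps)
 moreover have "cder (\<lambda>s. U s + \<kappa>) v" using cder_add[OF Uc cder_const[of \<kappa>]] by simp
 ultimately show ?thesis using that by blast
qed

lemma AE_circle_continuous_eq:
 fixes f g :: "real => 'a::euclidean_space"
 assumes "AE s in circle. f s = g s" "continuous_on UNIV f" "continuous_on UNIV g" "periodic f" "periodic g"
 shows "f = g"
proof -
 obtain N where N: "negligible N" "\<And>s. s \<in> {0..2*pi} - N ==> f s = g s"
  using AE_circle_negligible[OF assms(1)] by blast
 have "f s = g s" if s: "s \<in> {0..<2*pi}" for s
 proof (rule ccontr)
  assume ne: "f s \<noteq> g s"
  have "open {x. f x \<noteq> g x}" by (intro open_Collect_neq assms)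
  then obtain d where d: "d > 0" "ball s d \<subseteq> {x. f x \<noteq> g x}" using ne open_contains_ball by blast
  define y where "y = min (s + d) (2*pi)"
  have "{s<..<y} \<subseteq> N"
  proof
   fix x assume x: "x \<in> {s<..<y}"
   then have "x \<in> ball s d" by (auto simp: y_def dist_real_def)
   then have "f x \<noteq> g x" using d by blast
   then show "x \<in> N" using N(2)[of x] x s by (auto simp: y_def)
  qed
  then have neg: "negligible {s<..<y}" by (rule negligible_subset[OF N(1)])
  have "s < y" using d(1) s by (simp add: y_def)
  then have "{s<..<y} \<noteq> {}" by simp
  then show False using open_not_negligible[of "{s<..<y}"] neg open_greaterThanLessThan by blast
 qed
 moreover have "periodic (\<lambda>x. f x - g x)" using assms(4,5) by (simp add: periodic_def)
 ultimately have "f s - g s = 0" for s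
  using periodic_all[of "\<lambda>x. f x - g x" "\<lambda>z. z = 0" s] by simp
 then show ?thesis by auto
qed

lemma cder_cong_AE: "cder u v ==> AE s in circle. v' s = v s ==> cder u v'"
 by (auto simp: cder_def elim!: AE_circle_negligible intro: ac_cong_negligible)

lemma wder_weak:
 assumes "has_weak_deriv u v"
 shows "has_weak_deriv u (wder u)" "has_weak_deriv u w ==> continuous_on UNIV w ==> continuous_on UNIV (wder u)"
proof -
 have "\<exists>v. has_weak_deriv u v \<and> ((\<exists>w. has_weak_deriv u w \<and> continuous_on UNIV w) \<longrightarrow> continuous_on UNIV v)"
  using assms by blast
 from someI_ex[OF this] show "has_weak_deriv u (wder u)"
  "has_weak_deriv u w ==> continuous_on UNIV w ==> continuous_on UNIV (wder u)"
  unfolding wder_def by blast+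
qed

lemma wder_cder:
 assumes u: "cder u v" and v: "v \<in> sqint" "periodic v"
 shows "cder u (wder u)" "wder u \<in> sqint" "periodic (wder u)" "AE s in circle. wder u s = v s"
  "continuous_on UNIV v ==> wder u = v"
proof -
 note w = cder_has_weak_deriv[OF u v]
 note ww = wder_weak(1)[OF w]
 show ae: "AE s in circle. wder u s = v s" by (rule has_weak_deriv_unique[OF ww w])
 show "cder u (wder u)" by (rule cder_cong_AE[OF u ae])
 show "wder u \<in> sqint" and p: "periodic (wder u)" using ww by (auto simp: has_weak_deriv_def L2_iff)
 show "wder u = v" if "continuous_on UNIV v"
  by (rule AE_circle_continuous_eq[OF ae wder_weak(2)[OF w w that] that p v(2)])
qed

lemma wc_continuous: "wc k U u ==> k > 0 ==> continuous_on UNIV u" "wc k U u ==> k > 0 ==> continuous_on UNIV (U n)"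
 by (cases k; auto elim!: wc_SucE dest: cder_continuous)+

text \<open>At the top order the choice made by \<open>wder\<close> agrees with the given derivative
  only almost everywhere, which weak L2 convergence does not see; at lower orders continuity forces
  equality.\<close>

lemma wc_wder:
 assumes "wc (Suc k) U u"
 shows "wc k (\<lambda>n. wder (U n)) (wder u)" "cder (U n) (wder (U n))" "cder u (wder u)"
proof -
 obtain V v where V: "\<And>n. cder (U n) (V n)" "cder u v" "wc k V v" using assms by (rule wc_SucE) blast
 note r = wc_regular[OF V(3)]
 show "cder (U n) (wder (U n))" "cder u (wder u)"
  using wder_cder(1)[OF V(1) r(1,2)] wder_cder(1)[OF V(2) r(3,4)] by auto
 show "wc k (\<lambda>n. wder (U n)) (wder u)"
 proof (cases k)
  case 0
  then show ?thesis
   using wl2_cong_AE[of V v "\<lambda>n. wder (U n)" "wder u"] V(3) wder_cder[OF V(1) r(1,2)] wder_cder[OF V(2) r(3,4)] by simp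
 next
  case (Suc j)
  then have "wder (U n) = V n" "wder u = v" for n
   using wder_cder(5)[OF V(1) r(1,2)] wder_cder(5)[OF V(2) r(3,4)] wc_continuous[OF V(3)] by auto
  then show ?thesis using V(3) by simp
 qed
qed

lemma Sob_wder: "Sob (Suc k) u ==> Sob k (wder u)"
 using wc_wder(1)[of k "\<lambda>_. u" u] by simp

lemma Sob_cder: "Sob (Suc k) u ==> cder u (wder u)"
 using wc_wder(3) by blast

lemma Sob_SucI:
 assumes "cder u v" "Sob k v"
 shows "Sob (Suc k) u"
proof -
 obtain C where "\<And>s. norm (u s) \<le> C" using periodic_bounded cderD(1) cder_continuous assms(1) by metis
 then have "pc (\<lambda>_. u) u" by (auto simp: pc_def)
 then show ?thesis using assms by (intro wc_SucI) auto
qed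

lemma Sob_0: "u \<in> sqint ==> periodic u ==> Sob 0 u"
 by (auto simp: wl2_def)

text \<open>If \<open>wder u\<close> is itself weakly differentiable, it agrees almost everywhere
  with a continuous function. That function is another weak derivative of \<open>u\<close>, so the
  choice in \<open>wder\<close> must be a continuous one, and the induction can proceed with
  \<open>wder u\<close> in place of \<open>u\<close>.\<close>

lemma sobolev_imp_Sob:
 "periodic u ==> continuous_on UNIV u ==> (\<And>j. j < Suc m ==> \<exists>v. has_weak_deriv ((wder ^^ j) u) v) ==> Sob (Suc m) u"
proof (induction m arbitrary: u)
 case (0 u)
 obtain v where v: "has_weak_deriv u v" using "0.prems"(3)[of 0] by auto
 obtain w where w: "cder w v" "AE s in circle. u s = w s" using has_weak_deriv_cder[OF v] .
 have "u = w" by (rule AE_circle_continuous_eq[OF w(2)]) (use 0 cder_continuous[OF w(1)] cderD(1)[OF w(1)] in auto)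
 then show ?case using w(1) v by (intro Sob_SucI[of u v] Sob_0) (auto simp: has_weak_deriv_def L2_iff)
next
 case (Suc m u)
 obtain v where v: "has_weak_deriv u v" using Suc.prems(3)[of 0] by auto
 note ww = wder_weak(1)[OF v]
 obtain w where w: "cder w (wder u)" "AE s in circle. u s = w s" using has_weak_deriv_cder[OF ww] .
 have uw: "u = w" by (rule AE_circle_continuous_eq[OF w(2)]) (use Suc.prems cder_continuous[OF w(1)] cderD(1)[OF w(1)] in auto)
 have nx: "\<exists>v. has_weak_deriv ((wder ^^ j) (wder u)) v" if "j < Suc m" for j
  using Suc.prems(3)[of "Suc j"] that by (simp add: funpow_swap1)
 obtain v2 where v2: "has_weak_deriv (wder u) v2" using nx[of 0] by auto
 obtain w2 where w2: "cder w2 v2" "AE s in circle. wder u s = w2 s" using has_weak_deriv_cder[OF v2] .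
 have "has_weak_deriv u w2"
  by (rule has_weak_deriv_cong[OF ww]) (use ww w2 in \<open>auto simp: has_weak_deriv_def L2_iff cder_sqint cderD\<close>)
 then have "continuous_on UNIV (wder u)"
  using wder_weak(2)[OF v] cder_continuous[OF w2(1)] by blast
 moreover have "periodic (wder u)" using ww by (auto simp: has_weak_deriv_def L2_iff)
 ultimately have "Sob (Suc m) (wder u)" using nx by (intro Suc.IH)
 then show ?case using w(1) uw by (intro Sob_SucI[of u "wder u"]) auto
qed

lemma Sob_imp_weak: "Sob m u ==> j < m ==> \<exists>v. has_weak_deriv ((wder ^^ j) u) v"
proof (induction j arbitrary: u m)
 case 0
 then obtain k where m: "m = Suc k" by (cases m) auto
 have "has_weak_deriv u (wder u)"
  using 0 m wc_regular[OF Sob_wder[of k u]] by (intro cder_has_weak_deriv Sob_cder) auto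
 then show ?case by auto
next
 case (Suc j)
 then obtain k where m: "m = Suc k" by (cases m) auto
 then have "\<exists>v. has_weak_deriv ((wder ^^ j) (wder u)) v" using Suc by (intro Suc.IH[of k] Sob_wder) auto
 then show ?case by (simp add: funpow_swap1)
qed

lemma sobolev_iff: "m > 0 ==> u \<in> sobolev m \<longleftrightarrow> Sob m u"
 using sobolev_imp_Sob[of u "m - 1"] Sob_imp_weak[of m u] wc_regular(4)[of m "\<lambda>_. u" u] wc_continuous(1)[of m "\<lambda>_. u" u]
 by (auto simp: sobolev_def simp del: wc.simps)

section \<open>Bounded functionals on Sobolev spaces\<close>

lemma wc_wder_pow: "wc m U u ==> j \<le> m ==> wc (m - j) (\<lambda>n. (wder ^^ j) (U n)) ((wder ^^ j) u)"
proof (induction j)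
 case (Suc j)
 then have "wc (Suc (m - Suc j)) (\<lambda>n. (wder ^^ j) (U n)) ((wder ^^ j) u)"
  by (simp add: Suc_diff_Suc)
 from wc_wder(1)[OF this] show ?case by simp
qed simp

lemma Sob_wder_pow: "Sob m u ==> j \<le> m ==> Sob (m - j) ((wder ^^ j) u)"
 using wc_wder_pow[of m "\<lambda>_. u" u j] by simp

lemma wder_lincomb:
 fixes u v :: "real => real ^ 'd::finite"
 assumes u: "Sob (Suc k) u" and v: "Sob (Suc k) v"
 shows "AE x in circle. wder (\<lambda>x. a *\<^sub>R u x + b *\<^sub>R v x) x = a *\<^sub>R wder u x + b *\<^sub>R wder v x"
  "k > 0 ==> wder (\<lambda>x. a *\<^sub>R u x + b *\<^sub>R v x) = (\<lambda>x. a *\<^sub>R wder u x + b *\<^sub>R wder v x)"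
proof -
 have c: "cder (\<lambda>x. a *\<^sub>R u x + b *\<^sub>R v x) (\<lambda>x. a *\<^sub>R wder u x + b *\<^sub>R wder v x)"
  by (intro cder_add cder_scaleR Sob_cder[OF u] Sob_cder[OF v])
 note ru = wc_regular[OF Sob_wder[OF u]] and rv = wc_regular[OF Sob_wder[OF v]]
 have s: "(\<lambda>x. a *\<^sub>R wder u x + b *\<^sub>R wder v x) \<in> sqint"
  by (intro sqint_add sqint_scaleR ru(1) rv(1))
 have p: "periodic (\<lambda>x. a *\<^sub>R wder u x + b *\<^sub>R wder v x)"
  using ru(2) rv(2) by (simp add: periodic_def)
 show "AE x in circle. wder (\<lambda>x. a *\<^sub>R u x + b *\<^sub>R v x) x = a *\<^sub>R wder u x + b *\<^sub>R wder v x"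
  by (rule wder_cder(4)[OF c s p])
 show "wder (\<lambda>x. a *\<^sub>R u x + b *\<^sub>R v x) = (\<lambda>x. a *\<^sub>R wder u x + b *\<^sub>R wder v x)" if "k > 0"
  by (rule wder_cder(5)[OF c s p])
   (intro continuous_intros wc_continuous(1)[OF Sob_wder[OF u] that] wc_continuous(1)[OF Sob_wder[OF v] that])
qed

lemma wder_pow_lincomb:
 fixes u v :: "real => real ^ 'd::finite"
 assumes u: "Sob m u" and v: "Sob m v" and j: "j \<le> m"
 shows "AE x in circle. (wder ^^ j) (\<lambda>x. a *\<^sub>R u x + b *\<^sub>R v x) x = a *\<^sub>R (wder ^^ j) u x + b *\<^sub>R (wder ^^ j) v x"
  "j < m ==> (wder ^^ j) (\<lambda>x. a *\<^sub>R u x + b *\<^sub>R v x) = (\<lambda>x. a *\<^sub>R (wder ^^ j) u x + b *\<^sub>R (wder ^^ j) v x)"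
proof -
 have *: "(wder ^^ i) (\<lambda>x. a *\<^sub>R u x + b *\<^sub>R v x) = (\<lambda>x. a *\<^sub>R (wder ^^ i) u x + b *\<^sub>R (wder ^^ i) v x)" if "i < m" for i
  using that
 proof (induction i)
  case (Suc i)
  obtain k where k: "m - i = Suc k" "k > 0" using Suc.prems by (metis Suc_diff_Suc Suc_lessD zero_less_diff)
  have "Sob (Suc k) ((wder ^^ i) u)" "Sob (Suc k) ((wder ^^ i) v)"
   using Sob_wder_pow[OF u, of i] Sob_wder_pow[OF v, of i] Suc.prems k by auto
  from wder_lincomb(2)[OF this k(2)] Suc show ?case by simp
 qed simp
 then show "j < m ==> (wder ^^ j) (\<lambda>x. a *\<^sub>R u x + b *\<^sub>R v x) = (\<lambda>x. a *\<^sub>R (wder ^^ j) u x + b *\<^sub>R (wder ^^ j) v x)"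
  by blast
 show "AE x in circle. (wder ^^ j) (\<lambda>x. a *\<^sub>R u x + b *\<^sub>R v x) x = a *\<^sub>R (wder ^^ j) u x + b *\<^sub>R (wder ^^ j) v x"
 proof (cases j)
  case (Suc i)
  obtain k where k: "m - i = Suc k" using Suc j by (metis Suc_diff_Suc Suc_le_lessD)
  have "Sob (Suc k) ((wder ^^ i) u)" "Sob (Suc k) ((wder ^^ i) v)"
   using Sob_wder_pow[OF u, of i] Sob_wder_pow[OF v, of i] Suc j k by auto
  from wder_lincomb(1)[OF this, of a b] *[of i] Suc j show ?thesis by simp
 qed simp
qed

lemma Sob_lincomb: "Sob m u ==> Sob m v ==> Sob m (\<lambda>x. a *\<^sub>R u x + b *\<^sub>R v x)"
 by (intro wc_add wc_cmult) auto

lemma Sob_diff: "Sob m u ==> Sob m v ==> Sob m (\<lambda>x. u x - v x)"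
 by (rule wc_diff)

lemma sobolev_norm_eq:
 assumes "Sob m u"
 shows "sobolev_norm m u = sqrt (nsq u + nsq ((wder ^^ m) u))"
 unfolding sobolev_norm_def nsq_def
 using sqintD(2)[OF wc_regular(1)[OF assms]] sqintD(2)[OF wc_regular(1)[OF Sob_wder_pow[OF assms order_refl]]] by simp

text \<open>Weak closedness of the target set is phrased in terms of bounded functionals, so
  \<open>wc\<close> has to imply convergence against each of them. Only linearity and the bound of
  the functional enter: if it stayed away from zero along the differences, it would become too large
  on suitable signed sums of them.\<close>

lemma dual_tendsto:
 fixes u :: "real => real ^ 'd::finite"
 assumes m: "m > 0" and l: "l \<in> sobolev_dual m" and U: "wc m U u"
 shows "(\<lambda>n. l (U n)) \<longlonglongrightarrow> l u"
proof -
 obtain C where ladd: "\<And>u v. Sob m u ==> Sob m v ==> l (\<lambda>x. u x + v x) = l u + l v"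
  and lsc: "\<And>a u. Sob m u ==> l (\<lambda>x. a *\<^sub>R u x) = a * l u"
  and lC: "\<And>u. Sob m u ==> \<bar>l u\<bar> \<le> C * sobolev_norm m u"
 proof -
  have "sobolev m = {u :: real => real ^ 'd. Sob m u}" using sobolev_iff[OF m] by auto
  with l that show ?thesis by (auto simp: sobolev_dual_def)
 qed
 have SU: "Sob m (U n)" for n by (rule wc_Sob_seq[OF U])
 have Su: "Sob m u" by (rule wc_Sob[OF U])
 define w where "w n = (\<lambda>x. U n x - u x)" for n
 have w: "wc m w (\<lambda>x. u x - u x)" unfolding w_def[abs_def] by (rule wc_diff[OF U Su])
 then have w0: "wc m w (\<lambda>x. 0)" by simp
 have Sw: "Sob m (w n)" for n by (rule wc_Sob_seq[OF w])
 have lw: "l (w n) = l (U n) - l u" for n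
  using ladd[OF SU[of n], of "\<lambda>x. (-1) *\<^sub>R u x"] lsc[OF Su, of "-1"] wc_cmult[of "\<lambda>_. -1" "-1", OF _ Su]
  by (simp add: w_def)
 define D where "D = (wder ^^ m :: (real => real ^ 'd) => _)"
 define nn where "nn f = nsq f + nsq (D f)" for f :: "real => real ^ 'd"
 have Ds: "D f \<in> sqint" if "Sob m f" for f
  unfolding D_def using wc_regular(1)[OF Sob_wder_pow[OF that order_refl]] .
 have fs: "f \<in> sqint" if "Sob m f" for f :: "real => real ^ 'd" using wc_regular(1)[OF that] .
 have nn_add: "nn (\<lambda>x. f x + s *\<^sub>R g x) = nn f + 2 * s * (ip f g + ip (D f) (D g)) + s\<^sup>2 * nn g"
  if f: "Sob m f" and g: "Sob m g" for f g s
 proof -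
  have "AE x in circle. D (\<lambda>x. f x + s *\<^sub>R g x) x = D f x + s *\<^sub>R D g x"
   using wder_pow_lincomb(1)[OF f g order_refl, of 1 s] by (simp add: D_def)
  then have "nsq (D (\<lambda>x. f x + s *\<^sub>R g x)) = nsq (\<lambda>x. D f x + s *\<^sub>R D g x)"
   using Ds[OF Sob_lincomb[OF f g, of 1 s]] Ds[OF f] Ds[OF g] by (intro nsq_cong_AE) auto
  also have "\<dots> = nsq (D f) + 2 * s * ip (D f) (D g) + s\<^sup>2 * nsq (D g)"
   using Ds[OF f] Ds[OF g] by (simp add: nsq_add nsq_scaleR ip_scaleR)
  finally show ?thesis
   using fs[OF f] fs[OF g] by (simp add: nn_def nsq_add nsq_scaleR ip_scaleR algebra_simps)
 qed
 have w2: "wl2 w (\<lambda>x. 0)" using wc_le[OF w0, of 0] by simp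
 from wl2D(5)[OF w2] obtain M1 where M1: "\<forall>n. nsq (w n) \<le> M1" ..
 have wD: "wl2 (\<lambda>n. D (w n)) (D (\<lambda>x. 0))" using wc_wder_pow[OF w0 order_refl] by (simp add: D_def)
 from wl2D(5)[OF wD] obtain M2 where M2: "\<forall>n. nsq (D (w n)) \<le> M2" ..
 define M where "M = M1 + M2"
 have M: "nn (w n) \<le> M" for n using M1[rule_format, of n] M2[rule_format, of n] by (simp add: nn_def M_def)
 have "nn (w 0) \<ge> 0" by (simp add: nn_def)
 then have M0: "M \<ge> 0" using M[of 0] by linarith
 have D0: "AE x in circle. D (\<lambda>x. 0) x = 0"
  using wder_pow_lincomb(1)[OF Su Su order_refl, of 0 0] by (simp add: D_def)
 have S0: "Sob m (\<lambda>x. 0 :: real ^ 'd)" by (rule wc_const) simp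
 have lim: "(\<lambda>n. ip S (w n) + ip (D S) (D (w n))) \<longlonglongrightarrow> 0" if S: "Sob m S" for S
 proof -
  have "(\<lambda>n. ip S (w n)) \<longlonglongrightarrow> ip S (\<lambda>x. 0)" by (rule wl2D(6)[OF w2 fs[OF S]])
  moreover have "(\<lambda>n. ip (D S) (D (w n))) \<longlonglongrightarrow> ip (D S) (D (\<lambda>x. 0))" by (rule wl2D(6)[OF wD Ds[OF S]])
  moreover have "ip (D S) (D (\<lambda>x. 0)) = ip (D S) (\<lambda>x. 0)"
   by (rule ip_cong_AE[OF D0 Ds[OF S0] _ Ds[OF S]]) simp
  ultimately show ?thesis by (auto simp: ip_def intro: tendsto_add_zero)
 qed
 have "(\<lambda>n. l (w n)) \<longlonglongrightarrow> 0"
 proof (rule ccontr)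
  assume "\<not> (\<lambda>n. l (w n)) \<longlonglongrightarrow> 0"
  then obtain e where e: "e > 0" "\<And>N. \<exists>n\<ge>N. e \<le> \<bar>l (w n)\<bar>"
   unfolding LIMSEQ_iff by (auto simp: not_less)
  \<comment> \<open>Adding members of the sequence that are almost orthogonal to the sum so far lets the squared norm grow
   linearly, while the functional grows linearly as well.\<close>
  have S: "\<exists>S. Sob m S \<and> nn S \<le> real N * (M + 2) \<and> real N * e \<le> l S" for N
  proof (induction N)
   case 0
   have "nn (\<lambda>x. 0) = 0"
    using nsq_cong_AE[OF D0 Ds[OF S0] sqint_const] by (simp add: nn_def nsq_def)
   moreover have "l (\<lambda>x. 0) = 0" using lsc[OF S0, of 0] by simp
   ultimately show ?case using S0 by (intro exI[of _ "\<lambda>x. 0"]) auto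
  next
   case (Suc N)
   then obtain S where S: "Sob m S" "nn S \<le> real N * (M + 2)" "real N * e \<le> l S" by blast
   obtain n0 where n0: "\<And>n. n \<ge> n0 ==> \<bar>ip S (w n) + ip (D S) (D (w n))\<bar> < 1"
    using LIMSEQ_D[OF lim[OF S(1)], of 1] by auto
   obtain n where n: "n \<ge> n0" "e \<le> \<bar>l (w n)\<bar>" using e(2) by blast
   define s where "s = (if l (w n) \<ge> 0 then 1 else - 1 :: real)"
   have s: "s * l (w n) = \<bar>l (w n)\<bar>" "s\<^sup>2 = 1" "\<bar>s\<bar> = 1" by (auto simp: s_def)
   have "s * (ip S (w n) + ip (D S) (D (w n))) \<le> 1"
    using n0[OF n(1)] by (simp add: s_def abs_less_iff)
   \<comment> \<open>The cross term contributes at most 2 and \<open>nn (w n)\<close> at most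
     \<open>M\<close>, which is where \<open>M + 2\<close> comes from.\<close>
   then have "nn (\<lambda>x. S x + s *\<^sub>R w n x) \<le> real (Suc N) * (M + 2)"
    using S(2) M[of n] unfolding nn_add[OF S(1) Sw] by (simp add: s(2) algebra_simps)
   moreover have "l (\<lambda>x. S x + s *\<^sub>R w n x) = l S + s * l (w n)"
    using ladd[OF S(1) wc_cmult[OF tendsto_const Sw]] lsc[OF Sw] by simp
   moreover have "Sob m (\<lambda>x. S x + s *\<^sub>R w n x)" using Sob_lincomb[OF S(1) Sw, of 1 s n] by simp
   ultimately show ?case
    using S(3) n(2) s(1) by (intro exI[of _ "\<lambda>x. S x + s *\<^sub>R w n x"]) (auto simp: algebra_simps)
  qed
  \<comment> \<open>Comparison of growth: the functional is at least \<open>N * e\<close> on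
    \<open>S\<close>, whereas its bound only grows like the square root of \<open>N\<close>.\<close>
  have bd: "real N * e\<^sup>2 \<le> C\<^sup>2 * (M + 2)" if "N > 0" for N
  proof -
   obtain S where S: "Sob m S" "nn S \<le> real N * (M + 2)" "real N * e \<le> l S" using S by blast
   have "real N * e \<le> \<bar>C\<bar> * sqrt (nn S)"
   proof -
    have "l S \<le> C * sqrt (nn S)" using lC[OF S(1)] unfolding sobolev_norm_eq[OF S(1)] by (simp add: nn_def D_def)
    also have "\<dots> \<le> \<bar>C\<bar> * sqrt (nn S)" by (intro mult_right_mono) (auto simp: nn_def)
    finally show ?thesis using S(3) by linarith
   qed
   then have "(real N * e)\<^sup>2 \<le> (\<bar>C\<bar> * sqrt (nn S))\<^sup>2" using e(1) by (intro power_mono) auto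
   also have "\<dots> = C\<^sup>2 * nn S" by (simp add: power_mult_distrib nn_def)
   also have "\<dots> \<le> C\<^sup>2 * (real N * (M + 2))" by (intro mult_left_mono S(2)) auto
   finally have "real N * (real N * e\<^sup>2) \<le> real N * (C\<^sup>2 * (M + 2))" by (simp add: power2_eq_square algebra_simps)
   then show ?thesis using that by simp
  qed
  obtain N where "real N > C\<^sup>2 * (M + 2) / e\<^sup>2" using reals_Archimedean2 by blast
  then have "C\<^sup>2 * (M + 2) < real N * e\<^sup>2" using e(1) by (simp add: pos_divide_less_eq)
  with bd[of "Suc N"] have "real (Suc N) * e\<^sup>2 < real N * e\<^sup>2" by linarith
  then show False using e(1) by (simp add: algebra_simps)
 qed
 then show ?thesis unfolding lw by (rule LIM_zero_cancel)
qed

section \<open>The metric along linear paths\<close>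

lemma sobolev_Sob: "2 \<le> m ==> u \<in> sobolev m \<longleftrightarrow> Sob m u"
 by (rule sobolev_iff) simp

lemma Imm_iff: "2 \<le> m ==> c \<in> Imm m \<longleftrightarrow> Sob m c \<and> (\<forall>th. wder c th \<noteq> 0)"
 by (auto simp: Imm_def sobolev_Sob)

lemma wc_linear_path:
 assumes "wc m A a" "wc m B b" "T \<longlonglongrightarrow> t"
 shows "wc m (\<lambda>n. linear_path (A n) (B n) (T n)) (linear_path a b t)"
 unfolding linear_path_def
 by (intro wc_add wc_cmult assms tendsto_intros)

lemma Sob_linear_path: "Sob m a ==> Sob m b ==> Sob m (linear_path a b t)"
 using wc_linear_path[of m "\<lambda>_. a" a "\<lambda>_. b" b "\<lambda>_. t" t] by simp

lemma two_le_SucE: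
 assumes "2 \<le> m"
 obtains k where "m = Suc (Suc k)"
 using assms by (metis One_nat_def Suc_1 Suc_diff_le diff_Suc_Suc le_add_diff_inverse plus_1_eq_Suc add_Suc)

lemma wder_linear_path:
 assumes "2 \<le> m" "Sob m a" "Sob m b"
 shows "wder (linear_path a b t) = linear_path (wder a) (wder b) t"
proof -
 obtain k where k: "m = Suc (Suc k)" using two_le_SucE[OF assms(1)] .
 show ?thesis
  using wder_lincomb(2)[of "Suc k" a b "1 - t" t] assms(2,3) k unfolding linear_path_def by simp
qed

lemma wder_diff:
 assumes "2 \<le> m" "Sob m a" "Sob m b"
 shows "wder (\<lambda>th. b th - a th) = (\<lambda>th. wder b th - wder a th)"
proof -
 obtain k where k: "m = Suc (Suc k)" using two_le_SucE[OF assms(1)] .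
 show ?thesis
  using wder_lincomb(2)[of "Suc k" b a 1 "- 1"] assms(2,3) k by simp
qed

lemma wc_wder':
 assumes "2 \<le> m" "wc m C c"
 shows "wc (m - 1) (\<lambda>n. wder (C n)) (wder c)" "pc (\<lambda>n. wder (C n)) (wder c)"
proof -
 obtain k where k: "m = Suc (Suc k)" using two_le_SucE[OF assms(1)] .
 show 1: "wc (m - 1) (\<lambda>n. wder (C n)) (wder c)" using wc_wder(1)[of "Suc k"] assms(2) k by simp
 show "pc (\<lambda>n. wder (C n)) (wder c)" by (rule wc_pc[OF 1]) (use k in simp)
qed

lemma wder_regular:
 assumes "2 \<le> m" "Sob m c"
 shows "continuous_on UNIV (wder c)" "periodic (wder c)" "wder c \<in> sqint" "cder c (wder c)" "wder c \<in> borel_measurable borel"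
proof -
 obtain k where k: "m = Suc (Suc k)" using two_le_SucE[OF assms(1)] .
 have s: "Sob (Suc k) (wder c)" using Sob_wder[of "Suc k" c] assms(2) k by simp
 show "continuous_on UNIV (wder c)" by (rule wc_continuous(1)[OF s]) simp
 show "periodic (wder c)" "wder c \<in> sqint" using wc_regular[OF s] by auto
 then show "wder c \<in> borel_measurable borel" by (simp add: sqintD)
 show "cder c (wder c)" using assms(2) k Sob_cder by simp
qed

lemma Imm_lower_bound:
 assumes "2 \<le> m" "c \<in> Imm m"
 obtains d where "d > 0" "\<And>th. norm (wder c th) \<ge> d"
proof -
 have S: "Sob m c" "\<And>th. wder c th \<noteq> 0" using assms by (auto simp: Imm_iff)
 note r = wder_regular[OF assms(1) S(1)]
 have "\<exists>x\<in>{0..2*pi}. \<forall>y\<in>{0..2*pi}. norm (wder c x) \<le> norm (wder c y)"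
  by (intro continuous_attains_inf continuous_on_norm continuous_on_subset[OF r(1)]) auto
 then obtain x where x: "\<forall>y\<in>{0..2*pi}. norm (wder c x) \<le> norm (wder c y)" by blast
 have "norm (wder c x) \<le> norm (wder c th)" for th
  using periodic_all[OF r(2), of "\<lambda>z. norm (wder c x) \<le> norm z"] x by auto
 then show ?thesis using that[of "norm (wder c x)"] S(2) by auto
qed

definition xi :: "('d::finite) curve => 'd curve => nat => 'd curve" where
 "xi c h i = (arc_deriv c ^^ i) h"

lemma xi_0: "xi c h 0 = h" and xi_Suc: "xi c h (Suc i) = arc_deriv c (xi c h i)"
 by (auto simp: xi_def)

lemma wder_xi: "wder c th \<noteq> 0 ==> wder (xi c h i) th = norm (wder c th) *\<^sub>R xi c h (Suc i) th"
 by (simp add: xi_Suc arc_deriv_def)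

text \<open>Each arc length derivative multiplies the derivative of the preceding one by the inverse
  speed. The latter has \<open>m - 1\<close> convergent orders and stays bounded by the lower bound
  \<open>d\<close>, so exactly one order is lost per step.\<close>

lemma wc_xi:
 assumes m: "2 \<le> m" and C: "wc m C c" and H: "wc m H h" and d: "d > 0" "\<And>n th. norm (wder (C n) th) \<ge> d" and i: "i \<le> m"
 shows "wc (m - i) (\<lambda>n. xi (C n) (H n) i) (xi c h i)"
 using i
proof (induction i)
 case 0
 then show ?case using H by (simp add: xi_0)
next
 case (Suc i)
 note w = wc_wder'[OF m C]
 note wn = wc_norm[OF w d] and pn = pc_norm[OF w(2)]
 have "wc (Suc (m - Suc i)) (\<lambda>n. xi (C n) (H n) i) (xi c h i)"
  using Suc by (simp add: Suc_diff_Suc)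
 note x = wc_wder(1)[OF this]
 have "wc (m - Suc i) (\<lambda>n th. inverse (norm (wder (C n) th))) (\<lambda>th. inverse (norm (wder c th)))"
  by (rule wc_le[OF wc_inverse[OF wn pn d]]) simp
 from wc_scaleR[OF pc_inverse[OF pn d] this x] show ?case
  by (simp add: xi_Suc arc_deriv_def[abs_def] inverse_eq_divide)
qed

lemma Sob_xi:
 assumes m: "2 \<le> m" and c: "c \<in> Imm m" and h: "Sob m h" and i: "i \<le> m"
 shows "Sob (m - i) (xi c h i)"
proof -
 obtain d where d: "d > 0" "\<And>th. norm (wder c th) \<ge> d" using Imm_lower_bound[OF m c] by blast
 show ?thesis using c m by (intro wc_xi[OF m _ h d i]) (auto simp: Imm_iff)
qed

definition gm :: "nat => ('d::finite) curve => 'd curve => real" where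
 "gm m c h = (LINT th|circle. (\<Sum>j=0..m. (norm (xi c h j th))\<^sup>2) * norm (wder c th))"

lemma sobolev_metric_gm: "sobolev_metric m c h h = gm m c h"
 by (simp add: sobolev_metric_def gm_def xi_def power2_norm_eq_inner)

lemma xi_term_integrable:
 assumes m: "2 \<le> m" and c: "c \<in> Imm m" and h: "Sob m h" and i: "i \<le> m"
 shows "integrable circle (\<lambda>th. (norm (xi c h i th))\<^sup>2 * norm (wder c th))"
  "xi c h i \<in> sqint" "(\<lambda>th. sqrt (norm (wder c th)) *\<^sub>R xi c h i th) \<in> sqint"
  "nsq (\<lambda>th. sqrt (norm (wder c th)) *\<^sub>R xi c h i th) = (LINT th|circle. (norm (xi c h i th))\<^sup>2 * norm (wder c th))"
proof -
 have Sc: "Sob m c" using c m by (simp add: Imm_iff)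
 note r = wder_regular[OF m Sc]
 obtain C where C: "\<And>th. norm (wder c th) \<le> C" using periodic_bounded[OF r(2,1)] by blast
 show x: "xi c h i \<in> sqint" by (rule wc_regular(1)[OF Sob_xi[OF assms]])
 note [measurable] = r(5) sqintD(1)[OF x]
 show s: "(\<lambda>th. sqrt (norm (wder c th)) *\<^sub>R xi c h i th) \<in> sqint"
  by (rule sqint_bound[OF _ x, of _ "sqrt C"]) (use C in \<open>auto intro!: mult_right_mono\<close>)
 have eq: "(norm (sqrt (norm (wder c th)) *\<^sub>R xi c h i th))\<^sup>2 = (norm (xi c h i th))\<^sup>2 * norm (wder c th)" for th
  by (simp add: power_mult_distrib)
 show "integrable circle (\<lambda>th. (norm (xi c h i th))\<^sup>2 * norm (wder c th))"
  using sqintD(2)[OF s] by (simp only: eq)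
 show "nsq (\<lambda>th. sqrt (norm (wder c th)) *\<^sub>R xi c h i th) = (LINT th|circle. (norm (xi c h i th))\<^sup>2 * norm (wder c th))"
  by (simp only: nsq_def eq)
qed

lemma gm_eq_sum:
 assumes m: "2 \<le> m" and c: "c \<in> Imm m" and h: "Sob m h"
 shows "gm m c h = (\<Sum>j=0..m. LINT th|circle. (norm (xi c h j th))\<^sup>2 * norm (wder c th))"
 unfolding gm_def sum_distrib_right
 by (intro Bochner_Integration.integral_sum xi_term_integrable[OF m c h]) auto

lemma gm_ge_term:
 assumes m: "2 \<le> m" and c: "c \<in> Imm m" and h: "Sob m h" and i: "i \<le> m"
 shows "(LINT th|circle. (norm (xi c h i th))\<^sup>2 * norm (wder c th)) \<le> gm m c h"
 unfolding gm_eq_sum[OF m c h] using i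
 by (intro member_le_sum) (auto intro!: integral_nonneg_AE)

lemma gm_nonneg: "gm m c h \<ge> 0"
 unfolding gm_def by (intro integral_nonneg_AE AE_I2) (auto intro!: mult_nonneg_nonneg sum_nonneg)

text \<open>The metric as a sum of weighted square integrals, the form to which
  \<open>weighted_nsq_lsc\<close> applies, with the speed as the weight.\<close>

lemma ennreal_gm:
 assumes m: "2 \<le> m" and c: "c \<in> Imm m" and h: "Sob m h"
 shows "ennreal (gm m c h) = (\<Sum>j=0..m. \<integral>\<^sup>+th. ennreal (norm (wder c th)) * ennreal ((norm (xi c h j th))\<^sup>2) \<partial>circle)"
proof -
 have "ennreal (gm m c h) = (\<Sum>j=0..m. ennreal (LINT th|circle. (norm (xi c h j th))\<^sup>2 * norm (wder c th)))"
  unfolding gm_eq_sum[OF assms] by (intro sum_ennreal[symmetric] integral_nonneg_AE) auto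
 also have "\<dots> = (\<Sum>j=0..m. \<integral>\<^sup>+th. ennreal ((norm (xi c h j th))\<^sup>2 * norm (wder c th)) \<partial>circle)"
  by (intro sum.cong refl nn_integral_eq_integral[symmetric] xi_term_integrable[OF assms]) auto
 also have "\<dots> = (\<Sum>j=0..m. \<integral>\<^sup>+th. ennreal (norm (wder c th)) * ennreal ((norm (xi c h j th))\<^sup>2) \<partial>circle)"
  by (intro sum.cong refl nn_integral_cong) (simp add: ennreal_mult mult.commute)
 finally show ?thesis .
qed

lemma cder_variation:
 fixes u v :: "real => 'a::euclidean_space"
 assumes u: "cder u v" and v: "v \<in> sqint"
 shows "norm (u x - u y) \<le> (LINT th|circle. norm (v th))"
proof -
 note ai = circle_integral[OF sqintD(1)[OF v] integrable_sqint[OF v]]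
 have n: "(LINT th|circle. norm (v th)) = integral {0..2*pi} (\<lambda>th. norm (v th))"
  using sqintD(1)[OF v] integrable_sqint[OF v] by (intro circle_integral(2)) auto
 have *: "norm (u t - u s) \<le> (LINT th|circle. norm (v th))" if "0 \<le> s" "s \<le> t" "t \<le> 2*pi" for s t
 proof -
  have "norm (u t - u s) \<le> integral {s..t} (\<lambda>th. norm (v th))" by (rule ac_norm_diff_le[OF cderD(2)[OF u] that])
  also have "\<dots> \<le> integral {0..2*pi} (\<lambda>th. norm (v th))"
   using that by (intro integral_subset_le absint_sub(3)[OF ai(1)]) auto
  finally show ?thesis by (simp add: n)
 qed
 have **: "norm (u t - u s) \<le> (LINT th|circle. norm (v th))" if "s \<in> {0..<2*pi}" "t \<in> {0..<2*pi}" for s t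
  using *[of s t] *[of t s] that by (cases "s \<le> t") (auto simp: norm_minus_commute)
 obtain j k where j: "x + 2 * pi * of_int j \<in> {0..<2*pi}" and k: "y + 2 * pi * of_int k \<in> {0..<2*pi}"
  using periodic_reduce by metis
 from **[OF k j] show ?thesis by (simp add: periodic_shift_int[OF cderD(1)[OF u]])
qed

lemma cder_integral_zero:
 fixes u v :: "real => 'a::euclidean_space"
 assumes u: "cder u v" and v: "v \<in> sqint"
 shows "(LINT th|circle. v th) = 0"
proof -
 have "(LINT th|circle. v th) = u (2*pi) - u 0"
  unfolding circle_integral(2)[OF sqintD(1)[OF v] integrable_sqint[OF v]]
  by (rule ac_integral[OF cderD(2)[OF u]]) auto
 then show ?thesis using cderD(1)[OF u, unfolded periodic_def, rule_format, of 0] by simp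
qed

text \<open>The Sobolev embedding with explicit constants: the value at \<open>x\<close> exceeds any
  other value by at most the total variation; averaging over the circle and Cauchy-Schwarz give the
  two terms.\<close>

lemma cder_sup_le:
 fixes u v :: "real => 'a::euclidean_space"
 assumes u: "cder u v" and v: "v \<in> sqint"
 shows "norm (u x) \<le> sqrt (nsq u) / sqrt (2*pi) + sqrt (2*pi) * sqrt (nsq v)"
proof -
 have us: "u \<in> sqint" by (rule cder_sqint[OF u])
 define V where "V = (LINT th|circle. norm (v th))"
 have "norm (u x) \<le> norm (u th) + V" for th
  using cder_variation[OF u v, of x th] norm_triangle_ineq2[of "u x" "u th"] by (simp add: V_def)
 then have "(LINT th|circle. norm (u x)) \<le> (LINT th|circle. norm (u th) + V)"
  using integrable_sqint[OF us] by (intro integral_mono) auto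
 then have "2 * pi * norm (u x) \<le> (LINT th|circle. norm (u th)) + 2 * pi * V"
  using integrable_sqint[OF us] by (simp add: measure_circle)
 also have "\<dots> \<le> sqrt (2*pi) * sqrt (nsq u) + 2 * pi * (sqrt (2*pi) * sqrt (nsq v))"
  unfolding V_def by (intro add_mono mult_left_mono integral_norm_le_nsq us v) auto
 finally have "norm (u x) \<le> (sqrt (2*pi) * sqrt (nsq u) + 2 * pi * (sqrt (2*pi) * sqrt (nsq v))) / (2*pi)"
  by (simp add: field_simps)
 also have "\<dots> = sqrt (2*pi) / (2*pi) * sqrt (nsq u) + sqrt (2*pi) * sqrt (nsq v)"
  by (simp add: add_divide_distrib)
 also have "sqrt (2*pi) / (2*pi) = 1 / sqrt (2*pi)" by (simp add: real_div_sqrt field_simps)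
 finally show ?thesis by simp
qed

text \<open>The first arc length derivative has mean zero, so it is controlled by the second one.\<close>

lemma xi_1_le:
 assumes m: "2 \<le> m" and c: "c \<in> Imm m" and h: "Sob m h"
 defines "l \<equiv> (LINT th|circle. norm (wder c th))"
 shows "norm (xi c h 1 th) \<le> sqrt l * sqrt (gm m c h)"
  "(LINT th|circle. norm (wder h th)) \<le> sqrt l * sqrt (gm m c h)"
  "l \<ge> 0"
proof -
 have Sc: "Sob m c" and nz: "\<And>th. wder c th \<noteq> 0" using c m by (auto simp: Imm_iff)
 note r = wder_regular[OF m Sc]
 note [measurable] = r(5)
 obtain C where C: "\<And>th. norm (wder c th) \<le> C" using periodic_bounded[OF r(2,1)] by blast
 obtain d where d: "d > 0" "\<And>th. norm (wder c th) \<ge> d" using Imm_lower_bound[OF m c] by blast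
 define g where "g = gm m c h"
 show "l \<ge> 0" by (simp add: l_def)
 have sr: "(\<lambda>th. sqrt (norm (wder c th))) \<in> sqint"
  by (rule sqint_bounded[where C = "sqrt C"]) (use C in auto)
 have nsr: "nsq (\<lambda>th. sqrt (norm (wder c th))) = l" by (simp add: nsq_def l_def)
 have CS: "(LINT th|circle. norm (wder c th) * norm (xi c h i th)) \<le> sqrt l * sqrt g" if i: "i \<le> m" for i
 proof -
  have "(LINT th|circle. norm (wder c th) * norm (xi c h i th)) =
   (LINT th|circle. norm (sqrt (norm (wder c th))) * norm (sqrt (norm (wder c th)) *\<^sub>R xi c h i th))"
   by (intro Bochner_Integration.integral_cong) (auto simp: mult.assoc[symmetric])
  also have "\<dots> \<le> sqrt l * sqrt (nsq (\<lambda>th. sqrt (norm (wder c th)) *\<^sub>R xi c h i th))"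
   using integral_norm_mult_le[OF sr xi_term_integrable(3)[OF m c h i]] by (simp add: nsr)
  also have "\<dots> \<le> sqrt l * sqrt g"
   unfolding xi_term_integrable(4)[OF m c h i] g_def
   by (intro mult_left_mono real_sqrt_le_mono gm_ge_term[OF m c h i]) (simp add: \<open>l \<ge> 0\<close>)
  finally show ?thesis .
 qed
 have wh: "wder h th = norm (wder c th) *\<^sub>R xi c h 1 th" for th
  using wder_xi[OF nz, of h 0 th] by (simp add: xi_0)
 show "(LINT th|circle. norm (wder h th)) \<le> sqrt l * sqrt (gm m c h)"
  using CS[of 1] m by (simp add: wh g_def)
 have "Sob (Suc (m - 2)) (xi c h 1)"
  using Sob_xi[OF m c h, of 1] m by (simp add: Suc_diff_Suc numeral_2_eq_2)
 note x1 = Sob_cder[OF this] and w1 = wc_regular(1)[OF Sob_wder[OF this]]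
 have "norm (wder (xi c h 1) th) = norm (wder c th) * norm (xi c h 2 th)" for th
  using wder_xi[OF nz, of h 1 th] by (simp add: numeral_2_eq_2)
 then have V: "norm (xi c h 1 x - xi c h 1 y) \<le> sqrt l * sqrt g" for x y
  using cder_variation[OF x1 w1, of x y] CS[of 2] m by simp
 have lpos: "l > 0"
 proof -
  have "(LINT th|circle. d) \<le> l" unfolding l_def using d r(3) by (intro integral_mono) (auto intro: integrable_sqint)
  then show ?thesis using d(1) by (simp add: measure_circle) (meson less_le_trans mult_pos_pos pi_gt_zero zero_less_numeral)
 qed
 have z: "(LINT \<eta>|circle. norm (wder c \<eta>) *\<^sub>R xi c h 1 \<eta>) = 0"
  using cder_integral_zero[OF wder_regular(4,3)[OF m h]] by (simp add: wh)
 have x1s: "xi c h 1 \<in> sqint" using m by (intro xi_term_integrable(2)[OF m c h]) simp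
 have i1: "integrable circle (\<lambda>\<eta>. norm (wder c \<eta>) *\<^sub>R xi c h 1 \<eta>)"
  using integrable_mult_sqint[OF x1s, of "\<lambda>\<eta>. norm (wder c \<eta>)" C] C by auto
 have i2: "integrable circle (\<lambda>\<eta>. norm (wder c \<eta>) *\<^sub>R xi c h 1 th)"
  using integrable_sqint[OF r(3)] by auto
 have "l *\<^sub>R xi c h 1 th = (LINT \<eta>|circle. norm (wder c \<eta>) *\<^sub>R xi c h 1 th) - (LINT \<eta>|circle. norm (wder c \<eta>) *\<^sub>R xi c h 1 \<eta>)"
  using z integrable_sqint[OF r(3)] by (simp add: l_def)
 also have "\<dots> = (LINT \<eta>|circle. norm (wder c \<eta>) *\<^sub>R (xi c h 1 th - xi c h 1 \<eta>))"
  using i1 i2 by (simp add: scaleR_diff_right)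
 also have "norm \<dots> \<le> (LINT \<eta>|circle. norm (wder c \<eta>) * (sqrt l * sqrt g))"
 proof (rule order_trans[OF integral_norm_bound integral_mono])
  show "integrable circle (\<lambda>\<eta>. norm (norm (wder c \<eta>) *\<^sub>R (xi c h 1 th - xi c h 1 \<eta>)))"
   using Bochner_Integration.integrable_diff[OF i2 i1] by (auto simp: scaleR_diff_right)
  show "integrable circle (\<lambda>\<eta>. norm (wder c \<eta>) * (sqrt l * sqrt g))"
   using integrable_sqint[OF r(3)] by auto
 qed (auto intro!: mult_left_mono V[unfolded One_nat_def])
 also have "\<dots> = l * (sqrt l * sqrt g)" by (simp add: l_def)
 finally have "l * norm (xi c h 1 th) \<le> l * (sqrt l * sqrt g)" using lpos by simp
 then show "norm (xi c h 1 th) \<le> sqrt l * sqrt (gm m c h)" using lpos by (simp add: g_def)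
qed

text \<open>The difference quotients of a linear path all equal its increment, so the limit
  condition reduces to a vanishing Sobolev norm, which determines a continuous function.\<close>

lemma time_deriv_linear_path:
 assumes m: "2 \<le> m" and a: "Sob m a" and b: "Sob m b" and t: "t \<in> {0..1}"
 shows "time_deriv m (linear_path a b) t = (\<lambda>th. b th - a th)"
proof -
 define h where "h = (\<lambda>th. b th - a th)"
 have h: "Sob m h" unfolding h_def by (rule Sob_diff[OF b a])
 have q: "(\<lambda>th. (1 / (s - t)) *\<^sub>R (linear_path a b s th - linear_path a b t th) - u th) = (\<lambda>th. h th - u th)"
  if "s \<noteq> t" for s u
 proof -
  have "linear_path a b s th - linear_path a b t th = (s - t) *\<^sub>R h th" for th
   by (simp add: linear_path_def h_def algebra_simps)
  then show ?thesis using that by simp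
 qed
 have lim: "((\<lambda>s. sobolev_norm m (\<lambda>th. (1 / (s - t)) *\<^sub>R (linear_path a b s th - linear_path a b t th) - u th)) \<longlongrightarrow> 0) (at t within {0..1})
  \<longleftrightarrow> sobolev_norm m (\<lambda>th. h th - u th) = 0" for u
 proof -
  have "(\<forall>\<^sub>F s in at t within {0..1}. sobolev_norm m (\<lambda>th. (1 / (s - t)) *\<^sub>R (linear_path a b s th - linear_path a b t th) - u th) = sobolev_norm m (\<lambda>th. h th - u th))"
   unfolding eventually_at_filter by (intro always_eventually) (simp add: q)
  then have "((\<lambda>s. sobolev_norm m (\<lambda>th. (1 / (s - t)) *\<^sub>R (linear_path a b s th - linear_path a b t th) - u th)) \<longlongrightarrow> 0) (at t within {0..1})
   \<longleftrightarrow> ((\<lambda>s. sobolev_norm m (\<lambda>th. h th - u th)) \<longlongrightarrow> 0) (at t within {0..1})"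
   by (rule tendsto_cong)
  moreover have "at t within {0..1} \<noteq> bot"
   using t by (simp add: at_within_Icc_at trivial_limit_within islimpt_Icc)
  ultimately show ?thesis by (simp add: tendsto_const_iff)
 qed
 have D0: "sobolev_norm m (\<lambda>th. h th - h th) = 0"
 proof -
  have "AE th in circle. (wder ^^ m) (\<lambda>th. h th - h th) th = 0"
   using wder_pow_lincomb(1)[OF h h order_refl, of 0 0] by simp
  then have "nsq ((wder ^^ m) (\<lambda>th. h th - h th)) = nsq (\<lambda>th. 0 :: real ^ 'a)"
   using wc_regular(1)[OF Sob_wder_pow[OF Sob_diff[OF h h] order_refl]] by (intro nsq_cong_AE) auto
  then show ?thesis unfolding sobolev_norm_eq[OF Sob_diff[OF h h]] by (simp add: nsq_def)
 qed
 show ?thesis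
  unfolding time_deriv_def h_def[symmetric] lim
 proof (rule the_equality)
  show "h \<in> sobolev m \<and> sobolev_norm m (\<lambda>th. h th - h th) = 0"
   using h D0 by (simp add: sobolev_Sob[OF m])
  fix u assume u: "u \<in> sobolev m \<and> sobolev_norm m (\<lambda>th. h th - u th) = 0"
  then have S: "Sob m u" by (simp add: sobolev_Sob[OF m])
  have s: "(\<lambda>th. h th - u th) \<in> sqint" by (rule wc_regular(1)[OF Sob_diff[OF h S]])
  have "nsq (\<lambda>th. h th - u th) = 0"
   using u unfolding sobolev_norm_eq[OF Sob_diff[OF h S]]
   by (simp add: add_nonneg_eq_0_iff)
  then have "AE th in circle. (norm (h th - u th))\<^sup>2 = 0"
   unfolding nsq_def by (subst (asm) integral_nonneg_eq_0_iff_AE[OF sqintD(2)[OF s]]) auto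
  then have "AE th in circle. u th = h th" by eventually_elim auto
  then show "u = h"
   using m wc_continuous(1)[OF S] wc_continuous(1)[OF h] wc_regular(4)[OF S] wc_regular(4)[OF h]
   by (intro AE_circle_continuous_eq) auto
 qed
qed

lemma path_energy_linear:
 assumes m: "2 \<le> m" and a: "Sob m a" and b: "Sob m b"
 shows "path_energy m (linear_path a b) = (if \<forall>t\<in>{0..1}. linear_path a b t \<in> Imm m
  then \<integral>\<^sup>+t. ennreal (gm m (linear_path a b t) (\<lambda>th. b th - a th)) * indicator {0..1} t \<partial>lborel else \<infinity>)"
proof -
 have "ennreal (sobolev_metric m (linear_path a b t) (time_deriv m (linear_path a b) t) (time_deriv m (linear_path a b) t)) * indicator {0..1} t
  = ennreal (gm m (linear_path a b t) (\<lambda>th. b th - a th)) * indicator {0..1} t" for t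
  by (cases "t \<in> {0..1}") (auto simp: time_deriv_linear_path[OF m a b] sobolev_metric_gm)
 then show ?thesis unfolding path_energy_def by simp
qed

text \<open>The estimates use the initial curve and the energy only. A good time exists because a
  nonnegative function cannot exceed its mean everywhere. At such a time the integral
  \<open>x\<close> of |h'| satisfies \<open>x^2 \<le> (la + x) * e\<close>, whence
  \<open>x \<le> la + e\<close>, and all lengths along the path are at most
  \<open>2 * la + e\<close>, hence at most \<open>\<Lambda>\<close>. With the lengths bounded,
  \<open>xi_1_le\<close> controls the ratio of |h'| to |c'|, and integrating the logarithmic
  derivative of |c'|^2 in time bounds the speed from below.\<close>

lemma lin_estimates:
 assumes m: "2 \<le> m" and a: "Sob m a" and b: "Sob m b" and imm_all: "\<forall>t\<in>{0..1}. linear_path a b t \<in> Imm m"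
  and E: "(\<integral>\<^sup>+t. ennreal (gm m (linear_path a b t) (\<lambda>th. b th - a th)) * indicator {0..1} t \<partial>lborel) \<le> ennreal E" "E \<ge> 0"
  and A: "\<And>th. norm (wder a th) \<le> A"
 defines "g \<equiv> \<lambda>t. gm m (linear_path a b t) (\<lambda>th. b th - a th)"
  and "\<Lambda> \<equiv> 4 * pi * A + (E + 1)"
 shows "\<tau> \<in> {0<..1} ==> \<exists>t\<in>{0..\<tau>}. g t \<le> (E + 1) / \<tau>"
  "t \<in> {0..1} ==> (norm (wder b th - wder a th))\<^sup>2 \<le> \<Lambda> * g t * (norm (wder (linear_path a b t) th))\<^sup>2"
  "t \<in> {0..1} ==> norm (wder (linear_path a b t) th) \<ge> norm (wder a th) * exp (- (1 + \<Lambda> * E) / 2)"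
proof -
 note imm = imm_all[rule_format]
 define h where "h = (\<lambda>th. b th - a th)"
 have h: "Sob m h" unfolding h_def by (rule Sob_diff[OF b a])
 have wh: "wder h = (\<lambda>th. wder b th - wder a th)" unfolding h_def by (rule wder_diff[OF m a b])
 have wc: "wder (linear_path a b t) th = wder a th + t *\<^sub>R wder h th" for t th
  unfolding wder_linear_path[OF m a b] by (simp add: linear_path_def wh algebra_simps)
 have g: "g t = gm m (linear_path a b t) h" for t by (simp add: g_def h_def)
 have g0: "g t \<ge> 0" for t unfolding g by (rule gm_nonneg)
 note ra = wder_regular[OF m a] and rh = wder_regular[OF m h]
 have A0: "A \<ge> 0" using A[of 0] norm_ge_zero[of "wder a 0"] by linarith
 \<comment> \<open>The excess over \<open>E\<close> makes the comparison of the time integrals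
   strict, also for \<open>E = 0\<close>.\<close>
 define e where "e = E + 1"
 have e: "e \<ge> 1" using E(2) by (simp add: e_def)
 show ex: "\<exists>t\<in>{0..\<tau>}. g t \<le> (E + 1) / \<tau>" if \<tau>: "\<tau> \<in> {0<..1}" for \<tau>
 proof (rule ccontr)
  assume "\<not> ?thesis"
  then have gt: "\<And>t. t \<in> {0..\<tau>} ==> e / \<tau> < g t" by (auto simp: not_le e_def)
  have "ennreal e = ennreal (e / \<tau>) * ennreal \<tau>" using \<tau> e by (simp add: ennreal_mult[symmetric])
  also have "\<dots> = (\<integral>\<^sup>+t. ennreal (e / \<tau>) * indicator {0..\<tau>} t \<partial>lborel)"
   using \<tau> by (subst nn_integral_cmult_indicator) auto
  also have "\<dots> \<le> (\<integral>\<^sup>+t. ennreal (g t) * indicator {0..1} t \<partial>lborel)"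
  proof (rule nn_integral_mono)
   fix t
   have "t \<in> {0..\<tau>} ==> ennreal (e / \<tau>) \<le> ennreal (g t)" using gt by (intro ennreal_leI less_imp_le)
   then show "ennreal (e / \<tau>) * indicator {0..\<tau>} t \<le> ennreal (g t) * indicator {0..1} t"
    using \<tau> by (auto simp: indicator_def)
  qed
  also have "\<dots> \<le> ennreal E" using E(1) by (simp add: g_def)
  finally show False using E(2) by (simp add: e_def)
 qed
 define L where "L t = (LINT th|circle. norm (wder (linear_path a b t) th))" for t
 define la where "la = (LINT th|circle. norm (wder a th))"
 define x where "x = (LINT th|circle. norm (wder h th))"
 have la0: "la \<ge> 0" and x0: "x \<ge> 0" by (auto simp: la_def x_def)
 have la: "la \<le> 2 * pi * A"
 proof -
  have "la \<le> (LINT th|circle. A)" unfolding la_def using A ra(3) by (intro integral_mono) (auto intro: integrable_sqint)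
  then show ?thesis by (simp add: measure_circle mult.commute)
 qed
 have Ll: "L t \<le> la + x" if "t \<in> {0..1}" for t
 proof -
  have "L t \<le> (LINT th|circle. norm (wder a th) + norm (wder h th))"
   unfolding L_def
  proof (rule integral_mono)
   show "integrable circle (\<lambda>th. norm (wder (linear_path a b t) th))"
    using integrable_sqint[OF wder_regular(3)[OF m Sob_linear_path[OF a b]]] by simp
   show "integrable circle (\<lambda>th. norm (wder a th) + norm (wder h th))"
    using integrable_sqint[OF ra(3)] integrable_sqint[OF rh(3)] by simp
   fix th
   have "norm (t *\<^sub>R wder h th) \<le> norm (wder h th)" using that by (simp add: mult_left_le_one_le)
   then show "norm (wder (linear_path a b t) th) \<le> norm (wder a th) + norm (wder h th)"
    unfolding wc using norm_triangle_ineq[of "wder a th" "t *\<^sub>R wder h th"] by linarith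
  qed
  also have "\<dots> = la + x"
   using integrable_sqint[OF ra(3)] integrable_sqint[OF rh(3)] by (simp add: la_def x_def)
  finally show ?thesis .
 qed
 have xle: "x \<le> la + e"
 proof (rule ccontr)
  assume "\<not> ?thesis"
  then have gt: "x > la + e" by simp
  obtain t where t: "t \<in> {0..1}" "g t \<le> e" using ex[of 1] by (auto simp: e_def)
  have "x \<le> sqrt (L t) * sqrt (g t)"
   unfolding x_def L_def g by (rule xi_1_le(2)[OF m imm[OF t(1)] h])
  then have "x\<^sup>2 \<le> (sqrt (L t) * sqrt (g t))\<^sup>2" using x0 by (rule power_mono)
  also have "\<dots> = L t * g t" using g0[of t] by (simp add: power_mult_distrib L_def)
  also have "\<dots> \<le> (la + x) * e" using Ll[OF t(1)] t(2) g0[of t] la0 x0 by (intro mult_mono) auto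
  also have "\<dots> < x\<^sup>2"
  proof -
   have "la * e \<le> la * x" using gt la0 by (intro mult_left_mono) auto
   moreover have "(la + e) * x < x * x" using gt la0 e by (intro mult_strict_right_mono) auto
   ultimately show ?thesis by (simp add: power2_eq_square algebra_simps)
  qed
  finally show False by simp
 qed
 have L\<Lambda>: "L t \<le> \<Lambda>" if "t \<in> {0..1}" for t
  using Ll[OF that] xle la unfolding \<Lambda>_def e_def by simp
 have \<Lambda>p: "\<Lambda> > 0" using A0 E(2) by (simp add: \<Lambda>_def add_nonneg_pos)
 then have \<Lambda>0: "\<Lambda> \<ge> 0" by simp
 show C1: "(norm (wder b th - wder a th))\<^sup>2 \<le> \<Lambda> * g t * (norm (wder (linear_path a b t) th))\<^sup>2" if t: "t \<in> {0..1}" for t th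
 proof -
  have nz: "wder (linear_path a b t) th \<noteq> 0" using imm[OF t] m by (simp add: Imm_iff)
  have "norm (xi (linear_path a b t) h 1 th) \<le> sqrt (L t) * sqrt (g t)"
   unfolding L_def g by (rule xi_1_le(1)[OF m imm[OF t] h])
  also have "\<dots> \<le> sqrt \<Lambda> * sqrt (g t)" using L\<Lambda>[OF t] g0 by (intro mult_right_mono) auto
  finally have "(norm (xi (linear_path a b t) h 1 th))\<^sup>2 \<le> (sqrt \<Lambda> * sqrt (g t))\<^sup>2" by (rule power_mono) simp
  then have q: "(norm (xi (linear_path a b t) h 1 th))\<^sup>2 \<le> \<Lambda> * g t" using \<Lambda>0 g0[of t] by (simp add: power_mult_distrib)
  have "wder h th = norm (wder (linear_path a b t) th) *\<^sub>R xi (linear_path a b t) h 1 th"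
   using wder_xi[OF nz, of h 0] by (simp add: xi_0)
  then have "(norm (wder h th))\<^sup>2 = (norm (xi (linear_path a b t) h 1 th))\<^sup>2 * (norm (wder (linear_path a b t) th))\<^sup>2"
   by (simp add: power_mult_distrib mult.commute)
  also have "\<dots> \<le> \<Lambda> * g t * (norm (wder (linear_path a b t) th))\<^sup>2"
   by (rule mult_right_mono[OF q]) simp
  finally show ?thesis by (simp add: wh)
 qed
 show "norm (wder (linear_path a b t) th) \<ge> norm (wder a th) * exp (- (1 + \<Lambda> * E) / 2)" if t: "t \<in> {0..1}" for t th
 proof -
  define p q where "p = wder a th" and "q = wder h th"
  have nz: "p + s *\<^sub>R q \<noteq> 0" if "s \<in> {0..1}" for s
   using imm[OF that] m wc[of s th] by (simp add: Imm_iff p_def q_def) metis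
  define y where "y s = (norm (p + s *\<^sub>R q))\<^sup>2" for s
  have y_in: "y s = (p + s *\<^sub>R q) \<bullet> (p + s *\<^sub>R q)" for s by (simp add: y_def power2_norm_eq_inner)
  have ypos: "y s > 0" if "s \<in> {0..1}" for s using nz[OF that] by (simp add: y_def)
  \<comment> \<open>The squared ratio of |h'| to |c'|. The logarithmic derivative of |c'|^2 is at
    least \<open>- (1 + k)\<close>, because twice the ratio is at most one plus its square, and the
    second estimate bounds the time integral of \<open>k\<close> by
    \<open>\<Lambda> * E\<close>.\<close>
  define k where "k s = (norm q)\<^sup>2 / y s" for s
  have kc: "continuous_on {0..1} k"
   unfolding k_def[abs_def] y_def using nz by (intro continuous_intros) (auto simp: y_def)
  have kE: "integral {0..1} k \<le> \<Lambda> * E"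
  proof -
   have si: "set_integrable lborel {0..1} k" by (rule borel_integrable_atLeastAtMost'[OF kc])
   have k0: "k s \<ge> 0" for s by (simp add: k_def y_def)
   have "ennreal (integral {0..1} k) = ennreal (LINT s|lborel. indicator {0..1} s *\<^sub>R k s)"
    using set_borel_integral_eq_integral(2)[OF si] by (simp add: set_lebesgue_integral_def)
   also have "\<dots> = (\<integral>\<^sup>+s. ennreal (indicator {0..1} s *\<^sub>R k s) \<partial>lborel)"
    using si by (intro nn_integral_eq_integral[symmetric]) (auto simp: set_integrable_def k0)
   also have "\<dots> = (\<integral>\<^sup>+s. ennreal \<Lambda> * ennreal (indicator {0..1} s *\<^sub>R k s / \<Lambda>) \<partial>lborel)"
    using \<Lambda>p k0 by (intro nn_integral_cong) (simp add: ennreal_mult[symmetric])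
   also have "\<dots> = ennreal \<Lambda> * (\<integral>\<^sup>+s. ennreal (indicator {0..1} s *\<^sub>R k s / \<Lambda>) \<partial>lborel)"
   proof (rule nn_integral_cmult)
    have [measurable]: "(\<lambda>s. indicator {0..1} s *\<^sub>R k s) \<in> borel_measurable lborel"
     using si by (auto simp: set_integrable_def)
    show "(\<lambda>s. ennreal (indicator {0..1} s *\<^sub>R k s / \<Lambda>)) \<in> borel_measurable lborel" by measurable
   qed
   also have "\<dots> \<le> ennreal \<Lambda> * (\<integral>\<^sup>+s. ennreal (g s) * indicator {0..1} s \<partial>lborel)"
   proof (intro mult_left_mono nn_integral_mono)
    fix s :: real
    show "ennreal (indicator {0..1} s *\<^sub>R k s / \<Lambda>) \<le> ennreal (g s) * indicator {0..1} s"
    proof (cases "s \<in> {0..1}")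
     case True
     have "k s \<le> \<Lambda> * g s"
      using C1[OF True, of th] ypos[OF True] unfolding wc k_def by (simp add: field_simps y_def p_def q_def wh)
     then show ?thesis using True \<Lambda>p by (simp add: ennreal_leI field_simps)
    qed simp
   qed simp
   also have "\<dots> \<le> ennreal \<Lambda> * ennreal E" using E(1) by (intro mult_left_mono) (auto simp: g_def)
   also have "\<dots> = ennreal (\<Lambda> * E)" using \<Lambda>0 E(2) by (simp add: ennreal_mult)
   finally show ?thesis using \<Lambda>0 E(2) by simp
  qed
  have der: "((\<lambda>s. ln (y s)) has_real_derivative (2 * ((p + s *\<^sub>R q) \<bullet> q) / y s)) (at s)" if "s \<in> {0..1}" for s
  proof -
   have "(y has_real_derivative 2 * ((p + s *\<^sub>R q) \<bullet> q)) (at s)"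
    unfolding y_in[abs_def] by (auto intro!: derivative_eq_intros simp: has_field_derivative_def inner_commute algebra_simps fun_eq_iff)
   from DERIV_chain2[OF DERIV_ln[OF ypos[OF that]] this] show ?thesis by (simp add: field_simps)
  qed
  have I1: "((\<lambda>s. 2 * ((p + s *\<^sub>R q) \<bullet> q) / y s) has_integral (ln (y t) - ln (y 0))) {0..t}"
  proof (rule fundamental_theorem_of_calculus)
   fix s assume "s \<in> {0..t}"
   then have "s \<in> {0..1}" using t by auto
   from has_field_derivative_at_within[OF der[OF this], of "{0..t}"]
   show "((\<lambda>s. ln (y s)) has_vector_derivative 2 * ((p + s *\<^sub>R q) \<bullet> q) / y s) (at s within {0..t})"
    by (simp add: has_real_derivative_iff_has_vector_derivative)
  qed (use t in simp)
  have I2: "((\<lambda>s. - (1 + k s)) has_integral - integral {0..t} (\<lambda>s. 1 + k s)) {0..t}"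
   using t by (intro has_integral_neg integrable_integral integrable_continuous_interval continuous_intros continuous_on_subset[OF kc]) auto
  have "- integral {0..t} (\<lambda>s. 1 + k s) \<le> ln (y t) - ln (y 0)"
  proof (rule has_integral_le[OF I2 I1])
   fix s assume s: "s \<in> {0..t}"
   then have s1: "s \<in> {0..1}" using t by auto
   have "- (norm (p + s *\<^sub>R q) * norm q) \<le> (p + s *\<^sub>R q) \<bullet> q"
    using Cauchy_Schwarz_ineq2[of "p + s *\<^sub>R q" q] by linarith
   moreover have "2 * norm (p + s *\<^sub>R q) * norm q \<le> y s + (norm q)\<^sup>2" unfolding y_def by (rule sum_squares_bound)
   ultimately have "- (y s + (norm q)\<^sup>2) \<le> 2 * ((p + s *\<^sub>R q) \<bullet> q)" by linarith
   then have "- (y s + (norm q)\<^sup>2) / y s \<le> 2 * ((p + s *\<^sub>R q) \<bullet> q) / y s" using ypos[OF s1] by (intro divide_right_mono) auto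
   moreover have "- (y s + (norm q)\<^sup>2) / y s = - (1 + k s)" using ypos[OF s1] by (simp add: k_def field_simps)
   ultimately show "- (1 + k s) \<le> 2 * ((p + s *\<^sub>R q) \<bullet> q) / y s" by simp
  qed
  moreover have "integral {0..t} (\<lambda>s. 1 + k s) \<le> integral {0..1} (\<lambda>s. 1 + k s)"
   using t by (intro integral_subset_le integrable_continuous_interval continuous_intros continuous_on_subset[OF kc])
    (auto simp: k_def y_def)
  moreover have "integral {0..1} (\<lambda>s. 1 + k s) = 1 + integral {0..1} k"
   by (subst Henstock_Kurzweil_Integration.integral_add) (auto intro!: integrable_continuous_interval kc)
  ultimately have "ln (y t) \<ge> ln (y 0) - (1 + \<Lambda> * E)" using kE by linarith
  then have "y t \<ge> exp (ln (y 0) - (1 + \<Lambda> * E))" using ypos[OF t] by (metis exp_le_cancel_iff exp_ln)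
  also have "exp (ln (y 0) - (1 + \<Lambda> * E)) = y 0 * exp (- (1 + \<Lambda> * E) / 2) ^ 2"
  proof -
   define z where "z = 1 + \<Lambda> * E"
   have "exp (- z / 2) ^ 2 = exp (- z)" by (simp add: exp_double[symmetric])
   moreover have "exp (ln (y 0) - z) = exp (ln (y 0)) * exp (- z)" by (simp add: exp_add[symmetric])
   ultimately show ?thesis using ypos[of 0] by (simp add: z_def)
  qed
  finally have "(norm p * exp (- (1 + \<Lambda> * E) / 2))\<^sup>2 \<le> (norm (p + t *\<^sub>R q))\<^sup>2"
   by (simp add: y_def power_mult_distrib)
  then have "norm p * exp (- (1 + \<Lambda> * E) / 2) \<le> norm (p + t *\<^sub>R q)" by (rule power2_le_imp_le) simp
  then show ?thesis by (simp add: wc p_def q_def)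
 qed
qed

section \<open>Compactness of sequences of bounded energy\<close>

text \<open>Values of a primitive are pairings of its derivative with indicators; in this way weak
  convergence of derivatives becomes pointwise convergence of the functions.\<close>

lemma integral_component_ip:
 fixes f :: "real => 'a::euclidean_space"
 assumes f: "f \<in> sqint" and x: "x \<in> {0..2*pi}"
 shows "b \<bullet> integral {0..x} f = ip (\<lambda>th. indicator {..x} th *\<^sub>R b) f"
proof -
 note [measurable] = sqintD(1)[OF f]
 have s: "(\<lambda>th. indicator {..x} th *\<^sub>R b) \<in> sqint"
  by (rule sqint_bounded[where C = "norm b"]) (auto simp: indicator_def)
 have "ip (\<lambda>th. indicator {..x} th *\<^sub>R b) f = integral {0..2*pi} (\<lambda>th. (indicator {..x} th *\<^sub>R b) \<bullet> f th)"
  unfolding ip_def by (rule circle_integral(2)[OF _ integrable_sqint_inner[OF s f]]) measurable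
 also have "\<dots> = integral {0..2*pi} (\<lambda>th. if th \<in> {0..x} then b \<bullet> f th else 0)"
  by (rule integral_cong) (auto simp: indicator_def)
 also have "\<dots> = integral {0..x} (\<lambda>th. b \<bullet> f th)"
 proof -
  have "{0..x} \<inter> {0..2*pi} = {0..x}" using x by auto
  then show ?thesis by (simp only: integral_restrict_Int)
 qed
 also have "\<dots> = b \<bullet> integral {0..x} f"
  using integral_linear[OF absint_sub(2)[OF circle_integral(1)[OF sqintD(1)[OF f] integrable_sqint[OF f]], of 0 x] bounded_linear_inner_right[of b]] x
  by (simp add: o_def)
 finally show ?thesis by simp
qed

lemma wl2_integral_tendsto:
 fixes v :: "real => 'a::euclidean_space"
 assumes V: "wl2 V v" and x: "x \<in> {0..2*pi}"
 shows "(\<lambda>n. integral {0..x} (V n)) \<longlonglongrightarrow> integral {0..x} v"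
proof (subst tendsto_componentwise_iff, rule ballI)
 fix b :: 'a assume "b \<in> Basis"
 have s: "(\<lambda>th. indicator {..x} th *\<^sub>R b) \<in> sqint"
  by (rule sqint_bounded[where C = "norm b"]) (auto simp: indicator_def)
 show "(\<lambda>n. integral {0..x} (V n) \<bullet> b) \<longlonglongrightarrow> integral {0..x} v \<bullet> b"
  using wl2D(6)[OF V s] integral_component_ip[OF wl2D(1)[OF V] x, of b] integral_component_ip[OF wl2D(3)[OF V] x, of b]
  by (simp add: inner_commute)
qed

lemma nsq_0_AE:
 assumes u: "u \<in> sqint" and z: "nsq u = 0"
 shows "AE th in circle. u th = 0"
proof -
 have "AE th in circle. (norm (u th))\<^sup>2 = 0"
  using z unfolding nsq_def by (subst (asm) integral_nonneg_eq_0_iff_AE[OF sqintD(2)[OF u]]) auto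
 then show ?thesis by eventually_elim auto
qed

lemma wl2_unique_AE:
 assumes u: "wl2 U u" and v: "wl2 U v"
 shows "AE th in circle. u th = v th"
proof -
 note us = wl2D(3)[OF u] and vs = wl2D(3)[OF v]
 have "ip (\<lambda>th. u th - v th) u = ip (\<lambda>th. u th - v th) v"
  by (rule LIMSEQ_unique[OF wl2D(6)[OF u] wl2D(6)[OF v]]) (use us vs in auto)
 then have "nsq (\<lambda>th. u th - v th) = 0" using us vs by (simp add: nsq_ip ip_diff)
 from nsq_0_AE[OF sqint_diff[OF us vs] this] show ?thesis by simp
qed

text \<open>One extraction makes the derivatives converge weakly, a second one makes the constants
  of integration \<open>U n 0\<close> converge. The functions then converge pointwise, as primitives
  of the derivatives.\<close>

lemma bounded_cder_subseq:
 fixes U V :: "nat => real => 'a::euclidean_space"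
 assumes c: "\<And>n. cder (U n) (V n)" and V: "\<And>n. V n \<in> sqint" "\<And>n. periodic (V n)" "\<And>n. nsq (V n) \<le> K"
  and b: "\<And>n th. norm (U n th) \<le> K'"
 obtains r u v where "strict_mono (r :: nat => nat)" "pc (\<lambda>n. U (r n)) u" "cder u v" "wl2 (\<lambda>n. V (r n)) v"
proof -
 obtain r1 v where r1: "strict_mono (r1 :: nat => nat)" "wl2 (\<lambda>n. V (r1 n)) v" by (rule weakly_compact[OF V])
 have "bounded (range (\<lambda>n. U (r1 n) 0))" by (intro boundedI[of _ K']) (use b in auto)
 then obtain l r2 where r2: "strict_mono (r2 :: nat => nat)" "((\<lambda>n. U (r1 n) 0) \<circ> r2) \<longlonglongrightarrow> l"
  using bounded_imp_convergent_subsequence by blast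
 define r where "r n = r1 (r2 n)" for n
 have r: "strict_mono r" using strict_mono_o[OF r1(1) r2(1)] by (simp add: r_def[abs_def] o_def)
 have w: "wl2 (\<lambda>n. V (r n)) v" using wl2_subseq[OF r1(2) r2(1)] by (simp add: r_def)
 note vs = wl2D(3)[OF w]
 note va = circle_integral(1)[OF sqintD(1)[OF vs] integrable_sqint[OF vs]]
 have lim: "(\<lambda>n. U (r n) x) \<longlonglongrightarrow> l + integral {0..x} v" if x: "x \<in> {0..2*pi}" for x
 proof -
  have "U (r n) x = U (r n) 0 + integral {0..x} (V (r n))" for n
   using ac_integral[OF cderD(2)[OF c[of "r n"]], of 0 x] x by simp
  moreover have "(\<lambda>n. U (r n) 0 + integral {0..x} (V (r n))) \<longlonglongrightarrow> l + integral {0..x} v"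
   using r2(2) by (intro tendsto_add wl2_integral_tendsto[OF w x]) (simp add: o_def r_def)
  ultimately show ?thesis by simp
 qed
 define u where "u th = lim (\<lambda>n. U (r n) th)" for th
 have ulim: "(\<lambda>n. U (r n) th) \<longlonglongrightarrow> u th" for th
 proof -
  obtain k where k: "th + 2 * pi * of_int k \<in> {0..<2*pi}" by (rule periodic_reduce)
  have "U (r n) (th + 2 * pi * of_int k) = U (r n) th" for n
   by (rule periodic_shift_int[OF cderD(1)[OF c]])
  with lim[of "th + 2 * pi * of_int k"] k have "convergent (\<lambda>n. U (r n) th)" by (auto simp: convergent_def)
  then show ?thesis by (simp add: u_def convergent_LIMSEQ_iff)
 qed
 have pcu: "pc (\<lambda>n. U (r n)) u" using b ulim by (auto simp: pc_def)
 have ux: "u x = l + integral {0..x} v" if "x \<in> {0..2*pi}" for x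
  using LIMSEQ_unique[OF ulim lim[OF that]] .
 have "cder u v"
  unfolding cder_def ac_def
 proof (intro conjI ballI va)
  show "periodic u" using cderD(1)[OF c] by (simp add: periodic_def u_def)
  fix x y assume xy: "x \<in> {0..2*pi}" "y \<in> {x..2*pi}"
  have "integral {0..x} v + integral {x..y} v = integral {0..y} v"
   using xy by (intro Henstock_Kurzweil_Integration.integral_combine absint_sub(2)[OF va]) auto
  then have "integral {x..y} v = u y - u x" using ux[of x] ux[of y] xy by (auto simp: algebra_simps)
  then show "(v has_integral (u y - u x)) {x..y}"
   using absint_sub(2)[OF va, of x y] xy by (metis atLeastAtMost_iff integrable_integral)
 qed
 then show ?thesis using that r pcu w by blast
qed

lemma finite_common_subseq:
 fixes N :: nat
 assumes ex: "\<And>i r. i < N ==> strict_mono (r :: nat => nat) ==> \<exists>s. strict_mono (s :: nat => nat) \<and> P i (r \<circ> s)"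
  and sub: "\<And>i r s. i < N ==> P i r ==> strict_mono s ==> P i (r \<circ> s)"
 obtains r where "strict_mono (r :: nat => nat)" "\<And>i. i < N ==> P i r"
proof -
 have "\<exists>r. strict_mono r \<and> (\<forall>i<n. P i r)" if n: "n \<le> N" for n
  using n
 proof (induction n)
  case 0
  show ?case using strict_mono_id by auto
 next
  case (Suc n)
  then obtain r where r: "strict_mono r" "\<forall>i<n. P i r" by auto
  obtain s where s: "strict_mono s" "P n (r \<circ> s)" using ex[of n r] r(1) Suc.prems by auto
  have "P i (r \<circ> s)" if "i < Suc n" for i
   using that s sub[of i r s] r(2) Suc.prems by (cases "i = n") auto
  then show ?case using strict_mono_o[OF r(1) s(1)] by blast
 qed
 then show ?thesis using that by blast
qed

text \<open>The speed \<open>r\<close> along the linear path solves a quadratic equation whose coefficients only involve the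
 initial velocity \<open>p\<close> and \<open>s = t * xi 1\<close>. This breaks the circularity between bounds on \<open>r\<close> and on \<open>xi\<close>.\<close>

lemma speed_quadratic:
 fixes p s :: "'a::real_inner"
 assumes r: "r = norm (p + r *\<^sub>R s)" and s: "norm s < 1" and r0: "r > 0" and p: "p \<noteq> 0"
 shows "r = (p \<bullet> s + sqrt ((p \<bullet> s) * (p \<bullet> s) + (p \<bullet> p) * (1 - s \<bullet> s))) * inverse (1 - s \<bullet> s)"
proof -
 define q where "q = 1 - s \<bullet> s"
 have "(norm s)\<^sup>2 < 1" using s by (simp add: abs_square_less_1)
 then have q: "q > 0" by (simp add: q_def power2_norm_eq_inner)
 have "r * r = (p + r *\<^sub>R s) \<bullet> (p + r *\<^sub>R s)" using r by (metis power2_norm_eq_inner power2_eq_square)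
 also have "\<dots> = p \<bullet> p + 2 * r * (p \<bullet> s) + r * r * (s \<bullet> s)"
  by (simp add: inner_add_left inner_add_right inner_commute[of s p] distrib_left)
 finally have "r * r = p \<bullet> p + 2 * r * (p \<bullet> s) + r * r * (s \<bullet> s)" .
 moreover have "q * r\<^sup>2 = r * r - r * r * (s \<bullet> s)" by (simp add: q_def power2_eq_square algebra_simps)
 ultimately have eq: "q * r\<^sup>2 = 2 * r * (p \<bullet> s) + p \<bullet> p" by linarith
 have "(q * r - p \<bullet> s)\<^sup>2 = q * (q * r\<^sup>2) - 2 * q * r * (p \<bullet> s) + (p \<bullet> s)\<^sup>2"
  by (simp add: power2_eq_square algebra_simps)
 also have "\<dots> = (p \<bullet> s) * (p \<bullet> s) + (p \<bullet> p) * q" unfolding eq by (simp add: power2_eq_square algebra_simps)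
 finally have sq: "(q * r - p \<bullet> s)\<^sup>2 = (p \<bullet> s) * (p \<bullet> s) + (p \<bullet> p) * q" .
 have "q * r - p \<bullet> s > 0"
 proof -
  have "r * (q * r - 2 * (p \<bullet> s)) = p \<bullet> p" using eq by (simp add: power2_eq_square algebra_simps)
  then have "r * (q * r - 2 * (p \<bullet> s)) > 0" using p by simp
  then have "q * r - 2 * (p \<bullet> s) > 0" using r0 by (simp add: zero_less_mult_iff)
  moreover have "q * r > 0" using q r0 by simp
  ultimately show ?thesis by linarith
 qed
 then have "sqrt ((p \<bullet> s) * (p \<bullet> s) + (p \<bullet> p) * q) = q * r - p \<bullet> s"
  using sq by (metis real_sqrt_abs abs_of_pos)
 then show ?thesis using q by (simp add: q_def[symmetric] field_simps)
qed

text \<open>The solution of the quadratic equation is composed of sums, products, roots and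
  inverses, all of which preserve convergence. The bound 1/2 keeps
  \<open>1 - S n th \<bullet> S n th\<close> above 3/4, and \<open>d\<close> keeps the radicand
  positive, so that root and inverse stay away from their singularities.\<close>

lemma wc_speed:
 fixes p :: "real => 'a::euclidean_space"
 assumes P: "wc j P p" "pc P p" and S: "wc j S s" "pc S s" and d: "d > 0" "\<And>n th. norm (P n th) \<ge> d"
  and sl: "\<And>n th. norm (S n th) \<le> 1/2"
  and r: "\<And>n th. R n th = norm (P n th + R n th *\<^sub>R S n th)" "\<And>n th. R n th > 0"
 obtains \<rho> where "wc j R \<rho>" "pc R \<rho>"
proof -
 have eq: "R = (\<lambda>n th. (P n th \<bullet> S n th + sqrt ((P n th \<bullet> S n th) * (P n th \<bullet> S n th) + (P n th \<bullet> P n th) * (1 - S n th \<bullet> S n th))) * inverse (1 - S n th \<bullet> S n th))"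
 proof (intro ext)
  fix n th
  have "norm (S n th) < 1" using sl[of n th] by linarith
  moreover have "P n th \<noteq> 0" using d(2)[of n th] d(1) by auto
  ultimately show "R n th = (P n th \<bullet> S n th + sqrt ((P n th \<bullet> S n th) * (P n th \<bullet> S n th) + (P n th \<bullet> P n th) * (1 - S n th \<bullet> S n th))) * inverse (1 - S n th \<bullet> S n th)"
   by (intro speed_quadratic r)
 qed
 note ps = wc_inner[OF P(2) P(1) S(1)] pc_inner[OF P(2) S(2)]
 note pp = wc_inner[OF P(2) P(1) P(1)] pc_inner[OF P(2) P(2)]
 have one: "wc j (\<lambda>n th. 1::real) (\<lambda>th. 1)" "pc (\<lambda>n th. 1::real) (\<lambda>th. 1)" by (rule wc_const pc_const, simp)+
 have m1: "wc j (\<lambda>n th. -1::real) (\<lambda>th. -1)" "pc (\<lambda>n th. -1::real) (\<lambda>th. -1)" by (rule wc_const pc_const, simp)+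
 have q: "wc j (\<lambda>n th. 1 - S n th \<bullet> S n th) (\<lambda>th. 1 - s th \<bullet> s th)" "pc (\<lambda>n th. 1 - S n th \<bullet> S n th) (\<lambda>th. 1 - s th \<bullet> s th)"
  using wc_add[OF one(1) wc_mult[OF m1(2,1) wc_inner[OF S(2,1,1)]]]
   pc_add[OF one(2) pc_mult[OF m1(2) pc_inner[OF S(2,2)]]] by simp_all
 have ql: "1 - S n th \<bullet> S n th \<ge> 3/4" for n th
  using power_mono[OF sl[of n th], of 2] by (simp add: power2_norm_eq_inner power_divide)
 note X = wc_add[OF wc_mult[OF ps(2,1,1)] wc_mult[OF pp(2,1) q(1)]] pc_add[OF pc_mult[OF ps(2,2)] pc_mult[OF pp(2) q(2)]]
 have Xl: "(P n th \<bullet> S n th) * (P n th \<bullet> S n th) + (P n th \<bullet> P n th) * (1 - S n th \<bullet> S n th) \<ge> d\<^sup>2 * (3/4)" for n th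
 proof -
  have "P n th \<bullet> P n th \<ge> d\<^sup>2" using power_mono[OF d(2)[of n th], of 2] d(1) by (simp add: power2_norm_eq_inner)
  then have "(P n th \<bullet> P n th) * (1 - S n th \<bullet> S n th) \<ge> d\<^sup>2 * (3/4)" using ql[of n th] by (intro mult_mono) auto
  then show ?thesis using zero_le_square[of "P n th \<bullet> S n th"] by linarith
 qed
 have d2: "d\<^sup>2 * (3/4) > 0" using d(1) by simp
 note Y = wc_sqrt[OF X d2 Xl] pc_sqrt[OF X(2)]
 note Z = wc_add[OF ps(1) Y(1)] pc_add[OF ps(2) Y(2)]
 have "3/4 > (0::real)" by simp
 note I = wc_inverse[OF q this ql] pc_inverse[OF q(2) this ql]
 from that[OF wc_mult[OF Z(2) Z(1) I(1), folded eq] pc_mult[OF Z(2) I(2), folded eq]] show ?thesis .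
qed

text \<open>The metric is evaluated at one early time \<open>T n\<close> for each pair of curves.
  There all arc length derivatives \<open>\<xi> i n\<close> of the increment are bounded in L2, and
  those below the top order also uniformly. Their limits provide only one derivative at a time;
  \<open>wc_speed\<close> then gives the speed the orders that the next derivative requires.\<close>

lemma energy_compact:
 fixes A B :: "nat => ('d::finite) curve"
 assumes m: "2 \<le> m" and A: "wc m A a" and B: "\<And>n. Sob m (B n)"
  and imm: "\<And>n t. t \<in> {0..1} ==> linear_path (A n) (B n) t \<in> Imm m"
  and E: "\<And>n. (\<integral>\<^sup>+t. ennreal (gm m (linear_path (A n) (B n) t) (\<lambda>th. B n th - A n th)) * indicator {0..1} t \<partial>lborel) \<le> ennreal E"
  and E0: "E \<ge> 0" and \<delta>: "\<delta> > 0" "\<And>n th. \<delta> \<le> norm (wder (A n) th)"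
 obtains r b d where "strict_mono (r :: nat => nat)" "wc m (\<lambda>n. B (r n)) b" "d > 0"
  "\<And>n t th. t \<in> {0..1} ==> d \<le> norm (wder (linear_path (A n) (B n) t) th)"
proof -
 have SA: "Sob m (A n)" for n by (rule wc_Sob_seq[OF A])
 note wA = wc_wder'[OF m A]
 obtain M where M: "\<And>n th. norm (wder (A n) th) \<le> M" using pcD(1)[OF wA(2)] by blast
 have M0: "M > 0" using M[of 0 0] \<delta>(2)[of 0 0] \<delta>(1) by linarith
 define \<Lambda> where "\<Lambda> = 4 * pi * M + (E + 1)"
 define e where "e = E + 1"
 have e: "e \<ge> 1" using E0 by (simp add: e_def)
 have \<Lambda>: "\<Lambda> > 0" using M0 E0 by (simp add: \<Lambda>_def add_pos_nonneg)
 have imm_all: "\<forall>t\<in>{0..1}. linear_path (A n) (B n) t \<in> Imm m" for n using imm by blast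
 note est = lin_estimates[OF m SA B imm_all E E0 M, folded \<Lambda>_def]
 define d where "d = \<delta> * exp (- (1 + \<Lambda> * E) / 2)"
 have d: "d > 0" using \<delta>(1) by (simp add: d_def)
 have dl: "d \<le> norm (wder (linear_path (A n) (B n) t) th)" if t: "t \<in> {0..1}" for n t th
  using est(3)[OF t, of n th] \<delta>(2)[of n th] mult_right_mono[OF \<delta>(2)[of n th], of "exp (- (1 + \<Lambda> * E) / 2)"]
  unfolding d_def by (smt (verit) exp_ge_zero)
 \<comment> \<open>Up to time \<open>\<tau>\<close> the squared norm of
   \<open>T n *\<^sub>R \<xi> 1 n\<close> is at most \<open>\<tau>^2\<close> times
   \<open>\<Lambda> * (e / \<tau>)\<close>, that is \<open>\<tau> * (\<Lambda> * e)\<close>. The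
   choice makes this at most 1/4, as \<open>wc_speed\<close> demands.\<close>
 define \<tau> where "\<tau> = min 1 (1 / (4 * \<Lambda> * e))"
 have \<tau>: "\<tau> \<in> {0<..1}" "\<tau> * (\<Lambda> * e) \<le> 1/4"
 proof -
  have p: "\<Lambda> * e > 0" using \<Lambda> e by simp
  then show "\<tau> \<in> {0<..1}" by (simp add: \<tau>_def)
  have "\<tau> \<le> 1 / (4 * \<Lambda> * e)" by (simp add: \<tau>_def)
  then have "\<tau> * (\<Lambda> * e) \<le> 1 / (4 * \<Lambda> * e) * (\<Lambda> * e)" using p by (intro mult_right_mono) auto
  also have "\<dots> = 1/4" using \<Lambda> e by simp
  finally show "\<tau> * (\<Lambda> * e) \<le> 1/4" .
 qed
 have "\<exists>t. t \<in> {0..\<tau>} \<and> gm m (linear_path (A n) (B n) t) (\<lambda>th. B n th - A n th) \<le> e / \<tau>" for n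
  using est(1)[OF \<tau>(1), of n] by (auto simp: e_def)
 then obtain T where T: "\<And>n. T n \<in> {0..\<tau>}" "\<And>n. gm m (linear_path (A n) (B n) (T n)) (\<lambda>th. B n th - A n th) \<le> e / \<tau>"
  by metis
 have T1: "T n \<in> {0..1}" for n using T(1)[of n] \<tau>(1) by auto
 define C where "C n = linear_path (A n) (B n) (T n)" for n
 define H where "H n = (\<lambda>th. B n th - A n th)" for n
 define R where "R n th = norm (wder (C n) th)" for n th
 define \<xi> where "\<xi> i n = xi (C n) (H n) i" for i n
 have CI: "C n \<in> Imm m" for n unfolding C_def by (rule imm[OF T1])
 have SC: "Sob m (C n)" for n using CI m by (simp add: Imm_iff)
 have SH: "Sob m (H n)" for n unfolding H_def by (rule Sob_diff[OF B SA])
 have gmC: "gm m (C n) (H n) \<le> e / \<tau>" for n using T(2)[of n] by (simp add: C_def H_def)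
 have Rd: "d \<le> R n th" for n th unfolding R_def C_def by (rule dl[OF T1])
 have R0: "R n th > 0" for n th using Rd[of n th] d by linarith
 have wH: "wder (H n) th = R n th *\<^sub>R \<xi> 1 n th" for n th
  using wder_xi[of "C n" th "H n" 0] R0[of n th] by (simp add: R_def \<xi>_def xi_0)
 have wC: "wder (C n) th = wder (A n) th + T n *\<^sub>R wder (H n) th" for n th
  unfolding C_def H_def wder_linear_path[OF m SA B] wder_diff[OF m SA B] by (simp add: linear_path_def algebra_simps)
 have Ts: "norm (T n *\<^sub>R \<xi> 1 n th) \<le> 1/2" for n th
 proof -
  have "(R n th * norm (\<xi> 1 n th))\<^sup>2 \<le> \<Lambda> * (e / \<tau>) * (R n th)\<^sup>2"
  proof -
   have "(norm (wder (H n) th))\<^sup>2 \<le> \<Lambda> * gm m (C n) (H n) * (R n th)\<^sup>2"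
    using est(2)[OF T1, of n th] unfolding C_def H_def R_def wder_diff[OF m SA B] .
   also have "\<dots> \<le> \<Lambda> * (e / \<tau>) * (R n th)\<^sup>2"
    using \<Lambda> gmC[of n] by (intro mult_right_mono mult_left_mono) auto
   finally show ?thesis using R0[of n th] by (simp add: wH)
  qed
  then have "(R n th)\<^sup>2 * (norm (\<xi> 1 n th))\<^sup>2 \<le> (R n th)\<^sup>2 * (\<Lambda> * (e / \<tau>))"
   by (simp only: power_mult_distrib mult.commute[of "\<Lambda> * (e / \<tau>)"])
  then have "(norm (\<xi> 1 n th))\<^sup>2 \<le> \<Lambda> * (e / \<tau>)"
   by (rule mult_left_le_imp_le) (use R0[of n th] in simp)
  then have "(T n)\<^sup>2 * (norm (\<xi> 1 n th))\<^sup>2 \<le> \<tau>\<^sup>2 * (\<Lambda> * (e / \<tau>))"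
   using T(1)[of n] by (intro mult_mono power_mono) auto
  also have "\<dots> = \<tau> * (\<Lambda> * e)" using \<tau>(1) by (simp add: power2_eq_square)
  also have "\<dots> \<le> (1/2)\<^sup>2" using \<tau>(2) by (simp add: power_divide)
  finally have "(norm (T n *\<^sub>R \<xi> 1 n th))\<^sup>2 \<le> (1/2)\<^sup>2" by (simp add: power_mult_distrib)
  then show ?thesis by (rule power2_le_imp_le) simp
 qed
 have Req: "R n th = norm (wder (A n) th + R n th *\<^sub>R (T n *\<^sub>R \<xi> 1 n th))" for n th
 proof -
  have "R n th *\<^sub>R (T n *\<^sub>R \<xi> 1 n th) = T n *\<^sub>R wder (H n) th" by (simp add: wH)
  then show ?thesis unfolding R_def wC by simp
 qed
 \<comment> \<open>By \<open>Req\<close> and \<open>Ts\<close> the speed is at most \<open>M\<close>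
   plus half of itself, and the half is absorbed.\<close>
 have RM: "R n th \<le> 2 * M" for n th
 proof -
  have "R n th \<le> norm (wder (A n) th) + R n th * norm (T n *\<^sub>R \<xi> 1 n th)"
   using norm_triangle_ineq[of "wder (A n) th" "R n th *\<^sub>R (T n *\<^sub>R \<xi> 1 n th)"] R0[of n th] by (subst Req) (simp add: abs_mult)
  also have "\<dots> \<le> M + R n th * (1/2)"
   using R0[of n th] by (intro add_mono M mult_left_mono Ts) auto
  finally show ?thesis by simp
 qed
 have xis: "\<xi> i n \<in> sqint" if "i \<le> m" for i n
  unfolding \<xi>_def by (rule xi_term_integrable(2)[OF m CI SH that])
 define K where "K = e / (\<tau> * d)"
 have xiK: "nsq (\<xi> i n) \<le> K" if i: "i \<le> m" for i n
 proof -
  have "d * nsq (\<xi> i n) = (LINT th|circle. d * (norm (\<xi> i n th))\<^sup>2)" by (simp add: nsq_def)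
  also have "\<dots> \<le> (LINT th|circle. (norm (xi (C n) (H n) i th))\<^sup>2 * norm (wder (C n) th))"
   using sqintD(2)[OF xis[OF i]] Rd
   by (intro integral_mono xi_term_integrable(1)[OF m CI SH i]) (auto simp: \<xi>_def R_def mult.commute[of _ "norm (wder _ _)"] intro!: mult_right_mono)
  also have "\<dots> \<le> e / \<tau>" using gm_ge_term[OF m CI SH i, of n n] gmC[of n] by linarith
  finally have "nsq (\<xi> i n) \<le> (e / \<tau>) / d"
   using d by (subst pos_le_divide_eq) (auto simp: mult.commute)
  then show ?thesis by (simp add: K_def)
 qed
 have wx: "wder (\<xi> i n) = (\<lambda>th. R n th *\<^sub>R \<xi> (Suc i) n th)" for i n
 proof
  fix th show "wder (\<xi> i n) th = R n th *\<^sub>R \<xi> (Suc i) n th"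
   using wder_xi[of "C n" th "H n" i] R0[of n th] by (simp add: R_def \<xi>_def)
 qed
 have Sx: "Sob (Suc (m - Suc i)) (\<xi> i n)" if "i < m" for i n
  using Sob_xi[OF m CI SH, of i n n] that by (simp add: \<xi>_def Suc_diff_Suc)
 have cx: "cder (\<xi> i n) (wder (\<xi> i n))" "wder (\<xi> i n) \<in> sqint" "periodic (wder (\<xi> i n))" if "i < m" for i n
  using Sob_cder[OF Sx[OF that]] wc_regular[OF Sob_wder[OF Sx[OF that]]] by auto
 have wxK: "nsq (wder (\<xi> i n)) \<le> (2 * M)\<^sup>2 * K" if i: "i < m" for i n
 proof -
  have "nsq (wder (\<xi> i n)) \<le> nsq (\<lambda>th. (2 * M) *\<^sub>R \<xi> (Suc i) n th)"
   using cx(2)[OF i] xis[of "Suc i"] i RM R0 M0 unfolding wx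
   by (intro nsq_mono) (auto intro!: mult_right_mono simp: abs_of_pos)
  also have "\<dots> \<le> (2 * M)\<^sup>2 * K" unfolding nsq_scaleR using i by (intro mult_left_mono xiK) auto
  finally show ?thesis .
 qed
 define K' where "K' = sqrt K / sqrt (2*pi) + sqrt (2*pi) * sqrt ((2 * M)\<^sup>2 * K)"
 have xK': "norm (\<xi> i n th) \<le> K'" if i: "i < m" for i n th
 proof -
  have "norm (\<xi> i n th) \<le> sqrt (nsq (\<xi> i n)) / sqrt (2*pi) + sqrt (2*pi) * sqrt (nsq (wder (\<xi> i n)))"
   by (rule cder_sup_le[OF cx(1,2)[OF i]])
  also have "\<dots> \<le> K'"
   unfolding K'_def using i by (intro add_mono divide_right_mono mult_left_mono real_sqrt_le_mono xiK wxK) auto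
  finally show ?thesis .
 qed
 have "bounded (range T)" using T1 by (auto simp: bounded_iff intro: exI[of _ 1])
 then obtain tl r0 where r0: "strict_mono (r0 :: nat => nat)" "(T \<circ> r0) \<longlonglongrightarrow> tl"
  using bounded_imp_convergent_subsequence by blast
 \<comment> \<open>Below the top order the functions converge pointwise and their derivatives
   weakly; at the top order only weak convergence is to be had.\<close>
 define P where "P i s = (if i < m then \<exists>u v. pc (\<lambda>n. \<xi> i (r0 (s n))) u \<and> cder u v \<and> wl2 (\<lambda>n. wder (\<xi> i (r0 (s n)))) v
  else \<exists>u. wl2 (\<lambda>n. \<xi> i (r0 (s n))) u)" for i and s :: "nat => nat"
 obtain r1 where r1: "strict_mono r1" "\<And>i. i < Suc m ==> P i r1"
 proof (rule finite_common_subseq[of "Suc m" P])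
  fix i :: nat and s :: "nat => nat" assume i: "i < Suc m" and s: "strict_mono s"
  show "\<exists>s'. strict_mono s' \<and> P i (s \<circ> s')"
  proof (cases "i < m")
   case True
   obtain s' u v where "strict_mono (s' :: nat => nat)" "pc (\<lambda>n. \<xi> i (r0 (s (s' n)))) u" "cder u v" "wl2 (\<lambda>n. wder (\<xi> i (r0 (s (s' n))))) v"
    using bounded_cder_subseq[of "\<lambda>n. \<xi> i (r0 (s n))" "\<lambda>n. wder (\<xi> i (r0 (s n)))", OF cx[OF True] wxK[OF True] xK'[OF True]] by blast
   then show ?thesis using True by (auto simp: P_def)
  next
   case False
   then have im: "i \<le> m" using i by simp
   have "periodic (\<xi> i n)" for n unfolding \<xi>_def by (rule wc_regular(2)[OF Sob_xi[OF m CI SH im]])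
   then obtain s' u where "strict_mono (s' :: nat => nat)" "wl2 (\<lambda>n. \<xi> i (r0 (s (s' n)))) u"
    using weakly_compact[of "\<lambda>n. \<xi> i (r0 (s n))" K, OF xis[OF im] _ xiK[OF im]] by blast
   then show ?thesis using False by (auto simp: P_def)
  qed
 next
  fix i s s' assume "P i s" "strict_mono (s' :: nat => nat)"
  then show "P i (s \<circ> s')"
   unfolding P_def o_def by (auto split: if_splits dest: pc_subseq[of _ _ s'] wl2_subseq[of _ _ s'])
 qed blast
 define r where "r n = r0 (r1 n)" for n
 have r: "strict_mono r" using strict_mono_o[OF r0(1) r1(1)] by (simp add: r_def[abs_def] o_def)
 have Tl: "(\<lambda>n. T (r n)) \<longlonglongrightarrow> tl"
  using LIMSEQ_subseq_LIMSEQ[OF r0(2) r1(1)] by (simp add: r_def o_def)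
 have low: "\<exists>u v. pc (\<lambda>n. \<xi> i (r n)) u \<and> cder u v \<and> wl2 (\<lambda>n. wder (\<xi> i (r n))) v" if "i < m" for i
  using r1(2)[of i] that by (simp add: P_def r_def)
 have top: "\<exists>u. wl2 (\<lambda>n. \<xi> m (r n)) u" using r1(2)[of m] by (simp add: P_def r_def)
 \<comment> \<open>Induction on the number \<open>j\<close> of derivatives, for all \<open>i\<close>
   at once: the derivative of \<open>\<xi> i\<close> is the speed times
   \<open>\<xi> (Suc i)\<close>, and the speed takes its \<open>j\<close> orders from
   \<open>\<xi> 1\<close>, for which the induction hypothesis is available too.\<close>
 have main: "\<exists>u. wc j (\<lambda>n. \<xi> i (r n)) u \<and> (i < m \<longrightarrow> pc (\<lambda>n. \<xi> i (r n)) u)" if "i + j \<le> m" for i j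
  using that
 proof (induction j arbitrary: i)
  case 0
  show ?case
  proof (cases "i < m")
   case True
   then obtain u v where u: "pc (\<lambda>n. \<xi> i (r n)) u" using low by blast
   then have "wl2 (\<lambda>n. \<xi> i (r n)) u"
    using cx(1)[OF True] by (intro pc_wl2) (auto dest: cder_measurable cderD)
   with u show ?thesis by auto
  next
   case False
   then show ?thesis using top 0 by auto
  qed
 next
  case (Suc j)
  then have i: "i < m" by simp
  obtain u v where u: "pc (\<lambda>n. \<xi> i (r n)) u" "cder u v" "wl2 (\<lambda>n. wder (\<xi> i (r n))) v" using low[OF i] by blast
  obtain z where z: "wc j (\<lambda>n. \<xi> (Suc i) (r n)) z" using Suc.IH[of "Suc i"] Suc.prems by auto
  obtain y where y: "wc j (\<lambda>n. \<xi> 1 (r n)) y" "pc (\<lambda>n. \<xi> 1 (r n)) y" using Suc.IH[of 1] Suc.prems m by auto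
  have Aj: "wc j (\<lambda>n. wder (A (r n))) (wder a)"
   using Suc.prems by (intro wc_le[OF wc_subseq[OF wA(1) r]]) simp
  obtain \<rho> where \<rho>: "wc j (\<lambda>n. R (r n)) \<rho>" "pc (\<lambda>n. R (r n)) \<rho>"
   using wc_speed[OF Aj pc_subseq[OF wA(2) r] wc_cmult[OF Tl y(1)] pc_scaleR[OF pc_const[OF Tl] y(2)] \<delta>, of "\<lambda>n. R (r n)"]
    Ts Req R0 by blast
  have W: "wc j (\<lambda>n. wder (\<xi> i (r n))) (\<lambda>th. \<rho> th *\<^sub>R z th)"
   unfolding wx by (rule wc_scaleR[OF \<rho>(2,1) z])
  have "wl2 (\<lambda>n. wder (\<xi> i (r n))) (\<lambda>th. \<rho> th *\<^sub>R z th)" using wc_le[OF W, of 0] by simp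
  from cder_cong_AE[OF u(2) wl2_unique_AE[OF this u(3)]]
  have "wc (Suc j) (\<lambda>n. \<xi> i (r n)) u"
   by (intro wc_SucI[OF u(1) _ _ W] cx(1)[OF i])
  with u(1) show ?case by blast
 qed
 obtain u where u: "wc m (\<lambda>n. H (r n)) u" using main[of 0 m] by (auto simp: \<xi>_def xi_0)
 have "wc m (\<lambda>n. B (r n)) (\<lambda>th. a th + u th)"
  using wc_add[OF wc_subseq[OF A r] u] by (simp add: H_def)
 then show ?thesis using that r d dl by blast
qed

section \<open>Existence of minimizers\<close>

lemma sum_liminf_le:
 fixes f :: "nat => 'i => ennreal"
 assumes "finite I"
 shows "(\<Sum>i\<in>I. liminf (\<lambda>n. f n i)) \<le> liminf (\<lambda>n. \<Sum>i\<in>I. f n i)"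
 using nn_integral_liminf[of f "count_space I"] by (simp add: nn_integral_count_space_finite[OF assms])

lemma tendsto_imp_liminf_ge:
 fixes f :: "nat => ennreal"
 shows "f \<longlonglongrightarrow> l ==> l \<le> liminf f"
 using lim_imp_Liminf[OF trivial_limit_sequentially, of f l] by simp

lemma pc_norm_ge:
 assumes "pc U u" "\<And>n. d \<le> norm (U n x)"
 shows "d \<le> norm (u x)"
 by (rule LIMSEQ_le_const[OF tendsto_norm[OF pcD(2)[OF assms(1)]]]) (use assms(2) in auto)

lemma Imm_lowerI:
 assumes "2 \<le> m" "Sob m c" "d > 0" "\<And>x. d \<le> norm (wder c x)"
 shows "c \<in> Imm m"
proof -
 have "wder c x \<noteq> 0" for x using assms(3) assms(4)[of x] by auto
 then show ?thesis using assms(1,2) by (simp add: Imm_iff)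
qed

text \<open>Thanks to the lower speed bound the arc length derivatives converge weakly up to order
  \<open>m\<close>, while the weight, the speed, converges pointwise.\<close>

lemma gm_lsc:
 assumes m: "2 \<le> m" and C: "wc m C c" and H: "wc m H h" and d: "d > 0" "\<And>n x. d \<le> norm (wder (C n) x)"
 shows "ennreal (gm m c h) \<le> liminf (\<lambda>n. ennreal (gm m (C n) (H n)))"
proof -
 note wC = wc_wder'[OF m C]
 have dl: "d \<le> norm (wder c x)" for x by (rule pc_norm_ge[OF wC(2) d(2)])
 have cI: "c \<in> Imm m" by (rule Imm_lowerI[OF m wc_Sob[OF C] d(1) dl])
 have CI: "C n \<in> Imm m" for n by (rule Imm_lowerI[OF m wc_Sob_seq[OF C] d])
 note Ch = wc_Sob[OF H] and CH = wc_Sob_seq[OF H]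
 have "(\<integral>\<^sup>+x. ennreal (norm (wder c x)) * ennreal ((norm (xi c h j x))\<^sup>2) \<partial>circle) \<le>
  liminf (\<lambda>n. \<integral>\<^sup>+x. ennreal (norm (wder (C n) x)) * ennreal ((norm (xi (C n) (H n) j x))\<^sup>2) \<partial>circle)" if "j \<le> m" for j
 proof -
  have w: "wl2 (\<lambda>n. xi (C n) (H n) j) (xi c h j)"
   using wc_le[OF wc_xi[OF m C H d that], of 0] by simp
  have [measurable]: "wder (C n) \<in> borel_measurable borel" for n
   by (rule wder_regular(5)[OF m wc_Sob_seq[OF C]])
  have "(\<integral>\<^sup>+x. ennreal (norm (wder c x)) * ennreal ((norm (xi c h j x))\<^sup>2) \<partial>circle) \<le>
   (\<integral>\<^sup>+x. liminf (\<lambda>n. ennreal (norm (wder (C n) x))) * ennreal ((norm (xi c h j x))\<^sup>2) \<partial>circle)"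
   by (intro nn_integral_mono mult_right_mono tendsto_imp_liminf_ge tendsto_ennrealI tendsto_norm pcD(2)[OF wC(2)]) simp
  also have "\<dots> \<le> liminf (\<lambda>n. \<integral>\<^sup>+x. ennreal (norm (wder (C n) x)) * ennreal ((norm (xi (C n) (H n) j x))\<^sup>2) \<partial>circle)"
   by (rule weighted_nsq_lsc[OF w]) measurable
  finally show ?thesis .
 qed
 then have "ennreal (gm m c h) \<le> (\<Sum>j=0..m.
  liminf (\<lambda>n. \<integral>\<^sup>+x. ennreal (norm (wder (C n) x)) * ennreal ((norm (xi (C n) (H n) j x))\<^sup>2) \<partial>circle))"
  unfolding ennreal_gm[OF m cI Ch] by (intro sum_mono) auto
 also have "\<dots> \<le> liminf (\<lambda>n. ennreal (gm m (C n) (H n)))"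
  unfolding ennreal_gm[OF m CI CH] by (rule sum_liminf_le) simp
 finally show ?thesis .
qed

text \<open>Applied to sequences of times on one linear path, \<open>gm_lsc\<close> is lower
  semicontinuity in \<open>t\<close>. It makes the sublevel sets closed, which gives Borel
  measurability.\<close>

lemma gm_measurable:
 assumes m: "2 \<le> m" and a: "Sob m a" and b: "Sob m b" and d: "d > 0" "\<And>t x. t \<in> {0..1} ==> d \<le> norm (wder (linear_path a b t) x)"
 shows "(\<lambda>t. ennreal (gm m (linear_path a b t) (\<lambda>x. b x - a x)) * indicator {0..1} t) \<in> borel_measurable borel"
proof -
 define g where "g t = gm m (linear_path a b t) (\<lambda>x. b x - a x)" for t
 have g0: "g t \<ge> 0" for t by (simp add: g_def gm_nonneg)
 have cl: "closed {t\<in>{0..1}. g t \<le> \<alpha>}" for \<alpha>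
  unfolding closed_sequential_limits
 proof (intro allI impI, elim conjE)
  fix T t assume T: "\<forall>n. T n \<in> {t\<in>{0..1}. g t \<le> \<alpha>}" and lim: "T \<longlonglongrightarrow> t"
  then have t: "t \<in> {0..1}" using closed_sequentially[of "{0..1::real}" T t] by auto
  have "ennreal (g t) \<le> liminf (\<lambda>n. ennreal (g (T n)))"
   unfolding g_def by (rule gm_lsc[OF m wc_linear_path[OF a b lim] wc_diff[OF b a] d(1)]) (use T d(2) in auto)
  also have "\<dots> \<le> ennreal \<alpha>"
   using T by (intro Liminf_le always_eventually) (auto intro: ennreal_leI)
  finally have le: "ennreal (g t) \<le> ennreal \<alpha>" .
  have "g (T 0) \<le> \<alpha>" using T by blast
  then have "0 \<le> \<alpha>" using g0[of "T 0"] by linarith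
  then have "g t \<le> \<alpha>" using le by simp
  then show "t \<in> {t\<in>{0..1}. g t \<le> \<alpha>}" using t by simp
 qed
 have "(\<lambda>t. g t * indicator {0..1} t) \<in> borel_measurable borel"
  unfolding borel_measurable_iff_le
 proof
  fix \<alpha> :: real
  have "{t \<in> space borel. g t * indicator {0..1} t \<le> \<alpha>} = {t\<in>{0..1}. g t \<le> \<alpha>} \<union> (if 0 \<le> \<alpha> then - {0..1} else {})"
   by (auto simp: indicator_def split: if_splits)
  also have "\<dots> \<in> sets borel" using cl by auto
  finally show "{t \<in> space borel. g t * indicator {0..1} t \<le> \<alpha>} \<in> sets borel" .
 qed
 then have "(\<lambda>t. ennreal (g t * indicator {0..1} t)) \<in> borel_measurable borel" by measurable
 moreover have "ennreal (g t * indicator {0..1} t) = ennreal (g t) * indicator {0..1} t" for t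
  by (auto simp: indicator_def)
 ultimately show ?thesis by (simp add: g_def)
qed

text \<open>Domination of the energy of the linear path is all that compactness asks of a
  functional, since \<open>energy_compact\<close> speaks of this energy alone.\<close>

definition coercive :: "nat => (('d::finite) curve => 'd curve => ennreal) => bool" where
 "coercive m V \<longleftrightarrow> (\<forall>a\<in>Imm m. \<forall>b\<in>Imm m. path_energy m (linear_path a b) \<le> V a b)"

text \<open>Semicontinuity is demanded only along sequences with a uniform lower bound for the speed
  on the whole linear paths. Coercivity provides such a bound for minimizing sequences.\<close>

definition path_lsc :: "nat => (('d::finite) curve => 'd curve => ennreal) => bool" where
 "path_lsc m V \<longleftrightarrow> (\<forall>A a B b d. wc m A a \<longrightarrow> wc m B b \<longrightarrow> d > 0 \<longrightarrow>
  (\<forall>n. \<forall>t\<in>{0..1}. \<forall>x. d \<le> norm (wder (linear_path (A n) (B n) t) x)) \<longrightarrow>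
  V a b \<le> liminf (\<lambda>n. V (A n) (B n)))"

lemma linear_path_0 [simp]: "linear_path a b 0 = a" and linear_path_1 [simp]: "linear_path a b 1 = b"
 by (auto simp: linear_path_def)

lemma linear_limit:
 assumes m: "2 \<le> m" and A: "wc m A a" and B: "wc m B b"
  and d: "\<And>n t x. t \<in> {0..1} ==> d \<le> norm (wder (linear_path (A n) (B n) t) x)" and t: "t \<in> {0..1}"
 shows "d \<le> norm (wder (linear_path a b t) x)"
 by (rule pc_norm_ge[OF wc_wder'(2)[OF m wc_linear_path[OF A B tendsto_const]] d[OF t]])

lemma path_lsc_linear:
 assumes m: "2 \<le> m"
 shows "path_lsc m (\<lambda>a b. path_energy m (linear_path a b))"
 unfolding path_lsc_def
proof (intro allI impI)
 fix A a B b and d :: real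
 assume A: "wc m A a" and B: "wc m B b" and d: "d > 0"
  and dl: "\<forall>n. \<forall>t\<in>{0..1}. \<forall>x. d \<le> norm (wder (linear_path (A n) (B n) t) x)"
 note SA = wc_Sob_seq[OF A] and SB = wc_Sob_seq[OF B] and Sa = wc_Sob[OF A] and Sb = wc_Sob[OF B]
 have dn: "d \<le> norm (wder (linear_path (A n) (B n) t) x)" if "t \<in> {0..1}" for n t x using dl that by blast
 have dlim: "d \<le> norm (wder (linear_path a b t) x)" if "t \<in> {0..1}" for t x
  by (rule linear_limit[OF m A B dn that])
 have I: "\<forall>t\<in>{0..1}. linear_path a b t \<in> Imm m"
  by (intro ballI Imm_lowerI[OF m Sob_linear_path[OF Sa Sb] d] dlim)
 have In: "\<forall>t\<in>{0..1}. linear_path (A n) (B n) t \<in> Imm m" for n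
  by (intro ballI Imm_lowerI[OF m Sob_linear_path[OF SA SB] d] dn)
 have e: "path_energy m (linear_path a b) = (\<integral>\<^sup>+t. ennreal (gm m (linear_path a b t) (\<lambda>x. b x - a x)) * indicator {0..1} t \<partial>lborel)"
  using I by (subst path_energy_linear[OF m Sa Sb]) simp
 have en: "path_energy m (linear_path (A n) (B n)) = (\<integral>\<^sup>+t. ennreal (gm m (linear_path (A n) (B n) t) (\<lambda>x. B n x - A n x)) * indicator {0..1} t \<partial>lborel)" for n
  using In[of n] by (subst path_energy_linear[OF m SA SB]) simp
 have "path_energy m (linear_path a b) \<le>
  (\<integral>\<^sup>+t. liminf (\<lambda>n. ennreal (gm m (linear_path (A n) (B n) t) (\<lambda>x. B n x - A n x)) * indicator {0..1} t) \<partial>lborel)"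
  unfolding e
 proof (rule nn_integral_mono)
  fix t :: real
  show "ennreal (gm m (linear_path a b t) (\<lambda>x. b x - a x)) * indicator {0..1} t
   \<le> liminf (\<lambda>n. ennreal (gm m (linear_path (A n) (B n) t) (\<lambda>x. B n x - A n x)) * indicator {0..1} t)"
  proof (cases "t \<in> {0..1}")
   case True
   then show ?thesis
    using gm_lsc[OF m wc_linear_path[OF A B tendsto_const] wc_diff[OF B A] d dn[OF True]] by simp
  qed simp
 qed
 also have "\<dots> \<le> liminf (\<lambda>n. path_energy m (linear_path (A n) (B n)))"
  unfolding en by (rule nn_integral_liminf) (use gm_measurable[OF m SA SB d dn] in simp)
 finally show "path_energy m (linear_path a b) \<le> liminf (\<lambda>n. path_energy m (linear_path (A n) (B n)))" .
qed

text \<open>Induction along the discrete path: if the curves with index \<open>k\<close> converge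
  and have speeds bounded below, coercivity and \<open>energy_compact\<close> pass both properties
  on to index \<open>Suc k\<close>. The speed bounds on the linear paths in between are recorded for
  the sake of \<open>path_lsc\<close>.\<close>

lemma minimizing_sequence_compact:
 fixes V :: "('d::finite) curve => 'd curve => ennreal"
 assumes m: "2 \<le> m" and cA: "cA \<in> Imm m" and co: "coercive m V"
  and c: "\<And>n. discrete_path m K (c n)" "\<And>n. c n 0 = cA"
  and E: "\<forall>n. \<forall>k<K. V (c n k) (c n (Suc k)) \<le> ennreal E" "E \<ge> 0"
 shows "k \<le> K ==> \<exists>r. strict_mono (r :: nat => nat) \<and>
  (\<forall>i\<le>k. \<exists>u \<delta>. wc m (\<lambda>n. c (r n) i) u \<and> \<delta> > 0 \<and> (\<forall>n x. \<delta> \<le> norm (wder (c (r n) i) x))) \<and>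
  (\<forall>i<k. \<exists>d>0. \<forall>n. \<forall>t\<in>{0..1}. \<forall>x. d \<le> norm (wder (linear_path (c (r n) i) (c (r n) (Suc i)) t) x))"
proof (induction k)
 case 0
 obtain d where "d > 0" "\<And>x. norm (wder cA x) \<ge> d" using Imm_lower_bound[OF m cA] by blast
 then show ?case using cA m c(2)
  by (intro exI[of _ "\<lambda>n. n"]) (auto simp: Imm_iff strict_mono_def intro!: exI[of _ cA] exI[of _ d])
next
 case (Suc k)
 then obtain r where r: "strict_mono (r :: nat => nat)"
  and ri: "\<And>i. i \<le> k ==> \<exists>u \<delta>. wc m (\<lambda>n. c (r n) i) u \<and> \<delta> > 0 \<and> (\<forall>n x. \<delta> \<le> norm (wder (c (r n) i) x))"
  and rd: "\<And>i. i < k ==> \<exists>d>0. \<forall>n. \<forall>t\<in>{0..1}. \<forall>x. d \<le> norm (wder (linear_path (c (r n) i) (c (r n) (Suc i)) t) x)"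
  by auto
 obtain u \<delta> where u: "wc m (\<lambda>n. c (r n) k) u" "\<delta> > 0" "\<And>n x. \<delta> \<le> norm (wder (c (r n) k) x)" using ri[of k] by blast
 have I: "c n i \<in> Imm m" if "i \<le> K" for n i using c(1)[of n] that by (simp add: discrete_path_def)
 have S: "Sob m (c n i)" if "i \<le> K" for n i using I[OF that] m by (simp add: Imm_iff)
 have pe: "path_energy m (linear_path (c n k) (c n (Suc k))) \<le> ennreal E" for n
  using co I Suc.prems E(1)[rule_format, of k n] unfolding coercive_def by (meson Suc_leD Suc_le_lessD order_trans)
 have imm: "\<forall>t\<in>{0..1}. linear_path (c n k) (c n (Suc k)) t \<in> Imm m" for n
  using pe[of n] S Suc.prems by (subst (asm) path_energy_linear[OF m]) (auto split: if_splits simp: top_unique)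
 have en: "(\<integral>\<^sup>+t. ennreal (gm m (linear_path (c n k) (c n (Suc k)) t) (\<lambda>x. c n (Suc k) x - c n k x)) * indicator {0..1} t \<partial>lborel) \<le> ennreal E" for n
  using pe[of n] S Suc.prems imm[of n] by (subst (asm) path_energy_linear[OF m]) auto
 obtain s b d where s: "strict_mono (s :: nat => nat)" "wc m (\<lambda>n. c (r (s n)) (Suc k)) b" "d > 0"
  "\<And>n t x. t \<in> {0..1} ==> d \<le> norm (wder (linear_path (c (r n) k) (c (r n) (Suc k)) t) x)"
  by (rule energy_compact[OF m u(1), of "\<lambda>n. c (r n) (Suc k)" E \<delta>]) (use S Suc.prems imm en E(2) u in auto)
 have "\<exists>u \<delta>. wc m (\<lambda>n. c (r (s n)) i) u \<and> \<delta> > 0 \<and> (\<forall>n x. \<delta> \<le> norm (wder (c (r (s n)) i) x))" if "i \<le> Suc k" for i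
 proof (cases "i = Suc k")
  case True
  have "d \<le> norm (wder (c (r (s n)) (Suc k)) x)" for n x using s(4)[of 1 "s n" x] by simp
  then show ?thesis using True s(2,3) by blast
 next
  case False
  then have "i \<le> k" using that by simp
  from ri[OF this] obtain u \<delta> where "wc m (\<lambda>n. c (r n) i) u" "\<delta> > 0" "\<forall>n x. \<delta> \<le> norm (wder (c (r n) i) x)"
   by (elim exE conjE) (rule that)
  then show ?thesis using wc_subseq[OF _ s(1)] by blast
 qed
 moreover have "\<exists>d>0. \<forall>n. \<forall>t\<in>{0..1}. \<forall>x. d \<le> norm (wder (linear_path (c (r (s n)) i) (c (r (s n)) (Suc i)) t) x)" if "i < Suc k" for i
 proof (cases "i = k")
  case True
  then show ?thesis using s(3,4) by blast
 next
  case False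
  then show ?thesis using rd[of i] that by auto
 qed
 moreover have "strict_mono (\<lambda>n. r (s n))" using strict_mono_o[OF r s(1)] by (simp add: o_def)
 ultimately show ?case by (intro exI[of _ "\<lambda>n. r (s n)"]) blast
qed

lemma minimizer_exists:
 fixes V :: "('d::finite) curve => 'd curve => ennreal"
 assumes m: "2 \<le> m" and cA: "cA \<in> Imm m" and co: "coercive m V" and lsc: "path_lsc m V"
  and WV: "\<And>a b. a \<in> Imm m ==> b \<in> Imm m ==> W a b = enn2ereal (V a b)"
  and B: "\<And>U u. (\<And>n. U n \<in> B) ==> wc m U u ==> u \<in> Imm m ==> u \<in> B"
  and ex: "\<exists>c. discrete_path m K c \<and> c 0 = cA \<and> c K \<in> B \<and> \<bar>discrete_energy W K c\<bar> \<noteq> \<infinity>"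
 shows "\<exists>c. discrete_path m K c \<and> c 0 = cA \<and> c K \<in> B \<and>
  (\<forall>c'. discrete_path m K c' \<and> c' 0 = cA \<and> c' K \<in> B \<longrightarrow> discrete_energy W K c \<le> discrete_energy W K c')"
proof (cases "K = 0")
 \<comment> \<open>For \<open>K = 0\<close> the factor \<open>K\<close> and the empty sum make every
   discrete energy zero, so the given path is already a minimizer.\<close>
 case True
 then show ?thesis using ex by (auto simp: discrete_energy_def)
next
 case False
 \<comment> \<open>Summation over pairs counts each term \<open>K\<close> times. This absorbs the
   factor \<open>K\<close> of the discrete energy into one finite sum, to which
   \<open>sum_liminf_le\<close> applies directly.\<close>
 define D where "D c = (\<Sum>p\<in>{..<K} \<times> {..<K}. V (c (snd p)) (c (Suc (snd p))))" for c :: "nat => 'd curve"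
 have DE: "discrete_energy W K c = enn2ereal (D c)" if "discrete_path m K c" for c
 proof -
  have I: "c i \<in> Imm m" if "i \<le> K" for i using \<open>discrete_path m K c\<close> that by (simp add: discrete_path_def)
  have "(\<Sum>k=1..K. W (c (k - 1)) (c k)) = (\<Sum>k<K. W (c k) (c (Suc k)))"
   by (rule sum.reindex_bij_witness[of _ Suc "\<lambda>k. k - 1"]) auto
  also have "\<dots> = (\<Sum>k<K. enn2ereal (V (c k) (c (Suc k))))" by (intro sum.cong refl WV I) auto
  also have "\<dots> = enn2ereal (\<Sum>k<K. V (c k) (c (Suc k)))" by (rule sum_enn2ereal) simp
  finally have "discrete_energy W K c = enn2ereal (of_nat K) * enn2ereal (\<Sum>k<K. V (c k) (c (Suc k)))"
   by (simp add: discrete_energy_def ennreal_of_nat_eq_real_of_nat enn2ereal_ennreal)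
  also have "\<dots> = enn2ereal (of_nat K * (\<Sum>k<K. V (c k) (c (Suc k))))" by (simp add: times_ennreal.rep_eq)
  also have "of_nat K * (\<Sum>k<K. V (c k) (c (Suc k))) = D c"
  proof -
   have "D c = (\<Sum>(j, k)\<in>{..<K} \<times> {..<K}. V (c k) (c (Suc k)))"
    unfolding D_def by (intro sum.cong) auto
   also have "\<dots> = (\<Sum>j<K. \<Sum>k<K. V (c k) (c (Suc k)))" by (rule sum.cartesian_product[symmetric])
   finally show ?thesis by simp
  qed
  finally show ?thesis .
 qed
 define Q where "Q = {c. discrete_path m K c \<and> c 0 = cA \<and> c K \<in> B}"
 obtain c0 where c0: "c0 \<in> Q" "\<bar>discrete_energy W K c0\<bar> \<noteq> \<infinity>" using ex by (auto simp: Q_def)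
 have D0: "D c0 < \<infinity>" using c0 DE[of c0] by (auto simp: Q_def less_top[symmetric] top_ennreal.rep_eq)
 define I where "I = Inf (D ` Q)"
 have "D ` Q \<noteq> {}" using c0 by auto
 from ennreal_Inf_countable_INF[OF this] obtain f :: "nat => ennreal"
  where f: "decseq f" "range f \<subseteq> D ` Q" "I = (INF i. f i)" by (auto simp: I_def)
 have fI: "f \<longlonglongrightarrow> I" using LIMSEQ_INF[OF f(1)] f(3) by simp
 have "I \<le> D c0" unfolding I_def using c0 by (intro Inf_lower) auto
 then have "I < \<infinity>" using D0 by (rule le_less_trans)
 \<comment> \<open>Only finitely many of the values approaching the infimum can be infinite;
   starting behind them gives the common finite bound \<open>E\<close>.\<close>
 from order_tendstoD(2)[OF fI this] obtain N where N: "f n < \<infinity>" if "n \<ge> N" for n by (auto simp: eventually_sequentially)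
 have "\<forall>n. \<exists>c. c \<in> Q \<and> D c = f (n + N)"
 proof
  fix n
  have "f (n + N) \<in> D ` Q" by (rule subsetD[OF f(2)]) (rule rangeI)
  then show "\<exists>c. c \<in> Q \<and> D c = f (n + N)" by (rule imageE) (auto intro: exI)
 qed
 from choice[OF this] obtain c where "\<forall>n. c n \<in> Q \<and> D (c n) = f (n + N)" ..
 then have c: "\<And>n. c n \<in> Q" "\<And>n. D (c n) = f (n + N)" by simp_all
 define E where "E = enn2real (f N)"
 have fE: "f (n + N) \<le> ennreal E" for n
  using decseqD[OF f(1), of N "n + N"] N[of N] by (simp add: E_def)
 have VE: "V (c n k) (c n (Suc k)) \<le> ennreal E" if k: "k < K" for n k
 proof -
  have "V (c n k) (c n (Suc k)) \<le> D (c n)"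
   unfolding D_def using k member_le_sum[of "(0, k)" "{..<K} \<times> {..<K}" "\<lambda>p. V (c n (snd p)) (c n (Suc (snd p)))"] by auto
  then show ?thesis using c(2)[of n] fE[of n] by simp
 qed
 have cp: "discrete_path m K (c n)" "c n 0 = cA" "c n K \<in> B" for n using c(1)[of n] by (auto simp: Q_def)
 have "0 \<le> E" by (simp add: E_def)
 have VE': "\<forall>n. \<forall>k<K. V (c n k) (c n (Suc k)) \<le> ennreal E" by (intro allI impI VE)
 from minimizing_sequence_compact[where c = c and E = E and K = K and V = V and cA = cA and k = K,
   OF m cA co cp(1,2) VE' \<open>0 \<le> E\<close> order_refl]
 obtain r where r: "strict_mono (r :: nat => nat)"
  and ri: "\<forall>i\<le>K. \<exists>u \<delta>. wc m (\<lambda>n. c (r n) i) u \<and> \<delta> > 0 \<and> (\<forall>n x. \<delta> \<le> norm (wder (c (r n) i) x))"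
  and rd: "\<forall>i<K. \<exists>d>0. \<forall>n. \<forall>t\<in>{0..1}. \<forall>x. d \<le> norm (wder (linear_path (c (r n) i) (c (r n) (Suc i)) t) x)"
  by (elim exE conjE) (rule that)
 obtain u where u: "\<And>i. i \<le> K ==> wc m (\<lambda>n. c (r n) i) (u i)"
  and ud: "\<And>i. i \<le> K ==> \<exists>\<delta>>0. \<forall>n x. \<delta> \<le> norm (wder (c (r n) i) x)"
  using ri by metis
 have uI: "u i \<in> Imm m" if i: "i \<le> K" for i
 proof -
  obtain \<delta> where \<delta>: "\<delta> > 0" "\<And>n x. \<delta> \<le> norm (wder (c (r n) i) x)" using ud[OF i] by blast
  show ?thesis by (rule Imm_lowerI[OF m wc_Sob[OF u[OF i]] \<delta>(1) pc_norm_ge[OF wc_wder'(2)[OF m u[OF i]] \<delta>(2)]])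
 qed
 have u0: "u 0 = cA"
 proof
  fix x
  have "(\<lambda>n. c (r n) 0 x) \<longlonglongrightarrow> u 0 x" using m by (intro pcD(2) wc_pc[OF u]) auto
  then show "u 0 x = cA x" by (simp add: cp(2) LIMSEQ_const_iff)
 qed
 have uB: "u K \<in> B" using B[of "\<lambda>n. c (r n) K" "u K", OF cp(3) u uI] by simp
 have uQ: "u \<in> Q" using uI u0 uB by (auto simp: Q_def discrete_path_def)
 have "D u \<le> (\<Sum>p\<in>{..<K} \<times> {..<K}. liminf (\<lambda>n. V (c (r n) (snd p)) (c (r n) (Suc (snd p)))))"
  unfolding D_def
 proof (rule sum_mono)
  fix p assume "p \<in> {..<K} \<times> {..<K}"
  then have k: "snd p < K" by auto
  obtain d where "d > 0" "\<forall>n. \<forall>t\<in>{0..1}. \<forall>x. d \<le> norm (wder (linear_path (c (r n) (snd p)) (c (r n) (Suc (snd p))) t) x)"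
   using rd k by blast
  then show "V (u (snd p)) (u (Suc (snd p))) \<le> liminf (\<lambda>n. V (c (r n) (snd p)) (c (r n) (Suc (snd p))))"
   using lsc[unfolded path_lsc_def, rule_format, OF u u, of "snd p" "Suc (snd p)" d] k by auto
 qed
 also have "\<dots> \<le> liminf (\<lambda>n. D (c (r n)))" unfolding D_def by (rule sum_liminf_le) simp
 also have "\<dots> = I"
 proof -
  have "(\<lambda>n. f (n + N)) \<longlonglongrightarrow> I" using fI by (rule LIMSEQ_ignore_initial_segment)
  from LIMSEQ_subseq_LIMSEQ[OF this r] have "(\<lambda>n. D (c (r n))) \<longlonglongrightarrow> I" by (simp add: c(2) o_def)
  from lim_imp_Liminf[OF trivial_limit_sequentially this] show ?thesis .
 qed
 finally have "D u \<le> I" .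
 have "discrete_energy W K u \<le> discrete_energy W K c'" if "discrete_path m K c'" "c' 0 = cA" "c' K \<in> B" for c'
 proof -
  have "I \<le> D c'" unfolding I_def using that by (intro Inf_lower) (auto simp: Q_def)
  then show ?thesis using \<open>D u \<le> I\<close> that(1) uQ by (simp add: DE Q_def less_eq_ennreal.rep_eq[symmetric])
 qed
 then show ?thesis using uQ by (auto simp: Q_def intro!: exI[of _ u])
qed

section \<open>Reparameterization classes are closed\<close>

text \<open>A classical primitive \<open>G\<close> of \<open>v\<close> on the whole line agrees with
  \<open>u\<close> up to a constant on one period. As \<open>u\<close> is periodic, so is
  \<open>G\<close>, and the agreement extends to the line.\<close>

lemma cder_has_vector_derivative:
 fixes u v :: "real => 'a::euclidean_space"
 assumes u: "cder u v" and c: "continuous_on UNIV v" and p: "periodic v"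
 shows "(u has_vector_derivative v x) (at x)"
proof -
 have "\<exists>G. \<forall>x::real. -\<infinity> < ereal x \<longrightarrow> ereal x < \<infinity> \<longrightarrow> (G has_vector_derivative v x) (at x)"
  by (rule einterval_antiderivative) (use c in \<open>auto simp: continuous_on_eq_continuous_at\<close>)
 then obtain G where G: "\<And>x. (G has_vector_derivative v x) (at x)" by auto
 have GI: "(v has_integral (G y - G x)) {x..y}" if "x \<le> y" for x y
  by (rule fundamental_theorem_of_calculus[OF that has_vector_derivative_at_within[OF G]])
 have uG: "u x = G x + (u 0 - G 0)" if "x \<in> {0..2*pi}" for x
  using has_integral_unique[OF GI[of 0 x] acD(2)[OF cderD(2)[OF u], of 0 x]] that by (auto simp: algebra_simps)
 have Gp: "G (x + 2*pi) = G x" for x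
 proof -
  have "((\<lambda>x. G (x + 2*pi) - G x) has_vector_derivative 0) (at x)" for x
  proof -
   have "((\<lambda>x. G (x + 2*pi)) has_vector_derivative v (x + 2*pi)) (at x)"
   proof -
    have "((\<lambda>x. x + 2*pi) has_real_derivative 1) (at x)" by (auto intro!: derivative_eq_intros)
    then have "((\<lambda>x. x + 2*pi) has_vector_derivative 1) (at x)"
     by (simp add: has_real_derivative_iff_has_vector_derivative)
    from vector_diff_chain_at[OF this G] show ?thesis by (simp add: o_def)
   qed
   from has_vector_derivative_diff[OF this G[of x]] show ?thesis using p by (simp add: periodic_def)
  qed
  then obtain k where k: "\<And>x. G (x + 2*pi) - G x = k"
   using has_vector_derivative_zero_constant[of UNIV "\<lambda>x. G (x + 2*pi) - G x"] by auto
  have "u (0 + 2*pi) = u 0" using cderD(1)[OF u] unfolding periodic_def by blast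
  then have "k = 0" using k[of 0] uG[of "2*pi"] by simp
  then show ?thesis using k[of x] by simp
 qed
 have "periodic G" using Gp by (simp add: periodic_def)
 have "u x = G x + (u 0 - G 0)" for x
 proof -
  obtain k where k: "x + 2 * pi * of_int k \<in> {0..<2*pi}" by (rule periodic_reduce)
  then show ?thesis
   using uG[of "x + 2 * pi * of_int k"] periodic_shift_int[OF cderD(1)[OF u], of x k] periodic_shift_int[OF \<open>periodic G\<close>, of x k] by simp
 qed
 then have "u = (\<lambda>x. G x + (u 0 - G 0))" by blast
 moreover have "((\<lambda>x. G x + (u 0 - G 0)) has_vector_derivative v x) (at x)"
  using has_vector_derivative_add_const[of G "u 0 - G 0"] G by blast
 ultimately show ?thesis by simp
qed

lemma Sob_has_vector_derivative:
 assumes "2 \<le> m" "Sob m u"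
 shows "(u has_vector_derivative wder u x) (at x)"
 using wder_regular[OF assms] by (intro cder_has_vector_derivative) auto

lemma has_vector_derivative_increment_le:
 fixes u v :: "real => 'a::euclidean_space"
 assumes d: "\<And>t. t \<in> {x..y} ==> (u has_vector_derivative v t) (at t)" and xy: "x \<le> y"
  and M: "\<And>t. t \<in> {x..y} ==> norm (v t - w) \<le> M"
 shows "norm (u y - u x - (y - x) *\<^sub>R w) \<le> M * (y - x)"
proof -
 have "(v has_integral (u y - u x)) {x..y}"
  by (rule fundamental_theorem_of_calculus[OF xy has_vector_derivative_at_within[OF d]])
 then have h: "((\<lambda>t. v t - w) has_integral (u y - u x - (y - x) *\<^sub>R w)) {x..y}"
  using has_integral_const_real[of w x y] xy by (intro has_integral_diff) auto
 have "M \<ge> 0" using xy by (intro order_trans[OF norm_ge_zero M[of x]]) simp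
 then show ?thesis using has_integral_bound_real[OF _ _ h, of M "{}"] M xy by simp
qed

lemma Sob_lipschitz:
 assumes m: "2 \<le> m" and u: "Sob m u" and M: "\<And>th. norm (wder u th) \<le> M"
 shows "norm (u y - u x) \<le> M * \<bar>y - x\<bar>"
proof -
 have *: "norm (u y - u x) \<le> M * (y - x)" if "x \<le> y" for x y
  using has_vector_derivative_increment_le[OF Sob_has_vector_derivative[OF m u] that, of 0 M] M by simp
 show ?thesis using *[of x y] *[of y x] by (cases "x \<le> y") (auto simp: norm_minus_commute)
qed

text \<open>On short intervals uniform continuity lets the derivative vary by less than half its
  minimal norm \<open>d\<close>, which leaves \<open>d/2\<close> as a lower Lipschitz constant. The
  interval up to \<open>4*pi\<close> accommodates every interval of length below 1 that begins in
  the first period.\<close>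

lemma Imm_locally_injective:
 assumes m: "2 \<le> m" and u: "u \<in> Imm m"
 obtains \<rho> \<delta> where "\<rho> > 0" "\<delta> > 0" "\<And>x y. \<bar>x - y\<bar> < \<rho> ==> \<delta> * \<bar>x - y\<bar> \<le> norm (u x - u y)"
proof -
 have S: "Sob m u" using u m by (simp add: Imm_iff)
 note r = wder_regular[OF m S]
 obtain d where d: "d > 0" "\<And>th. norm (wder u th) \<ge> d" using Imm_lower_bound[OF m u] by blast
 have "uniformly_continuous_on {0..4*pi} (wder u)"
  by (intro compact_uniformly_continuous continuous_on_subset[OF r(1)]) auto
 then obtain \<rho>0 where \<rho>0: "\<rho>0 > 0" "\<And>s t. s \<in> {0..4*pi} ==> t \<in> {0..4*pi} ==> dist s t < \<rho>0 ==> dist (wder u s) (wder u t) < d/2"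
  using d(1) unfolding uniformly_continuous_on_def by (metis half_gt_zero_iff)
 define \<rho> where "\<rho> = min \<rho>0 1"
 have *: "(d/2) * (y - x) \<le> norm (u y - u x)" if xy: "x \<le> y" "y - x < \<rho>" for x y
 proof -
  obtain k where k: "x + 2 * pi * of_int k \<in> {0..<2*pi}" by (rule periodic_reduce)
  define s where "s = 2 * pi * of_int k"
  have sh: "u (t + s) = u t" "wder u (t + s) = wder u t" for t
   unfolding s_def using periodic_shift_int[OF r(2)] periodic_shift_int[OF wc_regular(4)[OF S]] by auto
  have near: "norm (wder u t - wder u (x + s)) \<le> d/2" if "t \<in> {x + s..y + s}" for t
  proof -
   have "dist (wder u t) (wder u (x + s)) < d/2"
    using k that xy pi_gt3 by (intro \<rho>0(2)) (auto simp: s_def \<rho>_def dist_real_def)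
   then show ?thesis by (simp add: dist_norm)
  qed
  have "norm (u (y + s) - u (x + s) - (y + s - (x + s)) *\<^sub>R wder u (x + s)) \<le> d/2 * (y + s - (x + s))"
   using xy by (intro has_vector_derivative_increment_le[where v = "wder u", OF Sob_has_vector_derivative[OF m S] _ near]) auto
  then have "norm ((y - x) *\<^sub>R wder u x) - norm (u y - u x) \<le> d/2 * (y - x)"
   using norm_triangle_ineq2[of "(y - x) *\<^sub>R wder u x" "u y - u x"] by (simp add: sh norm_minus_commute)
  moreover have "norm ((y - x) *\<^sub>R wder u x) \<ge> (y - x) * d" using xy d(2)[of x] by (auto intro: mult_left_mono)
  ultimately show ?thesis by (simp add: algebra_simps)
 qed
 show ?thesis
 proof (rule that[of \<rho> "d/2"])
  show "\<rho> > 0" "d/2 > 0" using \<rho>0 d by (auto simp: \<rho>_def)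
  show "d/2 * \<bar>x - y\<bar> \<le> norm (u x - u y)" if "\<bar>x - y\<bar> < \<rho>" for x y
   using *[of x y] *[of y x] that by (cases "x \<le> y") (auto simp: norm_minus_commute)
 qed
qed

text \<open>Injectivity on the circle makes the monotone lift strictly monotone. Its increment over
  one turn is a positive multiple of 2 pi, and it is a single turn, since otherwise some angle
  strictly inside the turn would have the same image point as the initial one. The normalization at
  0 is what makes families of lifts bounded.\<close>

lemma circle_reparam_lift:
 assumes "circle_reparam \<phi>"
 obtains \<Phi> where "continuous_on UNIV \<Phi>" "strict_mono \<Phi>" "\<And>th. \<Phi> (th + 2 * pi) = \<Phi> th + 2 * pi"
  "\<And>th. \<phi> (cis th) = cis (\<Phi> th)" "\<Phi> 0 \<in> {0..<2*pi}"
proof -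
 obtain \<Psi> where \<Psi>: "continuous_on UNIV \<Psi>" "mono \<Psi>" "\<And>th. \<phi> (cis th) = cis (\<Psi> th)"
  using assms by (auto simp: circle_reparam_def)
 have inj: "cis x = cis y" if "\<phi> (cis x) = \<phi> (cis y)" for x y
  using assms that by (auto simp: circle_reparam_def bij_betw_def dest: inj_onD)
 have ne: "\<phi> (cis x) \<noteq> \<phi> (cis y)" if "x < y" "y < x + 2 * pi" for x y
  using inj[of x y] cis_inj[of x y] that by auto
 have sm: "strict_mono \<Psi>"
 proof (rule strict_monoI)
  fix x y :: real assume xy: "x < y"
  define z where "z = min y (x + 1)"
  have "x < z" "z < x + 2 * pi" using xy min.cobounded2[of y "x + 1"] pi_gt3 by (simp_all add: z_def)
  from ne[OF this] have "\<Psi> x \<noteq> \<Psi> z" using \<Psi>(3) by auto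
  moreover have "\<Psi> x \<le> \<Psi> z" "\<Psi> z \<le> \<Psi> y" using \<Psi>(2) xy by (auto simp: mono_def z_def)
  ultimately show "\<Psi> x < \<Psi> y" by linarith
 qed
 have per: "\<Psi> (th + 2 * pi) = \<Psi> th + 2 * pi" for th
 proof -
  have "cis (th + 2 * pi) = cis th" unfolding cis_eq_iff by (rule exI[of _ 1]) simp
  then have "cis (\<Psi> (th + 2 * pi)) = cis (\<Psi> th)" using \<Psi>(3) by metis
  then obtain k :: int where k: "\<Psi> (th + 2 * pi) = \<Psi> th + 2 * pi * of_int k" unfolding cis_eq_iff by blast
  have "\<Psi> th < \<Psi> (th + 2 * pi)" using sm by (auto simp: strict_mono_def)
  then have "0 < 2 * pi * of_int k" using k by simp
  then have k1: "k \<ge> 1" by (simp add: zero_less_mult_iff)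
  have "\<not> k \<ge> 2"
  proof
   assume "k \<ge> 2"
   then have "(2::real) \<le> of_int k" by simp
   then have "2 * pi * 2 \<le> 2 * pi * of_int k" by (intro mult_left_mono) auto
   then have le: "\<Psi> th + 2 * pi < \<Psi> (th + 2 * pi)" using k pi_gt_zero by linarith
   then obtain t where t: "th \<le> t" "t \<le> th + 2 * pi" "\<Psi> t = \<Psi> th + 2 * pi"
    using IVT'[of \<Psi> th "\<Psi> th + 2 * pi" "th + 2 * pi"] continuous_on_subset[OF \<Psi>(1)] by auto
   have "t \<noteq> th" "t \<noteq> th + 2 * pi" using t(3) le by auto
   then have "\<phi> (cis th) \<noteq> \<phi> (cis t)" using t by (intro ne) auto
   moreover have "cis (\<Psi> t) = cis (\<Psi> th)" unfolding t(3) cis_eq_iff by (rule exI[of _ 1]) simp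
   ultimately show False using \<Psi>(3) by simp
  qed
  then have "k = 1" using k1 by simp
  then show ?thesis using k by simp
 qed
 obtain j where j: "\<Psi> 0 + 2 * pi * of_int j \<in> {0..<2*pi}" by (rule periodic_reduce)
 define \<Phi> where "\<Phi> th = \<Psi> th + 2 * pi * of_int j" for th
 have c\<Phi>: "cis (\<Phi> th) = cis (\<Psi> th)" for th unfolding cis_eq_iff \<Phi>_def by blast
 show ?thesis
 proof (rule that[of \<Phi>])
  show "continuous_on UNIV \<Phi>" unfolding \<Phi>_def[abs_def] by (intro continuous_intros \<Psi>(1))
  show "strict_mono \<Phi>" using sm by (simp add: \<Phi>_def strict_mono_def)
  show "\<Phi> (th + 2 * pi) = \<Phi> th + 2 * pi" for th by (simp add: \<Phi>_def per)
  show "\<phi> (cis th) = cis (\<Phi> th)" for th by (simp add: c\<Phi> \<Psi>(3))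
  show "\<Phi> 0 \<in> {0..<2*pi}" using j by (simp add: \<Phi>_def)
 qed
qed

text \<open>Two charts give continuity: \<open>Arg\<close> jumps at the negative real axis, where
  \<open>Arg (- z) + pi\<close> serves as the angle instead. Both yield the same map, because the
  lift commutes with full turns.\<close>

lemma circle_reparam_of_lift:
 assumes c: "continuous_on UNIV \<Phi>" and sm: "strict_mono \<Phi>" and per: "\<And>th. \<Phi> (th + 2 * pi) = \<Phi> th + 2 * pi"
 obtains \<phi> where "circle_reparam \<phi>" "\<And>th. \<phi> (cis th) = cis (\<Phi> th)"
proof -
 have "periodic (\<lambda>th. \<Phi> th - th)" using per by (simp add: periodic_def)
 from periodic_shift_int[OF this] have perk: "\<Phi> (th + 2 * pi * of_int k) = \<Phi> th + 2 * pi * of_int k" for th k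
  by (simp add: algebra_simps)
 have eq: "cis (\<Phi> x) = cis (\<Phi> y) \<longleftrightarrow> cis x = cis y" for x y
 proof -
  have "cis (\<Phi> x) = cis (\<Phi> y) \<longleftrightarrow> (\<exists>k::int. \<Phi> x = \<Phi> (y + 2 * pi * of_int k))" by (simp add: cis_eq_iff perk)
  also have "\<dots> \<longleftrightarrow> cis x = cis y" using strict_mono_eq[OF sm] by (simp add: cis_eq_iff)
  finally show ?thesis .
 qed
 define \<phi> where "\<phi> z = cis (\<Phi> (Arg z))" for z
 have cA: "cis (Arg z) = z" if "z \<in> sphere 0 1" for z
  using cis_Arg[of z] that by (cases "z = 0") (auto simp: sgn_div_norm)
 have \<phi>: "\<phi> (cis th) = cis (\<Phi> th)" for th unfolding \<phi>_def eq by (rule cA) simp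
 have \<phi>2: "\<phi> z = cis (\<Phi> (Arg (- z) + pi))" if "z \<in> sphere 0 1" for z
 proof -
  have "z = cis (Arg (- z) + pi)" using cA[of "- z"] that by (simp add: minus_cis[symmetric])
  then show ?thesis using \<phi> by metis
 qed
 have cP: "isCont (\<lambda>z. cis (\<Phi> (f z))) z" if "isCont f z" for f :: "complex => real" and z
 proof -
  have "isCont \<Phi> (f z)" using c by (simp add: continuous_on_eq_continuous_at)
  from isCont_o2[OF that this] have "isCont (\<lambda>z. \<Phi> (f z)) z" .
  moreover have "isCont cis (\<Phi> (f z))"
   using continuous_on_cis[OF continuous_on_id, of UNIV] by (simp add: continuous_on_eq_continuous_at)
  ultimately show ?thesis by (rule isCont_o2)
 qed
 have "continuous_on (sphere 0 1) \<phi>"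
  unfolding continuous_on_eq_continuous_within
 proof
  fix z :: complex assume z: "z \<in> sphere 0 1"
  show "continuous (at z within sphere 0 1) \<phi>"
  proof (cases "z \<in> \<real>\<^sub>\<le>\<^sub>0")
   case False
   then have "isCont (\<lambda>z. cis (\<Phi> (Arg z))) z" by (intro cP continuous_at_Arg)
   then show ?thesis unfolding \<phi>_def[abs_def] by (rule continuous_at_imp_continuous_at_within)
  next
   case True
   then have "- z \<notin> \<real>\<^sub>\<le>\<^sub>0" using z by (auto simp: complex_nonpos_Reals_iff cmod_def)
   then have "isCont Arg (- z)" by (rule continuous_at_Arg)
   have "isCont (\<lambda>z. - z) z" by (intro continuous_intros)
   from isCont_o2[OF this \<open>isCont Arg (- z)\<close>] have "isCont (\<lambda>z. Arg (- z)) z" .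
   then have "isCont (\<lambda>z. Arg (- z) + pi) z" by (intro continuous_intros)
   then have "isCont (\<lambda>z. cis (\<Phi> (Arg (- z) + pi))) z" by (rule cP)
   then have "continuous (at z within sphere 0 1) (\<lambda>z. cis (\<Phi> (Arg (- z) + pi)))" by (rule continuous_at_imp_continuous_at_within)
   then show ?thesis
    by (rule continuous_transform_within[OF _ zero_less_one z]) (simp add: \<phi>2)
  qed
 qed
 moreover have "bij_betw \<phi> (sphere 0 1) (sphere 0 1)"
  unfolding bij_betw_def
 proof
  show "inj_on \<phi> (sphere 0 1)"
  proof (rule inj_onI)
   fix x y assume "x \<in> sphere 0 1" "y \<in> sphere 0 1" "\<phi> x = \<phi> y"
   then show "x = y" using \<phi>[of "Arg x"] \<phi>[of "Arg y"] eq cA by metis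
  qed
  show "\<phi> ` sphere 0 1 = sphere 0 1"
  proof
   show "sphere 0 1 \<subseteq> \<phi> ` sphere 0 1"
   proof
    fix w :: complex assume w: "w \<in> sphere 0 1"
    obtain k where k: "Arg w - \<Phi> 0 + 2 * pi * of_int k \<in> {0..<2*pi}" by (rule periodic_reduce)
    define y where "y = Arg w + 2 * pi * of_int k"
    have "\<Phi> 0 \<le> y" "y \<le> \<Phi> (2 * pi)" using k per[of 0] by (auto simp: y_def)
    then obtain t where "\<Phi> t = y"
     using IVT'[of \<Phi> 0 y "2 * pi"] continuous_on_subset[OF c] by auto
    moreover have "cis y = w" using cA[OF w] cis_eq_iff[of y "Arg w"] by (auto simp: y_def)
    ultimately have "w = \<phi> (cis t)" by (simp add: \<phi>)
    then show "w \<in> \<phi> ` sphere 0 1" by auto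
   qed
  qed (auto simp: \<phi>_def)
 qed
 moreover have "mono \<Phi>" using sm by (rule strict_mono_mono)
 ultimately have "circle_reparam \<phi>" unfolding circle_reparam_def using c \<phi> by blast
 then show ?thesis using that \<phi> by blast
qed

text \<open>The lifts of the reparameterizations are equi-Lipschitz: \<open>cB\<close> has a local
  lower Lipschitz constant \<open>\<delta>\<close>, and the speeds of the curves \<open>U n\<close>
  are bounded by \<open>M\<close>. A subsequence therefore converges, at rational angles and hence
  everywhere, and the limit is the lift of a reparameterization because the limit curve is an
  immersion.\<close>

lemma reparam_class_closed:
 fixes U :: "nat => ('d::finite) curve"
 assumes m: "2 \<le> m" and cB: "cB \<in> Imm m" and U: "\<And>n. U n \<in> reparam_class m cB" and lim: "wc m U u" and u: "u \<in> Imm m"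
 shows "u \<in> reparam_class m cB"
proof -
 have "\<exists>\<Phi>. continuous_on UNIV \<Phi> \<and> strict_mono \<Phi> \<and> (\<forall>th. \<Phi> (th + 2 * pi) = \<Phi> th + 2 * pi) \<and> \<Phi> 0 \<in> {0..<2*pi} \<and> (\<forall>th. U n th = cB (\<Phi> th))" for n
 proof -
  obtain \<phi> where \<phi>: "circle_reparam \<phi>" "\<And>th \<eta>. \<phi> (cis th) = cis \<eta> ==> U n th = cB \<eta>"
   using U[of n] by (auto simp: reparam_class_def)
  obtain \<Phi> where "continuous_on UNIV \<Phi>" "strict_mono \<Phi>" "\<And>th. \<Phi> (th + 2 * pi) = \<Phi> th + 2 * pi"
   "\<And>th. \<phi> (cis th) = cis (\<Phi> th)" "\<Phi> 0 \<in> {0..<2*pi}" using circle_reparam_lift[OF \<phi>(1)] by blast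
  then show ?thesis using \<phi>(2) by blast
 qed
 then obtain \<Phi> where \<Phi>: "\<And>n. continuous_on UNIV (\<Phi> n)" "\<And>n. strict_mono (\<Phi> n)" "\<And>n th. \<Phi> n (th + 2 * pi) = \<Phi> n th + 2 * pi"
  "\<And>n. \<Phi> n 0 \<in> {0..<2*pi}" "\<And>n th. U n th = cB (\<Phi> n th)" by metis
 have SB: "Sob m cB" using cB m by (simp add: Imm_iff)
 obtain \<rho> \<delta> where \<rho>: "\<rho> > 0" "\<delta> > 0" "\<And>x y. \<bar>x - y\<bar> < \<rho> ==> \<delta> * \<bar>x - y\<bar> \<le> norm (cB x - cB y)"
  using Imm_locally_injective[OF m cB] by blast
 obtain M where M: "\<And>n th. norm (wder (U n) th) \<le> M" using pcD(1)[OF wc_wder'(2)[OF m lim]] by blast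
 have M0: "M \<ge> 0" using M[of 0 0] norm_ge_zero[of "wder (U 0) 0"] by linarith
 define L where "L = M / \<delta>"
 have L0: "L \<ge> 0" using M0 \<rho> by (simp add: L_def)
 \<comment> \<open>The lower estimate for \<open>cB\<close> is available for nearby parameters only,
   so the Lipschitz bound is proved locally and propagated by bisection.\<close>
 have lip1: "\<Phi> n y - \<Phi> n x \<le> L * (y - x)" if xy: "x \<le> y" for n x y
  using xy
 proof (induction x y rule: Bolzano)
  case (local x)
  have "isCont (\<Phi> n) x" using \<Phi>(1) by (simp add: continuous_on_eq_continuous_at)
  then obtain d where d: "d > 0" "\<And>t. dist t x < d ==> dist (\<Phi> n t) (\<Phi> n x) < \<rho>/2"
   using \<rho>(1) unfolding continuous_at_eps_delta by (metis half_gt_zero_iff)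
  have "\<Phi> n b - \<Phi> n a \<le> L * (b - a)" if "a \<le> x" "x \<le> b" "b - a < d" for a b
  proof -
   have "\<bar>\<Phi> n b - \<Phi> n a\<bar> < \<rho>"
   proof -
    have "dist a x < d" "dist b x < d" using that by (auto simp: dist_real_def)
    from d(2)[OF this(1)] d(2)[OF this(2)] show ?thesis unfolding dist_real_def by linarith
   qed
   then have "\<delta> * \<bar>\<Phi> n b - \<Phi> n a\<bar> \<le> norm (U n b - U n a)" using \<rho>(3) by (simp add: \<Phi>(5))
   also have "\<dots> \<le> M * (b - a)" using Sob_lipschitz[OF m wc_Sob_seq[OF lim] M, of n b a] that by simp
   finally have "\<bar>\<Phi> n b - \<Phi> n a\<bar> \<le> L * (b - a)" using \<rho>(2) by (simp add: L_def field_simps)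
   then show ?thesis by linarith
  qed
  then show ?case using d(1) by blast
 next
  case (trans a b c)
  then show ?case by (simp add: algebra_simps)
 qed
 have lip: "\<bar>\<Phi> n y - \<Phi> n x\<bar> \<le> L * \<bar>y - x\<bar>" for n x y
 proof -
  have mo: "\<Phi> n a \<le> \<Phi> n b" if "a \<le> b" for a b using \<Phi>(2)[of n] that by (simp add: strict_mono_less_eq)
  show ?thesis
  proof (cases "x \<le> y")
   case True
   then show ?thesis using lip1[OF True, of n] mo[OF True] by simp
  next
   case False
   then have "y \<le> x" by simp
   then show ?thesis using lip1[of y x n] mo[of y x] by simp
  qed
 qed
 define S where "S = \<rat> \<inter> {0..2*pi}"
 have "countable S" unfolding S_def using countable_rat by blast
 moreover have "norm (\<Phi> n x) \<le> 2 * pi + L * (2 * pi)" if "x \<in> S" for n x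
 proof -
  have "\<bar>\<Phi> n x - \<Phi> n 0\<bar> \<le> L * (2 * pi)"
   using lip[of n x 0] mult_left_mono[OF _ L0, of "\<bar>x - 0\<bar>" "2 * pi"] that by (auto simp: S_def)
  then show ?thesis using \<Phi>(4)[of n] by auto
 qed
 ultimately obtain r where r: "strict_mono (r :: nat => nat)" "\<And>x. x \<in> S ==> \<exists>l. (\<lambda>n. \<Phi> (r n) x) \<longlonglongrightarrow> l"
  using function_convergent_subsequence[of S \<Phi>] by metis
 have conv1: "convergent (\<lambda>n. \<Phi> (r n) x)" if x: "x \<in> {0..<2*pi}" for x
 proof -
  have "Cauchy (\<lambda>n. \<Phi> (r n) x)"
  proof (rule metric_CauchyI)
   fix e :: real assume e: "e > 0"
   define h where "h = min (e / (3 * (L + 1))) (2 * pi - x)"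
   have "h > 0" using e L0 x by (simp add: h_def)
   then obtain q where q: "q \<in> \<rat>" "x < q" "q < x + h" using Rats_dense_in_real[of x "x + h"] by auto
   then have "q \<in> S" using x by (auto simp: S_def h_def)
   then have "Cauchy (\<lambda>n. \<Phi> (r n) q)" using r(2) by (auto simp: Cauchy_convergent_iff convergent_def)
   then obtain N where N: "\<And>i j. i \<ge> N ==> j \<ge> N ==> dist (\<Phi> (r i) q) (\<Phi> (r j) q) < e/3"
    using e by (meson metric_CauchyD zero_less_divide_iff zero_less_numeral)
   have cl: "\<bar>\<Phi> n x - \<Phi> n q\<bar> \<le> e/3" for n
   proof -
    have "\<bar>\<Phi> n x - \<Phi> n q\<bar> \<le> L * \<bar>x - q\<bar>" by (rule lip)
    also have "\<dots> \<le> (L + 1) * (e / (3 * (L + 1)))"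
     using q L0 e by (intro mult_mono) (auto simp: h_def)
    also have "\<dots> = e/3"
    proof -
     have "L + 1 \<noteq> 0" using L0 by simp
     from mult_divide_mult_cancel_left[OF this, of e 3] show ?thesis
      by (simp only: times_divide_eq_right mult.commute[of 3])
    qed
    finally show ?thesis .
   qed
   have "dist (\<Phi> (r i) x) (\<Phi> (r j) x) < e" if "i \<ge> N" "j \<ge> N" for i j
    using N[OF that] cl[of "r i"] cl[of "r j"] unfolding dist_real_def by linarith
   then show "\<exists>N. \<forall>i\<ge>N. \<forall>j\<ge>N. dist (\<Phi> (r i) x) (\<Phi> (r j) x) < e" by blast
  qed
  then show ?thesis by (simp add: Cauchy_convergent_iff)
 qed
 have perk: "\<Phi> n (th + 2 * pi * of_int k) = \<Phi> n th + 2 * pi * of_int k" for n th k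
 proof -
  have "periodic (\<lambda>th. \<Phi> n th - th)" using \<Phi>(3) by (simp add: periodic_def)
  from periodic_shift_int[OF this, of th k] show ?thesis by (simp add: algebra_simps)
 qed
 define \<Psi> where "\<Psi> th = lim (\<lambda>n. \<Phi> (r n) th)" for th
 have \<Psi>: "(\<lambda>n. \<Phi> (r n) th) \<longlonglongrightarrow> \<Psi> th" for th
 proof -
  obtain k where k: "th + 2 * pi * of_int k \<in> {0..<2*pi}" by (rule periodic_reduce)
  then have "convergent (\<lambda>n. \<Phi> (r n) th + 2 * pi * of_int k)" using conv1[OF k] by (simp only: perk)
  then have "convergent (\<lambda>n. \<Phi> (r n) th + 2 * pi * of_int k - 2 * pi * of_int k)" by (intro convergent_diff convergent_const)
  then show ?thesis by (simp add: \<Psi>_def convergent_LIMSEQ_iff)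
 qed
 have lip\<Psi>: "\<bar>\<Psi> y - \<Psi> x\<bar> \<le> L * \<bar>y - x\<bar>" for x y
  by (rule LIMSEQ_le_const2[OF tendsto_rabs[OF tendsto_diff[OF \<Psi> \<Psi>]]]) (use lip in auto)
 have c\<Psi>: "continuous_on UNIV \<Psi>"
 proof (rule lipschitz_on_continuous_on)
  show "L-lipschitz_on UNIV \<Psi>" using lip\<Psi> L0 by (auto simp: lipschitz_on_def dist_real_def)
 qed
 have per\<Psi>: "\<Psi> (th + 2 * pi) = \<Psi> th + 2 * pi" for th
  using LIMSEQ_unique[OF \<Psi>[of "th + 2 * pi"]] tendsto_add[OF \<Psi>[of th] tendsto_const[of "2 * pi"]] by (simp add: \<Phi>(3))
 have mono\<Psi>: "\<Psi> x \<le> \<Psi> y" if "x \<le> y" for x y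
  using \<Phi>(2) that by (intro LIMSEQ_le[OF \<Psi> \<Psi>]) (auto simp: strict_mono_less_eq)
 have u\<Psi>: "u th = cB (\<Psi> th)" for th
 proof (rule LIMSEQ_unique)
  have "pc U u" using m by (intro wc_pc[OF lim]) simp
  from pcD(2)[OF pc_subseq[OF this r(1)], of th] show "(\<lambda>n. U (r n) th) \<longlonglongrightarrow> u th" .
  have "isCont cB (\<Psi> th)"
   using wc_continuous(1)[OF SB] m by (simp add: continuous_on_eq_continuous_at)
  from isCont_tendsto_compose[OF this \<Psi>] show "(\<lambda>n. U (r n) th) \<longlonglongrightarrow> cB (\<Psi> th)" by (simp add: \<Phi>(5))
 qed
 obtain \<rho>u \<delta>u where \<rho>u: "\<rho>u > 0" "\<delta>u > 0" "\<And>x y. \<bar>x - y\<bar> < \<rho>u ==> \<delta>u * \<bar>x - y\<bar> \<le> norm (u x - u y)"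
  using Imm_locally_injective[OF m u] by blast
 \<comment> \<open>A limit of increasing lifts may be constant on an interval; local injectivity of
   \<open>u\<close>, which is \<open>cB\<close> composed with \<open>\<Psi>\<close>, excludes
   this.\<close>
 have sm: "strict_mono \<Psi>"
 proof (rule strict_monoI)
  fix x y :: real assume xy: "x < y"
  define z where "z = min y (x + \<rho>u / 2)"
  have z: "x < z" "z \<le> y" "\<bar>z - x\<bar> < \<rho>u" using xy \<rho>u(1) by (auto simp: z_def min_def)
  have "0 < norm (u z - u x)" using \<rho>u(3)[OF z(3)] \<rho>u(2) z(1) by (smt (verit) mult_pos_pos)
  then have "\<Psi> x \<noteq> \<Psi> z" by (auto simp: u\<Psi>)
  then show "\<Psi> x < \<Psi> y" using mono\<Psi>[of x z] mono\<Psi>[of z y] z by auto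
 qed
 obtain \<phi> where \<phi>: "circle_reparam \<phi>" "\<And>th. \<phi> (cis th) = cis (\<Psi> th)"
  using circle_reparam_of_lift[OF c\<Psi> sm per\<Psi>] by blast
 have "u th = cB \<eta>" if "\<phi> (cis th) = cis \<eta>" for th \<eta>
 proof -
  have "cis (\<Psi> th) = cis \<eta>" using that \<phi>(2) by simp
  then obtain k :: int where "\<Psi> th = \<eta> + 2 * pi * of_int k" unfolding cis_eq_iff by blast
  then show ?thesis using periodic_shift_int[OF wc_regular(4)[OF SB]] by (simp add: u\<Psi>)
 qed
 then show ?thesis using u \<phi>(1) by (auto simp: reparam_class_def)
qed

section \<open>Jointly measurable families\<close>

text \<open>The choice in \<open>wder_path\<close> has its defining properties only if some jointly
  measurable family of weak derivatives exists. \<open>jm k\<close> describes families with such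
  derivatives up to order \<open>k\<close>, each of them the derivative of the preceding one at
  every time.\<close>

primrec jm :: "nat => (real => real => 'a::euclidean_space) => bool" where
 "jm 0 p \<longleftrightarrow> (\<lambda>(t, z). p t z) \<in> borel_measurable borel \<and> (\<forall>t\<in>{0..1}. p t \<in> sqint \<and> periodic (p t))"
| "jm (Suc k) p \<longleftrightarrow> (\<lambda>(t, z). p t z) \<in> borel_measurable borel \<and> (\<exists>q. jm k q \<and> (\<forall>t\<in>{0..1}. cder (p t) (q t)))"

lemma jm_measurable: "jm k p ==> (\<lambda>(t, z). p t z) \<in> borel_measurable borel"
 by (cases k) auto

lemma jm_sqint: "jm k p ==> t \<in> {0..1} ==> p t \<in> sqint" "jm k p ==> t \<in> {0..1} ==> periodic (p t)"
 by (cases k; auto dest: cder_sqint cderD)+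

lemma jm_SucE:
 assumes "jm (Suc k) p"
 obtains q where "(\<lambda>(t, z). p t z) \<in> borel_measurable borel" "jm k q" "\<forall>t\<in>{0..1}. cder (p t) (q t)"
 using assms by auto

lemma jm_continuous: "jm (Suc k) p ==> t \<in> {0..1} ==> continuous_on UNIV (p t)"
 by (rule jm_SucE) (auto dest: cder_continuous)

lemma jm_Suc: "jm (Suc k) p ==> jm k p"
proof (induction k arbitrary: p)
 case 0
 then show ?case by (auto dest: cder_sqint cderD)
next
 case (Suc k)
 obtain q where "(\<lambda>(t, z). p t z) \<in> borel_measurable borel" "jm (Suc k) q" "\<forall>t\<in>{0..1}. cder (p t) (q t)"
  by (rule jm_SucE[OF Suc.prems])
 then show ?case using Suc.IH by (subst jm.simps(2)) blast
qed

lemma jm_le: "jm k p ==> j \<le> k ==> jm j p"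
proof (induction k)
 case (Suc k)
 then show ?case using jm_Suc by (cases "j = Suc k") auto
qed simp

lemma measurable_pair_bilinear:
 fixes B :: "'a::euclidean_space => 'b::euclidean_space => 'c::euclidean_space"
 assumes "bounded_bilinear B" "(\<lambda>(t, z). p t z) \<in> borel_measurable borel" "(\<lambda>(t, z). q t z) \<in> borel_measurable borel"
 shows "(\<lambda>(t, z). B (p t z) (q t z)) \<in> borel_measurable borel"
 using measurable_bilinear[OF assms] by (simp add: case_prod_beta)

lemma jm_add: "jm k p ==> jm k q ==> jm k (\<lambda>t z. p t z + q t z)"
proof (induction k arbitrary: p q)
 case 0
 have "(\<lambda>x. (\<lambda>(t, z). p t z) x + (\<lambda>(t, z). q t z) x) \<in> borel_measurable borel"
  using jm_measurable[OF 0(1)] jm_measurable[OF 0(2)] by (rule borel_measurable_add)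
 then show ?case using 0 by (auto simp: periodic_def case_prod_beta)
next
 case (Suc k)
 obtain p' where p: "jm k p'" "\<forall>t\<in>{0..1}. cder (p t) (p' t)" using Suc.prems(1) by (rule jm_SucE)
 obtain q' where q: "jm k q'" "\<forall>t\<in>{0..1}. cder (q t) (q' t)" using Suc.prems(2) by (rule jm_SucE)
 have "(\<lambda>x. (\<lambda>(t, z). p t z) x + (\<lambda>(t, z). q t z) x) \<in> borel_measurable borel"
  using jm_measurable[OF Suc.prems(1)] jm_measurable[OF Suc.prems(2)] by (rule borel_measurable_add)
 then have "(\<lambda>(t, z). p t z + q t z) \<in> borel_measurable borel" by (simp add: case_prod_beta)
 then show ?case using Suc.IH[OF p(1) q(1)] p(2) q(2) by (subst jm.simps(2)) (blast intro: cder_add)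
qed

lemma sqint_bilinear_bounded:
 fixes B :: "'a::euclidean_space => 'b::euclidean_space => 'c::euclidean_space"
 assumes B: "bounded_bilinear B" and f: "continuous_on UNIV f" "periodic f" and g: "g \<in> sqint"
 shows "(\<lambda>z. B (f z) (g z)) \<in> sqint"
proof -
 obtain K where K: "K > 0" "\<And>x y. norm (B x y) \<le> norm x * norm y * K" using bounded_bilinear.pos_bounded[OF B] by blast
 obtain C where C: "\<And>z. norm (f z) \<le> C" using periodic_bounded[OF f(2,1)] by blast
 have "norm (B (f z) (g z)) \<le> (C * K) * norm (g z)" for z
  using order_trans[OF K(2) mult_right_mono[OF mult_right_mono[OF C norm_ge_zero[of "g z"]] less_imp_le[OF K(1)]]]
  by (simp add: ac_simps)
 then show ?thesis
  by (intro sqint_bound[OF measurable_bilinear[OF B borel_measurable_continuous_onI[OF f(1)] sqintD(1)[OF g]] g]) auto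
qed

lemma jm_bilinear_SucI:
 fixes B :: "'a::euclidean_space => 'b::euclidean_space => 'c::euclidean_space"
 assumes B: "bounded_bilinear B" and pq: "jm (Suc k) p" "jm (Suc k) q"
  and IH: "\<And>p q. jm (Suc k) p ==> jm k q ==> jm k (\<lambda>t z. B (p t z) (q t z))"
   "\<And>p q. jm k p ==> jm (Suc k) q ==> jm k (\<lambda>t z. B (p t z) (q t z))"
 shows "jm (Suc k) (\<lambda>t z. B (p t z) (q t z))"
proof -
 obtain p' where p: "jm k p'" "\<forall>t\<in>{0..1}. cder (p t) (p' t)" using pq(1) by (rule jm_SucE)
 obtain q' where q: "jm k q'" "\<forall>t\<in>{0..1}. cder (q t) (q' t)" using pq(2) by (rule jm_SucE)
 have "jm k (\<lambda>t z. B (p' t z) (q t z) + B (p t z) (q' t z))"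
  by (rule jm_add[OF IH(2)[OF p(1) pq(2)] IH(1)[OF pq(1) q(1)]])
 moreover have "\<forall>t\<in>{0..1}. cder (\<lambda>z. B (p t z) (q t z)) (\<lambda>z. B (p' t z) (q t z) + B (p t z) (q' t z))"
  using p(2) q(2) by (auto intro: cder_bilinear[OF B])
 ultimately show ?thesis
  using measurable_pair_bilinear[OF B jm_measurable[OF pq(1)] jm_measurable[OF pq(2)]]
  by (subst jm.simps(2)) (intro conjI exI)
qed

text \<open>Two families of order 0 may have a product that is not square integrable, hence one
  factor carries an extra order, which makes it continuous and bounded at each time. Differentiation
  moves the extra order from one factor to the other, so both versions are proved together.\<close>

lemma jm_bilinear_aux:
 fixes B :: "'a::euclidean_space => 'b::euclidean_space => 'c::euclidean_space"
 assumes B: "bounded_bilinear B"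
 shows "(\<forall>p q. jm (Suc k) p \<longrightarrow> jm k q \<longrightarrow> jm k (\<lambda>t z. B (p t z) (q t z))) \<and>
  (\<forall>p q. jm k p \<longrightarrow> jm (Suc k) q \<longrightarrow> jm k (\<lambda>t z. B (p t z) (q t z)))"
proof (induction k)
 case 0
 have "jm 0 (\<lambda>t z. B (p t z) (q t z))" if pq: "jm (Suc 0) p" "jm 0 q" for p q
  unfolding jm.simps(1)
 proof (intro conjI ballI)
  fix t :: real assume t: "t \<in> {0..1}"
  show "(\<lambda>z. B (p t z) (q t z)) \<in> sqint"
   by (rule sqint_bilinear_bounded[OF B jm_continuous[OF pq(1) t] jm_sqint(2)[OF pq(1) t] jm_sqint(1)[OF pq(2) t]])
  show "periodic (\<lambda>z. B (p t z) (q t z))"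
   using jm_sqint(2)[OF pq(1) t] jm_sqint(2)[OF pq(2) t] by (simp add: periodic_def)
 qed (rule measurable_pair_bilinear[OF B jm_measurable[OF pq(1)] jm_measurable[OF pq(2)]])
 moreover have "jm 0 (\<lambda>t z. B (p t z) (q t z))" if pq: "jm 0 p" "jm (Suc 0) q" for p q
  unfolding jm.simps(1)
 proof (intro conjI ballI)
  fix t :: real assume t: "t \<in> {0..1}"
  show "(\<lambda>z. B (p t z) (q t z)) \<in> sqint"
   by (rule sqint_bilinear_bounded[OF bounded_bilinear.flip[OF B] jm_continuous[OF pq(2) t] jm_sqint(2)[OF pq(2) t] jm_sqint(1)[OF pq(1) t]])
  show "periodic (\<lambda>z. B (p t z) (q t z))"
   using jm_sqint(2)[OF pq(1) t] jm_sqint(2)[OF pq(2) t] by (simp add: periodic_def)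
 qed (rule measurable_pair_bilinear[OF B jm_measurable[OF pq(1)] jm_measurable[OF pq(2)]])
 ultimately show ?case by blast
next
 case (Suc k)
 have main: "jm (Suc k) (\<lambda>t z. B (p t z) (q t z))" if "jm (Suc k) p" "jm (Suc k) q" for p q
  by (rule jm_bilinear_SucI[OF B that]) (use Suc.IH in blast)+
 show ?case
 proof (intro conjI allI impI)
  fix p :: "real => real => 'a" and q :: "real => real => 'b" assume pq: "jm (Suc (Suc k)) p" "jm (Suc k) q"
  show "jm (Suc k) (\<lambda>t z. B (p t z) (q t z))" by (rule main[OF jm_Suc[OF pq(1)] pq(2)])
 next
  fix p :: "real => real => 'a" and q :: "real => real => 'b" assume pq: "jm (Suc k) p" "jm (Suc (Suc k)) q"
  show "jm (Suc k) (\<lambda>t z. B (p t z) (q t z))" by (rule main[OF pq(1) jm_Suc[OF pq(2)]])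
 qed
qed

lemma jm_bilinear:
 fixes B :: "'a::euclidean_space => 'b::euclidean_space => 'c::euclidean_space"
 assumes "bounded_bilinear B"
 shows "jm (Suc k) p ==> jm k q ==> jm k (\<lambda>t z. B (p t z) (q t z))"
  "jm k p ==> jm (Suc k) q ==> jm k (\<lambda>t z. B (p t z) (q t z))"
 using jm_bilinear_aux[OF assms, of k] by blast+

lemma jm_Sob:
 fixes u :: "real => 'a::euclidean_space"
 assumes u: "Sob k u" and s: "continuous_on UNIV s"
 shows "jm k (\<lambda>t z. s t *\<^sub>R u z)"
 using u
proof (induction k arbitrary: u)
 case (0 u)
 have "(\<lambda>x. s (fst x) *\<^sub>R u (snd x)) \<in> borel_measurable (borel \<Otimes>\<^sub>M borel)"
  using wc_measurable(2)[OF 0] borel_measurable_continuous_onI[OF s] by measurable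
 then show ?case using wc_regular[OF 0] by (auto simp: borel_prod case_prod_beta periodic_def)
next
 case (Suc k u)
 obtain v where v: "cder u v" "Sob k v" using Suc.prems wc_Sob by (metis wc_SucE)
 have "(\<lambda>x. s (fst x) *\<^sub>R u (snd x)) \<in> borel_measurable (borel \<Otimes>\<^sub>M borel)"
  using wc_measurable(2)[OF Suc.prems] borel_measurable_continuous_onI[OF s] by measurable
 then have m: "(\<lambda>(t, z). s t *\<^sub>R u z) \<in> borel_measurable borel" by (simp add: borel_prod case_prod_beta)
 have "\<forall>t\<in>{0..1}. cder (\<lambda>z. s t *\<^sub>R u z) (\<lambda>z. s t *\<^sub>R v z)" using cder_scaleR[OF v(1)] by blast
 then show ?case using m Suc.IH[OF v(2)] by (subst jm.simps(2)) (intro conjI exI)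
qed

lemma jm_linear_path:
 assumes "Sob k a" "Sob k b"
 shows "jm k (linear_path a b)"
 using jm_add[OF jm_Sob[OF assms(1), of "\<lambda>t. 1 - t"] jm_Sob[OF assms(2), of "\<lambda>t. t"]]
 by (simp add: linear_path_def[abs_def] continuous_intros)

lemma jm_const: "Sob k u ==> jm k (\<lambda>t. u)"
 using jm_Sob[of k u "\<lambda>_. 1"] by simp

lemma sqint_cong_AE:
 assumes "u \<in> borel_measurable borel" "AE z in circle. u z = v z" "v \<in> sqint"
 shows "u \<in> sqint"
 unfolding sqint_def
proof safe
 note [measurable] = assms(1) sqintD(1)[OF assms(3)]
 show "integrable circle (\<lambda>z. (norm (u z))\<^sup>2)"
  by (rule integrable_cong_AE_imp[OF sqintD(2)[OF assms(3)]]) (use assms(2) in auto)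
qed fact

text \<open>At each time \<open>P\<close> is known only up to a null set, and \<open>p\<close> is a
  regular version of it. The derivative of \<open>p\<close> is a jointly measurable weak derivative
  of \<open>P\<close>, which justifies the choice in \<open>wder_path\<close> and identifies its
  result up to null sets.\<close>

lemma wder_path_props:
 fixes P :: "real => ('d::finite) curve"
 assumes P: "\<And>t. t \<in> {0..1} ==> P t \<in> sqint" "\<And>t. t \<in> {0..1} ==> periodic (P t)"
  and eq: "\<And>t. t \<in> {0..1} ==> AE z in circle. P t z = p t z" and p: "jm (Suc k) p"
 obtains q where "jm k q" "(\<lambda>(t, z). wder_path P t z) \<in> borel_measurable borel" "\<And>t. t \<in> {0..1} ==> cder (p t) (q t)"
  "\<And>t. t \<in> {0..1} ==> has_weak_deriv (P t) (wder_path P t)" "\<And>t. t \<in> {0..1} ==> AE z in circle. wder_path P t z = q t z"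
proof -
 obtain q where q: "jm k q" "\<forall>t\<in>{0..1}. cder (p t) (q t)" using p by (rule jm_SucE)
 have w: "has_weak_deriv (P t) (q t)" if t: "t \<in> {0..1}" for t
 proof (rule has_weak_deriv_cong)
  show "has_weak_deriv (p t) (q t)" using q t jm_sqint[OF q(1) t] by (intro cder_has_weak_deriv) auto
  show "P t \<in> L2" "q t \<in> L2" using P t jm_sqint[OF q(1) t] by (auto simp: L2_iff)
 qed (use eq t in auto)
 have "\<exists>Q. (\<lambda>(t, z). Q t z) \<in> borel_measurable borel \<and> (\<forall>t\<in>{0..1}. has_weak_deriv (P t) (Q t))"
  using jm_measurable[OF q(1)] w by blast
 from someI_ex[OF this] have "(\<lambda>(t, z). wder_path P t z) \<in> borel_measurable borel"
  "\<forall>t\<in>{0..1}. has_weak_deriv (P t) (wder_path P t)" unfolding wder_path_def by auto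
 then show ?thesis using that[OF q(1)] q(2) has_weak_deriv_unique w by blast
qed

lemma measurable_section:
 assumes "(\<lambda>(t, z). P t z) \<in> borel_measurable (borel :: (real \<times> real) measure)"
 shows "P t \<in> borel_measurable borel"
proof -
 have "(\<lambda>z. (\<lambda>(t, z). P t z) (t, z)) \<in> borel_measurable borel"
  by (rule measurable_compose[OF _ assms[folded borel_prod]]) measurable
 then show ?thesis by simp
qed

section \<open>The polynomials of the regularized energy\<close>

context
 fixes m :: nat and a b :: "('d::finite) curve"
 assumes m: "2 \<le> m" and a: "Sob m a" and b: "Sob m b"
begin

abbreviation (input) "cc \<equiv> linear_path a b"
abbreviation (input) "hh \<equiv> (\<lambda>z. b z - a z)"
abbreviation (input) "RR \<equiv> reg_P cc hh"

lemma wder_path_linear: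
 shows "(\<lambda>(t, z). wder_path cc t z) \<in> borel_measurable borel"
  "(\<lambda>(t, z). wder_path (wder_path cc) t z) \<in> borel_measurable borel"
  "t \<in> {0..1} ==> AE z in circle. wder_path cc t z = wder (cc t) z"
  "t \<in> {0..1} ==> AE z in circle. wder_path (wder_path cc) t z = wder (wder (cc t)) z"
  "t \<in> {0..1} ==> periodic (wder_path cc t)"
  "t \<in> {0..1} ==> periodic (wder_path (wder_path cc) t)"
proof -
 obtain k where k: "m = Suc (Suc k)" by (rule two_le_SucE[OF m])
 have Sc: "Sob (Suc (Suc k)) (cc t)" for t using Sob_linear_path[OF a b, of t] k by simp
 have j: "jm (Suc (Suc k)) cc" using jm_linear_path[OF a b] k by simp
 obtain q where q: "jm (Suc k) q" "(\<lambda>(t, z). wder_path cc t z) \<in> borel_measurable borel" "\<And>t. t \<in> {0..1} ==> cder (cc t) (q t)"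
  "\<And>t. t \<in> {0..1} ==> has_weak_deriv (cc t) (wder_path cc t)" "\<And>t. t \<in> {0..1} ==> AE z in circle. wder_path cc t z = q t z"
  by (rule wder_path_props[of cc cc, OF _ _ _ j]) (use wc_regular[OF Sc] in auto)
 have qw: "q t = wder (cc t)" if t: "t \<in> {0..1}" for t
 proof -
  obtain q' where "\<forall>t\<in>{0..1}. cder (q t) (q' t)" using q(1) by (rule jm_SucE)
  then have "continuous_on UNIV (q t)" using t cder_continuous by blast
  then show ?thesis using wder_cder(5)[OF q(3)[OF t] jm_sqint[OF q(1) t]] by simp
 qed
 have sq: "wder_path cc t \<in> sqint" "periodic (wder_path cc t)" if "t \<in> {0..1}" for t
  using q(4)[OF that] by (auto simp: has_weak_deriv_def L2_iff)
 obtain q2 where q2: "jm k q2" "(\<lambda>(t, z). wder_path (wder_path cc) t z) \<in> borel_measurable borel" "\<And>t. t \<in> {0..1} ==> cder (q t) (q2 t)"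
  "\<And>t. t \<in> {0..1} ==> has_weak_deriv (wder_path cc t) (wder_path (wder_path cc) t)" "\<And>t. t \<in> {0..1} ==> AE z in circle. wder_path (wder_path cc) t z = q2 t z"
  by (rule wder_path_props[of "wder_path cc" q, OF sq q(5) q(1)]) auto
 show "(\<lambda>(t, z). wder_path cc t z) \<in> borel_measurable borel"
  "(\<lambda>(t, z). wder_path (wder_path cc) t z) \<in> borel_measurable borel" by (fact q(2)) (fact q2(2))
 show "AE z in circle. wder_path cc t z = wder (cc t) z" if "t \<in> {0..1}" using q(5)[OF that] qw[OF that] by simp
 show "periodic (wder_path cc t)" if "t \<in> {0..1}" using sq(2)[OF that] .
 show "periodic (wder_path (wder_path cc) t)" if "t \<in> {0..1}" using q2(4)[OF that] by (auto simp: has_weak_deriv_def L2_iff)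
 show "AE z in circle. wder_path (wder_path cc) t z = wder (wder (cc t)) z" if t: "t \<in> {0..1}"
 proof -
  have "AE z in circle. wder (q t) z = q2 t z" by (rule wder_cder(4)[OF q2(3)[OF t] jm_sqint[OF q2(1) t]])
  with q2(5)[OF t] show ?thesis unfolding qw[OF t] by eventually_elim simp
 qed
qed

lemma reg_P_Suc: "1 \<le> j ==> RR (Suc j) t z = (norm (wder_path cc t z))\<^sup>2 *\<^sub>R wder_path (RR j) t z -
  ((3 * real j - 2) * (wder_path cc t z \<bullet> wder_path (wder_path cc) t z)) *\<^sub>R RR j t z"
 by simp

lemma jm_wder_linear: "jm (m - 1) (\<lambda>t. wder (cc t))" "jm (m - 2) (\<lambda>t. linear_path (wder (wder a)) (wder (wder b)) t)"
  "AE z in circle. wder (wder (cc t)) z = linear_path (wder (wder a)) (wder (wder b)) t z"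
proof -
 obtain k where k: "m = Suc (Suc k)" by (rule two_le_SucE[OF m])
 have 1: "Sob (Suc k) (wder a)" "Sob (Suc k) (wder b)" using Sob_wder[of "Suc k"] a b k by auto
 show "jm (m - 1) (\<lambda>t. wder (cc t))" unfolding wder_linear_path[OF m a b] using jm_linear_path[OF 1] k by simp
 show "jm (m - 2) (\<lambda>t. linear_path (wder (wder a)) (wder (wder b)) t)" using jm_linear_path[OF Sob_wder[OF 1(1)] Sob_wder[OF 1(2)]] k by simp
 show "AE z in circle. wder (wder (cc t)) z = linear_path (wder (wder a)) (wder (wder b)) t z"
  unfolding wder_linear_path[OF m a b] using wder_lincomb(1)[OF 1, of "1 - t" t] by (simp add: linear_path_def)
qed

text \<open>As \<open>reg_P\<close> involves arbitrary representatives, its remaining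
  \<open>m - j\<close> orders of differentiability are stated for a version \<open>r\<close> that
  agrees with it almost everywhere at each time. Measurability and periodicity are asserted of
  \<open>reg_P\<close> itself, for they are what the next application of \<open>wder_path\<close>
  takes as input.\<close>

lemma reg_P_inv:
 assumes "1 \<le> j" "j \<le> m"
 shows "(\<lambda>(t, z). RR j t z) \<in> borel_measurable borel \<and> (\<forall>t\<in>{0..1}. RR j t \<in> sqint \<and> periodic (RR j t)) \<and>
  (\<exists>r. jm (m - j) r \<and> (\<forall>t\<in>{0..1}. AE z in circle. RR j t z = r t z))"
 using assms
proof (induction j rule: dec_induct)
 case base
 have S: "Sob m hh" by (rule Sob_diff[OF b a])
 note r = wder_regular[OF m S]
 have "Sob (m - 1) (wder hh)" using Sob_wder[of "m - 1" hh] S m by (simp add: Suc_diff_Suc)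
 then have "jm (m - 1) (\<lambda>t. wder hh)" by (rule jm_const)
 moreover from jm_measurable[OF this] have "(\<lambda>(t, z). RR 1 t z) \<in> borel_measurable borel" by simp
 ultimately show ?case using r by (auto intro!: exI[of _ "\<lambda>t. wder hh"])
next
 case (step j)
 then obtain r where R: "(\<lambda>(t, z). RR j t z) \<in> borel_measurable borel" "\<And>t. t \<in> {0..1} ==> RR j t \<in> sqint" "\<And>t. t \<in> {0..1} ==> periodic (RR j t)"
  and r: "jm (m - j) r" "\<And>t. t \<in> {0..1} ==> AE z in circle. RR j t z = r t z" by auto
 define k where "k = m - Suc j"
 have k: "m - j = Suc k" "k \<le> m - 2" "Suc k \<le> m - 1" using step by (auto simp: k_def)
 obtain q where q: "jm k q" "(\<lambda>(t, z). wder_path (RR j) t z) \<in> borel_measurable borel" "\<And>t. t \<in> {0..1} ==> cder (r t) (q t)"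
  "\<And>t. t \<in> {0..1} ==> has_weak_deriv (RR j t) (wder_path (RR j) t)" "\<And>t. t \<in> {0..1} ==> AE z in circle. wder_path (RR j) t z = q t z"
  by (rule wder_path_props[OF R(2,3) r(2) r(1)[unfolded k(1)]]) auto
 define s where "s t z = (wder (cc t) z \<bullet> wder (cc t) z) *\<^sub>R q t z + (- (3 * real j - 2)) *\<^sub>R
  ((wder (cc t) z \<bullet> linear_path (wder (wder a)) (wder (wder b)) t z) *\<^sub>R r t z)" for t z
 note c1 = jm_le[OF jm_wder_linear(1) k(3)] and c2 = jm_le[OF jm_wder_linear(2) k(2)]
 have rk: "jm (Suc k) r" using r(1) k(1) by simp
 have "jm k (\<lambda>t z. (wder (cc t) z \<bullet> wder (cc t) z) *\<^sub>R q t z)"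
  by (rule jm_bilinear(1)[OF bounded_bilinear_scaleR jm_bilinear_SucI[OF bounded_bilinear_inner c1 c1
   jm_bilinear(1)[OF bounded_bilinear_inner] jm_bilinear(2)[OF bounded_bilinear_inner]] q(1)])
 moreover have "jm k (\<lambda>t z. (wder (cc t) z \<bullet> linear_path (wder (wder a)) (wder (wder b)) t z) *\<^sub>R r t z)"
  by (rule jm_bilinear(2)[OF bounded_bilinear_scaleR jm_bilinear(1)[OF bounded_bilinear_inner c1 c2] rk])
 then have "jm k (\<lambda>t z. (- (3 * real j - 2)) *\<^sub>R
  ((wder (cc t) z \<bullet> linear_path (wder (wder a)) (wder (wder b)) t z) *\<^sub>R r t z))"
  by (rule jm_bilinear(1)[OF bounded_bilinear_scaleR jm_const[OF wc_const[OF tendsto_const]]])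
 ultimately have s: "jm k s" unfolding s_def[abs_def] by (rule jm_add)
 have eq: "AE z in circle. RR (Suc j) t z = s t z" if t: "t \<in> {0..1}" for t
  using wder_path_linear(3)[OF t] wder_path_linear(4)[OF t] r(2)[OF t] q(5)[OF t] jm_wder_linear(3)[of t]
 proof eventually_elim
  case (elim z)
  have "x *\<^sub>R u - (c * y) *\<^sub>R v = x *\<^sub>R u + (- c) *\<^sub>R (y *\<^sub>R v)" for x y c :: real and u v :: "real ^ 'd" by simp
  then show ?case unfolding reg_P_Suc[OF step(1)] s_def elim power2_norm_eq_inner .
 qed
 have ms: "(\<lambda>(t, z). RR (Suc j) t z) \<in> borel_measurable borel"
 proof -
  note [measurable] = wder_path_linear(1,2)[unfolded case_prod_beta] q(2)[unfolded case_prod_beta] R(1)[unfolded case_prod_beta]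
  show ?thesis unfolding reg_P_Suc[OF step(1)] case_prod_beta by measurable
 qed
 have sq: "RR (Suc j) t \<in> sqint" if t: "t \<in> {0..1}" for t
  by (rule sqint_cong_AE[OF measurable_section[OF ms] eq[OF t] jm_sqint(1)[OF s t]])
 have per: "periodic (RR (Suc j) t)" if t: "t \<in> {0..1}" for t
 proof -
  have "periodic (wder_path (RR j) t)" using q(4)[OF t] by (simp add: has_weak_deriv_def L2_iff)
  then show ?thesis using wder_path_linear(5,6)[OF t] R(3)[OF t] unfolding periodic_def reg_P_Suc[OF step(1)] by simp
 qed
 show ?case using ms sq per s eq unfolding k_def by blast
qed

lemma reg_P_measurable: "1 \<le> j ==> j \<le> m ==> (\<lambda>(t, z). RR j t z) \<in> borel_measurable borel"
 using reg_P_inv by blast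

lemma reg_P_weak:
 assumes j: "1 \<le> j" "j < m" and t: "t \<in> {0..1}"
 shows "has_weak_deriv (RR j t) (wder_path (RR j) t)"
proof -
 from j obtain r where R: "\<And>t. t \<in> {0..1} ==> RR j t \<in> sqint" "\<And>t. t \<in> {0..1} ==> periodic (RR j t)"
  and r: "jm (m - j) r" "\<And>t. t \<in> {0..1} ==> AE z in circle. RR j t z = r t z" using reg_P_inv[of j] by auto
 have k: "m - j = Suc (m - Suc j)" using j by auto
 show ?thesis by (rule wder_path_props[OF R r(2) r(1)[unfolded k]]) (use t in auto)
qed

text \<open>Formulated without arc length derivatives, so that it is available for proving that the
  curve is an immersion.\<close>

lemma reg_P_2:
 assumes t: "t \<in> {0..1}"
 shows "AE z in circle. RR 2 t z = (norm (wder (cc t) z))\<^sup>2 *\<^sub>R wder (wder hh) z - (wder (cc t) z \<bullet> wder (wder (cc t)) z) *\<^sub>R wder hh z"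
proof -
 obtain k where k: "m = Suc (Suc k)" by (rule two_le_SucE[OF m])
 have S: "Sob (Suc k) (wder hh)" using Sob_wder[of "Suc k" hh] Sob_diff[OF b a] k by simp
 have "has_weak_deriv (wder hh) (wder (wder hh))"
  using wc_regular[OF Sob_wder[OF S]] by (intro cder_has_weak_deriv Sob_cder[OF S]) auto
 moreover have "has_weak_deriv (wder hh) (wder_path (RR 1) t)" using reg_P_weak[of 1 t] t m by simp
 ultimately have "AE z in circle. wder_path (RR 1) t z = wder (wder hh) z" using has_weak_deriv_unique by blast
 with wder_path_linear(3)[OF t] wder_path_linear(4)[OF t] show ?thesis
 proof eventually_elim
  case (elim z)
  then show ?case using reg_P_Suc[of 1 t z] by (simp add: numeral_2_eq_2)
 qed
qed

lemma cder_norm_power: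
 assumes nz: "\<And>z. wder (cc t) z \<noteq> 0"
 shows "cder (\<lambda>z. norm (wder (cc t) z) ^ p)
  (\<lambda>z. (wder (cc t) z \<bullet> wder (wder (cc t)) z) * (real p * norm (wder (cc t) z) ^ p / (norm (wder (cc t) z))\<^sup>2))"
proof (induction p)
 case 0
 show ?case using cder_const[of "1::real"] by simp
next
 case (Suc p)
 obtain k where k: "m = Suc (Suc k)" by (rule two_le_SucE[OF m])
 let ?u = "wder (cc t)" and ?v = "wder (wder (cc t))"
 have c: "cder ?u ?v" using Sob_cder[OF Sob_wder[of "Suc k" "cc t"]] Sob_linear_path[OF a b] k by simp
 have "cder (\<lambda>z. sqrt (?u z \<bullet> ?u z)) (\<lambda>z. (1/2 * (inverse (?u z \<bullet> ?u z) * sqrt (?u z \<bullet> ?u z))) * (?v z \<bullet> ?u z + ?u z \<bullet> ?v z))"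
  by (rule cder_sqrt[OF cder_bilinear[OF bounded_bilinear_inner c c]]) (use nz in simp)
 from cder_bilinear[OF bounded_bilinear_mult this Suc]
 have 1: "cder (\<lambda>z. norm (?u z) ^ Suc p) (\<lambda>z. (1/2 * (inverse ((norm (?u z))\<^sup>2) * norm (?u z))) * (?v z \<bullet> ?u z + ?u z \<bullet> ?v z) * norm (?u z) ^ p
  + norm (?u z) * ((?u z \<bullet> ?v z) * (real p * norm (?u z) ^ p / (norm (?u z))\<^sup>2)))" (is "cder _ ?w")
  by (simp add: norm_eq_sqrt_inner)
 have "?w = (\<lambda>z. (?u z \<bullet> ?v z) * (real (Suc p) * norm (?u z) ^ Suc p / (norm (?u z))\<^sup>2))"
 proof
  fix z
  have "norm (?u z) \<noteq> 0" using nz by simp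
  then show "?w z = (?u z \<bullet> ?v z) * (real (Suc p) * norm (?u z) ^ Suc p / (norm (?u z))\<^sup>2)"
   by (simp add: inner_commute[of "?v z"] divide_simps) (simp add: algebra_simps)
 qed
 with 1 show ?case by simp
qed

text \<open>Differentiating the power |c'|^(3j-2) produces a multiple of c' \<bullet> c'', which the
  recursion subtracts again. What remains is the derivative of \<open>xi\<close> at index
  \<open>j\<close>, which is |c'| times the next one; together with the factor |c'|^2 of the
  recursion the exponent grows by 3.\<close>

lemma reg_P_xi:
 assumes "1 \<le> j" "j \<le> m" and t: "t \<in> {0..1}" and imm: "cc t \<in> Imm m"
 shows "AE z in circle. RR j t z = norm (wder (cc t) z) ^ (3 * j - 2) *\<^sub>R xi (cc t) hh j z"
 using assms(1,2)
proof (induction j rule: dec_induct)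
 case base
 have "wder (cc t) z \<noteq> 0" for z using imm m by (simp add: Imm_iff)
 then show ?case by (simp add: xi_0 xi_Suc arc_deriv_def)
next
 case (step j)
 have nz: "wder (cc t) z \<noteq> 0" for z using imm m by (simp add: Imm_iff)
 have h: "Sob m hh" by (rule Sob_diff[OF b a])
 let ?r = "\<lambda>z. norm (wder (cc t) z)" and ?s = "\<lambda>z. wder (cc t) z \<bullet> wder (wder (cc t)) z" and ?x = "xi (cc t) hh j"
 define p where "p = 3 * j - 2"
 have p: "real p = 3 * real j - 2" "3 * Suc j - 2 = p + 3" using step(1) by (auto simp: p_def of_nat_diff)
 obtain k where k: "m = Suc (Suc k)" by (rule two_le_SucE[OF m])
 have "Sob (Suc (m - Suc j)) ?x" using Sob_xi[OF m imm h, of j] step by (simp add: Suc_diff_Suc)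
 note cx = Sob_cder[OF this]
 note rc = wder_regular[OF m Sob_linear_path[OF a b, of t]]
 have Sc: "Sob (Suc k) (wder (cc t))" using Sob_wder[of "Suc k" "cc t"] Sob_linear_path[OF a b] k by simp
 have wx: "wder ?x = (\<lambda>z. ?r z *\<^sub>R xi (cc t) hh (Suc j) z)" using wder_xi[OF nz] by auto
 define v where "v = (\<lambda>z. ?s z *\<^sub>R ((real p * ?r z ^ p / (?r z)\<^sup>2) *\<^sub>R ?x z) + (?r z ^ Suc p) *\<^sub>R xi (cc t) hh (Suc j) z)"
 have "cder (\<lambda>z. ?r z ^ p *\<^sub>R ?x z) v"
  using cder_bilinear[OF bounded_bilinear_scaleR cder_norm_power[OF nz, where p = p] cx]
  unfolding v_def wx by (simp add: mult.commute)
 moreover have "v \<in> sqint"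
  unfolding v_def
 proof (rule sqint_add)
  have "?s \<in> sqint"
   by (rule sqint_bilinear_bounded[OF bounded_bilinear_inner rc(1,2) wc_regular(3)[OF Sob_wder[OF Sc]]])
  then show "(\<lambda>z. ?s z *\<^sub>R ((real p * ?r z ^ p / (?r z)\<^sup>2) *\<^sub>R ?x z)) \<in> sqint"
   by (intro sqint_bilinear_bounded[OF bounded_bilinear.flip[OF bounded_bilinear_scaleR], of "\<lambda>z. (real p * ?r z ^ p / (?r z)\<^sup>2) *\<^sub>R ?x z"])
    (use rc cder_continuous[OF cx] cderD(1)[OF cx] nz in \<open>auto simp: periodic_def intro!: continuous_intros\<close>)
  show "(\<lambda>z. (?r z ^ Suc p) *\<^sub>R xi (cc t) hh (Suc j) z) \<in> sqint"
   by (intro sqint_bilinear_bounded[OF bounded_bilinear_scaleR] xi_term_integrable(2)[OF m imm h] continuous_on_power continuous_on_norm rc)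
    (use rc(2) step in \<open>auto simp: periodic_def\<close>)
 qed
 moreover have "periodic v"
  using rc(2) cderD(1)[OF cx] wc_regular(4)[OF Sob_wder[OF Sc]] wc_regular(4)[OF Sob_xi[OF m imm h, of "Suc j"]] step
  by (auto simp: periodic_def v_def)
 ultimately have fv: "has_weak_deriv (\<lambda>z. ?r z ^ p *\<^sub>R ?x z) v" by (rule cder_has_weak_deriv)
 have w: "has_weak_deriv (RR j t) (wder_path (RR j) t)" using reg_P_weak[OF _ _ t, of j] step by simp
 have IH: "AE z in circle. RR j t z = ?r z ^ p *\<^sub>R ?x z" using step by (simp add: p_def)
 have "RR j t \<in> L2" using w unfolding has_weak_deriv_def by (rule conjunct1)
 moreover have "v \<in> L2" using fv unfolding has_weak_deriv_def by (elim conjE)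
 ultimately have "has_weak_deriv (RR j t) v" by (rule has_weak_deriv_cong[OF fv _ _ IH]) simp
 from has_weak_deriv_unique[OF w this] IH wder_path_linear(3)[OF t] wder_path_linear(4)[OF t]
 show ?case
 proof eventually_elim
  case (elim z)
  have "?r z \<noteq> 0" using nz by simp
  then have e: "(?r z)\<^sup>2 * (?s z * (real p * ?r z ^ p / (?r z)\<^sup>2)) = real p * ?s z * ?r z ^ p"
   "(?r z)\<^sup>2 * ?r z ^ Suc p = ?r z ^ (p + 3)"
   by (simp_all add: power_add power2_eq_square power3_eq_cube)
  have "(?r z)\<^sup>2 *\<^sub>R v z - (real p * ?s z) *\<^sub>R (?r z ^ p *\<^sub>R ?x z) = ?r z ^ (p + 3) *\<^sub>R xi (cc t) hh (Suc j) z"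
   unfolding v_def scaleR_add_right scaleR_scaleR e by (rule add_diff_cancel_left')
  then show ?case unfolding reg_P_Suc[OF step(1)] elim p by simp
 qed
qed

end

section \<open>Coercivity of the regularized functional\<close>

lemma max_eps_ge: "\<alpha> \<le> max_eps \<epsilon> \<alpha> \<beta>" "\<beta> \<le> max_eps \<epsilon> \<alpha> \<beta>"
proof -
 define s where "s = sqrt ((\<beta> - \<alpha>)\<^sup>2 + \<epsilon>\<^sup>2)"
 have "\<bar>\<beta> - \<alpha>\<bar> \<le> s" unfolding s_def by (rule real_sqrt_ge_abs1)
 then have s: "\<beta> - \<alpha> \<le> s" "\<alpha> - \<beta> \<le> s" by linarith+
 show "\<alpha> \<le> max_eps \<epsilon> \<alpha> \<beta>" unfolding max_eps_def s_def[symmetric] using s(2) by (simp add: field_simps)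
 show "\<beta> \<le> max_eps \<epsilon> \<alpha> \<beta>" unfolding max_eps_def s_def[symmetric] using s(1) by (simp add: field_simps)
qed

lemma min_eps_le: "min_eps \<epsilon> \<alpha> \<beta> \<le> \<alpha>" "min_eps \<epsilon> \<alpha> \<beta> \<le> \<beta>"
proof -
 define s where "s = sqrt ((\<beta> - \<alpha>)\<^sup>2 + \<epsilon>\<^sup>2)"
 have "\<bar>\<beta> - \<alpha>\<bar> \<le> s" unfolding s_def by (rule real_sqrt_ge_abs1)
 then have s: "\<beta> - \<alpha> \<le> s" "\<alpha> - \<beta> \<le> s" by linarith+
 show "min_eps \<epsilon> \<alpha> \<beta> \<le> \<alpha>" unfolding min_eps_def s_def[symmetric] using s(1) by (simp add: field_simps)
 show "min_eps \<epsilon> \<alpha> \<beta> \<le> \<beta>" unfolding min_eps_def s_def[symmetric] using s(2) by (simp add: field_simps)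
qed

text \<open>Projection onto the bisector \<open>w\<close> of the two directions: each of the two
  unit vectors has component |w| / 2 along it, so the projection of every point of the segment is at
  least \<open>\<mu>\<close> times this.\<close>

lemma norm_segment_ge:
 fixes x y :: "'a::real_inner"
 assumes t: "t \<in> {0..1}" and \<mu>: "\<mu> \<le> norm x" "\<mu> \<le> norm y" "0 \<le> \<mu>"
 shows "1 / 2 * norm (sgn x + sgn y) * \<mu> \<le> norm ((1 - t) *\<^sub>R x + t *\<^sub>R y)"
proof (cases "x = 0 \<or> y = 0")
 case True
 then show ?thesis using \<mu> by auto
next
 case False
 define w where "w = sgn x + sgn y"
 have 1: "sgn x \<bullet> sgn x = 1" "sgn y \<bullet> sgn y = 1" using False by (simp_all add: power2_norm_eq_inner[symmetric] norm_sgn)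
 have ww: "(norm w)\<^sup>2 = 2 + 2 * (sgn x \<bullet> sgn y)"
  unfolding power2_norm_eq_inner unfolding w_def inner_add_right inner_add_left 1 inner_commute[of "sgn y" "sgn x"] by simp
 have sw: "sgn x \<bullet> w = (norm w)\<^sup>2 / 2" "sgn y \<bullet> w = (norm w)\<^sup>2 / 2"
  unfolding ww unfolding w_def inner_add_right 1 inner_commute[of "sgn y" "sgn x"] by simp_all
 have "x \<bullet> w = norm x * ((norm w)\<^sup>2 / 2)" "y \<bullet> w = norm y * ((norm w)\<^sup>2 / 2)"
 proof -
  have nx: "x = norm x *\<^sub>R sgn x" "y = norm y *\<^sub>R sgn y" using False by (simp_all add: sgn_div_norm)
  show "x \<bullet> w = norm x * ((norm w)\<^sup>2 / 2)" by (subst nx(1)) (simp only: inner_scaleR_left sw)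
  show "y \<bullet> w = norm y * ((norm w)\<^sup>2 / 2)" by (subst nx(2)) (simp only: inner_scaleR_left sw)
 qed
 then have "((1 - t) *\<^sub>R x + t *\<^sub>R y) \<bullet> w = ((1 - t) * norm x + t * norm y) * ((norm w)\<^sup>2 / 2)"
  by (simp add: inner_add_left algebra_simps)
 moreover have "\<mu> \<le> (1 - t) * norm x + t * norm y"
 proof -
  have "(1 - t) * \<mu> + t * \<mu> \<le> (1 - t) * norm x + t * norm y" using t \<mu> by (intro add_mono mult_left_mono) auto
  then show ?thesis by (simp add: algebra_simps)
 qed
 then have "\<mu> * ((norm w)\<^sup>2 / 2) \<le> ((1 - t) * norm x + t * norm y) * ((norm w)\<^sup>2 / 2)" by (intro mult_right_mono) auto
 ultimately have "\<mu> * ((norm w)\<^sup>2 / 2) \<le> norm ((1 - t) *\<^sub>R x + t *\<^sub>R y) * norm w"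
  using norm_cauchy_schwarz[of "(1 - t) *\<^sub>R x + t *\<^sub>R y" w] by linarith
 then have le: "norm w * (1 / 2 * norm w * \<mu>) \<le> norm w * norm ((1 - t) *\<^sub>R x + t *\<^sub>R y)"
  by (simp add: power2_eq_square ac_simps)
 show ?thesis
 proof (cases "w = 0")
  case False
  then show ?thesis using le by (simp add: w_def[symmetric])
 qed (simp add: w_def[symmetric])
qed

lemma L_bounds:
 assumes "2 \<le> m" "Sob m a" "Sob m b" "t \<in> {0..1}"
 shows "L_minus \<epsilon> a b z \<le> norm (wder (linear_path a b t) z)" "norm (wder (linear_path a b t) z) \<le> L_plus \<epsilon> a b z"
proof -
 have w: "wder (linear_path a b t) z = (1 - t) *\<^sub>R wder a z + t *\<^sub>R wder b z"
  using wder_linear_path[OF assms(1-3)] by (simp add: linear_path_def)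
 show "L_minus \<epsilon> a b z \<le> norm (wder (linear_path a b t) z)"
  unfolding w L_minus_def using assms(4) min_eps_le[of \<epsilon> "norm (wder a z)" "norm (wder b z)"]
  by (intro norm_segment_ge) auto
 have "norm (wder (linear_path a b t) z) \<le> (1 - t) * norm (wder a z) + t * norm (wder b z)"
  unfolding w using norm_triangle_ineq[of "(1 - t) *\<^sub>R wder a z" "t *\<^sub>R wder b z"] assms(4) by simp
 also have "\<dots> \<le> L_plus \<epsilon> a b z"
  unfolding L_plus_def using assms(4) max_eps_ge by (intro convex_bound_le) auto
 finally show "norm (wder (linear_path a b t) z) \<le> L_plus \<epsilon> a b z" .
qed

lemma L_minus_nonneg: "0 \<le> L_minus \<epsilon> a b z"
 by (simp add: L_minus_def)

lemma L_measurable: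
 assumes "2 \<le> m" "Sob m a" "Sob m b"
 shows "L_minus \<epsilon> a b \<in> borel_measurable borel" "L_plus \<epsilon> a b \<in> borel_measurable borel"
 using wder_regular(5)[OF assms(1,2)] wder_regular(5)[OF assms(1,3)]
 unfolding L_minus_def[abs_def] L_plus_def[abs_def] min_eps_def max_eps_def sgn_div_norm by measurable

text \<open>For \<open>L = 0\<close> the right-hand side is infinite unless \<open>r\<close> or
  \<open>x\<close> vanishes, and then the left-hand side is zero; otherwise one power of
  \<open>r\<close> is left over after comparison with the smaller \<open>L\<close>.\<close>

lemma ennreal_weight_ge:
 assumes "0 \<le> L" "L \<le> r" "0 \<le> x" "n > 0"
 shows "ennreal r * ennreal x \<le> ennreal (r ^ Suc n * x) / ennreal (L ^ n)"
proof (cases "L = 0")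
 case True
 then show ?thesis using assms by (cases "r = 0 \<or> x = 0") (auto simp: ennreal_eq_0_iff zero_less_mult_iff not_le zero_power)
next
 case False
 have "r * x * L ^ n \<le> r * x * r ^ n" using assms by (intro mult_left_mono power_mono) auto
 then have "r * x \<le> r ^ Suc n * x / L ^ n" using False assms by (simp add: pos_le_divide_eq ac_simps)
 then show ?thesis using assms False by (simp add: ennreal_mult[symmetric] divide_ennreal ennreal_leI)
qed

definition reg_density :: "real => nat => ('d::finite) curve => 'd curve => real => ennreal" where
 "reg_density \<epsilon> m a b t = (\<Sum>j=1..m. \<integral>\<^sup>+z. ennreal ((norm (reg_P (linear_path a b) (\<lambda>z. b z - a z) j t z))\<^sup>2) /
  ennreal (L_minus \<epsilon> a b z ^ (6 * j - 5)) \<partial>circle)"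

definition reg_zero :: "real => ('d::finite) curve => 'd curve => ennreal" where
 "reg_zero \<epsilon> a b = (\<integral>\<^sup>+z. ennreal (L_plus \<epsilon> a b z * (norm (b z - a z))\<^sup>2) \<partial>circle)"

text \<open>Compared with \<open>W_reg\<close>, the integrals over time and angle are interchanged,
  because coercivity and semicontinuity are both argued at a fixed time.\<close>

definition V_reg :: "real => nat => ('d::finite) curve => 'd curve => ennreal" where
 "V_reg \<epsilon> m a b = reg_zero \<epsilon> a b + (\<integral>\<^sup>+t. reg_density \<epsilon> m a b t * indicator {0..1} t \<partial>lborel)"

interpretation lborel_circle: pair_sigma_finite lborel circle
 by (simp add: pair_sigma_finite_def sigma_finite_lborel circle.sigma_finite_measure_axioms)

lemma pair_measurable_circle:
 assumes "(\<lambda>(t, z). f t z) \<in> borel_measurable borel"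
 shows "(\<lambda>x. f (fst x) (snd x)) \<in> borel_measurable (lborel \<Otimes>\<^sub>M circle)"
proof -
 have "(\<lambda>x. x) \<in> borel_measurable circle" by measurable
 then have "snd \<in> borel_measurable (lborel \<Otimes>\<^sub>M circle)" using measurable_compose[OF measurable_snd] by blast
 moreover have "fst \<in> borel_measurable (lborel \<Otimes>\<^sub>M circle)"
  using measurable_fst[of lborel circle] by (simp cong: measurable_cong_sets)
 ultimately have "(\<lambda>x. (fst x, snd x)) \<in> (lborel \<Otimes>\<^sub>M circle) \<rightarrow>\<^sub>M borel \<Otimes>\<^sub>M borel"
  by (rule measurable_Pair[rotated])
 from measurable_compose[OF this assms[folded borel_prod]] show ?thesis by (simp add: case_prod_beta)
qed

lemma reg_measurable:
 assumes "2 \<le> m" "Sob m a" "Sob m b" "1 \<le> j" "j \<le> m"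
 shows "(\<lambda>x. ennreal ((norm (reg_P (linear_path a b) (\<lambda>z. b z - a z) j (fst x) (snd x)))\<^sup>2) /
  ennreal (L_minus \<epsilon> a b (snd x) ^ (6 * j - 5))) \<in> borel_measurable (lborel \<Otimes>\<^sub>M circle)"
proof -
 note [measurable] = pair_measurable_circle[OF reg_P_measurable[OF assms]]
 have [measurable]: "(\<lambda>x. L_minus \<epsilon> a b (snd x)) \<in> borel_measurable (lborel \<Otimes>\<^sub>M circle)"
  using measurable_compose[OF measurable_snd measurable_circle[OF L_measurable(1)[OF assms(1-3)]]] .
 show ?thesis by measurable
qed

lemma reg_density_measurable:
 assumes "2 \<le> m" "Sob m a" "Sob m b"
 shows "reg_density \<epsilon> m a b \<in> borel_measurable lborel"
 unfolding reg_density_def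
 by (intro borel_measurable_sum circle.borel_measurable_nn_integral)
  (use reg_measurable[OF assms] in \<open>auto simp: case_prod_beta\<close>)

lemma W_reg_eq:
 assumes m: "2 \<le> m" and a: "Sob m a" and b: "Sob m b"
 shows "W_reg \<epsilon> m a b = enn2ereal (V_reg \<epsilon> m a b)"
proof -
 define f where "f j t z = ennreal ((norm (reg_P (linear_path a b) (\<lambda>z. b z - a z) j t z))\<^sup>2) /
  ennreal (L_minus \<epsilon> a b z ^ (6 * j - 5))" for j t z
 note [measurable] = L_measurable[OF m a b] wc_measurable(2)[OF a] wc_measurable(2)[OF b]
 have fm: "(\<lambda>x. f j (fst x) (snd x)) \<in> borel_measurable (lborel \<Otimes>\<^sub>M circle)" if "j \<in> {1..m}" for j
  using reg_measurable[OF m a b, of j] that by (simp add: f_def)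
 have im: "(\<lambda>x. indicator {0..1} (fst x) :: ennreal) \<in> borel_measurable ((lborel :: real measure) \<Otimes>\<^sub>M circle)"
  by (rule measurable_compose[OF measurable_fst borel_measurable_indicator]) (auto intro: atLeastAtMost_borel)
 have sm: "(\<lambda>x. (\<Sum>j=1..m. f j (fst x) (snd x)) * indicator {0..1} (fst x)) \<in> borel_measurable (lborel \<Otimes>\<^sub>M circle)"
  by (intro borel_measurable_times_ennreal borel_measurable_sum im) (use fm in auto)
 have fs: "f j t \<in> borel_measurable circle" if "j \<in> {1..m}" for j t
  using measurable_compose[OF measurable_Pair1' fm[OF that], of t] by simp
 have "(\<integral>\<^sup>+z. (\<integral>\<^sup>+t. (\<Sum>j=1..m. f j t z) * indicator {0..1} t \<partial>lborel) \<partial>circle) =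
  (\<integral>\<^sup>+t. (\<integral>\<^sup>+z. (\<Sum>j=1..m. f j t z) * indicator {0..1} t \<partial>circle) \<partial>lborel)"
  by (rule lborel_circle.Fubini') (use sm in \<open>simp add: case_prod_beta\<close>)
 also have "\<dots> = (\<integral>\<^sup>+t. reg_density \<epsilon> m a b t * indicator {0..1} t \<partial>lborel)"
 proof (rule nn_integral_cong)
  fix t :: real
  have "(\<integral>\<^sup>+z. (\<Sum>j=1..m. f j t z) * indicator {0..1} t \<partial>circle) = (\<integral>\<^sup>+z. (\<Sum>j=1..m. f j t z) \<partial>circle) * indicator {0..1} t"
   by (rule nn_integral_multc) (use fs in auto)
  also have "(\<integral>\<^sup>+z. (\<Sum>j=1..m. f j t z) \<partial>circle) = (\<Sum>j=1..m. \<integral>\<^sup>+z. f j t z \<partial>circle)"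
   by (rule nn_integral_sum) (use fs in auto)
  also have "\<dots> = reg_density \<epsilon> m a b t" by (simp add: reg_density_def f_def)
  finally show "(\<integral>\<^sup>+z. (\<Sum>j=1..m. f j t z) * indicator {0..1} t \<partial>circle) = reg_density \<epsilon> m a b t * indicator {0..1} t" .
 qed
 finally have eq: "(\<integral>\<^sup>+z. (\<integral>\<^sup>+t. (\<Sum>j=1..m. f j t z) * indicator {0..1} t \<partial>lborel) \<partial>circle) =
  (\<integral>\<^sup>+t. reg_density \<epsilon> m a b t * indicator {0..1} t \<partial>lborel)" .
 have "W_reg \<epsilon> m a b = enn2ereal (\<integral>\<^sup>+z. ennreal (L_plus \<epsilon> a b z * (norm (b z - a z))\<^sup>2) +
  (\<integral>\<^sup>+t. (\<Sum>j=1..m. f j t z) * indicator {0..1} t \<partial>lborel) \<partial>circle)"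
  by (simp add: W_reg_def Let_def f_def)
 also have "(\<integral>\<^sup>+z. ennreal (L_plus \<epsilon> a b z * (norm (b z - a z))\<^sup>2) +
  (\<integral>\<^sup>+t. (\<Sum>j=1..m. f j t z) * indicator {0..1} t \<partial>lborel) \<partial>circle) = V_reg \<epsilon> m a b"
  unfolding V_reg_def reg_zero_def eq[symmetric]
 proof (rule nn_integral_add)
  show "(\<lambda>z. \<integral>\<^sup>+t. (\<Sum>j=1..m. f j t z) * indicator {0..1} t \<partial>lborel) \<in> borel_measurable circle"
   by (intro lborel.borel_measurable_nn_integral) (use measurable_pair_swap[OF sm] in \<open>simp add: case_prod_beta\<close>)
 qed measurable
 finally show ?thesis .
qed

text \<open>By \<open>reg_P_xi\<close> the squared norm of the polynomial with index
  \<open>j\<close> is |c'|^(6j-4) times that of the arc length derivative. Division by the power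
  6j-5 of \<open>L_minus\<close>, which is at most |c'|, leaves at least the weight |c'| of the
  metric.\<close>

lemma gm_le_reg:
 assumes m: "2 \<le> m" and a: "Sob m a" and b: "Sob m b" and t: "t \<in> {0..1}" and imm: "linear_path a b t \<in> Imm m"
 shows "ennreal (gm m (linear_path a b t) (\<lambda>z. b z - a z)) \<le> reg_zero \<epsilon> a b + reg_density \<epsilon> m a b t"
proof -
 let ?c = "linear_path a b t" and ?h = "\<lambda>z. b z - a z"
 have "ennreal (gm m ?c ?h) = (\<Sum>j=0..m. \<integral>\<^sup>+z. ennreal (norm (wder ?c z)) * ennreal ((norm (xi ?c ?h j z))\<^sup>2) \<partial>circle)"
  by (rule ennreal_gm[OF m imm Sob_diff[OF b a]])
 also have "\<dots> = (\<integral>\<^sup>+z. ennreal (norm (wder ?c z)) * ennreal ((norm (?h z))\<^sup>2) \<partial>circle) +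
  (\<Sum>j=1..m. \<integral>\<^sup>+z. ennreal (norm (wder ?c z)) * ennreal ((norm (xi ?c ?h j z))\<^sup>2) \<partial>circle)"
  by (simp add: sum.atLeast_Suc_atMost xi_0)
 also have "\<dots> \<le> reg_zero \<epsilon> a b + reg_density \<epsilon> m a b t"
  unfolding reg_zero_def reg_density_def
 proof (intro add_mono sum_mono)
  show "(\<integral>\<^sup>+z. ennreal (norm (wder ?c z)) * ennreal ((norm (?h z))\<^sup>2) \<partial>circle) \<le>
   (\<integral>\<^sup>+z. ennreal (L_plus \<epsilon> a b z * (norm (?h z))\<^sup>2) \<partial>circle)"
   using L_bounds(2)[OF m a b t] by (intro nn_integral_mono) (auto simp: ennreal_mult'[symmetric] intro!: ennreal_leI mult_right_mono)
  fix j assume j: "j \<in> {1..m}"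
  then have "AE z in circle. reg_P (linear_path a b) ?h j t z = norm (wder ?c z) ^ (3 * j - 2) *\<^sub>R xi ?c ?h j z"
   by (intro reg_P_xi[OF m a b _ _ t imm]) auto
  then show "(\<integral>\<^sup>+z. ennreal (norm (wder ?c z)) * ennreal ((norm (xi ?c ?h j z))\<^sup>2) \<partial>circle) \<le>
   (\<integral>\<^sup>+z. ennreal ((norm (reg_P (linear_path a b) ?h j t z))\<^sup>2) / ennreal (L_minus \<epsilon> a b z ^ (6 * j - 5)) \<partial>circle)"
  proof (intro nn_integral_mono_AE, eventually_elim)
   case (elim z)
   have e: "Suc (6 * j - 5) = (3 * j - 2) * 2" using j by auto
   have "(norm (reg_P (linear_path a b) ?h j t z))\<^sup>2 = norm (wder ?c z) ^ Suc (6 * j - 5) * (norm (xi ?c ?h j z))\<^sup>2"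
    unfolding elim e power_mult by (simp add: power_mult_distrib)
   then show ?case using ennreal_weight_ge[OF L_minus_nonneg L_bounds(1)[OF m a b t], of "(norm (xi ?c ?h j z))\<^sup>2" "6 * j - 5"] j by simp
  qed
 qed
 finally show ?thesis .
qed

lemma reg_summand_le:
 assumes "j \<in> {1..m}"
 shows "(\<integral>\<^sup>+w. ennreal ((norm (reg_P (linear_path a b) (\<lambda>w. b w - a w) j t w))\<^sup>2) / ennreal (L_minus \<epsilon> a b w ^ (6 * j - 5)) \<partial>circle)
  \<le> reg_density \<epsilon> m a b t"
 unfolding reg_density_def using assms
 by (intro member_le_sum[of j "{1..m}" "\<lambda>j. \<integral>\<^sup>+w. ennreal ((norm (reg_P (linear_path a b) (\<lambda>w. b w - a w) j t w))\<^sup>2) / ennreal (L_minus \<epsilon> a b w ^ (6 * j - 5)) \<partial>circle"]) auto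

text \<open>If \<open>c'\<close> had a zero \<open>z\<close>, then \<open>h'(z) \<noteq> 0\<close>, whereas on an interval to the right of the zero set the
 derivative of \<open>h' / |c'|\<close> has norm \<open>|P\<^sub>2| / |c'|\<^sup>3\<close> and is therefore integrable, which makes \<open>h'\<close> vanish wherever \<open>c'\<close> does.\<close>

lemma reg_density_imp_Imm:
 assumes m: "2 \<le> m" and aI: "a \<in> Imm m" and bI: "b \<in> Imm m" and t: "t \<in> {0..1}" and fin: "reg_density \<epsilon> m a b t < \<infinity>"
 shows "linear_path a b t \<in> Imm m"
proof -
 have a: "Sob m a" "\<And>w. wder a w \<noteq> 0" and b: "Sob m b" using aI bI m by (auto simp: Imm_iff)
 define c where "c = linear_path a b t"
 define h where "h = (\<lambda>w. b w - a w)"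
 define L where "L = L_minus \<epsilon> a b"
 define R where "R j = reg_P (linear_path a b) h j t" for j
 obtain k where k: "m = Suc (Suc k)" by (rule two_le_SucE[OF m])
 have Sc: "Sob m c" unfolding c_def by (rule Sob_linear_path[OF a(1) b])
 have Sh: "Sob m h" unfolding h_def by (rule Sob_diff[OF b a(1)])
 note rc = wder_regular[OF m Sc] and rh = wder_regular[OF m Sh]
 have cc: "cder (wder c) (wder (wder c))" using Sob_cder[OF Sob_wder[of "Suc k" c]] Sc k by simp
 have ch: "cder (wder h) (wder (wder h))" using Sob_cder[OF Sob_wder[of "Suc k" h]] Sh k by simp
 have c': "wder c w = wder a w + t *\<^sub>R wder h w" for w
  using wder_linear_path[OF m a(1) b] wder_diff[OF m a(1) b] by (simp add: c_def h_def linear_path_def algebra_simps)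
 have h_nz: "wder h w \<noteq> 0" if "wder c w = 0" for w using c'[of w] a(2)[of w] that by auto
 have LB: "0 \<le> L w" "L w \<le> norm (wder c w)" for w
  unfolding L_def c_def by (rule L_minus_nonneg, rule L_bounds(1)[OF m a(1) b t])
 have Lm [measurable]: "L \<in> borel_measurable borel" unfolding L_def by (rule L_measurable(1)[OF m a(1) b])
 have Rm [measurable]: "R j \<in> borel_measurable borel" if "j \<in> {1..m}" for j
  unfolding R_def h_def using measurable_section[OF reg_P_measurable[OF m a(1) b, of j], of t] that by simp
 have Rm12 [measurable]: "R 1 \<in> borel_measurable borel" "R 2 \<in> borel_measurable borel" using m by (auto intro: Rm)
 define \<gamma>1 where "\<gamma>1 w = ennreal ((norm (R 1 w))\<^sup>2) / ennreal (L w ^ 1)" for w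
 define \<gamma> where "\<gamma> w = ennreal ((norm (R 2 w))\<^sup>2) / ennreal (L w ^ 7)" for w
 have \<gamma>m [measurable]: "\<gamma>1 \<in> borel_measurable borel" "\<gamma> \<in> borel_measurable borel" unfolding \<gamma>_def[abs_def] \<gamma>1_def[abs_def] by measurable
 have g1: "(\<integral>\<^sup>+w. \<gamma>1 w \<partial>circle) < \<infinity>"
  using le_less_trans[OF reg_summand_le[of 1 m a b t \<epsilon>] fin] m unfolding \<gamma>1_def R_def L_def h_def by simp
 have g2: "(\<integral>\<^sup>+w. \<gamma> w \<partial>circle) < \<infinity>"
  using le_less_trans[OF reg_summand_le[of 2 m a b t \<epsilon>] fin] m unfolding \<gamma>_def R_def L_def h_def by simp
 have ae1: "AE w in circle. \<gamma>1 w \<noteq> \<infinity>" using g1 by (intro nn_integral_PInf_AE) auto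
 have ae2: "AE w in circle. \<gamma> w \<noteq> \<infinity>" using g2 by (intro nn_integral_PInf_AE) auto
 define g where "g w = enn2real (\<gamma> w)" for w
 have gm [measurable]: "g \<in> borel_measurable borel" unfolding g_def[abs_def] by measurable
 have g0: "g w \<ge> 0" for w by (simp add: g_def)
 have gi: "integrable circle g"
 proof (rule integrableI_nonneg)
  have "(\<integral>\<^sup>+w. ennreal (g w) \<partial>circle) \<le> (\<integral>\<^sup>+w. \<gamma> w \<partial>circle)"
   unfolding g_def by (intro nn_integral_mono) (metis ennreal_enn2real_if order_refl zero_le)
  then show "(\<integral>\<^sup>+w. ennreal (g w) \<partial>circle) < \<infinity>" using g2 by (rule le_less_trans)
 qed (use g0 in auto)
 have ga: "g absolutely_integrable_on {0..2*pi}" by (rule circle_integral(1)[OF gm gi])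
 obtain Y where Y: "\<And>w. norm (wder c w) \<le> Y" using periodic_bounded[OF rc(2,1)] by blast
 have Y0: "Y \<ge> 0" using Y[of 0] norm_ge_zero[of "wder c 0"] by linarith
 have R2: "AE w in circle. R 2 w = (norm (wder c w))\<^sup>2 *\<^sub>R wder (wder h) w - (wder c w \<bullet> wder (wder c) w) *\<^sub>R wder h w"
  unfolding R_def c_def h_def by (rule reg_P_2[OF m a(1) b t])
 from AE_conjI[OF R2 ae2] obtain N where N: "negligible N"
  "\<And>w. w \<in> {0..2*pi} - N ==> R 2 w = (norm (wder c w))\<^sup>2 *\<^sub>R wder (wder h) w - (wder c w \<bullet> wder (wder c) w) *\<^sub>R wder h w \<and> \<gamma> w \<noteq> \<infinity>"
  by (rule AE_circle_negligible) blast
 have nz: "wder c w0 \<noteq> 0" if w0: "w0 \<in> {0..<2*pi}" for w0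
 proof
  assume z0: "wder c w0 = 0"
  \<comment> \<open>The term of index 1 keeps c' from vanishing on an interval: there
    \<open>L\<close> would be zero and h' would not, so the density would be infinite on a set of
    positive measure.\<close>
  have "\<exists>w1\<in>{w0<..<2*pi}. wder c w1 \<noteq> 0"
  proof (rule ccontr)
   assume "\<not> ?thesis"
   then have z: "wder c w = 0" if "w \<in> {w0<..<2*pi}" for w using that by blast
   obtain N1 where N1: "negligible N1" "\<And>w. w \<in> {0..2*pi} - N1 ==> \<gamma>1 w \<noteq> \<infinity>"
    using AE_circle_negligible[OF ae1] by blast
   have "\<gamma>1 w = \<infinity>" if "w \<in> {w0<..<2*pi}" for w
   proof -
    have "R 1 w \<noteq> 0" using h_nz[OF z[OF that]] by (simp add: R_def)
    moreover have "L w = 0" using LB[of w] z[OF that] by simp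
    ultimately show ?thesis by (simp add: \<gamma>1_def)
   qed
   then have inf: "\<gamma>1 w = \<infinity>" if "w \<in> {w0<..<2*pi}" for w using that .
   have "{w0<..<2*pi} \<subseteq> N1"
   proof
    fix w assume w: "w \<in> {w0<..<2*pi}"
    then have "w \<in> {0..2*pi}" using w0 by auto
    then show "w \<in> N1" using N1(2)[of w] inf[OF w] by blast
   qed
   then have "negligible {w0<..<2*pi}" using N1(1) negligible_subset by blast
   then show False using open_not_negligible[of "{w0<..<2*pi}"] w0 by auto
  qed
  then obtain w1 where w1: "w0 < w1" "w1 < 2*pi" "wder c w1 \<noteq> 0" by auto
  define Z where "Z = {w\<in>{w0..w1}. wder c w = 0}"
  have "closed Z" unfolding Z_def
   by (intro continuous_closed_preimage_constant continuous_on_subset[OF rc(1)]) auto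
  moreover have "bounded Z" by (rule bounded_subset[of "{w0..w1}"]) (auto simp: Z_def)
  ultimately have "compact Z" by (simp add: compact_eq_bounded_closed)
  moreover have "w0 \<in> Z" using z0 w1(1) by (simp add: Z_def)
  then have "Z \<noteq> {}" by blast
  \<comment> \<open>The last zero before \<open>w1\<close>. To its right c' does not vanish, so the
    quotient of h' by |c'| is absolutely continuous on every \<open>{x..w1}\<close> with
    \<open>z < x\<close>.\<close>
  ultimately obtain z where z: "z \<in> Z" "\<And>y. y \<in> Z ==> y \<le> z" using compact_attains_sup[of Z] by blast
  have zb: "w0 \<le> z" "z < w1" "wder c z = 0" using z(1) w1 by (auto simp: Z_def less_le)
  have nzc: "wder c x \<noteq> 0" if "z < x" "x \<le> w1" for x using z(2)[of x] that zb by (auto simp: Z_def)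
  define C where "C = inverse (norm (wder c w1)) * norm (wder h w1) + integral {0..2*pi} (\<lambda>s. g s + Y)"
  have gY: "(\<lambda>s. g s + Y) absolutely_integrable_on {0..2*pi}"
   by (intro set_integral_add ga) simp
  have bd: "norm (wder h x) \<le> C * norm (wder c x)" if x: "x \<in> {z<..w1}" for x
  proof -
   have xb: "0 \<le> x" "x \<le> w1" "w1 \<le> 2*pi" "z < x" using x zb w0 w1 by auto
   have pos: "wder c s \<noteq> 0" if "s \<in> {x..w1}" for s using nzc that xb by auto
   let ?u = "\<lambda>s. wder c s \<bullet> wder c s" and ?v = "\<lambda>s. wder (wder c) s \<bullet> wder c s + wder c s \<bullet> wder (wder c) s"
   have acu: "ac x w1 ?u ?v"
    by (rule ac_subinterval[OF ac_bilinear[OF bounded_bilinear_inner cderD(2)[OF cc] cderD(2)[OF cc]] xb(1,3)])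
   have acr: "ac x w1 (\<lambda>s. sqrt (?u s)) (\<lambda>s. (1/2 * (inverse (?u s) * sqrt (?u s))) * ?v s)"
    by (rule ac_sqrt[OF acu]) (use pos in auto)
   have aci: "ac x w1 (\<lambda>s. inverse (sqrt (?u s))) (\<lambda>s. - (inverse (sqrt (?u s)) * inverse (sqrt (?u s))) * ((1/2 * (inverse (?u s) * sqrt (?u s))) * ?v s))"
    by (rule ac_inverse[OF acr]) (use pos in auto)
   define f' where "f' = (\<lambda>s. (- (inverse (sqrt (?u s)) * inverse (sqrt (?u s))) * ((1/2 * (inverse (?u s) * sqrt (?u s))) * ?v s)) *\<^sub>R wder h s
    + inverse (sqrt (?u s)) *\<^sub>R wder (wder h) s)"
   have acf: "ac x w1 (\<lambda>s. inverse (sqrt (?u s)) *\<^sub>R wder h s) f'"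
    unfolding f'_def by (rule ac_bilinear[OF bounded_bilinear_scaleR aci ac_subinterval[OF cderD(2)[OF ch] xb(1,3)]])
   \<comment> \<open>With \<open>r\<close> the norm of c', the square of the derivative is at most g
     L^7 / r^6, which is at most g Y and hence at most (g + Y)^2. This yields an integrable bound
     that involves no root of \<open>g\<close>.\<close>
   have f'b: "norm (f' s) \<le> g s + Y" if s: "s \<in> {x..w1} - N" for s
   proof -
    define r where "r = norm (wder c s)"
    define \<sigma> where "\<sigma> = wder c s \<bullet> wder (wder c) s"
    have r: "r > 0" "L s \<le> r" "r \<le> Y" using pos s LB(2)[of s] Y[of s] by (auto simp: r_def)
    have u: "?u s = r\<^sup>2" "sqrt (?u s) = r" by (simp_all add: r_def power2_norm_eq_inner norm_eq_sqrt_inner)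
    have v: "?v s = 2 * \<sigma>" by (simp add: \<sigma>_def inner_commute)
    have "s \<in> {0..2*pi} - N" using s xb by auto
    note Ns = N(2)[OF this]
    have sc: "inverse (r ^ 3) * r\<^sup>2 = inverse r" "- (inverse r * inverse r) * ((1/2 * (inverse (r\<^sup>2) * r)) * (2 * \<sigma>)) = - (inverse (r^3) * \<sigma>)"
     using r(1) by (simp_all add: field_simps power2_eq_square power3_eq_cube)
    have "f' s = inverse (r ^ 3) *\<^sub>R R 2 s"
    proof -
     have "f' s = (- (inverse r * inverse r) * ((1/2 * (inverse (r\<^sup>2) * r)) * (2 * \<sigma>))) *\<^sub>R wder h s + inverse r *\<^sub>R wder (wder h) s"
      unfolding f'_def u(2) unfolding u(1) v ..
     moreover have "R 2 s = r\<^sup>2 *\<^sub>R wder (wder h) s - \<sigma> *\<^sub>R wder h s"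
      using Ns by (simp only: r_def \<sigma>_def)
     ultimately show ?thesis unfolding sc(2) by (simp only: scaleR_diff_right scaleR_scaleR sc(1)) simp
    qed
    moreover have "(norm (R 2 s))\<^sup>2 \<le> g s * L s ^ 7"
    proof (cases "L s = 0")
     case True
     then have "R 2 s = 0" using Ns by (cases "R 2 s = 0") (auto simp: \<gamma>_def)
     then show ?thesis using g0 LB by simp
    next
     case False
     then have L0: "L s > 0" using LB(1)[of s] by simp
     then have "\<gamma> s = ennreal ((norm (R 2 s))\<^sup>2 / L s ^ 7)" by (simp add: \<gamma>_def divide_ennreal)
     then have "g s = (norm (R 2 s))\<^sup>2 / L s ^ 7" using L0 by (simp add: g_def)
     then show ?thesis using L0 by simp
    qed
    moreover have "g s * L s ^ 7 \<le> g s * (Y * r ^ 6)"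
    proof -
     have "L s * L s ^ 6 \<le> Y * r ^ 6" using LB(1)[of s] r Y0 by (intro mult_mono power_mono) auto
     moreover have "L s ^ 7 = L s * L s ^ 6" by (simp add: power_Suc[symmetric] del: power_Suc)
     ultimately show ?thesis using g0[of s] by (intro mult_left_mono) auto
    qed
    ultimately have "(norm (f' s))\<^sup>2 \<le> inverse (r ^ 3) ^ 2 * (g s * (Y * r ^ 6))"
     using r(1) by (auto simp: power_mult_distrib intro!: mult_left_mono)
    also have "\<dots> = g s * Y"
    proof -
     have "inverse (r ^ 3) ^ 2 * r ^ 6 = 1" using r(1) by (simp add: power_inverse power_mult[symmetric])
     then show ?thesis by (simp add: ac_simps)
    qed
    also have "\<dots> \<le> (g s + Y)\<^sup>2"
    proof -
     have "(g s + Y)\<^sup>2 = g s * Y + (g s * g s + g s * Y + Y * Y)" by (simp add: power2_eq_square algebra_simps)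
     moreover have "0 \<le> g s * g s + g s * Y + Y * Y" using g0[of s] Y0 by simp
     ultimately show ?thesis by linarith
    qed
    finally show ?thesis using g0[of s] Y0 by (intro power2_le_imp_le[of "norm (f' s)"]) auto
   qed
   \<comment> \<open>Changing the derivative to zero on the null set makes the bound hold at every
     point, while the primitive stays the same.\<close>
   define f2 where "f2 = (\<lambda>s. if s \<in> N then 0 else f' s)"
   have acf2: "ac x w1 (\<lambda>s. inverse (sqrt (?u s)) *\<^sub>R wder h s) f2"
    by (rule ac_cong_negligible[OF acf N(1)]) (simp add: f2_def)
   have f2b: "norm (f2 s) \<le> g s + Y" if "s \<in> {x..w1}" for s
    using f'b[of s] that g0[of s] Y0 by (auto simp: f2_def)
   have "norm (inverse (sqrt (?u w1)) *\<^sub>R wder h w1 - inverse (sqrt (?u x)) *\<^sub>R wder h x) \<le> integral {x..w1} (\<lambda>s. norm (f2 s))"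
    by (rule ac_norm_diff_le[OF acf2]) (use xb in auto)
   also have "\<dots> \<le> integral {x..w1} (\<lambda>s. g s + Y)"
    by (intro integral_le absint_sub(3)[OF acD(1)[OF acf2]] absint_sub(2)[OF gY] f2b) (use xb in auto)
   also have "\<dots> \<le> integral {0..2*pi} (\<lambda>s. g s + Y)"
    using xb g0 Y0 by (intro integral_subset_le absint_sub(2)[OF gY]) auto
   finally have d: "norm (inverse (sqrt (?u w1)) *\<^sub>R wder h w1 - inverse (sqrt (?u x)) *\<^sub>R wder h x) \<le> integral {0..2*pi} (\<lambda>s. g s + Y)" .
   have "norm (inverse (sqrt (?u x)) *\<^sub>R wder h x) \<le> C"
    using d norm_triangle_ineq2[of "inverse (sqrt (?u x)) *\<^sub>R wder h x" "inverse (sqrt (?u w1)) *\<^sub>R wder h w1"]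
    unfolding C_def by (simp add: norm_minus_commute norm_eq_sqrt_inner[of "wder c _"])
   then have "inverse (norm (wder c x)) * norm (wder h x) \<le> C" by (simp add: norm_eq_sqrt_inner[of "wder c _"])
   then show ?thesis using pos[of x] xb by (simp add: field_simps)
  qed
  have "0 \<le> C * norm (wder c z) - norm (wder h z)"
  proof (rule continuous_ge_on_closure[where S = "{z<..w1}" and f = "\<lambda>x. C * norm (wder c x) - norm (wder h x)"])
   show "continuous_on (closure {z<..w1}) (\<lambda>x. C * norm (wder c x) - norm (wder h x))"
    by (intro continuous_intros continuous_on_subset[OF rc(1)] continuous_on_subset[OF rh(1)]) auto
   show "z \<in> closure {z<..w1}" using zb by simp
   show "0 \<le> C * norm (wder c x) - norm (wder h x)" if "x \<in> {z<..w1}" for x using bd[OF that] by simp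
  qed
  then show False using zb(3) h_nz[OF zb(3)] by simp
 qed
 have "wder c w \<noteq> 0" for w by (rule periodic_all[OF rc(2), where P = "\<lambda>z. z \<noteq> 0", OF nz])
 then show ?thesis using Sc m by (simp add: Imm_iff c_def[symmetric])
qed

lemma linear_path_diff: "linear_path a b t y = linear_path a b s y + (t - s) *\<^sub>R (b y - a y)"
 by (simp add: linear_path_def algebra_simps)

text \<open>At a zero \<open>y\<close> of \<open>c(t\<^sub>0)'\<close> one has \<open>|\<partial>\<^sub>s h| = 1 / |t - t\<^sub>0|\<close> along \<open>c(t)\<close>, which is not square integrable in \<open>t\<close>.\<close>

lemma linear_path_Imm_all:
 assumes m: "2 \<le> m" and aI: "a \<in> Imm m" and b: "Sob m b"
  and F: "F \<in> borel_measurable lborel" "(\<integral>\<^sup>+t. F t * indicator {0..1} t \<partial>lborel) < \<infinity>"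
  and ae: "AE t in lborel. t \<in> {0..1} \<longrightarrow> linear_path a b t \<in> Imm m \<and> ennreal (gm m (linear_path a b t) (\<lambda>y. b y - a y)) \<le> F t"
  and t0: "t0 \<in> {0..1}"
 shows "linear_path a b t0 \<in> Imm m"
proof -
 have a: "Sob m a" "\<And>y. wder a y \<noteq> 0" using aI m by (auto simp: Imm_iff)
 define h where "h = (\<lambda>y. b y - a y)"
 have Sh: "Sob m h" unfolding h_def by (rule Sob_diff[OF b a(1)])
 have h': "wder h y = wder b y - wder a y" for y unfolding h_def wder_diff[OF m a(1) b] ..
 have c': "wder (linear_path a b t) y = wder (linear_path a b s) y + (t - s) *\<^sub>R wder h y" for t s y
  unfolding wder_linear_path[OF m a(1) b] h' by (rule linear_path_diff)
 obtain Ya where Ya: "\<And>y. norm (wder a y) \<le> Ya" using periodic_bounded[OF wder_regular(2,1)[OF m a(1)]] by blast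
 obtain Yb where Yb: "\<And>y. norm (wder b y) \<le> Yb" using periodic_bounded[OF wder_regular(2,1)[OF m b]] by blast
 define Y where "Y = max Ya Yb"
 have Y: "norm (wder (linear_path a b t) y) \<le> Y" if t: "t \<in> {0..1}" for t y
 proof -
  have "norm (wder (linear_path a b t) y) \<le> (1 - t) * norm (wder a y) + t * norm (wder b y)"
   unfolding wder_linear_path[OF m a(1) b] unfolding linear_path_def
   using norm_triangle_ineq[of "(1 - t) *\<^sub>R wder a y" "t *\<^sub>R wder b y"] t by simp
  also have "\<dots> \<le> Y" using t Ya[of y] Yb[of y] by (intro convex_bound_le) (auto simp: Y_def)
  finally show ?thesis .
 qed
 have Y0: "Y \<ge> 0" by (rule order_trans[OF norm_ge_zero Y[of 0 0]]) simp
 define \<kappa> where "\<kappa> = Y * measure circle (space circle)"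
 have \<kappa>0: "\<kappa> \<ge> 0" using Y0 by (simp add: \<kappa>_def)
 have l: "(LINT y|circle. norm (wder (linear_path a b t) y)) \<le> \<kappa>" if t: "t \<in> {0..1}" for t
 proof -
  note [measurable] = wder_regular(5)[OF m Sob_linear_path[OF a(1) b, of t]]
  have i: "integrable circle (\<lambda>y. norm (wder (linear_path a b t) y))"
   by (rule circle.integrable_const_bound[where B = Y]) (use Y[OF t] in auto)
  have "(LINT y|circle. norm (wder (linear_path a b t) y)) \<le> (LINT y|circle. Y)"
   by (rule integral_mono[OF i]) (use Y[OF t] in auto)
  then show ?thesis by (simp add: \<kappa>_def mult.commute)
 qed
 have "wder (linear_path a b t0) y \<noteq> 0" for y
 proof
  assume z: "wder (linear_path a b t0) y = 0"
  then have hn: "wder h y \<noteq> 0" using c'[of 0 y t0] a(2)[of y] by auto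
  have key: "ennreal 1 \<le> ennreal (\<kappa> * (t - t0)\<^sup>2) * F t"
   if t: "t \<in> {0..1}" and imm: "linear_path a b t \<in> Imm m" and le: "ennreal (gm m (linear_path a b t) h) \<le> F t" for t
  proof -
   define g where "g = gm m (linear_path a b t) h"
   have g0: "g \<ge> 0" by (simp add: g_def gm_nonneg)
   have ct: "wder (linear_path a b t) y = (t - t0) *\<^sub>R wder h y" using c'[of t y t0] z by simp
   have "wder (linear_path a b t) y \<noteq> 0" using imm m by (simp add: Imm_iff)
   then have tt: "t \<noteq> t0" using ct by auto
   have "norm (xi (linear_path a b t) h 1 y) = 1 / \<bar>t - t0\<bar>"
    using tt hn by (simp add: xi_Suc xi_0 arc_deriv_def ct)
   then have "1 / \<bar>t - t0\<bar> \<le> sqrt (LINT y|circle. norm (wder (linear_path a b t) y)) * sqrt g"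
    using xi_1_le(1)[OF m imm Sh, of y] by (simp add: g_def)
   also have "\<dots> \<le> sqrt (\<kappa> * g)"
    unfolding real_sqrt_mult by (intro mult_right_mono real_sqrt_le_mono l t) (use g0 in auto)
   finally have "(1 / \<bar>t - t0\<bar>)\<^sup>2 \<le> (sqrt (\<kappa> * g))\<^sup>2" by (intro power_mono) auto
   then have "1 / (t - t0)\<^sup>2 \<le> \<kappa> * g" using \<kappa>0 g0 by (simp add: power_divide)
   then have "1 \<le> (\<kappa> * (t - t0)\<^sup>2) * g" using tt by (simp add: field_simps)
   then have "ennreal 1 \<le> ennreal (\<kappa> * (t - t0)\<^sup>2) * ennreal g"
    using \<kappa>0 g0 by (subst ennreal_mult[symmetric]) (auto intro!: ennreal_leI)
   also have "\<dots> \<le> ennreal (\<kappa> * (t - t0)\<^sup>2) * F t" using le by (intro mult_left_mono) (auto simp: g_def)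
   finally show ?thesis .
  qed
  obtain v where v: "(\<integral>\<^sup>+t. F t * indicator {0..1} t \<partial>lborel) = ennreal v" "v \<ge> 0"
   using F(2) by (cases "\<integral>\<^sup>+t. F t * indicator {0..1} t \<partial>lborel") auto
  \<comment> \<open>Integration of the pointwise inequality over an interval of length
    \<open>\<delta>\<close> with end point \<open>t0\<close> yields
    \<open>1 \<le> \<kappa> * v * \<delta>\<close>, which the second bound contradicts. The first
    bound makes such an interval fit into the unit interval on one side of
    \<open>t0\<close>.\<close>
  define \<delta> where "\<delta> = min (1/2) (1 / (2 * (\<kappa> * v + 1)))"
  have kv: "\<kappa> * v \<ge> 0" using \<kappa>0 v(2) by simp
  have \<delta>: "\<delta> > 0" "\<delta> \<le> 1/2" "\<delta> \<le> 1 / (2 * (\<kappa> * v + 1))" using kv by (auto simp: \<delta>_def)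
  define s where "s = (if t0 \<le> 1/2 then t0 else t0 - \<delta>)"
  have J: "{s..s+\<delta>} \<subseteq> {0..1}" "\<And>t. t \<in> {s..s+\<delta>} ==> \<bar>t - t0\<bar> \<le> \<delta>" using \<delta>(1,2) t0 by (auto simp: s_def split: if_splits)
  have "ennreal \<delta> = (\<integral>\<^sup>+t. indicator {s..s+\<delta>} t \<partial>lborel)" using \<delta>(1) by simp
  also have "\<dots> \<le> (\<integral>\<^sup>+t. ennreal (\<kappa> * \<delta>\<^sup>2) * (F t * indicator {0..1} t) \<partial>lborel)"
  proof (rule nn_integral_mono_AE)
   show "AE t in lborel. indicator {s..s+\<delta>} t \<le> ennreal (\<kappa> * \<delta>\<^sup>2) * (F t * indicator {0..1} t)"
    using ae
   proof eventually_elim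
    case (elim t)
    show ?case
    proof (cases "t \<in> {s..s+\<delta>}")
     case True
     then have t: "t \<in> {0..1}" and d: "\<bar>t - t0\<bar> \<le> \<delta>" using J by auto
     have "ennreal 1 \<le> ennreal (\<kappa> * (t - t0)\<^sup>2) * F t" using elim t by (intro key) (auto simp: h_def)
     also have "\<dots> \<le> ennreal (\<kappa> * \<delta>\<^sup>2) * F t"
      using \<kappa>0 abs_le_square_iff[of "t - t0" \<delta>] d \<delta>(1) by (intro mult_right_mono ennreal_leI mult_left_mono) auto
     finally show ?thesis using True t by simp
    qed simp
   qed
  qed
  also have "\<dots> = ennreal (\<kappa> * \<delta>\<^sup>2) * (\<integral>\<^sup>+t. F t * indicator {0..1} t \<partial>lborel)"
   using F(1) by (intro nn_integral_cmult) simp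
  also have "\<dots> = ennreal (\<kappa> * \<delta>\<^sup>2 * v)" unfolding v(1) using \<kappa>0 v(2) by (simp add: ennreal_mult)
  finally have "\<delta> \<le> \<kappa> * \<delta>\<^sup>2 * v" using \<kappa>0 v(2) by simp
  then have "\<delta> * 1 \<le> \<delta> * (\<kappa> * v * \<delta>)" by (simp add: power2_eq_square ac_simps)
  then have "1 \<le> \<kappa> * v * \<delta>" using \<delta>(1) by simp
  also have "\<dots> \<le> \<kappa> * v * (1 / (2 * (\<kappa> * v + 1)))" using \<delta>(3) kv by (rule mult_left_mono)
  also have "\<dots> < 1" using kv by (simp add: divide_simps)
  finally show False by simp
 qed
 then show ?thesis using Sob_linear_path[OF a(1) b] m by (simp add: Imm_iff)
qed

text \<open>The density \<open>F\<close> is compared with the metric for almost all times only. A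
  path energy is infinite as soon as one curve is not an immersion, and
  \<open>linear_path_Imm_all\<close> supplies the exceptional times.\<close>

lemma coercive_criterion:
 assumes m: "2 \<le> m" and aI: "a \<in> Imm m" and b: "Sob m b" and F: "F \<in> borel_measurable lborel"
  and ae: "(\<integral>\<^sup>+t. F t * indicator {0..1} t \<partial>lborel) < \<infinity> ==>
   AE t in lborel. t \<in> {0..1} \<longrightarrow> linear_path a b t \<in> Imm m \<and> ennreal (gm m (linear_path a b t) (\<lambda>y. b y - a y)) \<le> F t"
 shows "path_energy m (linear_path a b) \<le> (\<integral>\<^sup>+t. F t * indicator {0..1} t \<partial>lborel)"
proof (cases "(\<integral>\<^sup>+t. F t * indicator {0..1} t \<partial>lborel) < \<infinity>")
 case False
 then have "(\<integral>\<^sup>+t. F t * indicator {0..1} t \<partial>lborel) = top" by (simp add: not_less top_unique)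
 then show ?thesis by simp
next
 case True
 have a: "Sob m a" using aI m by (simp add: Imm_iff)
 have "path_energy m (linear_path a b) = (\<integral>\<^sup>+t. ennreal (gm m (linear_path a b t) (\<lambda>y. b y - a y)) * indicator {0..1} t \<partial>lborel)"
  using linear_path_Imm_all[OF m aI b F True ae[OF True]] by (subst path_energy_linear[OF m a b]) auto
 also have "\<dots> \<le> (\<integral>\<^sup>+t. F t * indicator {0..1} t \<partial>lborel)"
 proof (rule nn_integral_mono_AE)
  show "AE t in lborel. ennreal (gm m (linear_path a b t) (\<lambda>y. b y - a y)) * indicator {0..1} t \<le> F t * indicator {0..1} t"
   using ae[OF True] by eventually_elim (auto simp: indicator_def)
 qed
 finally show ?thesis .
qed

lemma coercive_V_reg:
 assumes m: "2 \<le> m"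
 shows "coercive m (V_reg \<epsilon> m)"
 unfolding coercive_def
proof (intro ballI)
 fix a b :: "('d::finite) curve" assume aI: "a \<in> Imm m" and bI: "b \<in> Imm m"
 then have a: "Sob m a" and b: "Sob m b" using m by (auto simp: Imm_iff)
 note dm [measurable] = reg_density_measurable[OF m a b, of \<epsilon>]
 define F where "F t = reg_zero \<epsilon> a b + reg_density \<epsilon> m a b t" for t
 have Fm: "F \<in> borel_measurable lborel" unfolding F_def[abs_def] by measurable
 have "(\<integral>\<^sup>+t. F t * indicator {0..1} t \<partial>lborel) = (\<integral>\<^sup>+t. reg_zero \<epsilon> a b * indicator {0..1::real} t + reg_density \<epsilon> m a b t * indicator {0..1} t \<partial>lborel)"
  by (simp add: F_def distrib_right)
 also have "\<dots> = (\<integral>\<^sup>+t. reg_zero \<epsilon> a b * indicator {0..1::real} t \<partial>lborel) + (\<integral>\<^sup>+t. reg_density \<epsilon> m a b t * indicator {0..1} t \<partial>lborel)"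
  by (rule nn_integral_add) measurable
 also have "\<dots> = V_reg \<epsilon> m a b" by (simp add: V_reg_def nn_integral_cmult_indicator)
 finally have FV: "(\<integral>\<^sup>+t. F t * indicator {0..1} t \<partial>lborel) = V_reg \<epsilon> m a b" .
 show "path_energy m (linear_path a b) \<le> V_reg \<epsilon> m a b"
  unfolding FV[symmetric]
 proof (rule coercive_criterion[OF m aI b Fm])
  assume "(\<integral>\<^sup>+t. F t * indicator {0..1} t \<partial>lborel) < \<infinity>"
  then have "AE t in lborel. F t * indicator {0..1} t \<noteq> \<infinity>"
   using Fm by (intro nn_integral_PInf_AE) auto
  then show "AE t in lborel. t \<in> {0..1} \<longrightarrow> linear_path a b t \<in> Imm m \<and> ennreal (gm m (linear_path a b t) (\<lambda>y. b y - a y)) \<le> F t"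
  proof eventually_elim
   case (elim t)
   show ?case
   proof
    assume t: "t \<in> {0..1}"
    then have "F t \<noteq> \<infinity>" using elim by simp
    then have "reg_density \<epsilon> m a b t < \<infinity>" by (simp add: F_def less_top[symmetric])
    from reg_density_imp_Imm[OF m aI bI t this]
    show "linear_path a b t \<in> Imm m \<and> ennreal (gm m (linear_path a b t) (\<lambda>y. b y - a y)) \<le> F t"
     using gm_le_reg[OF m a b t] by (simp add: F_def)
   qed
  qed
 qed
qed

section \<open>Lower semicontinuity of the regularized functional\<close>

lemma tendsto_inverse_ennreal:
 fixes f :: "nat => ennreal"
 assumes "f \<longlonglongrightarrow> l"
 shows "(\<lambda>n. inverse (f n)) \<longlonglongrightarrow> inverse l"
 using continuous_on_tendsto_compose[OF continuous_on_inverse_ennreal[OF continuous_on_id, of UNIV] assms] by simp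

lemma pc_power: "pc U u ==> pc (\<lambda>n y. U n y ^ p) (\<lambda>y. (u y :: real) ^ p)"
proof (induction p)
 case 0
 then show ?case using pc_const[OF tendsto_const[of "1::real"]] by simp
next
 case (Suc p)
 then show ?case using pc_mult[OF Suc.prems] by simp
qed

lemma L_minus_tendsto:
 assumes m: "2 \<le> m" and A: "wc m A a" and B: "wc m B b" and nz: "wder a y \<noteq> 0" "wder b y \<noteq> 0"
 shows "(\<lambda>n. L_minus \<epsilon> (A n) (B n) y) \<longlonglongrightarrow> L_minus \<epsilon> a b y"
 unfolding L_minus_def min_eps_def
 by (intro tendsto_intros tendsto_max tendsto_sgn pcD(2)[OF wc_wder'(2)[OF m A]] pcD(2)[OF wc_wder'(2)[OF m B]] nz) auto

lemma L_plus_tendsto: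
 assumes m: "2 \<le> m" and A: "wc m A a" and B: "wc m B b"
 shows "(\<lambda>n. L_plus \<epsilon> (A n) (B n) y) \<longlonglongrightarrow> L_plus \<epsilon> a b y"
 unfolding L_plus_def max_eps_def
 by (intro tendsto_intros pcD(2)[OF wc_wder'(2)[OF m A]] pcD(2)[OF wc_wder'(2)[OF m B]]) auto

text \<open>The polynomials are powers of the pointwise convergent speed times weakly convergent arc
  length derivatives. The weights, inverse powers of \<open>L_minus\<close>, converge in
  \<open>ennreal\<close> even where their limit is infinite; Fatou's lemma then treats the integral
  over time.\<close>

lemma path_lsc_V_reg:
 assumes m: "2 \<le> m"
 shows "path_lsc m (V_reg \<epsilon> m)"
 unfolding path_lsc_def
proof (intro allI impI)
 fix A B and a b :: "('d::finite) curve" and d :: real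
 assume A: "wc m A a" and B: "wc m B b" and d: "d > 0"
  and dn0: "\<forall>n. \<forall>t\<in>{0..1}. \<forall>y. d \<le> norm (wder (linear_path (A n) (B n) t) y)"
 have dn: "d \<le> norm (wder (linear_path (A n) (B n) t) y)" if "t \<in> {0..1}" for n t y using dn0 that by blast
 have Sa: "Sob m a" and Sb: "Sob m b" using wc_Sob[OF A] wc_Sob[OF B] by auto
 have SA: "Sob m (A n)" and SB: "Sob m (B n)" for n using wc_Sob_seq[OF A] wc_Sob_seq[OF B] by auto
 have dl: "d \<le> norm (wder (linear_path a b t) y)" if t: "t \<in> {0..1}" for t y
  by (rule linear_limit[OF m A B _ t]) (rule dn)
 have nz: "wder a y \<noteq> 0" "wder b y \<noteq> 0" for y using dl[of 0 y] dl[of 1 y] d by auto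
 have H: "wc m (\<lambda>n y. B n y - A n y) (\<lambda>y. b y - a y)" by (rule wc_diff[OF B A])
 have dens: "reg_density \<epsilon> m a b t \<le> liminf (\<lambda>n. reg_density \<epsilon> m (A n) (B n) t)" if t: "t \<in> {0..1}" for t
 proof -
  have C: "wc m (\<lambda>n. linear_path (A n) (B n) t) (linear_path a b t)" by (rule wc_linear_path[OF A B tendsto_const])
  have I: "linear_path a b t \<in> Imm m" by (rule Imm_lowerI[OF m wc_Sob[OF C] d dl[OF t]])
  have In: "linear_path (A n) (B n) t \<in> Imm m" for n by (rule Imm_lowerI[OF m wc_Sob_seq[OF C] d dn[OF t]])
  define T where "T a b j = (\<integral>\<^sup>+y. ennreal ((norm (reg_P (linear_path a b) (\<lambda>y. b y - a y) j t y))\<^sup>2) /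
  ennreal (L_minus \<epsilon> a b y ^ (6 * j - 5)) \<partial>circle)" for a b :: "'d curve" and j
  have Teq: "T a b j = (\<integral>\<^sup>+y. inverse (ennreal (L_minus \<epsilon> a b y ^ (6 * j - 5))) *
    ennreal ((norm (norm (wder (linear_path a b t) y) ^ (3 * j - 2) *\<^sub>R xi (linear_path a b t) (\<lambda>y. b y - a y) j y))\<^sup>2) \<partial>circle)"
   if "j \<in> {1..m}" "Sob m a" "Sob m b" "linear_path a b t \<in> Imm m" for j and a b :: "'d curve"
   unfolding T_def
  proof (rule nn_integral_cong_AE)
   have j: "1 \<le> j" "j \<le> m" using that(1) by auto
   show "AE y in circle. ennreal ((norm (reg_P (linear_path a b) (\<lambda>y. b y - a y) j t y))\<^sup>2) / ennreal (L_minus \<epsilon> a b y ^ (6 * j - 5)) =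
    inverse (ennreal (L_minus \<epsilon> a b y ^ (6 * j - 5))) *
    ennreal ((norm (norm (wder (linear_path a b t) y) ^ (3 * j - 2) *\<^sub>R xi (linear_path a b t) (\<lambda>y. b y - a y) j y))\<^sup>2)"
    using reg_P_xi[OF m that(2,3) j t that(4)] by eventually_elim (simp only: divide_ennreal_def mult.commute)
  qed
  have "T a b j \<le> liminf (\<lambda>n. T (A n) (B n) j)" if j: "j \<in> {1..m}" for j
  proof -
   let ?p = "3 * j - 2"
   have jm: "j \<le> m" using j by simp
   have X: "wc 0 (\<lambda>n. xi (linear_path (A n) (B n) t) (\<lambda>y. B n y - A n y) j) (xi (linear_path a b t) (\<lambda>y. b y - a y) j)"
    by (rule wc_le[OF wc_xi[OF m C H d dn[OF t] jm]]) simp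
   have w: "wl2 (\<lambda>n y. norm (wder (linear_path (A n) (B n) t) y) ^ ?p *\<^sub>R xi (linear_path (A n) (B n) t) (\<lambda>y. B n y - A n y) j y)
    (\<lambda>y. norm (wder (linear_path a b t) y) ^ ?p *\<^sub>R xi (linear_path a b t) (\<lambda>y. b y - a y) j y)"
   proof (rule wl2_bilinear[OF bounded_bilinear_scaleR pc_power[OF pc_norm[OF wc_wder'(2)[OF m C]]]])
    fix n
    note r = wder_regular[OF m wc_Sob_seq[OF C, of n]]
    show "(\<lambda>y. norm (wder (linear_path (A n) (B n) t) y) ^ ?p) \<in> borel_measurable borel" using r(5) by measurable
    show "periodic (\<lambda>y. norm (wder (linear_path (A n) (B n) t) y) ^ ?p)" using r(2) by (simp add: periodic_def)
   qed (use X in simp)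
   have lim: "liminf (\<lambda>n. inverse (ennreal (L_minus \<epsilon> (A n) (B n) y ^ (6 * j - 5)))) = inverse (ennreal (L_minus \<epsilon> a b y ^ (6 * j - 5)))" for y
    by (intro lim_imp_Liminf[OF trivial_limit_sequentially] tendsto_inverse_ennreal tendsto_ennrealI tendsto_power L_minus_tendsto[OF m A B nz])
   have "T a b j = (\<integral>\<^sup>+y. liminf (\<lambda>n. inverse (ennreal (L_minus \<epsilon> (A n) (B n) y ^ (6 * j - 5)))) *
    ennreal ((norm (norm (wder (linear_path a b t) y) ^ ?p *\<^sub>R xi (linear_path a b t) (\<lambda>y. b y - a y) j y))\<^sup>2) \<partial>circle)"
    unfolding lim by (rule Teq[OF j Sa Sb I])
   also have "\<dots> \<le> liminf (\<lambda>n. T (A n) (B n) j)"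
    unfolding Teq[OF j SA SB In]
    by (rule weighted_nsq_lsc[OF w]) (use L_measurable(1)[OF m SA SB] in measurable)
   finally show ?thesis .
  qed
  then have "(\<Sum>j=1..m. T a b j) \<le> (\<Sum>j=1..m. liminf (\<lambda>n. T (A n) (B n) j))" by (rule sum_mono)
  also have "\<dots> \<le> liminf (\<lambda>n. \<Sum>j=1..m. T (A n) (B n) j)" by (rule sum_liminf_le) simp
  finally show ?thesis by (simp add: reg_density_def T_def)
 qed
 have zero: "reg_zero \<epsilon> a b \<le> liminf (\<lambda>n. reg_zero \<epsilon> (A n) (B n))"
 proof -
  have eq: "reg_zero \<epsilon> a b = (\<integral>\<^sup>+y. ennreal (L_plus \<epsilon> a b y) * ennreal ((norm (b y - a y))\<^sup>2) \<partial>circle)" for a b :: "'d curve"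
   unfolding reg_zero_def by (intro nn_integral_cong) (simp add: ennreal_mult'')
  have lim: "liminf (\<lambda>n. ennreal (L_plus \<epsilon> (A n) (B n) y)) = ennreal (L_plus \<epsilon> a b y)" for y
   by (intro lim_imp_Liminf[OF trivial_limit_sequentially] tendsto_ennrealI L_plus_tendsto[OF m A B])
  have "wl2 (\<lambda>n y. B n y - A n y) (\<lambda>y. b y - a y)" using wc_le[OF H, of 0] by simp
  from weighted_nsq_lsc[OF this, of "\<lambda>n y. ennreal (L_plus \<epsilon> (A n) (B n) y)"] show ?thesis
   unfolding eq lim using L_measurable(2)[OF m SA SB] by simp
 qed
 have int: "(\<integral>\<^sup>+t. reg_density \<epsilon> m a b t * indicator {0..1} t \<partial>lborel) \<le>
  liminf (\<lambda>n. \<integral>\<^sup>+t. reg_density \<epsilon> m (A n) (B n) t * indicator {0..1} t \<partial>lborel)"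
 proof -
  have "(\<integral>\<^sup>+t. reg_density \<epsilon> m a b t * indicator {0..1} t \<partial>lborel) \<le>
   (\<integral>\<^sup>+t. liminf (\<lambda>n. reg_density \<epsilon> m (A n) (B n) t * indicator {0..1} t) \<partial>lborel)"
  proof (rule nn_integral_mono)
   fix t :: real
   show "reg_density \<epsilon> m a b t * indicator {0..1} t \<le> liminf (\<lambda>n. reg_density \<epsilon> m (A n) (B n) t * indicator {0..1} t)"
    using dens[of t] by (cases "t \<in> {0..1}") auto
  qed
  also have "\<dots> \<le> liminf (\<lambda>n. \<integral>\<^sup>+t. reg_density \<epsilon> m (A n) (B n) t * indicator {0..1} t \<partial>lborel)"
   by (rule nn_integral_liminf) (use reg_density_measurable[OF m SA SB] in simp)
  finally show ?thesis .
 qed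
 \<comment> \<open>The two parts of the functional are indexed by truth values, which makes
   \<open>sum_liminf_le\<close> applicable to their sum.\<close>
 define f where "f n x = (if x then reg_zero \<epsilon> (A n) (B n) else (\<integral>\<^sup>+t. reg_density \<epsilon> m (A n) (B n) t * indicator {0..1} t \<partial>lborel))" for n x
 have "V_reg \<epsilon> m a b \<le> (\<Sum>x\<in>UNIV. liminf (\<lambda>n. f n x))"
  unfolding UNIV_bool using add_mono[OF int zero] by (simp add: V_reg_def f_def add.commute)
 also have "\<dots> \<le> liminf (\<lambda>n. \<Sum>x\<in>UNIV. f n x)" by (rule sum_liminf_le) simp
 also have "\<dots> = liminf (\<lambda>n. V_reg \<epsilon> m (A n) (B n))" unfolding UNIV_bool by (simp add: V_reg_def f_def add.commute)
 finally show "V_reg \<epsilon> m a b \<le> liminf (\<lambda>n. V_reg \<epsilon> m (A n) (B n))" .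
qed

section \<open>The closed form of the rational integrand as an integral over time\<close>

lemma nn_integral_continuous:
 fixes f :: "real => real"
 assumes f: "continuous_on {0..1} f" "\<And>t. t \<in> {0..1} ==> 0 \<le> f t" and I: "(f has_integral I) {0..1}"
 shows "(\<integral>\<^sup>+t. ennreal (f t) * indicator {0..1} t \<partial>lborel) = ennreal I" "0 \<le> I"
proof -
 have i: "set_integrable lborel {0..1} f" by (rule borel_integrable_atLeastAtMost'[OF f(1)])
 have "(\<integral>\<^sup>+t. ennreal (f t) * indicator {0..1} t \<partial>lborel) = (\<integral>\<^sup>+t. ennreal (indicator {0..1} t *\<^sub>R f t) \<partial>lborel)"
  by (intro nn_integral_cong) (auto simp: indicator_def)
 also have "\<dots> = ennreal (LINT t|lborel. indicator {0..1} t *\<^sub>R f t)"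
  by (rule nn_integral_eq_integral) (use i f(2) in \<open>auto simp: set_integrable_def indicator_def\<close>)
 also have "(LINT t|lborel. indicator {0..1} t *\<^sub>R f t) = I"
  using set_borel_integral_eq_integral(2)[OF i] I by (simp add: set_lebesgue_integral_def integral_unique)
 finally show "(\<integral>\<^sup>+t. ennreal (f t) * indicator {0..1} t \<partial>lborel) = ennreal I" .
 show "0 \<le> I" using f(2) by (intro has_integral_nonneg[OF I]) auto
qed

context
 fixes r p q :: real
 assumes r: "r > 0" and p: "p > 0" and q: "q > 0" and qrp: "q \<le> r * p"
begin

private definition "l t = (1 - t) * r + t * p" for t
private definition "D t = (1 - t)\<^sup>2 * r\<^sup>2 + 2 * t * (1 - t) * q + t\<^sup>2 * p\<^sup>2" for t
private definition "D' t = - 2 * (1 - t) * r\<^sup>2 + 2 * (1 - 2 * t) * q + 2 * t * p\<^sup>2" for t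
text \<open>The scalar product of the initial velocity with the velocity at time \<open>t\<close>,
  whose squared norm is \<open>D t\<close>. By Cauchy-Schwarz \<open>r^2 / (e t)^2\<close> is at
  least \<open>1 / D t\<close>, and it has the rational primitive \<open>t / e t\<close> with
  integral \<open>1 / q\<close>.\<close>

private definition "e t = (1 - t) * r\<^sup>2 + t * q" for t
text \<open>\<open>\<eta>\<close> and \<open>B\<close> are the coefficients with which
  \<open>1 / D\<close> remains in \<open>l * (r^2 + p^2 - 2 * q) / D\<close> and in
  \<open>l / D^2\<close> after exact derivatives have been split off.\<close>

private definition "\<eta> = (r + p) * (r * p - q)"
private definition "B = (r + p) / (2 * (r * p + q))"

private lemma D_pos: "t \<in> {0..1} ==> D t > 0" and e_pos: "t \<in> {0..1} ==> e t > 0"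
proof -
 assume t: "t \<in> {0..1}"
 show "D t > 0"
 proof (cases "t = 1")
  case False
  then have "(1 - t)\<^sup>2 * r\<^sup>2 > 0" using r by simp
  then show ?thesis using t q by (simp add: D_def add_pos_nonneg)
 qed (use p in \<open>simp add: D_def\<close>)
 show "e t > 0"
 proof (cases "t = 1")
  case False
  then have "(1 - t) * r\<^sup>2 > 0" using r t by simp
  then show ?thesis using t q by (simp add: e_def add_pos_nonneg)
 qed (use q in \<open>simp add: e_def\<close>)
qed

private lemma D_deriv: "(D has_real_derivative D' t) (at t within S)"
 unfolding D_def[abs_def] D'_def by (auto intro!: derivative_eq_intros simp: algebra_simps)

private lemma te_deriv: "t \<in> {0..1} ==> ((\<lambda>t. t / e t) has_real_derivative (r\<^sup>2 / (e t)\<^sup>2)) (at t within S)"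
proof -
 assume t: "t \<in> {0..1}"
 have "((\<lambda>t. t / e t) has_real_derivative ((1 * e t - t * (q - r\<^sup>2)) / (e t * e t))) (at t within S)"
  by (rule DERIV_divide) (use e_pos[OF t] in \<open>auto simp: e_def[abs_def] intro!: derivative_eq_intros\<close>)
 moreover have "1 * e t - t * (q - r\<^sup>2) = r\<^sup>2" by (simp add: e_def algebra_simps)
 ultimately show ?thesis by (simp add: power2_eq_square)
qed

private lemma l_identity: "l t * (r\<^sup>2 + p\<^sup>2 - 2 * q) = (p - r) / 2 * D' t + \<eta>"
 by (simp add: l_def D'_def \<eta>_def power2_eq_square field_simps)

text \<open>The identity is arranged so that \<open>l / D^2 - B / D\<close> is the derivative of a
  quotient with denominator \<open>D\<close> and an affine numerator of slope
  \<open>B\<close>.\<close>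

private lemma l_identity2: "l t = 2 * B * D t - ((r + p) * t - r) / (2 * (r * p + q)) * D' t"
proof -
 define s where "s = r * p + q"
 have s: "s > 0" using r p q by (simp add: s_def add_pos_pos)
 have "2 * s * l t = 2 * (r + p) * D t - ((r + p) * t - r) * D' t"
  by (simp add: s_def l_def D_def D'_def power2_eq_square algebra_simps)
 then have "l t = (2 * (r + p) * D t - ((r + p) * t - r) * D' t) / (2 * s)" using s
  by (simp add: eq_divide_eq ac_simps)
 also have "\<dots> = 2 * ((r + p) / (2 * s)) * D t - ((r + p) * t - r) / (2 * s) * D' t"
  by (subst diff_divide_distrib) (simp only: times_divide_eq_right times_divide_eq_left)
 finally show ?thesis unfolding B_def s_def .
qed

text \<open>The primitive \<open>A\<close> collects those of \<open>l\<close>, \<open>D' / D\<close>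
  and \<open>r^2 / e^2\<close>. At the end points the second one gives the logarithm and the third
  one \<open>\<eta> / q\<close>, which is the summand with the reciprocal cosine.\<close>

lemma rat_zero_has_integral:
 "((\<lambda>t. l t * H + l t * (r\<^sup>2 + p\<^sup>2 - 2 * q) / D t + \<eta> * (r\<^sup>2 / (e t)\<^sup>2 - 1 / D t)) has_integral
  ((r + p) / 2 * H + (1 / (q / (r * p)) - 1) * (r + p) + (r - p) * ln (r / p))) {0..1}"
proof -
 define A where "A t = H * (r * t + (p - r) * t\<^sup>2 / 2) + (p - r) / 2 * ln (D t) + \<eta> * (t / e t)" for t
 have "((\<lambda>t. l t * H + l t * (r\<^sup>2 + p\<^sup>2 - 2 * q) / D t + \<eta> * (r\<^sup>2 / (e t)\<^sup>2 - 1 / D t)) has_integral (A 1 - A 0)) {0..1}"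
 proof (rule fundamental_theorem_of_calculus)
  fix t :: real assume t: "t \<in> {0..1}"
  have 1: "((\<lambda>t. r * t + (p - r) * t\<^sup>2 / 2) has_real_derivative l t) (at t within {0..1})"
   unfolding l_def by (auto intro!: derivative_eq_intros simp: field_simps)
  have 2: "((\<lambda>t. ln (D t)) has_real_derivative (1 / D t * D' t)) (at t within {0..1})"
   by (rule DERIV_chain2[OF DERIV_ln_divide[OF D_pos[OF t]] D_deriv])
  have "(A has_real_derivative (H * l t + (p - r) / 2 * (1 / D t * D' t) + \<eta> * (r\<^sup>2 / (e t)\<^sup>2))) (at t within {0..1})"
   unfolding A_def[abs_def] by (intro DERIV_add DERIV_cmult 1 2 te_deriv t)
  moreover have "H * l t + (p - r) / 2 * (1 / D t * D' t) + \<eta> * (r\<^sup>2 / (e t)\<^sup>2) =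
   l t * H + l t * (r\<^sup>2 + p\<^sup>2 - 2 * q) / D t + \<eta> * (r\<^sup>2 / (e t)\<^sup>2 - 1 / D t)"
   unfolding l_identity using D_pos[OF t] by (simp add: field_simps)
  ultimately show "(A has_vector_derivative (l t * H + l t * (r\<^sup>2 + p\<^sup>2 - 2 * q) / D t + \<eta> * (r\<^sup>2 / (e t)\<^sup>2 - 1 / D t))) (at t within {0..1})"
   by (simp only: has_real_derivative_iff_has_vector_derivative)
 qed simp
 moreover have "A 1 - A 0 = (r + p) / 2 * H + (1 / (q / (r * p)) - 1) * (r + p) + (r - p) * ln (r / p)"
 proof -
  have d1: "ln (D 1) - ln (D 0) = 2 * (ln p - ln r)" using r p by (simp add: D_def ln_realpow)
  have d2: "A 1 - A 0 = H * ((r + p) / 2) + (p - r) / 2 * (ln (D 1) - ln (D 0)) + \<eta> / q"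
  proof -
   have "r * 1 + (p - r) * 1\<^sup>2 / 2 = (r + p) / 2" by (simp add: field_simps)
   then have "A 1 = H * ((r + p) / 2) + (p - r) / 2 * ln (D 1) + \<eta> * (1 / q)" by (simp only: A_def) (simp add: e_def)
   moreover have "A 0 = (p - r) / 2 * ln (D 0)" by (simp add: A_def)
   ultimately show ?thesis unfolding right_diff_distrib by simp
  qed
  have d3: "ln (r / p) = ln r - ln p" using r p by (simp add: ln_div)
  have d4: "\<eta> / q = (1 / (q / (r * p)) - 1) * (r + p)" using r p q by (simp add: \<eta>_def field_simps)
  have "(p - r) / 2 * (2 * (ln p - ln r)) = (r - p) * (ln r - ln p)" by (simp add: field_simps)
  then show ?thesis unfolding d2 d1 d3 d4 by (simp add: mult.commute)
 qed
 ultimately show ?thesis by simp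
qed

lemma rat_quad_has_integral:
 "((\<lambda>t. B * (r\<^sup>2 / (e t)\<^sup>2 - 1 / D t) + l t / (D t)\<^sup>2) has_integral (1 / 2 * (1 / (r * q) + 1 / (p * q)))) {0..1}"
proof -
 have rpq: "r * p + q > 0" using r p q by (simp add: add_pos_pos)
 define \<mu> where "\<mu> t = ((r + p) * t - r) / (2 * (r * p + q))" for t
 define A where "A t = \<mu> t / D t + B * (t / e t)" for t
 have "((\<lambda>t. B * (r\<^sup>2 / (e t)\<^sup>2 - 1 / D t) + l t / (D t)\<^sup>2) has_integral (A 1 - A 0)) {0..1}"
 proof (rule fundamental_theorem_of_calculus)
  fix t :: real assume t: "t \<in> {0..1}"
  have "(\<mu> has_real_derivative B) (at t within {0..1})"
   unfolding \<mu>_def[abs_def] B_def using rpq by (auto intro!: derivative_eq_intros)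
  from DERIV_divide[OF this D_deriv] have 1: "((\<lambda>t. \<mu> t / D t) has_real_derivative ((B * D t - \<mu> t * D' t) / (D t * D t))) (at t within {0..1})"
   using D_pos[OF t] by simp
  have "(A has_real_derivative ((B * D t - \<mu> t * D' t) / (D t * D t) + B * (r\<^sup>2 / (e t)\<^sup>2))) (at t within {0..1})"
   unfolding A_def[abs_def] by (intro DERIV_add DERIV_cmult 1 te_deriv t)
  moreover have "(B * D t - \<mu> t * D' t) / (D t * D t) + B * (r\<^sup>2 / (e t)\<^sup>2) = B * (r\<^sup>2 / (e t)\<^sup>2 - 1 / D t) + l t / (D t)\<^sup>2"
  proof -
   have "l t = 2 * B * D t - \<mu> t * D' t" using l_identity2[of t] by (simp add: \<mu>_def)
   then have "(B * D t - \<mu> t * D' t) / (D t * D t) = (l t - B * D t) / (D t * D t)" by simp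
   also have "\<dots> = l t / (D t)\<^sup>2 - B * (1 / D t)"
    using D_pos[OF t] by (simp add: diff_divide_distrib power2_eq_square)
   finally show ?thesis by (simp add: algebra_simps)
  qed
  ultimately show "(A has_vector_derivative (B * (r\<^sup>2 / (e t)\<^sup>2 - 1 / D t) + l t / (D t)\<^sup>2)) (at t within {0..1})"
   by (simp only: has_real_derivative_iff_has_vector_derivative)
 qed simp
 moreover have "A 1 - A 0 = 1 / 2 * (1 / (r * q) + 1 / (p * q))"
 proof -
  define s where "s = r * p + q"
  have s: "s > 0" "q = s - r * p" using rpq by (auto simp: s_def)
  have "A 1 = p / (2 * s * p\<^sup>2) + (r + p) / (2 * s) * (1 / q)" "A 0 = - r / (2 * s * r\<^sup>2)"
   by (simp_all add: A_def \<mu>_def D_def e_def B_def s_def)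
  moreover have "p / (2 * s * p\<^sup>2) = 1 / (2 * s * p)" "- r / (2 * s * r\<^sup>2) = - (1 / (2 * s * r))"
   using r p by (simp_all add: power2_eq_square)
  ultimately have "A 1 - A 0 = 1 / (2 * s * p) + 1 / (2 * s * r) + (r + p) / (2 * s) * (1 / q)" by simp
  also have "\<dots> = (1 / p + 1 / r + (r + p) / q) / (2 * s)" by (simp add: add_divide_distrib ac_simps)
  also have "1 / p + 1 / r + (r + p) / q = (r + p) * s / (r * p * q)" using r p q by (simp add: s_def field_simps)
  also have "(r + p) * s / (r * p * q) / (2 * s) = (r + p) / (2 * (r * p * q))" using s(1) by simp
  also have "\<dots> = 1 / 2 * (1 / (r * q) + 1 / (p * q))" using r p q by (simp add: field_simps)
  finally show ?thesis .
 qed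
 ultimately show ?thesis by simp
qed

lemma gap_nonneg: "t \<in> {0..1} ==> 0 \<le> r\<^sup>2 / (e t)\<^sup>2 - 1 / D t"
proof -
 assume t: "t \<in> {0..1}"
 have "r\<^sup>2 * D t - (e t)\<^sup>2 = t\<^sup>2 * ((r * p)\<^sup>2 - q\<^sup>2)" by (simp add: D_def e_def power2_eq_square algebra_simps)
 moreover have "q\<^sup>2 \<le> (r * p)\<^sup>2" using q qrp by (intro power_mono) auto
 ultimately have "(e t)\<^sup>2 \<le> r\<^sup>2 * D t" by (smt (verit) mult_nonneg_nonneg zero_le_power2)
 then show ?thesis using D_pos[OF t] e_pos[OF t] by (simp add: field_simps)
qed

lemma rat_zero_nn_integral:
 assumes H: "H \<ge> 0"
 shows "(\<integral>\<^sup>+t. ennreal (l t * H + l t * (r\<^sup>2 + p\<^sup>2 - 2 * q) / D t + \<eta> * (r\<^sup>2 / (e t)\<^sup>2 - 1 / D t)) * indicator {0..1} t \<partial>lborel) =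
   ennreal ((r + p) / 2 * H + (1 / (q / (r * p)) - 1) * (r + p) + (r - p) * ln (r / p))"
  "0 \<le> (r + p) / 2 * H + (1 / (q / (r * p)) - 1) * (r + p) + (r - p) * ln (r / p)"
proof -
 have c: "continuous_on {0..1} (\<lambda>t. l t * H + l t * (r\<^sup>2 + p\<^sup>2 - 2 * q) / D t + \<eta> * (r\<^sup>2 / (e t)\<^sup>2 - 1 / D t))"
  using D_pos e_pos unfolding l_def D_def e_def by (intro continuous_intros) force+
 have n: "0 \<le> l t * H + l t * (r\<^sup>2 + p\<^sup>2 - 2 * q) / D t + \<eta> * (r\<^sup>2 / (e t)\<^sup>2 - 1 / D t)" if t: "t \<in> {0..1}" for t
 proof -
  have "l t \<ge> 0" using t r p by (simp add: l_def)
  moreover have "r\<^sup>2 + p\<^sup>2 - 2 * q \<ge> 0"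
  proof -
   have eq: "r\<^sup>2 + p\<^sup>2 - 2 * q = (r - p)\<^sup>2 + 2 * (r * p - q)" by (simp add: power2_eq_square algebra_simps)
   show ?thesis unfolding eq using qrp by (intro add_nonneg_nonneg) simp_all
  qed
  moreover have "\<eta> \<ge> 0" using r p qrp by (simp add: \<eta>_def)
  ultimately show ?thesis using H D_pos[OF t] gap_nonneg[OF t] by simp
 qed
 show "(\<integral>\<^sup>+t. ennreal (l t * H + l t * (r\<^sup>2 + p\<^sup>2 - 2 * q) / D t + \<eta> * (r\<^sup>2 / (e t)\<^sup>2 - 1 / D t)) * indicator {0..1} t \<partial>lborel) =
   ennreal ((r + p) / 2 * H + (1 / (q / (r * p)) - 1) * (r + p) + (r - p) * ln (r / p))"
  by (rule nn_integral_continuous(1)[OF c n rat_zero_has_integral])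
 show "0 \<le> (r + p) / 2 * H + (1 / (q / (r * p)) - 1) * (r + p) + (r - p) * ln (r / p)"
  by (rule nn_integral_continuous(2)[OF c n rat_zero_has_integral])
qed

text \<open>The terms with second derivatives form \<open>(B (r\<^sup>2 / e\<^sup>2 - 1 / D) + l / D\<^sup>2) |h''|\<^sup>2 - 2 l N / D\<^sup>3 h' \<sqdot> h'' + l N\<^sup>2 / D\<^sup>4 |h'|\<^sup>2\<close>,
 in which the last three summands are \<open>l / D\<^sup>4\<close> times \<open>|D h'' - N h'|\<^sup>2\<close>.\<close>

lemma rat_quad_nn_integral:
 fixes k1 k2 :: "'a::real_inner"
 assumes N: "continuous_on {0..1} N" and k1: "k1 \<bullet> k1 = r\<^sup>2 + p\<^sup>2 - 2 * q"
 defines "I1 \<equiv> (LINT t:{0..1}|lborel. l t * N t / D t ^ 3)" and "I2 \<equiv> (LINT t:{0..1}|lborel. l t * (N t)\<^sup>2 / D t ^ 4)"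
 shows "(\<integral>\<^sup>+t. ennreal (B * (r\<^sup>2 / (e t)\<^sup>2 - 1 / D t) * (norm k2)\<^sup>2 + l t / D t ^ 4 * (norm (D t *\<^sub>R k2 - N t *\<^sub>R k1))\<^sup>2) * indicator {0..1} t \<partial>lborel) =
   ennreal (1 / 2 * (1 / (r * q) + 1 / (p * q)) * (norm k2)\<^sup>2 - 2 * I1 * (k1 \<bullet> k2) + I2 * (r\<^sup>2 + p\<^sup>2 - 2 * q))"
  "0 \<le> 1 / 2 * (1 / (r * q) + 1 / (p * q)) * (norm k2)\<^sup>2 - 2 * I1 * (k1 \<bullet> k2) + I2 * (r\<^sup>2 + p\<^sup>2 - 2 * q)"
proof -
 define f where "f t = B * (r\<^sup>2 / (e t)\<^sup>2 - 1 / D t) * (norm k2)\<^sup>2 + l t / D t ^ 4 * (norm (D t *\<^sub>R k2 - N t *\<^sub>R k1))\<^sup>2" for t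
 have Dc: "continuous_on {0..1} D" "continuous_on {0..1} l" "continuous_on {0..1} e"
  unfolding D_def[abs_def] l_def[abs_def] e_def[abs_def] by (intro continuous_intros)+
 have D0: "D t \<noteq> 0" "e t \<noteq> 0" if "t \<in> {0..1}" for t using D_pos[OF that] e_pos[OF that] by auto
 have c: "continuous_on {0..1} f"
  unfolding f_def[abs_def] using D0 by (intro continuous_intros Dc N) auto
 have B0: "B \<ge> 0" using r p q by (simp add: B_def)
 have n: "0 \<le> f t" if t: "t \<in> {0..1}" for t
 proof -
  have "l t \<ge> 0" using t r p by (simp add: l_def)
  then show ?thesis unfolding f_def using B0 gap_nonneg[OF t] D_pos[OF t] by simp
 qed
 have 1: "continuous_on {0..1} (\<lambda>t. l t * N t / D t ^ 3)" "continuous_on {0..1} (\<lambda>t. l t * (N t)\<^sup>2 / D t ^ 4)"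
  using D0 by (auto intro!: continuous_intros Dc N)
 have I: "((\<lambda>t. l t * N t / D t ^ 3) has_integral I1) {0..1}" "((\<lambda>t. l t * (N t)\<^sup>2 / D t ^ 4) has_integral I2) {0..1}"
  unfolding I1_def I2_def set_borel_integral_eq_integral(2)[OF borel_integrable_atLeastAtMost'[OF 1(1)]]
   set_borel_integral_eq_integral(2)[OF borel_integrable_atLeastAtMost'[OF 1(2)]]
  by (intro integrable_integral integrable_continuous_real 1)+
 have "((\<lambda>t. (B * (r\<^sup>2 / (e t)\<^sup>2 - 1 / D t) + l t / (D t)\<^sup>2) * (norm k2)\<^sup>2 - l t * N t / D t ^ 3 * (2 * (k1 \<bullet> k2)) + l t * (N t)\<^sup>2 / D t ^ 4 * (r\<^sup>2 + p\<^sup>2 - 2 * q))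
  has_integral (1 / 2 * (1 / (r * q) + 1 / (p * q)) * (norm k2)\<^sup>2 - I1 * (2 * (k1 \<bullet> k2)) + I2 * (r\<^sup>2 + p\<^sup>2 - 2 * q))) {0..1}"
  by (intro has_integral_add has_integral_diff has_integral_mult_left rat_quad_has_integral I)
 moreover have "(B * (r\<^sup>2 / (e t)\<^sup>2 - 1 / D t) + l t / (D t)\<^sup>2) * (norm k2)\<^sup>2 - l t * N t / D t ^ 3 * (2 * (k1 \<bullet> k2)) + l t * (N t)\<^sup>2 / D t ^ 4 * (r\<^sup>2 + p\<^sup>2 - 2 * q) = f t"
  if t: "t \<in> {0..1}" for t
 proof -
  have e: "(norm (D t *\<^sub>R k2 - N t *\<^sub>R k1))\<^sup>2 = (D t)\<^sup>2 * (norm k2)\<^sup>2 - 2 * D t * N t * (k1 \<bullet> k2) + (N t)\<^sup>2 * (r\<^sup>2 + p\<^sup>2 - 2 * q)"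
   unfolding power2_norm_eq_inner k1[symmetric] by (simp add: inner_diff_left inner_diff_right inner_commute[of k2 k1] power2_eq_square algebra_simps)
  have "l t / D t ^ 4 * (D t)\<^sup>2 = l t / (D t)\<^sup>2" "l t / D t ^ 4 * (2 * D t * N t) = 2 * (l t * N t / D t ^ 3)"
   using D0[OF t] by (simp_all add: field_simps power2_eq_square power3_eq_cube power4_eq_xxxx)
  then have "l t / D t ^ 4 * ((D t)\<^sup>2 * (norm k2)\<^sup>2 - 2 * D t * N t * (k1 \<bullet> k2) + (N t)\<^sup>2 * (r\<^sup>2 + p\<^sup>2 - 2 * q)) =
   l t / (D t)\<^sup>2 * (norm k2)\<^sup>2 - 2 * (l t * N t / D t ^ 3) * (k1 \<bullet> k2) + l t * (N t)\<^sup>2 / D t ^ 4 * (r\<^sup>2 + p\<^sup>2 - 2 * q)"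
   unfolding distrib_left right_diff_distrib mult.assoc[symmetric] by simp
  then show ?thesis unfolding f_def e by (simp add: algebra_simps)
 qed
 ultimately have F: "(f has_integral (1 / 2 * (1 / (r * q) + 1 / (p * q)) * (norm k2)\<^sup>2 - I1 * (2 * (k1 \<bullet> k2)) + I2 * (r\<^sup>2 + p\<^sup>2 - 2 * q))) {0..1}"
  by (rule has_integral_eq[rotated])
 have I': "I1 * (2 * (k1 \<bullet> k2)) = 2 * I1 * (k1 \<bullet> k2)" by simp
 show "(\<integral>\<^sup>+t. ennreal (B * (r\<^sup>2 / (e t)\<^sup>2 - 1 / D t) * (norm k2)\<^sup>2 + l t / D t ^ 4 * (norm (D t *\<^sub>R k2 - N t *\<^sub>R k1))\<^sup>2) * indicator {0..1} t \<partial>lborel) =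
   ennreal (1 / 2 * (1 / (r * q) + 1 / (p * q)) * (norm k2)\<^sup>2 - 2 * I1 * (k1 \<bullet> k2) + I2 * (r\<^sup>2 + p\<^sup>2 - 2 * q))"
  using nn_integral_continuous(1)[OF c n F] unfolding f_def I' .
 show "0 \<le> 1 / 2 * (1 / (r * q) + 1 / (p * q)) * (norm k2)\<^sup>2 - 2 * I1 * (k1 \<bullet> k2) + I2 * (r\<^sup>2 + p\<^sup>2 - 2 * q)"
  using nn_integral_continuous(2)[OF c n F] unfolding I' .
qed

lemmas rat_zero_eq = rat_zero_nn_integral[unfolded l_def D_def e_def \<eta>_def]
lemmas rat_quad_eq = rat_quad_nn_integral[unfolded l_def D_def e_def B_def]
lemmas rat_gap = gap_nonneg[unfolded D_def e_def]
lemmas rat_pos = D_pos[unfolded D_def] e_pos[unfolded e_def]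

end

section \<open>Pointwise densities of the rational functional\<close>

definition rat_l :: "real => 'a::real_inner => 'a => real" where
 "rat_l t x y = (1 - t) * norm x + t * norm y"

definition rat_D :: "real => 'a::real_inner => 'a => real" where
 "rat_D t x y = (1 - t)\<^sup>2 * (norm x)\<^sup>2 + 2 * t * (1 - t) * (x \<bullet> y) + t\<^sup>2 * (norm y)\<^sup>2"

definition rat_N :: "real => 'a::real_inner => 'a => 'a => 'a => real" where
 "rat_N t x y x2 y2 = (x \<bullet> x2) * (1 - t)\<^sup>2 + (y \<bullet> y2) * t\<^sup>2 + 2 * (1 / 2 * (x \<bullet> y2 + y \<bullet> x2)) * t * (1 - t)"

definition rat_gap :: "real => 'a::real_inner => 'a => real" where
 "rat_gap t x y = (norm x)\<^sup>2 / ((1 - t) * (norm x)\<^sup>2 + t * (x \<bullet> y))\<^sup>2 - 1 / rat_D t x y"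

definition rat_S :: "'a::real_inner => 'a => real => real" where
 "rat_S x y H = (norm x + norm y) / 2 * H + (1 / (x \<bullet> y / (norm x * norm y)) - 1) * (norm x + norm y) + (norm x - norm y) * ln (norm x / norm y)"

definition rat_S0 :: "'a::real_inner => 'a => real => ennreal" where
 "rat_S0 x y H = (if x \<bullet> y \<le> 0 then \<infinity> else ennreal (rat_S x y H))"

text \<open>The time density belonging to \<open>rat_S0\<close>: the energy terms of orders 0 and 1
  with \<open>rat_l\<close> in place of the speed, and the nonnegative excess that comes from
  replacing \<open>1 / D\<close>.\<close>

definition rat_s0 :: "real => 'a::real_inner => 'a => real => ennreal" where
 "rat_s0 t x y H = (if x \<bullet> y \<le> 0 then \<infinity> else ennreal (rat_l t x y * H +
  rat_l t x y * ((norm x)\<^sup>2 + (norm y)\<^sup>2 - 2 * (x \<bullet> y)) / rat_D t x y +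
  (norm x + norm y) * (norm x * norm y - x \<bullet> y) * rat_gap t x y))"

text \<open>Setting the value to 0 for nonpositive scalar products is harmless, since
  \<open>rat_S0\<close> is infinite there, and makes semicontinuity immediate at such
  limits.\<close>

definition rat_k :: "real => 'a::real_inner => 'a => real" where
 "rat_k t x y = (if x \<bullet> y \<le> 0 then 0 else (norm x + norm y) / (2 * (norm x * norm y + x \<bullet> y)) * rat_gap t x y)"

text \<open>The polynomial of index 2 of the regularized functional, as a function of the first and
  second derivatives of both end curves.\<close>

definition rat_P :: "real => 'a::real_inner => 'a => 'a => 'a => 'a" where
 "rat_P t x y x2 y2 = rat_D t x y *\<^sub>R (y2 - x2) - rat_N t x y x2 y2 *\<^sub>R (y - x)"

definition rat_s2 :: "real => 'a::real_inner => 'a => 'a => 'a => ennreal" where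
 "rat_s2 t x y x2 y2 = ennreal (rat_k t x y) * ennreal ((norm (y2 - x2))\<^sup>2) +
  ennreal (rat_l t x y / rat_D t x y ^ 4) * ennreal ((norm (rat_P t x y x2 y2))\<^sup>2)"

lemma rat_D_eq: "rat_D t x y = (norm ((1 - t) *\<^sub>R x + t *\<^sub>R y))\<^sup>2"
 unfolding rat_D_def power2_norm_eq_inner
 by (simp add: inner_add_left inner_add_right inner_commute[of y x] power2_eq_square algebra_simps)

lemma rat_N_eq: "rat_N t x y x2 y2 = ((1 - t) *\<^sub>R x + t *\<^sub>R y) \<bullet> ((1 - t) *\<^sub>R x2 + t *\<^sub>R y2)"
 by (simp add: rat_N_def inner_add_left inner_add_right power2_eq_square algebra_simps)

lemma norm_diff_square: "(norm (y - x))\<^sup>2 = (norm x)\<^sup>2 + (norm y)\<^sup>2 - 2 * (x \<bullet> y)" for x y :: "'a::real_inner"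
 unfolding power2_norm_eq_inner by (simp add: inner_diff_left inner_diff_right inner_commute)

lemma rat_l_ge: "t \<in> {0..1} ==> norm ((1 - t) *\<^sub>R x + t *\<^sub>R y) \<le> rat_l t x y"
 unfolding rat_l_def using norm_triangle_ineq[of "(1 - t) *\<^sub>R x" "t *\<^sub>R y"] by simp

context
 fixes x y :: "'a::real_inner"
 assumes q: "x \<bullet> y > 0"
begin

private lemma xy: "norm x > 0" "norm y > 0" "x \<bullet> y \<le> norm x * norm y"
 using q norm_cauchy_schwarz[of x y] by auto

lemma rat_gap_nonneg: "t \<in> {0..1} ==> 0 \<le> rat_gap t x y"
 using rat_gap[OF xy(1,2) q xy(3)] by (simp add: rat_gap_def rat_D_def)

lemma rat_k_nonneg: "t \<in> {0..1} ==> 0 \<le> rat_k t x y"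
 using rat_gap_nonneg q xy by (simp add: rat_k_def)

lemma rat_D_pos: "t \<in> {0..1} ==> 0 < rat_D t x y"
 using rat_pos(1)[OF xy(1,2) q xy(3)] by (simp add: rat_D_def)

lemma rat_e_pos: "t \<in> {0..1} ==> 0 < (1 - t) * (norm x)\<^sup>2 + t * (x \<bullet> y)"
 using rat_pos(2)[OF xy(1,2) q xy(3)] by simp

lemma rat_zero:
 assumes "H \<ge> 0"
 shows "(\<integral>\<^sup>+t. rat_s0 t x y H * indicator {0..1} t \<partial>lborel) = rat_S0 x y H" "0 \<le> rat_S x y H"
 using rat_zero_eq[OF xy(1,2) q xy(3) assms] q
 by (simp_all add: rat_s0_def rat_S0_def rat_S_def rat_l_def rat_gap_def rat_D_def mult.assoc)

lemma rat_quad: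
 shows "(\<integral>\<^sup>+t. rat_s2 t x y x2 y2 * indicator {0..1} t \<partial>lborel) =
   ennreal (1 / 2 * (1 / (norm x * (x \<bullet> y)) + 1 / (norm y * (x \<bullet> y))) * (norm (y2 - x2))\<^sup>2
    - 2 * (LINT t:{0..1}|lborel. rat_l t x y * rat_N t x y x2 y2 / rat_D t x y ^ 3) * ((y - x) \<bullet> (y2 - x2))
    + (LINT t:{0..1}|lborel. rat_l t x y * (rat_N t x y x2 y2)\<^sup>2 / rat_D t x y ^ 4) * ((norm x)\<^sup>2 + (norm y)\<^sup>2 - 2 * (x \<bullet> y)))"
  "0 \<le> 1 / 2 * (1 / (norm x * (x \<bullet> y)) + 1 / (norm y * (x \<bullet> y))) * (norm (y2 - x2))\<^sup>2
    - 2 * (LINT t:{0..1}|lborel. rat_l t x y * rat_N t x y x2 y2 / rat_D t x y ^ 3) * ((y - x) \<bullet> (y2 - x2))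
    + (LINT t:{0..1}|lborel. rat_l t x y * (rat_N t x y x2 y2)\<^sup>2 / rat_D t x y ^ 4) * ((norm x)\<^sup>2 + (norm y)\<^sup>2 - 2 * (x \<bullet> y))"
proof -
 have c: "continuous_on {0..1} (\<lambda>t. rat_N t x y x2 y2)" unfolding rat_N_def by (intro continuous_intros)
 have k1: "(y - x) \<bullet> (y - x) = (norm x)\<^sup>2 + (norm y)\<^sup>2 - 2 * (x \<bullet> y)"
  using norm_diff_square[of y x] by (simp add: power2_norm_eq_inner)
 note eq = rat_quad_eq[OF xy(1,2) q xy(3) c k1, of "y2 - x2", folded rat_l_def rat_D_def, folded rat_gap_def]
 have "(\<integral>\<^sup>+t. rat_s2 t x y x2 y2 * indicator {0..1} t \<partial>lborel) =
  (\<integral>\<^sup>+t. ennreal ((norm x + norm y) / (2 * (norm x * norm y + x \<bullet> y)) * rat_gap t x y * (norm (y2 - x2))\<^sup>2 +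
   rat_l t x y / rat_D t x y ^ 4 * (norm (rat_D t x y *\<^sub>R (y2 - x2) - rat_N t x y x2 y2 *\<^sub>R (y - x)))\<^sup>2) * indicator {0..1} t \<partial>lborel)"
 proof (rule nn_integral_cong)
  fix t :: real
  show "rat_s2 t x y x2 y2 * indicator {0..1} t =
   ennreal ((norm x + norm y) / (2 * (norm x * norm y + x \<bullet> y)) * rat_gap t x y * (norm (y2 - x2))\<^sup>2 +
   rat_l t x y / rat_D t x y ^ 4 * (norm (rat_D t x y *\<^sub>R (y2 - x2) - rat_N t x y x2 y2 *\<^sub>R (y - x)))\<^sup>2) * indicator {0..1} t"
  proof (cases "t \<in> {0..1}")
   case True
   have l: "rat_l t x y \<ge> 0" using True by (simp add: rat_l_def)
   have k: "rat_k t x y = (norm x + norm y) / (2 * (norm x * norm y + x \<bullet> y)) * rat_gap t x y" using q by (simp add: rat_k_def)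
   show ?thesis
    unfolding rat_s2_def rat_P_def k[symmetric] using rat_k_nonneg[OF True] l rat_D_pos[OF True]
    by (simp add: ennreal_mult[symmetric] ennreal_plus[symmetric] del: ennreal_plus)
  qed simp
 qed
 with eq(1) show "(\<integral>\<^sup>+t. rat_s2 t x y x2 y2 * indicator {0..1} t \<partial>lborel) =
   ennreal (1 / 2 * (1 / (norm x * (x \<bullet> y)) + 1 / (norm y * (x \<bullet> y))) * (norm (y2 - x2))\<^sup>2
    - 2 * (LINT t:{0..1}|lborel. rat_l t x y * rat_N t x y x2 y2 / rat_D t x y ^ 3) * ((y - x) \<bullet> (y2 - x2))
    + (LINT t:{0..1}|lborel. rat_l t x y * (rat_N t x y x2 y2)\<^sup>2 / rat_D t x y ^ 4) * ((norm x)\<^sup>2 + (norm y)\<^sup>2 - 2 * (x \<bullet> y)))"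
  by simp
qed (rule rat_quad_eq(2)[OF xy(1,2) q xy(3), folded rat_l_def rat_D_def];
  use norm_diff_square[of y x] in \<open>auto simp: rat_N_def power2_norm_eq_inner intro!: continuous_intros\<close>)

end

text \<open>Where the scalar product is not positive, \<open>rat_S0\<close> makes the right-hand
  side infinite whatever the second summand is. As the negative part vanishes,
  \<open>ereal_integral\<close> involves no difference of infinities.\<close>

lemma rat_integrand:
 fixes a b :: "('d::finite) curve"
 shows "e2ennreal (W_rat_integrand a b s) = rat_S0 (wder a s) (wder b s) ((norm (b s - a s))\<^sup>2) +
   (\<integral>\<^sup>+t. rat_s2 t (wder a s) (wder b s) (wder (wder a) s) (wder (wder b) s) * indicator {0..1} t \<partial>lborel)"
  "e2ennreal (- W_rat_integrand a b s) = 0"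
proof -
 let ?x = "wder a s" and ?y = "wder b s" and ?x2 = "wder (wder a) s" and ?y2 = "wder (wder b) s"
 have "e2ennreal (W_rat_integrand a b s) = rat_S0 ?x ?y ((norm (b s - a s))\<^sup>2) +
   (\<integral>\<^sup>+t. rat_s2 t ?x ?y ?x2 ?y2 * indicator {0..1} t \<partial>lborel) \<and> e2ennreal (- W_rat_integrand a b s) = 0"
 proof (cases "?x \<bullet> ?y \<le> 0")
  case True
  then show ?thesis by (simp add: W_rat_integrand_def Let_def rat_S0_def e2ennreal_neg)
 next
  case False
  then have q: "?x \<bullet> ?y > 0" by simp
  define S where "S = rat_S ?x ?y ((norm (b s - a s))\<^sup>2)"
  define Q where "Q = 1 / 2 * (1 / (norm ?x * (?x \<bullet> ?y)) + 1 / (norm ?y * (?x \<bullet> ?y))) * (norm (?y2 - ?x2))\<^sup>2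
    - 2 * (LINT t:{0..1}|lborel. rat_l t ?x ?y * rat_N t ?x ?y ?x2 ?y2 / rat_D t ?x ?y ^ 3) * ((?y - ?x) \<bullet> (?y2 - ?x2))
    + (LINT t:{0..1}|lborel. rat_l t ?x ?y * (rat_N t ?x ?y ?x2 ?y2)\<^sup>2 / rat_D t ?x ?y ^ 4) * ((norm ?x)\<^sup>2 + (norm ?y)\<^sup>2 - 2 * (?x \<bullet> ?y))"
  have SQ: "S \<ge> 0" "Q \<ge> 0" unfolding S_def Q_def by (rule rat_zero(2)[OF q], simp, rule rat_quad(2)[OF q])
  have i: "(?y - ?x) \<bullet> (?y2 - ?x2) = ?x \<bullet> ?x2 + ?y \<bullet> ?y2 - 2 * (1 / 2 * (?x \<bullet> ?y2 + ?y \<bullet> ?x2))"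
   by (simp add: inner_diff_left inner_diff_right field_simps)
  have W: "W_rat_integrand a b s = ereal (S + Q)"
   unfolding W_rat_integrand_def Let_def if_not_P[OF False] ereal.inject S_def Q_def rat_S_def i rat_l_def rat_N_def rat_D_def by simp
  have "rat_S0 ?x ?y ((norm (b s - a s))\<^sup>2) = ennreal S" using False by (simp add: rat_S0_def S_def)
  moreover have "(\<integral>\<^sup>+t. rat_s2 t ?x ?y ?x2 ?y2 * indicator {0..1} t \<partial>lborel) = ennreal Q" unfolding Q_def by (rule rat_quad(1)[OF q])
  moreover have "e2ennreal (W_rat_integrand a b s) = ennreal (S + Q)" by (simp add: W e2ennreal_ereal)
  moreover have "e2ennreal (- W_rat_integrand a b s) = 0" using SQ by (intro e2ennreal_neg) (simp add: W)
  ultimately show ?thesis using SQ by simp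
 qed
 then show "e2ennreal (W_rat_integrand a b s) = rat_S0 ?x ?y ((norm (b s - a s))\<^sup>2) +
   (\<integral>\<^sup>+t. rat_s2 t ?x ?y ?x2 ?y2 * indicator {0..1} t \<partial>lborel)" "e2ennreal (- W_rat_integrand a b s) = 0" by auto
qed

definition rat_quad_density :: "('d::finite) curve => 'd curve => real => ennreal" where
 "rat_quad_density a b t = (\<integral>\<^sup>+s. rat_s2 t (wder a s) (wder b s) (wder (wder a) s) (wder (wder b) s) \<partial>circle)"

definition rat_zero_density :: "('d::finite) curve => 'd curve => real => ennreal" where
 "rat_zero_density a b t = (\<integral>\<^sup>+s. rat_s0 t (wder a s) (wder b s) ((norm (b s - a s))\<^sup>2) \<partial>circle)"

text \<open>The lower order part keeps its closed form, in which the blow-up for scalar products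
  tending to zero is visible. The part with second derivatives becomes a time integral, because its
  integrand is a sum of squares with nonnegative weights.\<close>

definition V_rat :: "('d::finite) curve => 'd curve => ennreal" where
 "V_rat a b = (\<integral>\<^sup>+s. rat_S0 (wder a s) (wder b s) ((norm (b s - a s))\<^sup>2) \<partial>circle) +
  (\<integral>\<^sup>+t. rat_quad_density a b t * indicator {0..1} t \<partial>lborel)"

lemma rat_measurable:
 fixes a b :: "('d::finite) curve"
 assumes a: "Sob 2 a" and b: "Sob 2 b"
 shows "(\<lambda>z. rat_s2 (fst z) (wder a (snd z)) (wder b (snd z)) (wder (wder a) (snd z)) (wder (wder b) (snd z))) \<in> borel_measurable (lborel \<Otimes>\<^sub>M circle)"
  "(\<lambda>z. rat_s0 (fst z) (wder a (snd z)) (wder b (snd z)) ((norm (b (snd z) - a (snd z)))\<^sup>2)) \<in> borel_measurable (lborel \<Otimes>\<^sub>M circle)"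
  "(\<lambda>s. rat_S0 (wder a s) (wder b s) ((norm (b s - a s))\<^sup>2)) \<in> borel_measurable borel"
  "(\<lambda>s. rat_s0 t (wder a s) (wder b s) ((norm (b s - a s))\<^sup>2)) \<in> borel_measurable borel"
  "(\<lambda>s. rat_s2 t (wder a s) (wder b s) (wder (wder a) s) (wder (wder b) s)) \<in> borel_measurable borel"
  "(\<lambda>s. ennreal (rat_k t (wder a s) (wder b s))) \<in> borel_measurable borel"
  "(\<lambda>s. ennreal (rat_l t (wder a s) (wder b s) / rat_D t (wder a s) (wder b s) ^ 4)) \<in> borel_measurable borel"
  "(\<lambda>s. rat_P t (wder a s) (wder b s) (wder (wder a) s) (wder (wder b) s)) \<in> borel_measurable borel"
proof -
 have 2: "(2::nat) = Suc (Suc 0)" by simp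
 note [measurable] = wc_measurable(2)[OF a] wc_measurable(2)[OF b] wder_regular(5)[OF order_refl a] wder_regular(5)[OF order_refl b]
  wc_measurable(2)[OF Sob_wder[OF Sob_wder[OF a[unfolded 2]]]] wc_measurable(2)[OF Sob_wder[OF Sob_wder[OF b[unfolded 2]]]]
 have c: "(\<lambda>z. u (snd z)) \<in> borel_measurable ((lborel :: real measure) \<Otimes>\<^sub>M circle)" if "u \<in> borel_measurable borel" for u :: "real => real^'d"
  using measurable_compose[OF measurable_snd measurable_circle[OF that]] .
 note [measurable] = c[OF wc_measurable(2)[OF a]] c[OF wc_measurable(2)[OF b]] c[OF wder_regular(5)[OF order_refl a]] c[OF wder_regular(5)[OF order_refl b]]
  c[OF wc_measurable(2)[OF Sob_wder[OF Sob_wder[OF a[unfolded 2]]]]] c[OF wc_measurable(2)[OF Sob_wder[OF Sob_wder[OF b[unfolded 2]]]]]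
 have [measurable]: "(\<lambda>z. fst z) \<in> borel_measurable ((lborel :: real measure) \<Otimes>\<^sub>M circle)"
  using measurable_fst[of "lborel :: real measure" circle] by (simp cong: measurable_cong_sets)
 show "(\<lambda>z. rat_s2 (fst z) (wder a (snd z)) (wder b (snd z)) (wder (wder a) (snd z)) (wder (wder b) (snd z))) \<in> borel_measurable (lborel \<Otimes>\<^sub>M circle)"
  unfolding rat_s2_def rat_P_def rat_N_def rat_k_def rat_gap_def rat_l_def rat_D_def by measurable
 show "(\<lambda>z. rat_s0 (fst z) (wder a (snd z)) (wder b (snd z)) ((norm (b (snd z) - a (snd z)))\<^sup>2)) \<in> borel_measurable (lborel \<Otimes>\<^sub>M circle)"
  unfolding rat_s0_def rat_gap_def rat_l_def rat_D_def by measurable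
 show "(\<lambda>s. rat_S0 (wder a s) (wder b s) ((norm (b s - a s))\<^sup>2)) \<in> borel_measurable borel"
  unfolding rat_S0_def rat_S_def by measurable
 show "(\<lambda>s. rat_s0 t (wder a s) (wder b s) ((norm (b s - a s))\<^sup>2)) \<in> borel_measurable borel"
  unfolding rat_s0_def rat_gap_def rat_l_def rat_D_def by measurable
 show "(\<lambda>s. ennreal (rat_k t (wder a s) (wder b s))) \<in> borel_measurable borel"
  unfolding rat_k_def rat_gap_def rat_D_def by measurable
 show "(\<lambda>s. ennreal (rat_l t (wder a s) (wder b s) / rat_D t (wder a s) (wder b s) ^ 4)) \<in> borel_measurable borel"
  unfolding rat_l_def rat_D_def by measurable
 show "(\<lambda>s. rat_P t (wder a s) (wder b s) (wder (wder a) s) (wder (wder b) s)) \<in> borel_measurable borel"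
  unfolding rat_P_def rat_N_def rat_D_def by measurable
 show "(\<lambda>s. rat_s2 t (wder a s) (wder b s) (wder (wder a) s) (wder (wder b) s)) \<in> borel_measurable borel"
  unfolding rat_s2_def rat_P_def rat_N_def rat_k_def rat_gap_def rat_l_def rat_D_def by measurable
qed

lemma indicator_fst_measurable:
 "(\<lambda>x. indicator {0..1} (fst x) :: ennreal) \<in> borel_measurable ((lborel :: real measure) \<Otimes>\<^sub>M circle)"
 by (rule measurable_compose[OF measurable_fst borel_measurable_indicator]) (auto intro: atLeastAtMost_borel)

lemma circle_time_swap:
 fixes f :: "real => real => ennreal"
 assumes f: "(\<lambda>z. f (fst z) (snd z)) \<in> borel_measurable (lborel \<Otimes>\<^sub>M circle)"
 shows "(\<integral>\<^sup>+s. (\<integral>\<^sup>+t. f t s * indicator {0..1} t \<partial>lborel) \<partial>circle) = (\<integral>\<^sup>+t. (\<integral>\<^sup>+s. f t s \<partial>circle) * indicator {0..1} t \<partial>lborel)"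
  "(\<lambda>s. \<integral>\<^sup>+t. f t s * indicator {0..1} t \<partial>lborel) \<in> borel_measurable circle"
  "(\<lambda>t. \<integral>\<^sup>+s. f t s \<partial>circle) \<in> borel_measurable lborel"
proof -
 have m: "(\<lambda>z. f (fst z) (snd z) * indicator {0..1} (fst z)) \<in> borel_measurable (lborel \<Otimes>\<^sub>M circle)"
  by (intro borel_measurable_times_ennreal indicator_fst_measurable f)
 have fs: "f t \<in> borel_measurable circle" for t
  using measurable_compose[OF measurable_Pair1' f, of t] by simp
 have "(\<integral>\<^sup>+s. (\<integral>\<^sup>+t. f t s * indicator {0..1} t \<partial>lborel) \<partial>circle) = (\<integral>\<^sup>+t. (\<integral>\<^sup>+s. f t s * indicator {0..1} t \<partial>circle) \<partial>lborel)"
  by (rule lborel_circle.Fubini') (use m in \<open>simp add: case_prod_beta\<close>)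
 also have "\<dots> = (\<integral>\<^sup>+t. (\<integral>\<^sup>+s. f t s \<partial>circle) * indicator {0..1} t \<partial>lborel)"
  by (intro nn_integral_cong nn_integral_multc fs)
 finally show "(\<integral>\<^sup>+s. (\<integral>\<^sup>+t. f t s * indicator {0..1} t \<partial>lborel) \<partial>circle) = (\<integral>\<^sup>+t. (\<integral>\<^sup>+s. f t s \<partial>circle) * indicator {0..1} t \<partial>lborel)" .
 show "(\<lambda>s. \<integral>\<^sup>+t. f t s * indicator {0..1} t \<partial>lborel) \<in> borel_measurable circle"
  by (intro lborel.borel_measurable_nn_integral) (use measurable_pair_swap[OF m] in \<open>simp add: case_prod_beta\<close>)
 show "(\<lambda>t. \<integral>\<^sup>+s. f t s \<partial>circle) \<in> borel_measurable lborel"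
  by (intro circle.borel_measurable_nn_integral) (use f in \<open>simp add: case_prod_beta\<close>)
qed

lemma W_rat_eq:
 fixes a b :: "('d::finite) curve"
 assumes a: "Sob 2 a" and b: "Sob 2 b"
 shows "W_rat a b = enn2ereal (V_rat a b)"
proof -
 note sw = circle_time_swap[OF rat_measurable(1)[OF a b]]
 have "(\<integral>\<^sup>+s. e2ennreal (W_rat_integrand a b s) \<partial>circle) = (\<integral>\<^sup>+s. rat_S0 (wder a s) (wder b s) ((norm (b s - a s))\<^sup>2) \<partial>circle) +
  (\<integral>\<^sup>+s. (\<integral>\<^sup>+t. rat_s2 t (wder a s) (wder b s) (wder (wder a) s) (wder (wder b) s) * indicator {0..1} t \<partial>lborel) \<partial>circle)"
  unfolding rat_integrand(1) by (rule nn_integral_add[OF measurable_circle[OF rat_measurable(3)[OF a b]] sw(2)])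
 also have "\<dots> = V_rat a b" unfolding V_rat_def rat_quad_density_def sw(1) ..
 finally show ?thesis by (simp add: W_rat_def ereal_integral_def rat_integrand(2) zero_ennreal.rep_eq)
qed

section \<open>Coercivity and lower semicontinuity of the rational functional\<close>

lemma liminf_add_le:
 fixes f g :: "nat => ennreal"
 shows "liminf f + liminf g \<le> liminf (\<lambda>n. f n + g n)"
 using sum_liminf_le[of "UNIV :: bool set" "\<lambda>n x. if x then f n else g n"] by (simp add: UNIV_bool add.commute)

text \<open>Finiteness makes the scalar product of the two derivatives positive almost everywhere
  and hence, by continuity, nonnegative everywhere; the segment between two such nonzero vectors
  avoids the origin, so the linear path consists of immersions. Discarding the terms with
  \<open>rat_gap\<close> and estimating \<open>rat_l\<close> from below by the speed leaves the
  metric.\<close>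

lemma coercive_V_rat: "coercive 2 (V_rat :: ('d::finite) curve => 'd curve => ennreal)"
 unfolding coercive_def
proof (intro ballI)
 fix a b :: "('d::finite) curve" assume aI: "a \<in> Imm 2" and bI: "b \<in> Imm 2"
 have m: "(2::nat) \<le> 2" by simp
 have a: "Sob 2 a" "\<And>v. wder a v \<noteq> 0" and b: "Sob 2 b" "\<And>v. wder b v \<noteq> 0" using aI bI by (auto simp: Imm_iff)
 have 2: "(2::nat) = Suc (Suc 0)" by simp
 have Sa': "Sob (Suc 0) (wder a)" and Sb': "Sob (Suc 0) (wder b)" using Sob_wder a(1) b(1) unfolding 2 by blast+
 define h where "h = (\<lambda>v. b v - a v)"
 have Sh: "Sob 2 h" unfolding h_def by (rule Sob_diff[OF b(1) a(1)])
 note rm = rat_measurable[OF a(1) b(1)]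
 define s0 where "s0 t v = rat_s0 t (wder a v) (wder b v) ((norm (b v - a v))\<^sup>2)" for t v
 define s2 where "s2 t v = rat_s2 t (wder a v) (wder b v) (wder (wder a) v) (wder (wder b) v)" for t v
 have s0m [measurable]: "s0 t \<in> borel_measurable circle" and s2m [measurable]: "s2 t \<in> borel_measurable circle" for t
  unfolding s0_def[abs_def] s2_def[abs_def] by (intro measurable_circle rm)+
 note sw = circle_time_swap[OF rm(2)]
 define F where "F t = rat_zero_density a b t + rat_quad_density a b t" for t
 have Feq: "F t = (\<integral>\<^sup>+v. s0 t v + s2 t v \<partial>circle)" for t
  unfolding F_def rat_zero_density_def rat_quad_density_def s0_def[symmetric] s2_def[symmetric] by (rule nn_integral_add[symmetric]) measurable
 have zm: "rat_zero_density a b \<in> borel_measurable lborel" and qm: "rat_quad_density a b \<in> borel_measurable lborel"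
  unfolding rat_zero_density_def[abs_def] rat_quad_density_def[abs_def] by (rule sw(3), rule circle_time_swap(3)[OF rm(1)])
 have Fm: "F \<in> borel_measurable lborel" unfolding F_def[abs_def] using zm qm by measurable
 have S0: "(\<integral>\<^sup>+t. s0 t v * indicator {0..1} t \<partial>lborel) = rat_S0 (wder a v) (wder b v) ((norm (b v - a v))\<^sup>2)" for v
 proof (cases "wder a v \<bullet> wder b v \<le> 0")
  case True
  then show ?thesis by (simp add: s0_def rat_s0_def rat_S0_def nn_integral_cmult_indicator)
 next
  case False
  then show ?thesis unfolding s0_def by (intro rat_zero(1)) auto
 qed
 have "(\<integral>\<^sup>+t. F t * indicator {0..1} t \<partial>lborel) = (\<integral>\<^sup>+t. rat_zero_density a b t * indicator {0..1} t + rat_quad_density a b t * indicator {0..1} t \<partial>lborel)"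
  by (simp add: F_def distrib_right)
 also have "\<dots> = (\<integral>\<^sup>+t. rat_zero_density a b t * indicator {0..1} t \<partial>lborel) + (\<integral>\<^sup>+t. rat_quad_density a b t * indicator {0..1} t \<partial>lborel)"
  using zm qm by (intro nn_integral_add) auto
 also have "(\<integral>\<^sup>+t. rat_zero_density a b t * indicator {0..1} t \<partial>lborel) = (\<integral>\<^sup>+v. rat_S0 (wder a v) (wder b v) ((norm (b v - a v))\<^sup>2) \<partial>circle)"
  unfolding rat_zero_density_def sw(1)[symmetric] S0[unfolded s0_def] ..
 finally have FV: "(\<integral>\<^sup>+t. F t * indicator {0..1} t \<partial>lborel) = V_rat a b" by (simp add: V_rat_def)
 show "path_energy 2 (linear_path a b) \<le> V_rat a b"
  unfolding FV[symmetric]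
 proof (rule coercive_criterion[OF m aI b(1) Fm])
  assume "(\<integral>\<^sup>+t. F t * indicator {0..1} t \<partial>lborel) < \<infinity>"
  then have "(\<integral>\<^sup>+v. rat_S0 (wder a v) (wder b v) ((norm (b v - a v))\<^sup>2) \<partial>circle) < \<infinity>"
   unfolding FV by (simp add: V_rat_def)
  then have "AE v in circle. rat_S0 (wder a v) (wder b v) ((norm (b v - a v))\<^sup>2) \<noteq> \<infinity>"
   using rm(3) by (intro nn_integral_PInf_AE) auto
  then have q: "AE v in circle. wder a v \<bullet> wder b v > 0"
   by eventually_elim (auto simp: rat_S0_def split: if_splits)
  note ra = wder_regular[OF m a(1)] and rb = wder_regular[OF m b(1)]
  have q0: "wder a v \<bullet> wder b v \<ge> 0" for v
  proof -
   have "(\<lambda>v. wder a v \<bullet> wder b v) = (\<lambda>v. \<bar>wder a v \<bullet> wder b v\<bar>)"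
   proof (rule AE_circle_continuous_eq)
    show "AE v in circle. wder a v \<bullet> wder b v = \<bar>wder a v \<bullet> wder b v\<bar>" using q by eventually_elim simp
    show "continuous_on UNIV (\<lambda>v. wder a v \<bullet> wder b v)" "continuous_on UNIV (\<lambda>v. \<bar>wder a v \<bullet> wder b v\<bar>)"
     by (intro continuous_intros ra rb)+
    show "periodic (\<lambda>v. wder a v \<bullet> wder b v)" "periodic (\<lambda>v. \<bar>wder a v \<bullet> wder b v\<bar>)"
     using ra(2) rb(2) by (simp_all add: periodic_def)
   qed
   from fun_cong[OF this, of v] show ?thesis by linarith
  qed
  have w: "wder (linear_path a b t) v = (1 - t) *\<^sub>R wder a v + t *\<^sub>R wder b v" for t v
   unfolding wder_linear_path[OF m a(1) b(1)] unfolding linear_path_def ..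
  have imm: "linear_path a b t \<in> Imm 2" if t: "t \<in> {0..1}" for t
  proof -
   have "wder (linear_path a b t) v \<noteq> 0" for v
   proof
    assume "wder (linear_path a b t) v = 0"
    then have z: "rat_D t (wder a v) (wder b v) = 0" by (simp add: rat_D_eq w)
    have n: "(1 - t)\<^sup>2 * (norm (wder a v))\<^sup>2 \<ge> 0" "2 * t * (1 - t) * (wder a v \<bullet> wder b v) \<ge> 0" "t\<^sup>2 * (norm (wder b v))\<^sup>2 \<ge> 0"
     using q0[of v] t by auto
    then have "(1 - t)\<^sup>2 * (norm (wder a v))\<^sup>2 = 0" "t\<^sup>2 * (norm (wder b v))\<^sup>2 = 0"
     using z unfolding rat_D_def by linarith+
    then show False using a(2)[of v] b(2)[of v] by simp
   qed
   then show ?thesis using Sob_linear_path[OF a(1) b(1)] by (simp add: Imm_iff)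
  qed
  have gmF: "ennreal (gm 2 (linear_path a b t) h) \<le> F t" if t: "t \<in> {0..1}" for t
  proof -
   let ?c = "linear_path a b t"
   have xm [measurable]: "xi ?c h j \<in> borel_measurable circle" if "j \<in> {0..2}" for j
    using sqintD(1)[OF xi_term_integrable(2)[OF m imm[OF t] Sh, of j]] that by (intro measurable_circle) auto
   have cm [measurable]: "(\<lambda>v. norm (wder ?c v)) \<in> borel_measurable circle"
    using wder_regular(5)[OF m Sob_linear_path[OF a(1) b(1), of t]] by measurable
   have "ennreal (gm 2 ?c h) = (\<Sum>j=0..2. \<integral>\<^sup>+v. ennreal (norm (wder ?c v)) * ennreal ((norm (xi ?c h j v))\<^sup>2) \<partial>circle)"
    by (rule ennreal_gm[OF m imm[OF t] Sh])
   also have "\<dots> = (\<integral>\<^sup>+v. (\<Sum>j=0..2. ennreal (norm (wder ?c v)) * ennreal ((norm (xi ?c h j v))\<^sup>2)) \<partial>circle)"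
    by (rule nn_integral_sum[symmetric]) measurable
   also have "\<dots> \<le> F t"
    unfolding Feq
   proof (rule nn_integral_mono_AE)
    have x2: "AE v in circle. reg_P (linear_path a b) h 2 t v = norm (wder ?c v) ^ 4 *\<^sub>R xi ?c h 2 v"
     using reg_P_xi[OF m a(1) b(1) _ _ t imm[OF t], of 2] by (simp add: h_def)
    have r2: "AE v in circle. reg_P (linear_path a b) h 2 t v = (norm (wder ?c v))\<^sup>2 *\<^sub>R wder (wder h) v - (wder ?c v \<bullet> wder (wder ?c) v) *\<^sub>R wder h v"
     unfolding h_def by (rule reg_P_2[OF m a(1) b(1) t])
    have wh: "wder h v = wder b v - wder a v" for v unfolding h_def wder_diff[OF m a(1) b(1)] ..
    have wh2: "AE v in circle. wder (wder h) v = wder (wder b) v - wder (wder a) v"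
     using wder_lincomb(1)[OF Sb' Sa', of 1 "-1"] by (simp add: wh[abs_def])
    have wc2: "AE v in circle. wder (wder ?c) v = (1 - t) *\<^sub>R wder (wder a) v + t *\<^sub>R wder (wder b) v"
     using wder_lincomb(1)[OF Sa' Sb', of "1 - t" t] by (simp add: w[abs_def])
    show "AE v in circle. (\<Sum>j=0..2. ennreal (norm (wder ?c v)) * ennreal ((norm (xi ?c h j v))\<^sup>2)) \<le> s0 t v + s2 t v"
     using q x2 r2 wh2 wc2
    proof eventually_elim
     case (elim v)
     let ?x = "wder a v" and ?y = "wder b v" and ?x2 = "wder (wder a) v" and ?y2 = "wder (wder b) v"
     let ?l = "rat_l t ?x ?y" and ?D = "rat_D t ?x ?y"
     have D: "?D > 0" by (rule rat_D_pos[OF elim(1) t])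
     have rD: "(norm (wder ?c v))\<^sup>2 = ?D" by (simp add: w rat_D_eq)
     have l: "norm (wder ?c v) \<le> ?l" "0 \<le> ?l" using rat_l_ge[OF t, of ?x ?y] norm_ge_zero order_trans unfolding w by blast+
     \<comment> \<open>Since \<open>rat_P\<close> is the polynomial of index 2, comparing
       \<open>reg_P_2\<close> with \<open>reg_P_xi\<close> shows it to be |c'|^4 times the second
       arc length derivative.\<close>
     have P: "rat_P t ?x ?y ?x2 ?y2 = norm (wder ?c v) ^ 4 *\<^sub>R xi ?c h 2 v"
     proof -
      have "rat_P t ?x ?y ?x2 ?y2 = (norm (wder ?c v))\<^sup>2 *\<^sub>R wder (wder h) v - (wder ?c v \<bullet> wder (wder ?c) v) *\<^sub>R wder h v"
       unfolding rat_P_def rat_N_eq rat_D_eq elim(4,5) wh w ..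
      also have "\<dots> = norm (wder ?c v) ^ 4 *\<^sub>R xi ?c h 2 v" by (rule trans[OF elim(3)[symmetric] elim(2)])
      finally show ?thesis .
     qed
     have D4: "(norm (wder ?c v) ^ 4)\<^sup>2 = ?D ^ 4" unfolding rD[symmetric] by (simp add: power_mult[symmetric])
     have j2: "(norm (xi ?c h 2 v))\<^sup>2 = (norm (rat_P t ?x ?y ?x2 ?y2))\<^sup>2 / ?D ^ 4"
     proof -
      have "(norm (rat_P t ?x ?y ?x2 ?y2))\<^sup>2 = (norm (wder ?c v) ^ 4)\<^sup>2 * (norm (xi ?c h 2 v))\<^sup>2"
       unfolding P by (simp add: power_mult_distrib)
      then show ?thesis unfolding D4 using D by simp
     qed
     have j1: "(norm (xi ?c h 1 v))\<^sup>2 = ((norm ?x)\<^sup>2 + (norm ?y)\<^sup>2 - 2 * (?x \<bullet> ?y)) / ?D"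
      unfolding norm_diff_square[symmetric] rD[symmetric] by (simp add: xi_Suc xi_0 arc_deriv_def wh power_divide)
     have j0: "xi ?c h 0 v = b v - a v" by (simp add: xi_0 h_def)
     define A0 where "A0 = (norm (b v - a v))\<^sup>2"
     define A1 where "A1 = ((norm ?x)\<^sup>2 + (norm ?y)\<^sup>2 - 2 * (?x \<bullet> ?y)) / ?D"
     define A2 where "A2 = (norm (rat_P t ?x ?y ?x2 ?y2))\<^sup>2"
     have A: "A0 \<ge> 0" "A1 \<ge> 0" "A2 \<ge> 0" using D norm_diff_square[of ?y ?x] zero_le_power2[of "norm (?y - ?x)"] by (auto simp: A0_def A1_def A2_def)
     have "(\<Sum>j=0..2. ennreal (norm (wder ?c v)) * ennreal ((norm (xi ?c h j v))\<^sup>2)) \<le> (\<Sum>j=0..2. ennreal ?l * ennreal ((norm (xi ?c h j v))\<^sup>2))"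
      using l by (intro sum_mono mult_right_mono ennreal_leI) auto
     also have "\<dots> = ennreal ?l * ennreal A0 + ennreal ?l * ennreal A1 + ennreal ?l * ennreal (A2 / ?D ^ 4)"
     proof -
      have "{0..2::nat} = {0, 1, 2}" by auto
      then show ?thesis by (simp add: j0 j1[simplified] j2 A0_def A1_def A2_def add.assoc)
     qed
     also have "\<dots> = ennreal (?l * A0 + ?l * A1) + ennreal (?l / ?D ^ 4) * ennreal A2"
      using l A D by (simp add: ennreal_mult[symmetric] ennreal_plus[symmetric] del: ennreal_plus)
     also have "\<dots> \<le> s0 t v + s2 t v"
     proof (rule add_mono)
      have "0 \<le> (norm ?x + norm ?y) * (norm ?x * norm ?y - ?x \<bullet> ?y) * rat_gap t ?x ?y"
       using rat_gap_nonneg[OF elim(1) t] norm_cauchy_schwarz[of ?x ?y] by simp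
      then show "ennreal (?l * A0 + ?l * A1) \<le> s0 t v"
       using elim(1) by (simp add: s0_def rat_s0_def A0_def A1_def ennreal_leI)
      show "ennreal (?l / ?D ^ 4) * ennreal A2 \<le> s2 t v" by (simp add: s2_def rat_s2_def A2_def)
     qed
     finally show ?case .
    qed
   qed
   finally show ?thesis .
  qed
  show "AE t in lborel. t \<in> {0..1} \<longrightarrow> linear_path a b t \<in> Imm 2 \<and> ennreal (gm 2 (linear_path a b t) (\<lambda>v. b v - a v)) \<le> F t"
   using imm gmF by (auto simp: h_def)
 qed
qed

text \<open>At limits with positive scalar product everything is continuous. Otherwise the norms
  stay away from zero while the scalar products become smaller than any positive number, so the
  summand with the reciprocal cosine exceeds every bound or the value is infinite already; the other
  summands are nonnegative.\<close>

lemma rat_S0_lsc: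
 fixes x y :: "'a::real_inner"
 assumes X: "X \<longlonglongrightarrow> x" and Y: "Y \<longlonglongrightarrow> y" and H: "H \<longlonglongrightarrow> h" and Hn: "\<And>n. H n \<ge> 0" and nz: "x \<noteq> 0" "y \<noteq> 0"
 shows "rat_S0 x y h \<le> liminf (\<lambda>n. rat_S0 (X n) (Y n) (H n))"
proof (cases "x \<bullet> y > 0")
 case True
 have Q: "(\<lambda>n. X n \<bullet> Y n) \<longlonglongrightarrow> x \<bullet> y" by (intro tendsto_intros X Y)
 have "(\<lambda>n. rat_S (X n) (Y n) (H n)) \<longlonglongrightarrow> rat_S x y h"
  unfolding rat_S_def using True nz by (intro tendsto_intros X Y H) auto
 then have "(\<lambda>n. ennreal (rat_S (X n) (Y n) (H n))) \<longlonglongrightarrow> ennreal (rat_S x y h)" by (rule tendsto_ennrealI)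
 moreover have "\<forall>\<^sub>F n in sequentially. ennreal (rat_S (X n) (Y n) (H n)) = rat_S0 (X n) (Y n) (H n)"
  using order_tendstoD(1)[OF Q True] by eventually_elim (simp add: rat_S0_def)
 ultimately have "(\<lambda>n. rat_S0 (X n) (Y n) (H n)) \<longlonglongrightarrow> ennreal (rat_S x y h)" by (rule Lim_transform_eventually)
 then have "ennreal (rat_S x y h) \<le> liminf (\<lambda>n. rat_S0 (X n) (Y n) (H n))" by (rule tendsto_imp_liminf_ge)
 then show ?thesis using True by (simp add: rat_S0_def)
next
 case False
 have Q: "(\<lambda>n. X n \<bullet> Y n) \<longlonglongrightarrow> x \<bullet> y" by (intro tendsto_intros X Y)
 have R: "(\<lambda>n. norm (X n) * norm (Y n)) \<longlonglongrightarrow> norm x * norm y" "(\<lambda>n. norm (X n) + norm (Y n)) \<longlonglongrightarrow> norm x + norm y"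
  by (intro tendsto_intros X Y)+
 define R0 where "R0 = norm x * norm y / 2"
 define s where "s = (norm x + norm y) / 2"
 have pos: "R0 > 0" "s > 0" using nz by (auto simp: R0_def s_def add_pos_pos)
 have "ennreal M \<le> liminf (\<lambda>n. rat_S0 (X n) (Y n) (H n))" if M: "M > 0" for M
 proof (rule Liminf_bounded)
  \<comment> \<open>Chosen so that \<open>R0 / \<epsilon> = 1 + M / s\<close>. As the product of the
    norms is eventually above \<open>R0\<close> and their sum above \<open>s\<close>, the growing
    summand is then at least \<open>M\<close>.\<close>
  define \<epsilon> where "\<epsilon> = R0 / (1 + M / s)"
  have \<epsilon>: "\<epsilon> > 0" using pos M by (simp add: \<epsilon>_def add_pos_pos)
  have "x \<bullet> y < \<epsilon>" "R0 < norm x * norm y" "s < norm x + norm y" using False \<epsilon> pos by (auto simp: R0_def s_def)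
  from order_tendstoD(2)[OF Q this(1)] order_tendstoD(1)[OF R(1) this(2)] order_tendstoD(1)[OF R(2) this(3)]
  show "\<forall>\<^sub>F n in sequentially. ennreal M \<le> rat_S0 (X n) (Y n) (H n)"
  proof (eventually_elim)
   case (elim n)
   have e1: "X n \<bullet> Y n < \<epsilon>" by (rule elim(1))
   have e2: "norm (X n) * norm (Y n) > R0" "norm (X n) + norm (Y n) > s" by (rule elim(2), rule elim(3))
   show ?case
   proof (cases "X n \<bullet> Y n \<le> 0")
    case False
    then have qn: "X n \<bullet> Y n > 0" by simp
    have xn: "norm (X n) > 0" "norm (Y n) > 0" using qn by auto
    have "1 + M / s = R0 / \<epsilon>" using pos M by (simp add: \<epsilon>_def)
    also have "\<dots> \<le> norm (X n) * norm (Y n) / (X n \<bullet> Y n)"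
     using e1 e2(1) qn pos by (intro frac_le) auto
    finally have "M / s \<le> 1 / (X n \<bullet> Y n / (norm (X n) * norm (Y n))) - 1" by simp
    from mult_mono[OF this less_imp_le[OF e2(2)] order_trans[OF _ this] less_imp_le[OF pos(2)]]
    have "M / s * s \<le> (1 / (X n \<bullet> Y n / (norm (X n) * norm (Y n))) - 1) * (norm (X n) + norm (Y n))"
     using pos M by simp
    moreover have "(norm (X n) - norm (Y n)) * ln (norm (X n) / norm (Y n)) \<ge> 0"
    proof (cases "norm (X n) \<ge> norm (Y n)")
     case True
     then show ?thesis using xn by (intro mult_nonneg_nonneg) auto
    next
     case False
     then show ?thesis using xn by (intro mult_nonpos_nonpos) (auto simp: ln_le_zero_iff)
    qed
    moreover have "(norm (X n) + norm (Y n)) / 2 * H n \<ge> 0" using Hn[of n] by simp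
    ultimately have "M \<le> rat_S (X n) (Y n) (H n)" using pos by (simp add: rat_S_def)
    then show ?thesis using qn by (simp add: rat_S0_def ennreal_leI)
   qed (simp add: rat_S0_def)
  qed
 qed
 note b = this
 have "liminf (\<lambda>n. rat_S0 (X n) (Y n) (H n)) = top"
 proof (rule ccontr)
  assume "liminf (\<lambda>n. rat_S0 (X n) (Y n) (H n)) \<noteq> top"
  then obtain z where z: "liminf (\<lambda>n. rat_S0 (X n) (Y n) (H n)) = ennreal z" "z \<ge> 0"
   by (cases "liminf (\<lambda>n. rat_S0 (X n) (Y n) (H n))") auto
  then show False using b[of "z + 1"] by simp
 qed
 then show ?thesis by simp
qed

lemma rat_k_lsc:
 fixes x y :: "'a::real_inner"
 assumes X: "X \<longlonglongrightarrow> x" and Y: "Y \<longlonglongrightarrow> y" and t: "t \<in> {0..1}"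
 shows "ennreal (rat_k t x y) \<le> liminf (\<lambda>n. ennreal (rat_k t (X n) (Y n)))"
proof (cases "x \<bullet> y > 0")
 case True
 have Q: "(\<lambda>n. X n \<bullet> Y n) \<longlonglongrightarrow> x \<bullet> y" by (intro tendsto_intros X Y)
 have nz: "(1 - t)\<^sup>2 * (norm x)\<^sup>2 + 2 * t * (1 - t) * (x \<bullet> y) + t\<^sup>2 * (norm y)\<^sup>2 \<noteq> 0"
  "((1 - t) * (norm x)\<^sup>2 + t * (x \<bullet> y))\<^sup>2 \<noteq> 0" "2 * (norm x * norm y + x \<bullet> y) \<noteq> 0"
  using rat_D_pos[OF True t] rat_e_pos[OF True t] add_nonneg_pos[OF mult_nonneg_nonneg[OF norm_ge_zero[of x] norm_ge_zero[of y]] True]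
  unfolding rat_D_def by auto
 have "(\<lambda>n. (norm (X n) + norm (Y n)) / (2 * (norm (X n) * norm (Y n) + X n \<bullet> Y n)) * rat_gap t (X n) (Y n)) \<longlonglongrightarrow>
  (norm x + norm y) / (2 * (norm x * norm y + x \<bullet> y)) * rat_gap t x y"
  unfolding rat_gap_def rat_D_def by (intro tendsto_intros X Y nz)
 then have l: "(\<lambda>n. ennreal ((norm (X n) + norm (Y n)) / (2 * (norm (X n) * norm (Y n) + X n \<bullet> Y n)) * rat_gap t (X n) (Y n))) \<longlonglongrightarrow> ennreal (rat_k t x y)"
  using True by (simp add: rat_k_def)
 have "\<forall>\<^sub>F n in sequentially. ennreal ((norm (X n) + norm (Y n)) / (2 * (norm (X n) * norm (Y n) + X n \<bullet> Y n)) * rat_gap t (X n) (Y n)) = ennreal (rat_k t (X n) (Y n))"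
  using order_tendstoD(1)[OF Q True] by eventually_elim (simp add: rat_k_def)
 from Lim_transform_eventually[OF l this] show ?thesis by (rule tendsto_imp_liminf_ge)
qed (simp add: rat_k_def)

text \<open>The vector \<open>rat_P\<close> is linear in the second derivatives with pointwise
  convergent coefficients, hence converges weakly, as does the difference of the second derivatives.
  The lower speed bound keeps the limiting \<open>rat_D\<close> positive even where the scalar
  product of the end velocities is not.\<close>

lemma path_lsc_V_rat: "path_lsc 2 (V_rat :: ('d::finite) curve => 'd curve => ennreal)"
 unfolding path_lsc_def
proof (intro allI impI)
 fix A B and a b :: "('d::finite) curve" and d :: real
 assume A: "wc 2 A a" and B: "wc 2 B b" and d: "d > 0"
  and dn0: "\<forall>n. \<forall>t\<in>{0..1}. \<forall>v. d \<le> norm (wder (linear_path (A n) (B n) t) v)"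
 have m: "(2::nat) \<le> 2" and 2: "(2::nat) = Suc (Suc 0)" by simp_all
 have dn: "d \<le> norm (wder (linear_path (A n) (B n) t) v)" if "t \<in> {0..1}" for n t v using dn0 that by blast
 have dl: "d \<le> norm (wder (linear_path a b t) v)" if t: "t \<in> {0..1}" for t v
  by (rule linear_limit[OF m A B _ t]) (rule dn)
 have Sa: "Sob 2 a" and Sb: "Sob 2 b" using wc_Sob[OF A] wc_Sob[OF B] by auto
 have SA: "Sob 2 (A n)" and SB: "Sob 2 (B n)" for n using wc_Sob_seq[OF A] wc_Sob_seq[OF B] by auto
 have nz: "wder a v \<noteq> 0" "wder b v \<noteq> 0" for v using dl[of 0 v] dl[of 1 v] d by auto
 note pA = wc_wder'(2)[OF m A] and pB = wc_wder'(2)[OF m B]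
 note tA = pcD(2)[OF pA] and tB = pcD(2)[OF pB]
 have tH: "(\<lambda>n. (norm (B n v - A n v))\<^sup>2) \<longlonglongrightarrow> (norm (b v - a v))\<^sup>2" for v
  by (intro tendsto_intros pcD(2)[OF wc_pc[OF A]] pcD(2)[OF wc_pc[OF B]]) auto
 note wA1 = wc_wder(1)[OF A[unfolded 2]] and wB1 = wc_wder(1)[OF B[unfolded 2]]
 note wA2 = wc_wder(1)[OF wA1] and wB2 = wc_wder(1)[OF wB1]
 have zero: "(\<integral>\<^sup>+v. rat_S0 (wder a v) (wder b v) ((norm (b v - a v))\<^sup>2) \<partial>circle) \<le>
  liminf (\<lambda>n. \<integral>\<^sup>+v. rat_S0 (wder (A n) v) (wder (B n) v) ((norm (B n v - A n v))\<^sup>2) \<partial>circle)"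
 proof -
  have "(\<integral>\<^sup>+v. rat_S0 (wder a v) (wder b v) ((norm (b v - a v))\<^sup>2) \<partial>circle) \<le>
   (\<integral>\<^sup>+v. liminf (\<lambda>n. rat_S0 (wder (A n) v) (wder (B n) v) ((norm (B n v - A n v))\<^sup>2)) \<partial>circle)"
   by (intro nn_integral_mono rat_S0_lsc tA tB tH nz) simp
  also have "\<dots> \<le> liminf (\<lambda>n. \<integral>\<^sup>+v. rat_S0 (wder (A n) v) (wder (B n) v) ((norm (B n v - A n v))\<^sup>2) \<partial>circle)"
   by (intro nn_integral_liminf measurable_circle rat_measurable(3) SA SB)
  finally show ?thesis .
 qed
 define K where "K t a b = (\<integral>\<^sup>+v. ennreal (rat_k t (wder a v) (wder b v)) * ennreal ((norm (wder (wder b) v - wder (wder a) v))\<^sup>2) \<partial>circle)" for t and a b :: "'d curve"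
 define L where "L t a b = (\<integral>\<^sup>+v. ennreal (rat_l t (wder a v) (wder b v) / rat_D t (wder a v) (wder b v) ^ 4) *
  ennreal ((norm (rat_P t (wder a v) (wder b v) (wder (wder a) v) (wder (wder b) v)))\<^sup>2) \<partial>circle)" for t and a b :: "'d curve"
 have KL: "rat_quad_density a b t = K t a b + L t a b" if a: "Sob 2 a" and b: "Sob 2 b" for a b :: "'d curve" and t
 proof -
  note rm = rat_measurable(6-8)[OF a b]
  note [measurable] = measurable_circle[OF rm(1)[of t]] measurable_circle[OF rm(2)[of t]] measurable_circle[OF rm(3)[of t]]
   measurable_circle[OF wc_measurable(2)[OF Sob_wder[OF Sob_wder[OF a[unfolded 2]]]]] measurable_circle[OF wc_measurable(2)[OF Sob_wder[OF Sob_wder[OF b[unfolded 2]]]]]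
  show ?thesis unfolding rat_quad_density_def K_def L_def rat_s2_def by (rule nn_integral_add) measurable
 qed
 have dens: "rat_quad_density a b t \<le> liminf (\<lambda>n. rat_quad_density (A n) (B n) t)" if t: "t \<in> {0..1}" for t
 proof -
  have h2: "wl2 (\<lambda>n v. wder (wder (B n)) v - wder (wder (A n)) v) (\<lambda>v. wder (wder b) v - wder (wder a) v)"
   using wc_diff[OF wB2 wA2] by simp
  have "K t a b \<le> (\<integral>\<^sup>+v. liminf (\<lambda>n. ennreal (rat_k t (wder (A n) v) (wder (B n) v))) * ennreal ((norm (wder (wder b) v - wder (wder a) v))\<^sup>2) \<partial>circle)"
   unfolding K_def by (intro nn_integral_mono mult_right_mono rat_k_lsc tA tB t) simp
  also have "\<dots> \<le> liminf (\<lambda>n. K t (A n) (B n))"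
   unfolding K_def by (rule weighted_nsq_lsc[OF h2 rat_measurable(6)[OF SA SB]])
  finally have Kl: "K t a b \<le> liminf (\<lambda>n. K t (A n) (B n))" .
  have w: "wder (linear_path a b t) v = (1 - t) *\<^sub>R wder a v + t *\<^sub>R wder b v" if "Sob 2 a" "Sob 2 b" for v and a b :: "'d curve"
   unfolding wder_linear_path[OF m that] unfolding linear_path_def ..
  have D0: "rat_D t (wder a v) (wder b v) \<noteq> 0" for v
   using dl[OF t, of v] d unfolding rat_D_eq w[OF Sa Sb] by auto
  have lim: "liminf (\<lambda>n. ennreal (rat_l t (wder (A n) v) (wder (B n) v) / rat_D t (wder (A n) v) (wder (B n) v) ^ 4)) =
   ennreal (rat_l t (wder a v) (wder b v) / rat_D t (wder a v) (wder b v) ^ 4)" for v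
  proof (rule lim_imp_Liminf[OF trivial_limit_sequentially tendsto_ennrealI])
   show "(\<lambda>n. rat_l t (wder (A n) v) (wder (B n) v) / rat_D t (wder (A n) v) (wder (B n) v) ^ 4) \<longlonglongrightarrow>
    rat_l t (wder a v) (wder b v) / rat_D t (wder a v) (wder b v) ^ 4"
    using D0[of v] unfolding rat_l_def rat_D_def by (intro tendsto_intros tA tB) auto
  qed
  have pc': "pc (\<lambda>n. wder (linear_path (A n) (B n) t)) (wder (linear_path a b t))"
   by (rule wc_wder'(2)[OF m wc_linear_path[OF A B tendsto_const]])
  have rn: "wder (linear_path (A n) (B n) t) \<in> borel_measurable borel" "periodic (wder (linear_path (A n) (B n) t))" for n
   using wder_regular(2,5)[OF m Sob_linear_path[where t = t, OF SA[of n] SB[of n]]] by auto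
  have c2: "wl2 (\<lambda>n. linear_path (wder (wder (A n))) (wder (wder (B n))) t) (linear_path (wder (wder a)) (wder (wder b)) t)"
   using wc_linear_path[OF wA2 wB2 tendsto_const, of t] by simp
  have N: "wl2 (\<lambda>n v. wder (linear_path (A n) (B n) t) v \<bullet> linear_path (wder (wder (A n))) (wder (wder (B n))) t v)
   (\<lambda>v. wder (linear_path a b t) v \<bullet> linear_path (wder (wder a)) (wder (wder b)) t v)"
   by (rule wl2_bilinear[OF bounded_bilinear_inner pc' rn c2])
  have pD: "pc (\<lambda>n v. (norm (wder (linear_path (A n) (B n) t) v))\<^sup>2) (\<lambda>v. (norm (wder (linear_path a b t) v))\<^sup>2)"
   by (rule pc_power[OF pc_norm[OF pc']])
  have Dh: "wl2 (\<lambda>n v. (norm (wder (linear_path (A n) (B n) t) v))\<^sup>2 *\<^sub>R (wder (wder (B n)) v - wder (wder (A n)) v))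
   (\<lambda>v. (norm (wder (linear_path a b t) v))\<^sup>2 *\<^sub>R (wder (wder b) v - wder (wder a) v))"
  proof (rule wl2_bilinear[OF bounded_bilinear_scaleR pD _ _ h2])
   show "(\<lambda>v. (norm (wder (linear_path (A n) (B n) t) v))\<^sup>2) \<in> borel_measurable borel" for n using rn(1)[of n] by measurable
   show "periodic (\<lambda>v. (norm (wder (linear_path (A n) (B n) t) v))\<^sup>2)" for n using rn(2)[of n] by (simp add: periodic_def)
  qed
  have ph: "pc (\<lambda>n. wder (\<lambda>v. B n v - A n v)) (wder (\<lambda>v. b v - a v))" by (rule wc_wder'(2)[OF m wc_diff[OF B A]])
  note rh = wder_regular[OF m Sob_diff[OF SB SA]]
  have Nh: "wl2 (\<lambda>n v. (wder (linear_path (A n) (B n) t) v \<bullet> linear_path (wder (wder (A n))) (wder (wder (B n))) t v) *\<^sub>R wder (\<lambda>v. B n v - A n v) v)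
   (\<lambda>v. (wder (linear_path a b t) v \<bullet> linear_path (wder (wder a)) (wder (wder b)) t v) *\<^sub>R wder (\<lambda>v. b v - a v) v)"
   by (rule wl2_bilinear[OF bounded_bilinear.flip[OF bounded_bilinear_scaleR] ph rh(5) rh(2) N])
  have Peq: "(norm (wder (linear_path a b t) v))\<^sup>2 *\<^sub>R (wder (wder b) v - wder (wder a) v) -
   (wder (linear_path a b t) v \<bullet> linear_path (wder (wder a)) (wder (wder b)) t v) *\<^sub>R wder (\<lambda>v. b v - a v) v =
   rat_P t (wder a v) (wder b v) (wder (wder a) v) (wder (wder b) v)" if "Sob 2 a" "Sob 2 b" for v and a b :: "'d curve"
   unfolding rat_P_def rat_D_eq rat_N_eq w[OF that] wder_diff[OF m that] unfolding linear_path_def ..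
  have "wc 0 (\<lambda>n v. (norm (wder (linear_path (A n) (B n) t) v))\<^sup>2 *\<^sub>R (wder (wder (B n)) v - wder (wder (A n)) v) -
   (wder (linear_path (A n) (B n) t) v \<bullet> linear_path (wder (wder (A n))) (wder (wder (B n))) t v) *\<^sub>R wder (\<lambda>v. B n v - A n v) v)
   (\<lambda>v. (norm (wder (linear_path a b t) v))\<^sup>2 *\<^sub>R (wder (wder b) v - wder (wder a) v) -
   (wder (linear_path a b t) v \<bullet> linear_path (wder (wder a)) (wder (wder b)) t v) *\<^sub>R wder (\<lambda>v. b v - a v) v)"
   by (rule wc_diff) (simp_all add: Dh Nh)
  then have P: "wl2 (\<lambda>n v. rat_P t (wder (A n) v) (wder (B n) v) (wder (wder (A n)) v) (wder (wder (B n)) v))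
   (\<lambda>v. rat_P t (wder a v) (wder b v) (wder (wder a) v) (wder (wder b) v))"
   unfolding Peq[OF SA SB] Peq[OF Sa Sb] by simp
  have Ll: "L t a b \<le> liminf (\<lambda>n. L t (A n) (B n))"
   using weighted_nsq_lsc[where w = "\<lambda>n v. ennreal (rat_l t (wder (A n) v) (wder (B n) v) / rat_D t (wder (A n) v) (wder (B n) v) ^ 4)", OF P rat_measurable(7)[OF SA SB]]
   unfolding lim L_def .
  have "K t a b + L t a b \<le> liminf (\<lambda>n. K t (A n) (B n)) + liminf (\<lambda>n. L t (A n) (B n))" by (rule add_mono[OF Kl Ll])
  also have "\<dots> \<le> liminf (\<lambda>n. K t (A n) (B n) + L t (A n) (B n))" by (rule liminf_add_le)
  finally show ?thesis unfolding KL[OF Sa Sb] KL[OF SA SB] .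
 qed
 have quad: "(\<integral>\<^sup>+t. rat_quad_density a b t * indicator {0..1} t \<partial>lborel) \<le>
  liminf (\<lambda>n. \<integral>\<^sup>+t. rat_quad_density (A n) (B n) t * indicator {0..1} t \<partial>lborel)"
 proof -
  have qm: "rat_quad_density (A n) (B n) \<in> borel_measurable lborel" for n
   unfolding rat_quad_density_def[abs_def] by (rule circle_time_swap(3)[OF rat_measurable(1)[OF SA SB]])
  have "(\<integral>\<^sup>+t. rat_quad_density a b t * indicator {0..1} t \<partial>lborel) \<le>
   (\<integral>\<^sup>+t. liminf (\<lambda>n. rat_quad_density (A n) (B n) t * indicator {0..1} t) \<partial>lborel)"
  proof (rule nn_integral_mono)
   fix t :: real
   show "rat_quad_density a b t * indicator {0..1} t \<le> liminf (\<lambda>n. rat_quad_density (A n) (B n) t * indicator {0..1} t)"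
    using dens[of t] by (cases "t \<in> {0..1}") auto
  qed
  also have "\<dots> \<le> liminf (\<lambda>n. \<integral>\<^sup>+t. rat_quad_density (A n) (B n) t * indicator {0..1} t \<partial>lborel)"
   by (rule nn_integral_liminf) (use qm in simp)
  finally show ?thesis .
 qed
 show "V_rat a b \<le> liminf (\<lambda>n. V_rat (A n) (B n))"
  unfolding V_rat_def by (rule order_trans[OF add_mono[OF zero quad] liminf_add_le])
qed

lemma coercive_linear: "coercive m (\<lambda>a b. path_energy m (linear_path a b))"
  by (simp add: coercive_def)

theorem theorem3p2:
  fixes m K :: nat and \<epsilon> :: real
    and cA :: "real \<Rightarrow> real ^ ('d::finite)" and B :: "(real \<Rightarrow> real ^ 'd) set"
    and W :: "(real \<Rightarrow> real ^ 'd) \<Rightarrow> (real \<Rightarrow> real ^ 'd) \<Rightarrow> ereal"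
  assumes "CARD('d) \<ge> 2" and "m \<ge> 2" and "\<epsilon> > 0"
    and "cA \<in> Imm m"
    and "weakly_seq_closed m B \<or> (\<exists>cB\<in>Imm m. B = reparam_class m cB)"
    and "W = W_lin m \<or> W = W_reg \<epsilon> m \<or> (m = 2 \<and> W = W_rat)"
    and "\<exists>c. discrete_path m K c \<and> c 0 = cA \<and> c K \<in> B \<and> \<bar>discrete_energy W K c\<bar> \<noteq> \<infinity>"
  shows "\<exists>c. discrete_path m K c \<and> c 0 = cA \<and> c K \<in> B \<and>
    (\<forall>c'. discrete_path m K c' \<and> c' 0 = cA \<and> c' K \<in> B \<longrightarrow>
       discrete_energy W K c \<le> discrete_energy W K c')"
proof -
  have closed: "u \<in> B" if U: "\<And>n. U n \<in> B" "wc m U u" "u \<in> Imm m" for U u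
    using assms(5)
  proof
    assume w: "weakly_seq_closed m B"
    have "u \<in> sobolev m" using U(3) by (simp add: Imm_def)
    moreover have "\<forall>l\<in>sobolev_dual m. (\<lambda>n. l (U n)) \<longlonglongrightarrow> l u"
      using dual_tendsto[OF _ _ U(2)] assms(2) by auto
    ultimately show ?thesis using w U(1) unfolding weakly_seq_closed_def by blast
  next
    assume "\<exists>cB\<in>Imm m. B = reparam_class m cB"
    then obtain cB where cB: "cB \<in> Imm m" "B = reparam_class m cB" by blast
    show ?thesis unfolding cB(2) by (rule reparam_class_closed[OF assms(2) cB(1) U(1)[unfolded cB(2)] U(2,3)])
  qed
  \<comment> \<open>On immersions each functional coincides with one valued in
    \<open>ennreal\<close>, for which lower limits of sums and integrals can be taken without regard
    to cancellation.\<close>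
  obtain V where V: "coercive m V" "path_lsc m V" "\<And>a b. a \<in> Imm m \<Longrightarrow> b \<in> Imm m \<Longrightarrow> W a b = enn2ereal (V a b)"
    using assms(6)
  proof (elim disjE conjE)
    assume W: "W = W_lin m"
    show thesis by (rule that[OF coercive_linear path_lsc_linear[OF assms(2)]]) (simp add: W W_lin_def)
  next
    assume W: "W = W_reg \<epsilon> m"
    show thesis by (rule that[OF coercive_V_reg[OF assms(2)] path_lsc_V_reg[OF assms(2)]])
      (use assms(2) in \<open>auto simp: W Imm_iff intro: W_reg_eq\<close>)
  next
    assume W: "m = 2" "W = W_rat"
    show thesis by (rule that) (use W coercive_V_rat path_lsc_V_rat in \<open>auto simp: Imm_iff intro: W_rat_eq\<close>)
  qed
  show ?thesis by (rule minimizer_exists[OF assms(2,4) V closed assms(7)])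
qed

end
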